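(* Let $\rho\in[0,1]$ and let $\alpha_0,\alpha_1,\beta_0,\beta_1\in(0,\infty)$ satisfy $\alpha_0\wedge\alpha_1-\beta_0\vee\beta_1>1$. Let $X$, $\mathbb{P}_{\nu_\rho}$ and the event $\Gamma$ be as constructed in the context. Then there exists a $\mathbb{P}_{\nu_\rho}$-a.s. positive and finite random time $\tau$ such that, $\mathbb{P}_{\nu_\rho}$-a.s., $$\mathbb{P}_{\nu_\rho}\Big((X_{\tau+s}-X_\tau)_{s\ge0}\in\cdot\,\Big|\,\tau,(X_s)_{s\le\tau}\Big)=\mathbb{P}_{\nu_\rho}\big(X\in\cdot\,\big|\,\Gamma\big)$$ and $$\mathbb{P}_{\nu_\rho}\Big((X_{\tau+s}-X_\tau)_{s\ge0}\in\cdot\,\Big|\,\Gamma,\tau,(X_s)_{s\le\tau}\Big)=\mathbb{P}_{\nu_\rho}\big(X\in\cdot\,\big|\,\Gamma\big).$$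
   Context: Notation: $a\wedge b=\min(a,b)$, $a\vee b=\max(a,b)$. Construction. Under $\mathbb{P}_{\nu_\rho}$ the following are independent: an initial configuration $\eta\in\{0,1\}^{\mathbb{Z}}$ with law $\nu_\rho$ (Bernoulli product measure with density $\rho$); Poisson processes $N^+,N^-,\widehat N^+,\widehat N^-$ on $[0,\infty)$ with rates $\alpha_0\wedge\alpha_1$, $\beta_0\wedge\beta_1$, $\alpha_0\vee\alpha_1-\alpha_0\wedge\alpha_1$, $\beta_0\vee\beta_1-\beta_0\wedge\beta_1$ respectively (rate $0$ means no events); and an i.i.d. family $I=(I(x))_{x\in\mathbb{Z}}$ of rate-1 Poisson processes. Each event of $I(x)$ at time $s$ is drawn as an arrow between $(x,s)$ and $(x+1,s)$. For $t\ge0$, $x\in\mathbb{Z}$, follow from $(x,t)$ the path going downwards in time to time $0$ that crosses every arrow it encounters (moving to the other endpoint); $\gamma_t(x)\in\mathbb{Z}$ denotes its end position at time $0$. The simple symmetric exclusion process is $\xi_t(x)=\eta(\gamma_t(x))$. The walk $X$ starts at $X_0=0$ and can jump only when one of the clocks $N^\pm,\widehat N^\pm$ rings: at an event of $N^+$ it jumps one step right; at an event of $N^-$ one step left; at an event of $\widehat N^+$ it jumps one step right if the state $j\in\{0,1\}$ of $\xi$ at its position satisfies $\alpha_j=\alpha_0\vee\alpha_1$ and otherwise stays; at an event of $\widehat N^-$ it jumps one step left if the state $j$ at its position satisfies $\beta_j=\beta_0\vee\beta_1$ and otherwise stays. For $t\ge0$, $x\in\mathbb{Z}$, $Y^t(x)=(Y^t_s(x))_{s\ge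 t}$ is the path started from $x$ at time $t$, going upwards in time and jumping from its current position $y$ to $y+1$ at each event of $I(y)$ (so it crosses arrows only to the right). $\Gamma:=\{X_s>Y^0_s(-1)\text{ for all } s>0\}$; it has positive $\mathbb{P}_{\nu_\rho}$-probability. Conditioning on $(\Gamma,\tau,(X_s)_{s\le\tau})$ in the second identity means conditioning on $\tau,(X_s)_{s\le\tau}$ under the measure $\mathbb{P}_{\nu_\rho}(\cdot\mid\Gamma)$. *)

theory Defs
  imports "HOL-Probability.Probability" "HOL-Library.While_Combinator"
begin

section \<open>Poisson processes\<close>

text \<open>The library's \<^term>\<open>poisson_pmf\<close> is specified for positive parameters only.\<close>

definition poisson_law :: "real \<Rightarrow> nat pmf" where
  "poisson_law r = (if r = 0 then return_pmf 0 else poisson_pmf r)"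

text \<open>
  A Poisson process is given by its counting paths \<open>N \<omega> :: real \<Rightarrow> nat\<close>; only times in
  \<open>[0,\<infinity>)\<close> matter. Regularity of the paths is required for every \<open>\<omega>\<close>; that all
  jumps have size one is then an almost sure consequence of the law of the increments.
\<close>

definition poisson_process :: "'a measure \<Rightarrow> real \<Rightarrow> ('a \<Rightarrow> real \<Rightarrow> nat) \<Rightarrow> bool" where
  "poisson_process M r N \<longleftrightarrow>
     (\<forall>t\<ge>0. (\<lambda>\<omega>. N \<omega> t) \<in> measurable M (count_space UNIV)) \<and>
     (\<forall>\<omega>\<in>space M. N \<omega> 0 = 0 \<and> mono_on {0..} (N \<omega>) \<and>
        (\<forall>t\<ge>0. (N \<omega> \<longlongrightarrow> N \<omega> t) (at_right t))) \<and>
     (\<forall>s\<ge>0. \<forall>t\<ge>s. distr M (count_space UNIV) (\<lambda>\<omega>. N \<omega> t - N \<omega> s)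
                     = measure_pmf (poisson_law (r * (t - s)))) \<and>
     (\<forall>t :: nat \<Rightarrow> real. 0 \<le> t 0 \<and> mono t \<longrightarrow>
        prob_space.indep_vars M (\<lambda>_. count_space UNIV)
          (\<lambda>i \<omega>. N \<omega> (t (Suc i)) - N \<omega> (t i)) UNIV)"

definition jump_times :: "(real \<Rightarrow> nat) \<Rightarrow> real set" where
  "jump_times n = {t. 0 < t \<and> (\<forall>s\<in>{0..<t}. n s < n t)}"


section \<open>The graphical construction\<close>

text \<open>
  Sites are integers; a site is in state \<^term>\<open>True\<close> (that is, 1) when it is occupied and
  \<^term>\<open>False\<close> (that is, 0) when it is vacant. Accordingly \<open>\<alpha> j\<close> and \<open>\<beta> j\<close> are the
  rates \<open>\<alpha>\<^sub>j\<close> and \<open>\<beta>\<^sub>j\<close>. The Poisson processes \<open>N\<^sup>+\<close>, \<open>N\<^sup>-\<close>, their hatted versions and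
  the \<open>I(x)\<close> form one family, indexed by the following type.
\<close>

datatype clock = Plus | Minus | HatPlus | HatMinus | Arrow int

fun clock_rate :: "(bool \<Rightarrow> real) \<Rightarrow> (bool \<Rightarrow> real) \<Rightarrow> clock \<Rightarrow> real" where
  "clock_rate \<alpha> \<beta> Plus = min (\<alpha> False) (\<alpha> True)"
| "clock_rate \<alpha> \<beta> Minus = min (\<beta> False) (\<beta> True)"
| "clock_rate \<alpha> \<beta> HatPlus = max (\<alpha> False) (\<alpha> True) - min (\<alpha> False) (\<alpha> True)"
| "clock_rate \<alpha> \<beta> HatMinus = max (\<beta> False) (\<beta> True) - min (\<beta> False) (\<beta> True)"
| "clock_rate \<alpha> \<beta> (Arrow y) = 1"

text \<open>Functions on \<open>[0,\<infinity>)\<close> with the cylinder \<open>\<sigma>\<close>-algebra.\<close>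

abbreviation path_space :: "(real \<Rightarrow> 'b) measure" where
  "path_space \<equiv> Pi\<^sub>M {0..} (\<lambda>_. count_space UNIV)"

locale graphical_construction = prob_space M
  for M :: "'a measure" and \<rho> :: real and \<alpha> \<beta> :: "bool \<Rightarrow> real"
    and \<eta> :: "'a \<Rightarrow> int \<Rightarrow> bool" and N :: "clock \<Rightarrow> 'a \<Rightarrow> real \<Rightarrow> nat" +
  assumes initial_measurable: "\<eta> \<in> measurable M (Pi\<^sub>M UNIV (\<lambda>_. count_space UNIV))"
    and initial_law: "distr M (Pi\<^sub>M UNIV (\<lambda>_. count_space UNIV)) \<eta>
                        = Pi\<^sub>M UNIV (\<lambda>_. measure_pmf (bernoulli_pmf \<rho>))"
    and clocks_poisson: "\<And>c. poisson_process M (clock_rate \<alpha> \<beta> c) (N c)"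
    and clocks_indep: "indep_vars (\<lambda>_. path_space) (\<lambda>c \<omega>. restrict (N c \<omega>) {0..}) UNIV"
    and initial_indep_clocks:
      "indep_set (sets (vimage_algebra (space M) \<eta> (Pi\<^sub>M UNIV (\<lambda>_. count_space UNIV))))
                 (sets (vimage_algebra (space M) (\<lambda>\<omega> c. restrict (N c \<omega>) {0..})
                          (Pi\<^sub>M UNIV (\<lambda>_. path_space))))"

text \<open>
  The rest of this section is pathwise: \<open>e\<close> stands for a realisation of the initial
  configuration and \<open>n\<close> for a realisation of the whole family of clocks. Simultaneous
  events of distinct clocks and infinitely many steps in bounded time (where
  \<^const>\<open>while\<close> yields an unspecified fixed value) have probability zero.
\<close>

text \<open>The other endpoint, as seen from \<open>y\<close>, of an arrow at time \<open>s\<close>, if there is one.\<close>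

definition cross :: "(clock \<Rightarrow> real \<Rightarrow> nat) \<Rightarrow> real \<Rightarrow> int \<Rightarrow> int" where
  "cross n s y = (if s \<in> jump_times (n (Arrow y)) then y + 1
                  else if s \<in> jump_times (n (Arrow (y - 1))) then y - 1 else y)"

definition arrow_times :: "(clock \<Rightarrow> real \<Rightarrow> nat) \<Rightarrow> int \<Rightarrow> real set" where
  "arrow_times n y = jump_times (n (Arrow y)) \<union> jump_times (n (Arrow (y - 1)))"

text \<open>
  In a loop state \<open>(s, y)\<close> the downward path occupies \<open>y\<close> just below time \<open>s\<close>. An
  arrow at time \<open>t\<close> itself is crossed, which makes the exclusion process right-continuous.
\<close>

definition gamma :: "(clock \<Rightarrow> real \<Rightarrow> nat) \<Rightarrow> real \<Rightarrow> int \<Rightarrow> int" where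
  "gamma n t x =
     snd (while (\<lambda>(s, y). arrow_times n y \<inter> {0<..<s} \<noteq> {})
                (\<lambda>(s, y). let r = Max (arrow_times n y \<inter> {0<..<s}) in (r, cross n r y))
                (t, cross n t x))"

definition exclusion :: "(int \<Rightarrow> bool) \<Rightarrow> (clock \<Rightarrow> real \<Rightarrow> nat) \<Rightarrow> real \<Rightarrow> int \<Rightarrow> bool" where
  "exclusion e n t x = e (gamma n t x)"

definition walk_clock_times :: "(clock \<Rightarrow> real \<Rightarrow> nat) \<Rightarrow> real set" where
  "walk_clock_times n = (\<Union>c\<in>{Plus, Minus, HatPlus, HatMinus}. jump_times (n c))"

definition walk_jump ::
  "(bool \<Rightarrow> real) \<Rightarrow> (bool \<Rightarrow> real) \<Rightarrow> (int \<Rightarrow> bool) \<Rightarrow> (clock \<Rightarrow> real \<Rightarrow> nat) \<Rightarrow> real \<Rightarrow> int \<Rightarrow> int"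
  where
  "walk_jump \<alpha> \<beta> e n s x = (let j = exclusion e n s x in
       of_bool (s \<in> jump_times (n Plus))
     - of_bool (s \<in> jump_times (n Minus))
     + of_bool (s \<in> jump_times (n HatPlus) \<and> \<alpha> j = max (\<alpha> False) (\<alpha> True))
     - of_bool (s \<in> jump_times (n HatMinus) \<and> \<beta> j = max (\<beta> False) (\<beta> True)))"

text \<open>The sum of the jumps at the (finitely many) rings in \<open>(0,t]\<close>, in chronological order.\<close>

definition walk ::
  "(bool \<Rightarrow> real) \<Rightarrow> (bool \<Rightarrow> real) \<Rightarrow> (int \<Rightarrow> bool) \<Rightarrow> (clock \<Rightarrow> real \<Rightarrow> nat) \<Rightarrow> real \<Rightarrow> int"
  where
  "walk \<alpha> \<beta> e n t =
     fold (\<lambda>s x. x + walk_jump \<alpha> \<beta> e n s x)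
          (sorted_list_of_set (walk_clock_times n \<inter> {0<..t})) 0"

text \<open>\<open>right_path n t x s\<close> is \<open>Y\<^sup>t\<^sub>s(x)\<close>, for \<open>s \<ge> t\<close>.\<close>

definition right_path :: "(clock \<Rightarrow> real \<Rightarrow> nat) \<Rightarrow> real \<Rightarrow> int \<Rightarrow> real \<Rightarrow> int" where
  "right_path n t x s =
     snd (while (\<lambda>(r, y). jump_times (n (Arrow y)) \<inter> {r<..s} \<noteq> {})
                (\<lambda>(r, y). (Min (jump_times (n (Arrow y)) \<inter> {r<..s}), y + 1))
                (t, x))"


section \<open>Random variables and conditioning\<close>

definition walk_process ::
  "(bool \<Rightarrow> real) \<Rightarrow> (bool \<Rightarrow> real) \<Rightarrow> ('a \<Rightarrow> int \<Rightarrow> bool) \<Rightarrow> (clock \<Rightarrow> 'a \<Rightarrow> real \<Rightarrow> nat)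
     \<Rightarrow> 'a \<Rightarrow> real \<Rightarrow> int" where
  "walk_process \<alpha> \<beta> \<eta> N \<omega> = walk \<alpha> \<beta> (\<eta> \<omega>) (\<lambda>c. N c \<omega>)"

definition Gamma_event ::
  "'a measure \<Rightarrow> (bool \<Rightarrow> real) \<Rightarrow> (bool \<Rightarrow> real) \<Rightarrow> ('a \<Rightarrow> int \<Rightarrow> bool)
     \<Rightarrow> (clock \<Rightarrow> 'a \<Rightarrow> real \<Rightarrow> nat) \<Rightarrow> 'a set" where
  "Gamma_event M \<alpha> \<beta> \<eta> N =
     {\<omega> \<in> space M. \<forall>s>0. walk_process \<alpha> \<beta> \<eta> N \<omega> s > right_path (\<lambda>c. N c \<omega>) 0 (-1) s}"

text \<open>
  The \<open>\<sigma>\<close>-algebra of \<open>\<tau>\<close> and \<open>(X\<^sub>s)\<close>, \<open>s \<le> \<tau>\<close>, is generated by the time \<open>\<tau>\<close> together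
  with the path stopped at \<open>\<tau>\<close>.
\<close>

definition history ::
  "'a measure \<Rightarrow> ('a \<Rightarrow> real \<Rightarrow> int) \<Rightarrow> ('a \<Rightarrow> ennreal) \<Rightarrow> 'a measure" where
  "history M X \<tau> =
     vimage_algebra (space M)
       (\<lambda>\<omega>. (\<tau> \<omega>, \<lambda>s\<in>{0..}. X \<omega> (enn2real (min (ennreal s) (\<tau> \<omega>)))))
       (borel \<Otimes>\<^sub>M path_space)"

definition future :: "('a \<Rightarrow> real \<Rightarrow> int) \<Rightarrow> ('a \<Rightarrow> ennreal) \<Rightarrow> 'a \<Rightarrow> real \<Rightarrow> int" where
  "future X \<tau> \<omega> = (\<lambda>s\<in>{0..}. X \<omega> (enn2real (\<tau> \<omega>) + s) - X \<omega> (enn2real (\<tau> \<omega>)))"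

text \<open>
  \<open>P\<close>-almost surely, the conditional law of \<open>Z\<close> given \<open>F\<close> is the deterministic
  set function \<open>\<mu>\<close>.
\<close>

definition cond_law_is ::
  "'a measure \<Rightarrow> 'a measure \<Rightarrow> 'b measure \<Rightarrow> ('a \<Rightarrow> 'b) \<Rightarrow> ('b set \<Rightarrow> real) \<Rightarrow> bool" where
  "cond_law_is P F S Z \<mu> \<longleftrightarrow>
     (\<forall>A\<in>sets S. AE \<omega> in P. real_cond_exp P F (indicator {\<omega>\<in>space P. Z \<omega> \<in> A}) \<omega> = \<mu> A)"

end

theory Submission
  imports Defs
begin

text \<open>
  Cut time into slabs of length \<open>h\<close>. At the end of slab \<open>m\<close>, a front bounds from above the position of all
  labels of the exclusion process which the walk has looked at so far; in a slab without hatted rings it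
  moves right at most like a block of consecutive arrows. If the walk is ahead of the front, then, since
  \<open>gamma\<close> is injective, the environment to the right of the walk is independent of the past; and if from
  then on the walk stays ahead of the path \<open>Y\<close> started one site behind it, then it only looks at this fresh
  environment. The time \<open>\<tau>\<close> is the first slab end at which both happen. That an earlier slab end was no
  such time is, given that the present one is, an event of the past, because a walk which is not caught by
  an earlier \<open>Y\<close> before \<open>\<tau>\<close> stays ahead of it for ever. Summing over the slab ends gives both identities.
  The same remark with the slab end \<open>0\<close> covers the conditioning on \<open>\<Gamma>\<close>.

  For small \<open>h\<close> and \<open>\<theta>\<close> the drift condition makes the exponential moment of \<open>\<theta>\<close> times the distance of the front
  (or of \<open>Y\<close>) to the walk contract by a factor less than 1 in each slab. Hence the front stays tight behind
  the walk and is outrun, with uniformly positive probability given the past, in a later slab, so that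
  \<open>\<tau>\<close> is almost surely finite; and \<open>\<Gamma>\<close> has positive probability by a union bound over the slabs.
\<close>

text \<open>The time \<tau> is no stopping time, as it demands that the walk stay ahead for ever.
  Admitting only deterministic slab ends replaces the strong Markov property by independence at
  fixed times, used as an iterated integral over initial configuration, past clocks and future
  clocks. The obstacle is the memory of the exclusion process: a state that has been read travels
  on. Therefore labels, that is positions at time 0, are followed instead of states, and freshness
  of the environment is a statement about which labels have been read. Given the clocks, the labels
  to the right of the walk form a fixed set of coordinates of a product measure. Origin of the drift
  condition: with a = \<alpha>0 min \<alpha>1 and b = \<beta>0 max \<beta>1, in a slab of length h
  the block of consecutive arrows has mean exp h - 1, the walk is credited one step to the right
  with probability 1 - exp(-a h) and loses b h on average. To first order the balance is h (1 + b -
  a), which is negative.\<close>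

section \<open>Counting paths and their jump times\<close>

definition counting_path :: "(real \<Rightarrow> nat) \<Rightarrow> bool" where
  "counting_path f \<longleftrightarrow> f 0 = 0 \<and> mono_on {0..} f \<and> (\<forall>t\<ge>0. (f \<longlongrightarrow> f t) (at_right t))"

lemma counting_path_mono: "counting_path f \<Longrightarrow> 0 \<le> s \<Longrightarrow> s \<le> t \<Longrightarrow> f s \<le> f t"
  by (auto simp: counting_path_def mono_on_def)

text \<open>In a discrete space, right-continuity means being constant on a short interval to the
  right.\<close>

lemma counting_path_right_const:
  assumes "counting_path f" "0 \<le> t"
  obtains u where "t < u" "\<And>s. t \<le> s \<Longrightarrow> s < u \<Longrightarrow> f s = f t"
proof -
  have "(f \<longlongrightarrow> f t) (at_right t)" using assms by (auto simp: counting_path_def)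
  then have "eventually (\<lambda>s. f s = f t) (at_right t)"
    by (simp add: tendsto_discrete)
  then obtain b where "b > t" "\<And>y. t < y \<Longrightarrow> y < b \<Longrightarrow> f y = f t"
    unfolding eventually_at_right_field by blast
  then show ?thesis
    by (intro that[of b]) (metis order_le_less)+
qed

text \<open>The jump is found at the infimum of the times at which the path exceeds
  \<open>f r\<close>; right-continuity makes it exceed \<open>f r\<close> at the infimum itself.
  Whether a clock rings in an interval thus becomes a comparison of two values, the form needed for
  measurability and for the laws.\<close>

lemma jump_times_Ioc_nonempty_iff:
  assumes f: "counting_path f" and rs: "0 \<le> r" "r \<le> s"
  shows "jump_times f \<inter> {r<..s} \<noteq> {} \<longleftrightarrow> f r < f s"
proof
  assume "jump_times f \<inter> {r<..s} \<noteq> {}"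
  then obtain t where t: "t \<in> jump_times f" "r < t" "t \<le> s" by auto
  have "f r < f t" using t rs by (auto simp: jump_times_def)
  also have "f t \<le> f s" using t rs f by (intro counting_path_mono) auto
  finally show "f r < f s" .
next
  assume less: "f r < f s"
  define S where "S = {u. r \<le> u \<and> f r < f u}"
  have S: "S \<noteq> {}" "bdd_below S" "s \<in> S" using less rs by (auto simp: S_def bdd_below_def)
  define t where "t = Inf S"
  have rt: "r \<le> t" unfolding t_def using S(1) by (rule cInf_greatest) (auto simp: S_def)
  have ts: "t \<le> s" unfolding t_def using S by (intro cInf_lower)
  have "0 \<le> t" using rt rs by simp
  obtain u where u: "t < u" "\<And>x. t \<le> x \<Longrightarrow> x < u \<Longrightarrow> f x = f t"
    using counting_path_right_const[OF f \<open>0 \<le> t\<close>] by blast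
  obtain x where x: "x \<in> S" "x < u" using cInf_lessD[OF S(1)] u(1) unfolding t_def by blast
  have "t \<le> x" unfolding t_def using x S by (intro cInf_lower)
  then have ft: "f r < f t" using u(2)[OF _ x(2)] x(1) by (auto simp: S_def)
  then have "r \<noteq> t" by auto
  then have "r < t" using rt by simp
  moreover have "f x < f t" if "0 \<le> x" "x < t" for x
  proof (cases "x \<le> r")
    case True
    then show ?thesis using ft counting_path_mono[OF f that(1) True] by simp
  next
    case False
    then have "x \<notin> S" using that S(2) unfolding t_def using cInf_lower not_le by blast
    then have "f x \<le> f r" using False by (auto simp: S_def)
    then show ?thesis using ft by simp
  qed
  ultimately show "jump_times f \<inter> {r<..s} \<noteq> {}"
    using ts rs by (auto simp: jump_times_def disjoint_iff intro!: exI[of _ t])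
qed

lemma jump_times_pos: "t \<in> jump_times f \<Longrightarrow> 0 < t"
  by (simp add: jump_times_def)

lemma jump_times_less: "t \<in> jump_times f \<Longrightarrow> 0 \<le> s \<Longrightarrow> s < t \<Longrightarrow> f s < f t"
  by (simp add: jump_times_def)

text \<open>Along its jump times the path increases strictly, and up to time \<open>t\<close> it
  takes only values up to \<open>f t\<close>.\<close>

lemma finite_jump_times:
  assumes f: "counting_path f"
  shows "finite (jump_times f \<inter> {..t})"
proof (rule inj_on_finite)
  show "inj_on f (jump_times f \<inter> {..t})"
  proof (rule inj_onI)
    fix x y assume "x \<in> jump_times f \<inter> {..t}" "y \<in> jump_times f \<inter> {..t}" "f x = f y"
    then have "\<not> x < y" "\<not> y < x"
      using jump_times_less[of y f x] jump_times_less[of x f y] jump_times_pos[of x f] jump_times_pos[of y f]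
      by force+
    then show "x = y" by simp
  qed
  show "f ` (jump_times f \<inter> {..t}) \<subseteq> {..f t}"
    using f by (auto simp: jump_times_def intro!: counting_path_mono)
qed simp

lemma finite_jump_times_subset: "counting_path f \<Longrightarrow> finite (jump_times f \<inter> {r<..s})"
  by (rule finite_subset[OF _ finite_jump_times[of f s]]) auto

lemma finite_jump_times_subset': "counting_path f \<Longrightarrow> finite (jump_times f \<inter> {r<..<s})"
  by (rule finite_subset[OF _ finite_jump_times[of f s]]) auto

lemma jump_times_restrict [simp]: "jump_times (restrict f {0..}) = jump_times f"
  by (auto simp: jump_times_def)

section \<open>Space-time shifts and stopping of the clocks\<close>

definition translate :: "int \<Rightarrow> clock \<Rightarrow> clock" where
  "translate v c = (case c of Arrow y \<Rightarrow> Arrow (y + v) | _ \<Rightarrow> c)"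

lemma translate_simps [simp]:
  "translate v Plus = Plus" "translate v Minus = Minus"
  "translate v HatPlus = HatPlus" "translate v HatMinus = HatMinus"
  "translate v (Arrow y) = Arrow (y + v)"
  by (simp_all add: translate_def)

lemma inj_translate: "inj (translate v)"
  by (rule injI, rename_tac x y, case_tac x; case_tac y) auto

text \<open>Restriction to \<open>{0..}\<close> makes each component a point of
  \<open>path_space\<close>. An event exactly at time \<open>T\<close> disappears: it belongs to the
  past.\<close>

definition shift_clocks :: "real \<Rightarrow> int \<Rightarrow> (clock \<Rightarrow> real \<Rightarrow> nat) \<Rightarrow> clock \<Rightarrow> real \<Rightarrow> nat" where
  "shift_clocks T v n c = (\<lambda>s\<in>{0..}. n (translate v c) (T + s) - n (translate v c) T)"

text \<open>The past up to \<open>T\<close> as a random variable: events of the past become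
  predicates of the initial configuration and the stopped clocks. An event exactly at time
  \<open>T\<close> is kept.\<close>

definition stop_clocks :: "real \<Rightarrow> (clock \<Rightarrow> real \<Rightarrow> nat) \<Rightarrow> clock \<Rightarrow> real \<Rightarrow> nat" where
  "stop_clocks T n c = (\<lambda>s\<in>{0..}. n c (min s T))"

lemma jump_times_shift_clocks:
  assumes "counting_path (n (translate v c))" "0 \<le> T"
  shows "jump_times (shift_clocks T v n c) = {s. 0 < s \<and> T + s \<in> jump_times (n (translate v c))}"
    (is "_ = {s. _ \<and> _ \<in> jump_times ?f}")
proof -
  have *: "(\<forall>s\<in>{0..<t}. ?f (T + s) - ?f T < ?f (T + t) - ?f T) \<longleftrightarrow> (\<forall>u\<in>{0..<T+t}. ?f u < ?f (T + t))"
    if "0 < t" for t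
  proof
    assume L: "\<forall>s\<in>{0..<t}. ?f (T + s) - ?f T < ?f (T + t) - ?f T"
    show "\<forall>u\<in>{0..<T+t}. ?f u < ?f (T + t)"
    proof
      fix u assume u: "u \<in> {0..<T+t}"
      show "?f u < ?f (T + t)"
      proof (cases "u \<le> T")
        case True
        have "?f T < ?f (T + t)" using L that by force
        then show ?thesis using counting_path_mono[OF assms(1), of u T] u True by auto
      next
        case False
        then have "?f (T + (u - T)) - ?f T < ?f (T + t) - ?f T" using L u by (intro bspec[OF L]) auto
        then show ?thesis by simp
      qed
    qed
  next
    assume R: "\<forall>u\<in>{0..<T+t}. ?f u < ?f (T + t)"
    show "\<forall>s\<in>{0..<t}. ?f (T + s) - ?f T < ?f (T + t) - ?f T"
      using R counting_path_mono[OF assms(1), of T] assms(2) that by (auto intro!: diff_less_mono)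
  qed
  show ?thesis
    using * assms(2) by (auto simp: jump_times_def shift_clocks_def)
qed

lemma jump_times_stop_clocks:
  assumes "counting_path (n c)" "0 \<le> T"
  shows "jump_times (stop_clocks T n c) = jump_times (n c) \<inter> {..T}"
proof (intro set_eqI iffI)
  fix t assume t: "t \<in> jump_times (stop_clocks T n c)"
  have "t \<le> T"
  proof (rule ccontr)
    assume "\<not> t \<le> T"
    then show False using t assms(2) by (auto simp: jump_times_def stop_clocks_def dest!: bspec[of _ _ T])
  qed
  then show "t \<in> jump_times (n c) \<inter> {..T}"
    using t by (auto simp: jump_times_def stop_clocks_def min_def)
next
  fix t assume "t \<in> jump_times (n c) \<inter> {..T}"
  then show "t \<in> jump_times (stop_clocks T n c)"
    by (auto simp: jump_times_def stop_clocks_def min_def)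
qed

lemma counting_path_shift_clocks:
  assumes "counting_path (n (translate v c))" "0 \<le> T"
  shows "counting_path (shift_clocks T v n c)"
  unfolding counting_path_def
proof (intro conjI allI impI)
  show "shift_clocks T v n c 0 = 0" by (simp add: shift_clocks_def)
  show "mono_on {0..} (shift_clocks T v n c)"
    using assms counting_path_mono[OF assms(1)] by (auto simp: mono_on_def shift_clocks_def intro!: diff_le_mono)
  fix t :: real assume "0 \<le> t"
  then have "0 \<le> T + t" using assms by simp
  then obtain u where u: "T + t < u" "\<And>s. T + t \<le> s \<Longrightarrow> s < u \<Longrightarrow> n (translate v c) s = n (translate v c) (T + t)"
    using counting_path_right_const[OF assms(1)] by metis
  have "eventually (\<lambda>s. shift_clocks T v n c s = shift_clocks T v n c t) (at_right t)"
    unfolding eventually_at_right_field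
  proof (intro exI[of _ "u - T"] conjI allI impI)
    show "t < u - T" using u(1) by simp
    fix y assume "t < y" "y < u - T"
    then show "shift_clocks T v n c y = shift_clocks T v n c t"
      using u(2)[of "T + y"] \<open>0 \<le> t\<close> by (simp add: shift_clocks_def)
  qed
  then show "(shift_clocks T v n c \<longlongrightarrow> shift_clocks T v n c t) (at_right t)"
    by (simp add: tendsto_discrete)
qed

lemma counting_path_stop_clocks:
  assumes "counting_path (n c)" "0 \<le> T"
  shows "counting_path (stop_clocks T n c)"
  unfolding counting_path_def
proof (intro conjI allI impI)
  show "stop_clocks T n c 0 = 0" using assms by (simp add: stop_clocks_def counting_path_def)
  show "mono_on {0..} (stop_clocks T n c)"
    using assms counting_path_mono[OF assms(1)] by (auto simp: mono_on_def stop_clocks_def)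
  fix t :: real assume "0 \<le> t"
  then obtain u where u: "t < u" "\<And>s. t \<le> s \<Longrightarrow> s < u \<Longrightarrow> n c s = n c t"
    using counting_path_right_const[OF assms(1)] by metis
  have "eventually (\<lambda>s. stop_clocks T n c s = stop_clocks T n c t) (at_right t)"
    unfolding eventually_at_right_field
  proof (intro exI[of _ "if t < T then min u T else u"] conjI allI impI)
    show "t < (if t < T then min u T else u)" using u by auto
    fix y assume "t < y" "y < (if t < T then min u T else u)"
    then show "stop_clocks T n c y = stop_clocks T n c t"
      using u(2)[of y] \<open>0 \<le> t\<close> by (auto simp: stop_clocks_def min_def split: if_splits)
  qed
  then show "(stop_clocks T n c \<longlongrightarrow> stop_clocks T n c t) (at_right t)"
    by (simp add: tendsto_discrete)
qed

text \<open>Induction on the number of events of \<open>J\<close> in \<open>{a<..<t}\<close>. The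
  end \<open>s\<close> of a step may or may not be an event itself; only the open interval before it
  is free of events. This fits paths which are constant between events and updated at them.\<close>

lemma event_induct [consumes 2, case_names finite start step]:
  fixes P :: "real \<Rightarrow> bool"
  assumes "a \<le> t" "0 \<le> a" and fin: "\<And>t. finite (J \<inter> {a<..t})" and start: "P a"
    and step: "\<And>r s. a \<le> r \<Longrightarrow> r < s \<Longrightarrow> J \<inter> {r<..<s} = {} \<Longrightarrow> P r \<Longrightarrow> P s"
  shows "P t"
  using \<open>a \<le> t\<close>
proof (induction "card (J \<inter> {a<..<t})" arbitrary: t rule: less_induct)
  case less
  have fin': "finite (J \<inter> {a<..<t})" for t by (rule finite_subset[OF _ fin[of t]]) auto
  show ?case
  proof (cases "t = a")
    case False
    with less.prems have "a < t" by simp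
    show ?thesis
    proof (cases "J \<inter> {a<..<t} = {}")
      case True
      then show ?thesis using step[OF order_refl \<open>a < t\<close> True start] by simp
    next
      case False
      define r where "r = Max (J \<inter> {a<..<t})"
      have r: "r \<in> J \<inter> {a<..<t}" unfolding r_def using False fin' by (intro Max_in)
      have max: "x \<le> r" if "x \<in> J \<inter> {a<..<t}" for x unfolding r_def using that fin' by (intro Max_ge)
      have "card (J \<inter> {a<..<r}) < card (J \<inter> {a<..<t})"
        using r by (intro psubset_card_mono fin') auto
      then have "P r" using less.hyps[of r] r by auto
      moreover have "J \<inter> {r<..<t} = {}" using max r by force
      ultimately show ?thesis using step[of r t] r by auto
    qed
  qed (use start in simp)
qed

section \<open>Regular realisations of the clocks\<close>

definition walk_clocks :: "clock set" where "walk_clocks = {Plus, Minus, HatPlus, HatMinus}"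

definition quiet :: "(clock \<Rightarrow> real \<Rightarrow> nat) \<Rightarrow> real \<Rightarrow> int \<Rightarrow> bool" where
  "quiet n t b \<longleftrightarrow> jump_times (n (Arrow b)) \<inter> {..t} = {}"

text \<open>The regularity which holds almost surely. The quiet edges, arbitrarily far on either side, confine
  every path up to time \<open>t\<close> to a finite region.\<close>

definition good :: "(clock \<Rightarrow> real \<Rightarrow> nat) \<Rightarrow> bool" where
  "good n \<longleftrightarrow> (\<forall>c. counting_path (n c)) \<and>
     (\<forall>c d. c \<noteq> d \<longrightarrow> jump_times (n c) \<inter> jump_times (n d) = {}) \<and>
     (\<forall>t k. (\<exists>b\<ge>k. quiet n t b) \<and> (\<exists>b\<le>k. quiet n t b))"

lemma good_path: "good n \<Longrightarrow> counting_path (n c)"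
  by (simp add: good_def)

lemma good_paths: "good n \<Longrightarrow> \<forall>c. counting_path (n c)"
  by (simp add: good_def)

lemma good_disjoint: "good n \<Longrightarrow> t \<in> jump_times (n c) \<Longrightarrow> t \<in> jump_times (n d) \<Longrightarrow> c = d"
  by (auto simp: good_def)

lemma good_shift: assumes "good n" "0 \<le> T" shows "good (shift_clocks T v n)"
  unfolding good_def
proof (intro conjI allI impI)
  note J = jump_times_shift_clocks[OF good_path[OF assms(1)] assms(2)]
  show "counting_path (shift_clocks T v n c)" for c
    using assms by (intro counting_path_shift_clocks good_path)
  show "jump_times (shift_clocks T v n c) \<inter> jump_times (shift_clocks T v n d) = {}" if "c \<noteq> d" for c d
    unfolding J using good_disjoint[OF assms(1)] inj_translate[THEN injD] that by blast
  have q: "quiet (shift_clocks T v n) t (b - v)" if "quiet n (T + t) b" for t b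
    using that unfolding quiet_def J by auto
  fix t k
  obtain b b' where "b \<ge> k + v" "quiet n (T + t) b" "b' \<le> k + v" "quiet n (T + t) b'"
    using assms(1) unfolding good_def by metis
  then show "\<exists>b\<ge>k. quiet (shift_clocks T v n) t b" "\<exists>b\<le>k. quiet (shift_clocks T v n) t b"
    using q[of t b] q[of t b'] by (smt (verit))+
qed

lemma good_stop: assumes "good n" "0 \<le> T" shows "good (stop_clocks T n)"
proof -
  note J = jump_times_stop_clocks[OF good_path[OF assms(1)] assms(2)]
  have "quiet (stop_clocks T n) t b" if "quiet n t b" for t b
    using that unfolding quiet_def J by auto
  then show ?thesis
    using assms unfolding good_def J
    by (auto intro!: counting_path_stop_clocks) blast+
qed

section \<open>The downward paths\<close>

lemma gamma_unfold:
  "gamma n t x = (let y = cross n t x; A = arrow_times n y \<inter> {0<..<t} in if A = {} then y else gamma n (Max A) y)"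
  unfolding gamma_def Let_def
  by (subst while_unfold) (simp split: if_splits)

lemma finite_arrow_times: "good n \<Longrightarrow> finite (arrow_times n y \<inter> {0<..<t})"
  unfolding arrow_times_def Int_Un_distrib2
  by (auto intro!: finite_jump_times_subset' good_path)

lemma cross_no_arrow: "s \<notin> arrow_times n y \<Longrightarrow> cross n s y = y"
  by (auto simp: cross_def arrow_times_def)

lemma arrow_times_pos: "t \<in> arrow_times n y \<Longrightarrow> 0 < t"
  by (auto simp: arrow_times_def jump_times_pos)

text \<open>The loop of \<open>gamma\<close> runs from arrow to arrow, whereas inductions have to
  stop at an arbitrary intermediate time \<open>r\<close>. If the current site has an arrow at
  \<open>r\<close>, that is the next one on the path and \<open>gamma n r\<close> crosses it first;
  otherwise both loops see the same arrows.\<close>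

lemma gamma_step:
  assumes n: "good n" and rt: "0 \<le> r" "r < t" and quiet: "arrow_times n (cross n t x) \<inter> {r<..<t} = {}"
  shows "gamma n t x = gamma n r (cross n t x)"
proof -
  define y where "y = cross n t x"
  define A where "A = arrow_times n y \<inter> {0<..<t}"
  have A: "finite A" unfolding A_def by (rule finite_arrow_times[OF n])
  have le: "q \<le> r" if "q \<in> A" for q using that quiet unfolding A_def y_def by force
  have t: "gamma n t x = (if A = {} then y else gamma n (Max A) y)"
    by (subst gamma_unfold) (simp add: Let_def A_def y_def)
  show ?thesis
  proof (cases "r \<in> A")
    case True
    then have "Max A = r" using le A by (intro Max_eqI) auto
    then show ?thesis using True unfolding t y_def by auto
  next
    case False
    then have r: "r \<notin> arrow_times n y"
      using rt arrow_times_pos[of r n y] by (auto simp: A_def)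
    have "x < r" if "x \<in> A" for x
      using le[OF that] r that by (cases "x = r") (auto simp: A_def)
    then have "arrow_times n y \<inter> {0<..<r} = A"
      using rt by (auto simp: A_def)
    then have "gamma n r y = (if A = {} then y else gamma n (Max A) y)"
      by (subst gamma_unfold) (simp add: Let_def cross_no_arrow[OF r])
    then show ?thesis unfolding t y_def by simp
  qed
qed

lemma gamma_0 [simp]: "gamma n 0 x = x"
  by (subst gamma_unfold) (auto simp: Let_def cross_def jump_times_def)

text \<open>The edges \<open>a\<close> to \<open>b\<close> are those touching the sites in
  \<open>{a<..b}\<close>. When the edges \<open>a\<close> and \<open>b\<close> are quiet, no path
  leaves these sites, and its changes happen at finitely many times.\<close>

definition region_times :: "(clock \<Rightarrow> real \<Rightarrow> nat) \<Rightarrow> int \<Rightarrow> int \<Rightarrow> real set" where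
  "region_times n a b = (\<Union>y\<in>{a..b}. jump_times (n (Arrow y))) \<union> (\<Union>c\<in>walk_clocks. jump_times (n c))"

lemma finite_region_times: "good n \<Longrightarrow> finite (region_times n a b \<inter> {r<..t})"
proof (rule finite_subset)
  show "region_times n a b \<inter> {r<..t} \<subseteq>
     (\<Union>y\<in>{a..b}. jump_times (n (Arrow y)) \<inter> {r<..t}) \<union> (\<Union>c\<in>walk_clocks. jump_times (n c) \<inter> {r<..t})"
    by (auto simp: region_times_def)
qed (intro finite_UnI finite_UN_I finite_jump_times_subset good_path; simp add: walk_clocks_def)

lemma quiet_Arrow: "quiet n t b \<Longrightarrow> s \<le> t \<Longrightarrow> s \<notin> jump_times (n (Arrow b))"
  by (auto simp: quiet_def)

lemma cross_region:
  assumes "quiet n t a" "quiet n t b" "s \<le> t" "a < x" "x \<le> b"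
  shows "a < cross n s x" "cross n s x \<le> b"
proof -
  have "s \<notin> jump_times (n (Arrow (x - 1)))" if "x = a + 1"
    using quiet_Arrow[OF assms(1,3)] that by simp
  moreover have "s \<notin> jump_times (n (Arrow x))" if "x = b"
    using quiet_Arrow[OF assms(2,3)] that by simp
  ultimately show "a < cross n s x" "cross n s x \<le> b"
    using assms(4,5) by (auto simp: cross_def) (cases "x = a + 1"; cases "x = b"; simp)+
qed

lemma region_no_arrow:
  assumes "region_times n a b \<inter> {r<..<s} = {}" "quiet n t a" "a < x" "x \<le> b"
  shows "arrow_times n x \<inter> {r<..<s} = {}"
  using assms unfolding region_times_def arrow_times_def by fastforce

lemma gamma_region_step:
  assumes n: "good n" and "quiet n t a" "quiet n t b" "0 \<le> r" "r < s" "s \<le> t" "a < x" "x \<le> b"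
    and "region_times n a b \<inter> {r<..<s} = {}"
  shows "gamma n s x = gamma n r (cross n s x)"
  using assms by (intro gamma_step region_no_arrow[where t=t and a=a and b=b] cross_region) auto

lemma good_region:
  assumes "good n" "finite X"
  obtains a b where "quiet n t a" "quiet n t b" "\<And>x. x \<in> X \<Longrightarrow> a < x \<and> x \<le> b"
proof -
  obtain a where a: "a \<le> Min (insert 0 X) - 1" "quiet n t a" using assms(1) unfolding good_def by metis
  obtain b where b: "b \<ge> Max (insert 0 X)" "quiet n t b" using assms(1) unfolding good_def by metis
  have "a < x \<and> x \<le> b" if "x \<in> X" for x
  proof -
    have "Min (insert 0 X) \<le> x" "x \<le> Max (insert 0 X)" using assms(2) that by auto
    then show ?thesis using a(1) b(1) by linarith
  qed
  then show ?thesis using that a b by blast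
qed

text \<open>A quiet edge is never crossed. Applied to shifted clocks, this stops all inspected
  labels at the end of a block of consecutive arrows.\<close>

lemma gamma_confined:
  assumes n: "good n" and b: "quiet n t b" and "b < x" "0 \<le> t"
  shows "b < gamma n t x"
proof -
  obtain d where d: "quiet n t d" "x \<le> d" using good_region[OF n, of "{x}" t] by blast
  have "t \<le> t \<longrightarrow> (\<forall>x. b < x \<and> x \<le> d \<longrightarrow> b < gamma n t x)"
  using \<open>0 \<le> t\<close> order_refl proof (induction t rule: event_induct[where a=0, where J="region_times n b d", where P="\<lambda>s. s \<le> t \<longrightarrow> (\<forall>x. b < x \<and> x \<le> d \<longrightarrow> b < gamma n s x)"])
    case (step r s)
    show ?case
    proof (intro impI allI)
      fix x assume *: "s \<le> t" "b < x \<and> x \<le> d"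
      then show "b < gamma n s x"
        using step gamma_region_step[OF n b d(1) step(1,2)] cross_region[OF b d(1)] by auto
    qed
  qed (auto simp: finite_region_times[OF n])
  then show ?thesis using d assms by auto
qed

text \<open>At most one arrow sits at time \<open>s\<close>, so crossing is the identity or a
  transposition of two neighbours.\<close>

lemma cross_inj:
  assumes n: "good n" and eq: "cross n s x = cross n s y"
  shows "x = y"
proof (cases "\<exists>a. s \<in> jump_times (n (Arrow a))")
  case True
  then obtain a where a: "s \<in> jump_times (n (Arrow a))" by blast
  have "s \<in> jump_times (n (Arrow y)) \<longleftrightarrow> y = a" for y
    using good_disjoint[OF n a, of "Arrow y"] a by auto
  then show ?thesis using eq by (simp add: cross_def split: if_splits)
next
  case False
  then show ?thesis using eq by (simp add: cross_def)
qed

text \<open>A composition of transpositions. Injectivity is what separates the labels to the right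
  of the walk from those inspected before, and what keeps an i.i.d. configuration i.i.d. when it is
  read through \<open>gamma\<close>.\<close>

lemma gamma_inj:
  assumes n: "good n" and "0 \<le> t"
  shows "inj (gamma n t)"
proof (rule injI)
  fix x y assume eq: "gamma n t x = gamma n t y"
  obtain a b where ab: "quiet n t a" "quiet n t b" and xy: "\<And>z. z \<in> {x, y} \<Longrightarrow> a < z \<and> z \<le> b"
    using good_region[OF n, of "{x,y}" t] by (metis finite.emptyI finite_insert)
  have "t \<le> t \<longrightarrow> (\<forall>x y. a < x \<and> x \<le> b \<longrightarrow> a < y \<and> y \<le> b \<longrightarrow> gamma n t x = gamma n t y \<longrightarrow> x = y)"
  using \<open>0 \<le> t\<close> order_refl proof (induction t rule: event_induct[where a=0, where J="region_times n a b", where P="\<lambda>s. s \<le> t \<longrightarrow> (\<forall>x y. a < x \<and> x \<le> b \<longrightarrow> a < y \<and> y \<le> b \<longrightarrow> gamma n s x = gamma n s y \<longrightarrow> x = y)"])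
    case (step r s)
    show ?case
    proof (intro impI allI)
      fix x y assume *: "s \<le> t" "a < x \<and> x \<le> b" "a < y \<and> y \<le> b" "gamma n s x = gamma n s y"
      note st = gamma_region_step[OF n ab(1,2) step(1,2) *(1) _ _ step(3)]
      have "gamma n r (cross n s x) = gamma n r (cross n s y)"
        using *(2-4) st by auto
      then have "cross n s x = cross n s y"
        using step cross_region[OF ab(1,2) *(1)] *(1-3) by auto
      then show "x = y" by (rule cross_inj[OF n])
    qed
  qed (auto simp: finite_region_times[OF n])
  then show "x = y" using xy[of x] xy[of y] eq by auto
qed

text \<open>Flow property of the downward paths. An arrow exactly at \<open>T\<close> is crossed
  once: by the outer \<open>gamma n T\<close>, while the shifted clocks have positive jump times
  only.\<close>

lemma gamma_shift:
  assumes n: "good n" and T: "0 \<le> T" and "0 \<le> s"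
  shows "gamma n (T + s) (v + z) = gamma n T (v + gamma (shift_clocks T v n) s z)"
proof -
  let ?n = "shift_clocks T v n"
  note n' = good_shift[OF n T, of v]
  note J = jump_times_shift_clocks[OF good_path[OF n] T]
  obtain a b where ab: "quiet ?n s a" "quiet ?n s b" "a < z" "z \<le> b"
    using good_region[OF n', of "{z}" s] by blast
  have "s \<le> s \<longrightarrow> (\<forall>z. a < z \<and> z \<le> b \<longrightarrow> gamma n (T + s) (v + z) = gamma n T (v + gamma ?n s z))"
  using \<open>0 \<le> s\<close> order_refl proof (induction s rule: event_induct[where a=0, where J="region_times ?n a b", where P="\<lambda>u. u \<le> s \<longrightarrow> (\<forall>z. a < z \<and> z \<le> b \<longrightarrow> gamma n (T + u) (v + z) = gamma n T (v + gamma ?n u z))"])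
    case (step r u)
    show ?case
    proof (intro impI allI)
      fix z assume *: "u \<le> s" "a < z \<and> z \<le> b"
      note cr = cross_region[OF ab(1,2) *(1), of z]
      have cross: "cross n (T + u) (v + z) = v + cross ?n u z"
        using step(1,2) by (auto simp: cross_def J algebra_simps)
      have "arrow_times ?n (cross ?n u z) \<inter> {r<..<u} = {}"
        using region_no_arrow[OF step(3) ab(1)] cr *(2) by blast
      moreover have "x - T \<in> arrow_times ?n (cross ?n u z)"
        if "T < x" "x \<in> arrow_times n (v + cross ?n u z)" for x
        using that by (simp add: arrow_times_def J algebra_simps)
      ultimately have "x \<notin> arrow_times n (v + cross ?n u z)" if "T + r < x" "x < T + u" for x
        using that step(1) by (metis (no_types, lifting) IntI add.commute add_increasing2 add_strict_increasing2
          diff_less_eq empty_iff greaterThanLessThan_iff less_diff_eq order.strict_trans1 le_add_same_cancel1)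
      then have no: "arrow_times n (v + cross ?n u z) \<inter> {T+r<..<T+u} = {}" by auto
      have "gamma n (T + u) (v + z) = gamma n (T + r) (v + cross ?n u z)"
        using gamma_step[OF n, of "T + r" "T + u" "v + z"] no step(1,2) T by (simp add: cross)
      also have "\<dots> = gamma n T (v + gamma ?n r (cross ?n u z))"
        using step *(1,2) cr by auto
      also have "gamma ?n r (cross ?n u z) = gamma ?n u z"
        using gamma_region_step[OF n' ab(1,2) step(1,2) *(1) _ _ step(3), of z] *(2) by simp
      finally show "gamma n (T + u) (v + z) = gamma n T (v + gamma ?n u z)" .
    qed
  qed (auto simp: finite_region_times[OF n'])
  then show ?thesis using ab by auto
qed

section \<open>The upward paths\<close>

lemma right_path_unfold:
  "right_path n t x s = (if jump_times (n (Arrow x)) \<inter> {t<..s} = {} then x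
     else right_path n (Min (jump_times (n (Arrow x)) \<inter> {t<..s})) (x + 1) s)"
  unfolding right_path_def by (subst while_unfold) simp

lemma right_path_no_arrow: "jump_times (n (Arrow x)) \<inter> {t<..s} = {} \<Longrightarrow> right_path n t x s = x"
  by (subst right_path_unfold) simp

lemma right_path_arrow:
  "jump_times (n (Arrow x)) \<inter> {t<..s} \<noteq> {} \<Longrightarrow>
    right_path n t x s = right_path n (Min (jump_times (n (Arrow x)) \<inter> {t<..s})) (x + 1) s"
  by (subst right_path_unfold) simp

lemma right_path_refl [simp]: "right_path n t x t = x"
  by (simp add: right_path_no_arrow)

lemma Min_jump_times:
  assumes "good n" "jump_times (n c) \<inter> {t<..s} \<noteq> {}"
  shows "Min (jump_times (n c) \<inter> {t<..s}) \<in> jump_times (n c) \<inter> {t<..s}"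
  using assms by (intro Min_in finite_jump_times_subset good_path)

lemma quiet_Int: "quiet n s b \<Longrightarrow> jump_times (n (Arrow b)) \<inter> {t<..s} = {}"
  by (auto simp: quiet_def)

text \<open>Induction on the distance to the quiet edge: every arrow taken brings the path one site
  closer, and the arrow out of \<open>b\<close> never comes. In particular the loop ends.\<close>

lemma right_path_bounds:
  assumes n: "good n" and b: "quiet n s b" "x \<le> b"
  shows "x \<le> right_path n t x s" "right_path n t x s \<le> b"
proof -
  have "x \<le> right_path n t x s \<and> right_path n t x s \<le> b"
    using b(2)
  proof (induction "nat (b - x)" arbitrary: x t)
    case 0
    then have "x = b" by simp
    then show ?case using right_path_no_arrow[of n b t s, OF quiet_Int[OF b(1)]] by simp
  next
    case (Suc k)
    then have *: "k = nat (b - (x + 1))" "x + 1 \<le> b" by auto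
    show ?case
      using Suc(1)[OF *, of "Min (jump_times (n (Arrow x)) \<inter> {t<..s})"] Suc.prems
      by (subst (1 2) right_path_unfold) simp
  qed
  then show "x \<le> right_path n t x s" "right_path n t x s \<le> b" by auto
qed

lemma right_path_append:
  assumes n: "good n" and trs: "t \<le> r" "r \<le> s"
  shows "right_path n t x s = right_path n r (right_path n t x r) s"
proof -
  obtain b where b: "quiet n s b" "x \<le> b"
    using good_region[OF n, of "{x}" s] by (metis finite.emptyI finite_insert insertI1)
  show ?thesis
    using b(2) trs(1)
  proof (induction "nat (b - x)" arbitrary: x t)
    case 0
    then have [simp]: "x = b" by simp
    have "jump_times (n (Arrow b)) \<inter> {t<..s} = {}" "jump_times (n (Arrow b)) \<inter> {t<..r} = {}"
      "jump_times (n (Arrow b)) \<inter> {r<..s} = {}"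
      using b(1) trs by (auto simp: quiet_def)
    then show ?case by (simp add: right_path_no_arrow)
  next
    case (Suc k)
    then have *: "k = nat (b - (x + 1))" "x + 1 \<le> b" by auto
    let ?J = "jump_times (n (Arrow x))"
    show ?case
    proof (cases "?J \<inter> {t<..r} = {}")
      case True
      then have "?J \<inter> {t<..s} = ?J \<inter> {r<..s}" using Suc.prems trs by force
      moreover have "right_path n t x r = x" using True by (rule right_path_no_arrow)
      ultimately show ?thesis by (subst (1 2) right_path_unfold) simp
    next
      case False
      define q where "q = Min (?J \<inter> {t<..r})"
      have q: "q \<in> ?J \<inter> {t<..r}" unfolding q_def by (rule Min_jump_times[OF n False])
      have qmin: "q \<le> z" if "z \<in> ?J \<inter> {t<..r}" for z
        unfolding q_def using that by (intro Min_le finite_jump_times_subset good_path n)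
      have q': "q = Min (?J \<inter> {t<..s})"
      proof (rule Min_eqI[symmetric])
        show "q \<in> ?J \<inter> {t<..s}" using q trs by auto
        show "q \<le> y" if "y \<in> ?J \<inter> {t<..s}" for y
          using that qmin[of y] q by (cases "y \<le> r") auto
      qed (intro finite_jump_times_subset good_path n)
      have "?J \<inter> {t<..s} \<noteq> {}" using q trs by auto
      then have "right_path n t x s = right_path n q (x + 1) s"
        by (simp add: right_path_arrow q')
      also have "\<dots> = right_path n r (right_path n q (x + 1) r) s"
        using q by (intro Suc(1) *) auto
      also have "right_path n q (x + 1) r = right_path n t x r"
        using False by (simp add: right_path_arrow q_def)
      finally show ?thesis .
    qed
  qed
qed

lemma right_path_step:
  assumes n: "good n" and "t \<le> r" "r < s"
    and no: "jump_times (n (Arrow (right_path n t x r))) \<inter> {r<..<s} = {}"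
  shows "right_path n t x s = right_path n t x r + of_bool (s \<in> jump_times (n (Arrow (right_path n t x r))))"
proof -
  let ?y = "right_path n t x r"
  let ?J = "jump_times (n (Arrow ?y))"
  have "right_path n t x s = right_path n r ?y s"
    using assms by (intro right_path_append) auto
  also have "\<dots> = ?y + of_bool (s \<in> ?J)"
  proof (cases "s \<in> ?J")
    case True
    then have "?J \<inter> {r<..s} = {s}" using no assms(3) by (auto simp: set_eq_iff)
    then show ?thesis using True by (subst right_path_unfold) simp
  next
    case False
    then have "?J \<inter> {r<..s} = {}" using no by (force simp: set_eq_iff)
    then show ?thesis using False by (subst right_path_unfold) simp
  qed
  finally show ?thesis .
qed

lemma right_path_shift:
  assumes n: "good n" and T: "0 \<le> T" and "0 \<le> t"
  shows "right_path (shift_clocks T v n) t x s + v = right_path n (T + t) (x + v) (T + s)"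
proof -
  let ?n = "shift_clocks T v n"
  note n' = good_shift[OF n T, of v]
  note J = jump_times_shift_clocks[OF good_path[OF n] T]
  obtain b where b: "quiet ?n s b" "x \<le> b"
    using good_region[OF n', of "{x}" s] by (metis finite.emptyI finite_insert insertI1)
  have img: "jump_times (n (Arrow (x + v))) \<inter> {T+t<..T+s} = (\<lambda>u. T + u) ` (jump_times (?n (Arrow x)) \<inter> {t<..s})"
    if "0 \<le> t" for x t
  proof (intro set_eqI iffI)
    fix u assume "u \<in> jump_times (n (Arrow (x + v))) \<inter> {T+t<..T+s}"
    then show "u \<in> (\<lambda>u. T + u) ` (jump_times (?n (Arrow x)) \<inter> {t<..s})"
      using that by (intro image_eqI[of _ _ "u - T"]) (auto simp: J)
  qed (use that in \<open>auto simp: J\<close>)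
  show ?thesis
    using b(2) \<open>0 \<le> t\<close>
  proof (induction "nat (b - x)" arbitrary: x t)
    case 0
    then have [simp]: "x = b" by simp
    have "jump_times (?n (Arrow b)) \<inter> {t<..s} = {}" by (rule quiet_Int[OF b(1)])
    then show ?case using img[OF 0(3), of b] by (simp add: right_path_no_arrow)
  next
    case (Suc k)
    then have *: "k = nat (b - (x + 1))" "x + 1 \<le> b" by auto
    let ?J = "jump_times (?n (Arrow x)) \<inter> {t<..s}"
    show ?case
    proof (cases "?J = {}")
      case True
      then show ?thesis using img[OF Suc(4), of x] by (simp add: right_path_no_arrow)
    next
      case False
      have fin: "finite ?J" by (intro finite_jump_times_subset good_path n')
      have "Min ((\<lambda>u. T + u) ` ?J) = T + Min ?J"
        using fin False by (intro mono_Min_commute[symmetric]) (auto simp: mono_def)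
      then have M: "Min (jump_times (n (Arrow (x + v))) \<inter> {T+t<..T+s}) = T + Min ?J"
        by (simp add: img[OF Suc(4)])
      have ne: "jump_times (n (Arrow (x + v))) \<inter> {T+t<..T+s} \<noteq> {}"
        using False by (simp add: img[OF Suc(4)])
      have "0 \<le> Min ?J" using Min_jump_times[OF n' False] Suc.prems by auto
      from Suc(1)[OF * this] show ?thesis
        unfolding right_path_arrow[of ?n x t s, OF False] right_path_arrow[of n "x + v" "T + t" "T + s", OF ne] M by (simp add: ac_simps)
    qed
  qed
qed

text \<open>At an event the lower path rises by at most one, so it can at most meet the upper one;
  once together, both paths use the same arrows.\<close>

lemma right_path_mono:
  assumes n: "good n" and "0 \<le> t" "t \<le> s" "x \<le> y"
  shows "right_path n t x s \<le> right_path n t y s"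
proof -
  obtain a b where ab: "quiet n s a" "quiet n s b" and xy: "\<And>z. z \<in> {x, y} \<Longrightarrow> a < z \<and> z \<le> b"
    using good_region[OF n, of "{x,y}" s] by (metis finite.emptyI finite_insert)
  have "s \<le> s \<longrightarrow> right_path n t x s \<le> right_path n t y s"
    using \<open>t \<le> s\<close> \<open>0 \<le> t\<close>
  proof (rule event_induct[where J="region_times n a b" and P="\<lambda>u. u \<le> s \<longrightarrow> right_path n t x u \<le> right_path n t y u"])
    fix r u assume ru: "t \<le> r" "r < u" "region_times n a b \<inter> {r<..<u} = {}"
      and IH: "r \<le> s \<longrightarrow> right_path n t x r \<le> right_path n t y r"
    show "u \<le> s \<longrightarrow> right_path n t x u \<le> right_path n t y u"
    proof
      assume "u \<le> s"
      then have q: "quiet n r b" using ab(2) ru unfolding quiet_def by auto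
      have st: "right_path n t z u = right_path n t z r + of_bool (u \<in> jump_times (n (Arrow (right_path n t z r))))"
        if "z \<in> {x, y}" for z
      proof (rule right_path_step[OF n ru(1,2)])
        have "right_path n t z r \<in> {a..b}" using right_path_bounds[OF n q, of z t] xy[OF that] by auto
        then show "jump_times (n (Arrow (right_path n t z r))) \<inter> {r<..<u} = {}"
          using ru(3) unfolding region_times_def by blast
      qed
      show "right_path n t x u \<le> right_path n t y u"
        using IH \<open>u \<le> s\<close> ru(2) by (cases "right_path n t x r = right_path n t y r") (auto simp: st)
    qed
  qed (use assms(4) in \<open>auto simp: finite_region_times[OF n]\<close>)
  then show ?thesis by simp
qed

text \<open>Duality of the two kinds of paths: a downward path starting strictly to the right of
  \<open>Y\<close> could get past it only over the arrow on the edge above \<open>Y\<close>, and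
  \<open>Y\<close> takes every such arrow upwards. So what lies ahead of \<open>Y\<close> carries
  labels to the right of its starting site.\<close>

lemma gamma_right_path:
  assumes n: "good n" and "0 \<le> s" and x: "right_path n 0 y s < x"
  shows "y < gamma n s x"
proof -
  obtain a b where ab: "quiet n s a" "quiet n s b" and xy: "\<And>z. z \<in> {x, y} \<Longrightarrow> a < z \<and> z \<le> b"
    using good_region[OF n, of "{x,y}" s] by (metis finite.emptyI finite_insert)
  define P where "P = (\<lambda>u. u \<le> s \<longrightarrow> (\<forall>x. a < x \<and> x \<le> b \<longrightarrow> right_path n 0 y u < x \<longrightarrow> y < gamma n u x))"
  have "P s"
    using \<open>0 \<le> s\<close> order_refl[of 0]
  proof (rule event_induct[where J="region_times n a b"])
    fix r u assume ru: "0 \<le> r" "r < u" "region_times n a b \<inter> {r<..<u} = {}" and IH: "P r"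
    show "P u" unfolding P_def
    proof (intro impI allI)
      fix x assume us: "u \<le> s" and x: "a < x \<and> x \<le> b" and less: "right_path n 0 y u < x"
      then have q: "quiet n r b" using ab(2) ru unfolding quiet_def by auto
      have "right_path n 0 y r \<in> {a..b}" using right_path_bounds[OF n q, of y 0] xy[of y] by auto
      then have "jump_times (n (Arrow (right_path n 0 y r))) \<inter> {r<..<u} = {}"
        using ru(3) unfolding region_times_def by blast
      then have st: "right_path n 0 y u = right_path n 0 y r + of_bool (u \<in> jump_times (n (Arrow (right_path n 0 y r))))"
        by (rule right_path_step[OF n ru(1,2)])
      \<comment> \<open>If \<open>x\<close> is adjacent to the position of \<open>Y\<close> before
        \<open>u\<close>, there is no arrow between them at \<open>u\<close>, since \<open>Y\<close>
        would have followed it to \<open>x\<close>. Otherwise there is room for one step of the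
        downward path to the left.\<close>
      have "right_path n 0 y r + 1 < x \<or> x = right_path n 0 y r + 1 \<and> u \<notin> jump_times (n (Arrow (x - 1)))"
        using less unfolding st
        by (cases "u \<in> jump_times (n (Arrow (right_path n 0 y r)))"; cases "x = right_path n 0 y r + 1") auto
      then have "right_path n 0 y r < cross n u x"
        by (auto simp: cross_def)
      then have "y < gamma n r (cross n u x)"
        using IH us ru(2) cross_region[OF ab us, of x] x unfolding P_def by auto
      then show "y < gamma n u x"
        using gamma_region_step[OF n ab ru(1,2) us _ _ ru(3)] x by simp
    qed
  qed (auto simp: P_def finite_region_times[OF n])
  then show ?thesis using x xy[of x] by (simp add: P_def)
qed

section \<open>The walk\<close>

lemma Ioc_split: "(a::real) \<le> r \<Longrightarrow> r < s \<Longrightarrow> J \<inter> {r<..<s} = {} \<Longrightarrow> J \<inter> {a<..s} = (J \<inter> {a<..r}) \<union> (J \<inter> {s})"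
  by (intro set_eqI iffI; simp add: disjoint_iff; metis not_le order_le_less order_less_le_trans order_less_trans)

lemma finite_walk_clock_times: "\<forall>c. counting_path (n c) \<Longrightarrow> finite (walk_clock_times n \<inter> {r<..t})"
proof (rule finite_subset)
  show "walk_clock_times n \<inter> {r<..t} \<subseteq> (\<Union>c\<in>walk_clocks. jump_times (n c) \<inter> {r<..t})"
    by (auto simp: walk_clocks_def walk_clock_times_def)
qed (intro finite_UN_I finite_jump_times_subset; simp add: walk_clocks_def)

lemma walk_jump_no_ring: "s \<notin> walk_clock_times n \<Longrightarrow> walk_jump \<alpha> \<beta> e n s x = 0"
  by (simp add: walk_jump_def walk_clock_times_def Let_def)

lemma walk_0 [simp]: "walk \<alpha> \<beta> e n 0 = 0"
  by (simp add: walk_def)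

lemma walk_step:
  assumes n: "\<forall>c. counting_path (n c)" and "0 \<le> r" "r < s" and no: "walk_clock_times n \<inter> {r<..<s} = {}"
  shows "walk \<alpha> \<beta> e n s = walk \<alpha> \<beta> e n r + walk_jump \<alpha> \<beta> e n s (walk \<alpha> \<beta> e n r)"
proof (cases "s \<in> walk_clock_times n")
  case True
  let ?A = "walk_clock_times n \<inter> {0<..r}"
  have eq: "walk_clock_times n \<inter> {0<..s} = insert s ?A"
    using Ioc_split[OF assms(2,3) no] True by auto
  have "sorted_list_of_set (insert s ?A) = sorted_list_of_set ?A @ [s]"
    using finite_walk_clock_times[OF n, of 0 r] assms(3)
    by (simp add: sorted_insort_is_snoc)
  then show ?thesis by (simp add: walk_def eq)
next
  case False
  then have "walk_clock_times n \<inter> {0<..s} = walk_clock_times n \<inter> {0<..r}"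
    using Ioc_split[OF assms(2,3) no] by auto
  then show ?thesis using False by (simp add: walk_def walk_jump_no_ring)
qed

text \<open>By \<open>gamma_shift\<close> the labels read after \<open>T\<close> factor through
  \<open>gamma n T\<close>, so the exclusion process at \<open>T\<close>, recentred at the walk,
  acts as a new initial configuration for the recentred clocks.\<close>

lemma walk_shift:
  assumes n: "good n" and T: "0 \<le> T" and "0 \<le> s"
    and v_def: "v = walk \<alpha> \<beta> e n T" and e'_def: "e' = (\<lambda>y. exclusion e n T (v + y))"
  shows "walk \<alpha> \<beta> e n (T + s) = v + walk \<alpha> \<beta> e' (shift_clocks T v n) s"
proof -
  let ?n = "shift_clocks T v n"
  note n' = good_shift[OF n T, of v]
  note J = jump_times_shift_clocks[OF good_path[OF n] T]
  have ring: "u \<in> walk_clock_times ?n \<longleftrightarrow> 0 < u \<and> T + u \<in> walk_clock_times n" for u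
    by (auto simp: walk_clock_times_def J)
  have jump: "walk_jump \<alpha> \<beta> e n (T + u) (v + z) = walk_jump \<alpha> \<beta> e' ?n u z" if "0 < u" for u z
  proof -
    have "exclusion e n (T + u) (v + z) = exclusion e' ?n u z"
      using gamma_shift[OF n T, of u v z] that by (simp add: exclusion_def e'_def)
    then show ?thesis using that by (simp add: walk_jump_def J Let_def)
  qed
  show ?thesis
    using \<open>0 \<le> s\<close> order_refl[of 0]
  proof (rule event_induct[where J="walk_clock_times ?n"])
    fix r u assume ru: "0 \<le> r" "r < u" "walk_clock_times ?n \<inter> {r<..<u} = {}"
      and IH: "walk \<alpha> \<beta> e n (T + r) = v + walk \<alpha> \<beta> e' ?n r"
    have "x \<notin> walk_clock_times n" if "T + r < x" "x < T + u" for x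
    proof
      assume "x \<in> walk_clock_times n"
      then have "x - T \<in> walk_clock_times ?n" using that ru by (simp add: ring)
      then show False using ru(3) that by auto
    qed
    then have "walk_clock_times n \<inter> {T+r<..<T+u} = {}" by auto
    then have "walk \<alpha> \<beta> e n (T + u) = walk \<alpha> \<beta> e n (T + r) + walk_jump \<alpha> \<beta> e n (T + u) (walk \<alpha> \<beta> e n (T + r))"
      using ru T by (intro walk_step good_paths[OF n]) auto
    also have "\<dots> = v + walk \<alpha> \<beta> e' ?n r + walk_jump \<alpha> \<beta> e' ?n u (walk \<alpha> \<beta> e' ?n r)"
      using jump ru by (simp add: IH)
    also have "\<dots> = v + walk \<alpha> \<beta> e' ?n u"
      using walk_step[OF good_paths[OF n'] ru, of \<alpha> \<beta> e'] by simp
    finally show "walk \<alpha> \<beta> e n (T + u) = v + walk \<alpha> \<beta> e' ?n u" .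
  qed (use finite_walk_clock_times[OF good_paths[OF n']] in \<open>auto simp: v_def\<close>)
qed

lemma walk_jump_bounds:
  assumes n: "\<forall>c. counting_path (n c)" and ru: "0 \<le> r" "r < u"
  shows "walk_jump \<alpha> \<beta> e n u x \<le> (int (n Plus u) - n Plus r) + (int (n HatPlus u) - n HatPlus r)"
    and "walk_jump \<alpha> \<beta> e n u x \<ge> of_bool (u \<in> jump_times (n Plus)) - (int (n Minus u) - n Minus r) - (int (n HatMinus u) - n HatMinus r)"
proof -
  have *: "of_bool (u \<in> jump_times (n c) \<and> Q) \<le> int (n c u) - n c r" for c Q
    using jump_times_less[of u "n c" r] counting_path_mono[of "n c" r u] n ru by auto
  show "walk_jump \<alpha> \<beta> e n u x \<le> (int (n Plus u) - n Plus r) + (int (n HatPlus u) - n HatPlus r)"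
    "walk_jump \<alpha> \<beta> e n u x \<ge> of_bool (u \<in> jump_times (n Plus)) - (int (n Minus u) - n Minus r) - (int (n HatMinus u) - n HatMinus r)"
    unfolding walk_jump_def Let_def
    using *[of Plus True] *[of HatPlus "\<alpha> (exclusion e n u x) = max (\<alpha> False) (\<alpha> True)"]
      *[of Minus True] *[of HatMinus "\<beta> (exclusion e n u x) = max (\<beta> False) (\<beta> True)"]
    by (auto simp del: of_bool_conj)
qed

text \<open>Regularity does not exclude jumps of a clock by more than one, at which the walk makes a
  single step. Hence the asymmetry: increments of the clocks bound numbers of steps from above, but
  steps to the right are bounded from below by counting jump times of \<open>Plus\<close>.\<close>

lemma walk_increment_bounds:
  assumes n: "\<forall>c. counting_path (n c)" and st: "0 \<le> s" "s \<le> t"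
  shows "walk \<alpha> \<beta> e n t - walk \<alpha> \<beta> e n s \<le> (int (n Plus t) - n Plus s) + (int (n HatPlus t) - n HatPlus s)"
    and "walk \<alpha> \<beta> e n t - walk \<alpha> \<beta> e n s \<ge> card (jump_times (n Plus) \<inter> {s<..t})
      - (int (n Minus t) - n Minus s) - (int (n HatMinus t) - n HatMinus s)"
proof -
  define P where "P = (\<lambda>t. walk \<alpha> \<beta> e n t - walk \<alpha> \<beta> e n s \<le> (int (n Plus t) - n Plus s) + (int (n HatPlus t) - n HatPlus s)
    \<and> walk \<alpha> \<beta> e n t - walk \<alpha> \<beta> e n s \<ge> card (jump_times (n Plus) \<inter> {s<..t})
      - (int (n Minus t) - n Minus s) - (int (n HatMinus t) - n HatMinus s))"
  have "P t"
    using st(2,1)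
  proof (rule event_induct[where J="walk_clock_times n"])
    fix r u assume ru: "s \<le> r" "r < u" "walk_clock_times n \<inter> {r<..<u} = {}" and IH: "P r"
    have r0: "0 \<le> r" using ru st by simp
    have "jump_times (n Plus) \<inter> {r<..<u} = {}" using ru(3) by (auto simp: walk_clock_times_def)
    then have "jump_times (n Plus) \<inter> {s<..u} = (if u \<in> jump_times (n Plus) then insert u (jump_times (n Plus) \<inter> {s<..r}) else jump_times (n Plus) \<inter> {s<..r})"
      using Ioc_split[OF ru(1,2), of "jump_times (n Plus)"] by auto
    moreover have "finite (jump_times (n Plus) \<inter> {s<..r})" using n by (intro finite_jump_times_subset) simp
    ultimately have "card (jump_times (n Plus) \<inter> {s<..u}) = card (jump_times (n Plus) \<inter> {s<..r}) + of_bool (u \<in> jump_times (n Plus))"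
      using ru by simp
    then show "P u"
      using IH walk_jump_bounds[OF n r0 ru(2), of \<alpha> \<beta> e "walk \<alpha> \<beta> e n r"] walk_step[OF n r0 ru(2,3), of \<alpha> \<beta> e]
      unfolding P_def by simp
  qed (auto simp: P_def finite_walk_clock_times n)
  then show "walk \<alpha> \<beta> e n t - walk \<alpha> \<beta> e n s \<le> (int (n Plus t) - n Plus s) + (int (n HatPlus t) - n HatPlus s)"
    "walk \<alpha> \<beta> e n t - walk \<alpha> \<beta> e n s \<ge> card (jump_times (n Plus) \<inter> {s<..t})
      - (int (n Minus t) - n Minus s) - (int (n HatMinus t) - n HatMinus s)"
    by (auto simp: P_def)
qed

lemma walk_const:
  assumes n: "\<forall>c. counting_path (n c)" and st: "0 \<le> s" "s \<le> t" and no: "walk_clock_times n \<inter> {s<..t} = {}"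
  shows "walk \<alpha> \<beta> e n t = walk \<alpha> \<beta> e n s"
proof -
  have "walk_clock_times n \<inter> {0<..t} = walk_clock_times n \<inter> {0<..s}"
    using st no by force
  then show ?thesis by (simp add: walk_def)
qed

text \<open>Only at these times does the walk look at the exclusion process.\<close>

definition hat_times :: "(clock \<Rightarrow> real \<Rightarrow> nat) \<Rightarrow> real set" where
  "hat_times n = jump_times (n HatPlus) \<union> jump_times (n HatMinus)"

lemma walk_jump_cong:
  "(s \<in> hat_times n \<Longrightarrow> exclusion e n s x = exclusion e' n s x) \<Longrightarrow> walk_jump \<alpha> \<beta> e n s x = walk_jump \<alpha> \<beta> e' n s x"
  by (cases "s \<in> hat_times n") (auto simp: walk_jump_def hat_times_def Let_def)

text \<open>At time \<open>u\<close>, the walk looks at the site where it has been since time \<open>r\<close>.\<close>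

definition inspects :: "(clock \<Rightarrow> real \<Rightarrow> nat) \<Rightarrow> real \<Rightarrow> real \<Rightarrow> bool" where
  "inspects n r u \<longleftrightarrow> 0 \<le> r \<and> r < u \<and> u \<in> hat_times n \<and> walk_clock_times n \<inter> {r<..<u} = {}"

text \<open>The configuration matters only through the labels read at hatted rings. The hypothesis
  refers to the path of \<open>e\<close> alone; by induction the path of \<open>e'\<close> has been
  the same up to each inspection.\<close>

lemma walk_cong_inspects:
  assumes n: "\<forall>c. counting_path (n c)" and "0 \<le> t" "t \<le> T"
    and eq: "\<And>r u. inspects n r u \<Longrightarrow> u \<le> T \<Longrightarrow>
      e (gamma n u (walk \<alpha> \<beta> e n r)) = e' (gamma n u (walk \<alpha> \<beta> e n r))"
  shows "walk \<alpha> \<beta> e n t = walk \<alpha> \<beta> e' n t"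
proof -
  define P where "P = (\<lambda>t. t \<le> T \<longrightarrow> walk \<alpha> \<beta> e n t = walk \<alpha> \<beta> e' n t)"
  have "P t" using \<open>0 \<le> t\<close> order_refl[of 0]
  proof (rule event_induct[where J="walk_clock_times n"])
    fix r u assume ru: "0 \<le> r" "r < u" "walk_clock_times n \<inter> {r<..<u} = {}" and IH: "P r"
    show "P u" unfolding P_def
    proof
      assume u: "u \<le> T"
      then have IH: "walk \<alpha> \<beta> e' n r = walk \<alpha> \<beta> e n r" using IH ru by (simp add: P_def)
      have "walk_jump \<alpha> \<beta> e n u (walk \<alpha> \<beta> e n r) = walk_jump \<alpha> \<beta> e' n u (walk \<alpha> \<beta> e n r)"
        using ru u by (intro walk_jump_cong) (auto simp: exclusion_def inspects_def intro!: eq)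
      then show "walk \<alpha> \<beta> e n u = walk \<alpha> \<beta> e' n u"
        using walk_step[OF n ru, of \<alpha> \<beta> e] walk_step[OF n ru, of \<alpha> \<beta> e'] IH by simp
    qed
  qed (auto simp: P_def finite_walk_clock_times n)
  then show ?thesis using assms by (simp add: P_def)
qed

section \<open>The front of the inspected labels\<close>

text \<open>Length of the run of edges from \<open>b\<close> on that all have an arrow during the
  slab. Whatever the order of these arrows in time, nothing starting at or to the left of
  \<open>b\<close> gets beyond \<open>b + block\<close>. The length is geometrically
  distributed.\<close>

definition block :: "(clock \<Rightarrow> real \<Rightarrow> nat) \<Rightarrow> real \<Rightarrow> real \<Rightarrow> int \<Rightarrow> nat" where
  "block n s t b = (LEAST k. n (Arrow (b + int k)) t = n (Arrow (b + int k)) s)"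

text \<open>At time \<open>h * m\<close>, every label \<open>gamma\<close> that the walk has looked at sits at or to the left of the front.\<close>

fun front :: "(bool \<Rightarrow> real) \<Rightarrow> (bool \<Rightarrow> real) \<Rightarrow> real \<Rightarrow> (int \<Rightarrow> bool) \<Rightarrow> (clock \<Rightarrow> real \<Rightarrow> nat) \<Rightarrow> nat \<Rightarrow> int" where
  "front \<alpha> \<beta> h e n 0 = -1"
| "front \<alpha> \<beta> h e n (Suc m) = (let s = h * m; t = h * Suc m;
     b = (if n HatPlus t = n HatPlus s \<and> n HatMinus t = n HatMinus s then front \<alpha> \<beta> h e n m
          else max (front \<alpha> \<beta> h e n m)
            (walk \<alpha> \<beta> e n s + (int (n Plus t) - n Plus s) + (int (n HatPlus t) - n HatPlus s)))
     in b + int (block n s t b))"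

text \<open>Quiet edges exist arbitrarily far to the right, so the least such \<open>k\<close>
  exists.\<close>

lemma block_quiet:
  assumes n: "good n" and s: "0 \<le> s" "s \<le> t"
  shows "n (Arrow (b + int (block n s t b))) t = n (Arrow (b + int (block n s t b))) s"
proof -
  obtain d where d: "d \<ge> b" "quiet n t d" using n unfolding good_def by blast
  have "jump_times (n (Arrow d)) \<inter> {s<..t} = {}" using d(2) by (rule quiet_Int)
  then have "n (Arrow d) t = n (Arrow d) s"
    using jump_times_Ioc_nonempty_iff[OF good_path[OF n] s, of "Arrow d"]
      counting_path_mono[OF good_path[OF n] s, of "Arrow d"] by auto
  then have "n (Arrow (b + int (nat (d - b)))) t = n (Arrow (b + int (nat (d - b)))) s" using d by simp
  then show ?thesis unfolding block_def by (rule LeastI)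
qed

lemma quiet_shift:
  assumes n: "good n" and s: "0 \<le> s" "s \<le> t" and "n (Arrow b) t = n (Arrow b) s" "s \<le> u"
  shows "quiet (shift_clocks u 0 n) (t - u) b"
proof -
  have u: "0 \<le> u" using assms by simp
  have "jump_times (n (Arrow b)) \<inter> {s<..t} = {}"
    using jump_times_Ioc_nonempty_iff[OF good_path[OF n] s, of "Arrow b"] assms(4) by simp
  then show ?thesis
    using \<open>s \<le> u\<close> by (fastforce simp: quiet_def jump_times_shift_clocks[OF good_path[OF n] u])
qed

text \<open>Suppose that a site beyond the edge \<open>B\<close> at the end of the last slab carried
  an inspected label. As \<open>B\<close> has no arrow in the slab, the downward path stays beyond
  \<open>B\<close>, either to the beginning of the slab, where the old front bounds older
  inspections, or to an inspection within the slab, where by injectivity it must meet the walk, and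
  the walk cannot have been beyond \<open>b\<close>.\<close>

lemma inspected_le_front:
  assumes n: "good n" and h: "0 < h"
  assumes "inspects n r u" "u \<le> h * m" "gamma n (h * m) x = gamma n u (walk \<alpha> \<beta> e n r)"
  shows "x \<le> front \<alpha> \<beta> h e n m"
  using assms(3-)
proof (induction m arbitrary: r u x)
  case 0
  then show ?case by (auto simp: inspects_def)
next
  case (Suc m)
  define s where "s = h * m"
  define t where "t = h * Suc m"
  have st: "0 \<le> s" "s < t" using h by (auto simp: s_def t_def)
  define b where "b = (if n HatPlus t = n HatPlus s \<and> n HatMinus t = n HatMinus s then front \<alpha> \<beta> h e n m
          else max (front \<alpha> \<beta> h e n m)
            (walk \<alpha> \<beta> e n s + (int (n Plus t) - n Plus s) + (int (n HatPlus t) - n HatPlus s)))"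
  define B where "B = b + int (block n s t b)"
  have B: "n (Arrow B) t = n (Arrow B) s" unfolding B_def using st by (intro block_quiet n) auto
  have front: "front \<alpha> \<beta> h e n (Suc m) = B" by (simp add: B_def b_def s_def t_def Let_def)
  have eq: "gamma n t x = gamma n u (walk \<alpha> \<beta> e n r)" and ut: "u \<le> t" using Suc.prems by (auto simp: t_def)
  have u: "0 \<le> r" "r < u" "0 \<le> u" "u \<in> hat_times n" "walk_clock_times n \<inter> {r<..<u} = {}"
    using Suc.prems by (auto simp: inspects_def)
  show ?case unfolding front
  proof (rule ccontr)
    assume "\<not> x \<le> B"
    then have x: "B < x" by simp
    show False
    proof (cases "u \<le> s")
      case True
      define w where "w = gamma (shift_clocks s 0 n) (t - s) x"
      have "gamma n t x = gamma n s w"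
        using gamma_shift[OF n st(1), of "t - s" 0 x] st by (simp add: w_def)
      then have "w \<le> front \<alpha> \<beta> h e n m"
        using Suc True eq by (simp add: s_def)
      moreover have "B < w" unfolding w_def
        using st x by (intro gamma_confined good_shift n quiet_shift[where s=s] B) auto
      moreover have "front \<alpha> \<beta> h e n m \<le> b" by (simp add: b_def)
      then have "front \<alpha> \<beta> h e n m \<le> B" by (simp add: B_def)
      ultimately show False by simp
    next
      case False
      define w where "w = gamma (shift_clocks u 0 n) (t - u) x"
      have "gamma n t x = gamma n u w"
        using gamma_shift[OF n u(3), of "t - u" 0 x] ut by (simp add: w_def)
      then have "w = walk \<alpha> \<beta> e n r" using eq gamma_inj[OF n u(3)] by (auto dest: injD)
      moreover have "B < w" unfolding w_def
        using st x False ut by (intro gamma_confined good_shift n quiet_shift[where s=s] B u) auto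
      moreover have "walk \<alpha> \<beta> e n r \<le> b"
      proof -
        have hat: "n c s < n c t" if "u \<in> jump_times (n c)" for c
          using jump_times_Ioc_nonempty_iff[OF good_path[OF n], of s t c] st that False ut by auto
        have *: "walk \<alpha> \<beta> e n s + (int (n Plus t) - n Plus s) + (int (n HatPlus t) - n HatPlus s) \<le> b"
          using u(4) hat[of HatPlus] hat[of HatMinus] by (auto simp: b_def hat_times_def)
        \<comment> \<open>The walk may have come to the inspected site before the slab began; its
          position at \<open>max r s\<close> is the same, and from time \<open>s\<close> on its
          steps to the right are counted by the clocks.\<close>
        define r' where "r' = max r s"
        have "walk_clock_times n \<inter> {r<..r'} = {}"
          using u(5) False u(2) by (auto simp: r'_def max_def)
        then have "walk \<alpha> \<beta> e n r' = walk \<alpha> \<beta> e n r"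
          using u by (intro walk_const good_paths[OF n]) (auto simp: r'_def)
        moreover have "walk \<alpha> \<beta> e n r' - walk \<alpha> \<beta> e n s \<le> (int (n Plus r') - n Plus s) + (int (n HatPlus r') - n HatPlus s)"
          using st by (intro walk_increment_bounds good_paths[OF n]) (auto simp: r'_def)
        moreover have "r' \<le> t" "0 \<le> r'" using u ut st by (auto simp: r'_def)
        then have "n Plus r' \<le> n Plus t" "n HatPlus r' \<le> n HatPlus t"
          using counting_path_mono[OF good_path[OF n]] by auto
        ultimately show ?thesis using * by linarith
      qed
      moreover have "b \<le> B" by (simp add: B_def)
      ultimately show False by simp
    qed
  qed
qed

lemma front_cong:
  assumes h: "0 < h"
  shows "(\<And>t. 0 \<le> t \<Longrightarrow> t \<le> h * m \<Longrightarrow> walk \<alpha> \<beta> e n t = walk \<alpha> \<beta> e' n t) \<Longrightarrow> front \<alpha> \<beta> h e n m = front \<alpha> \<beta> h e' n m"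
proof (induction m)
  case (Suc m)
  have le: "h * m \<le> h * Suc m" using h by simp
  have "front \<alpha> \<beta> h e n m = front \<alpha> \<beta> h e' n m"
    using Suc.prems le by (intro Suc.IH) auto
  moreover have "walk \<alpha> \<beta> e n (h * m) = walk \<alpha> \<beta> e' n (h * m)"
    using Suc.prems[of "h * m"] le h by simp
  ultimately show ?case by (simp add: Let_def)
qed simp

text \<open>Behind the front, the environment has not been inspected: it can be changed without changing the past of the walk.\<close>

lemma walk_local:
  assumes n: "good n" and h: "0 < h" and fr: "front \<alpha> \<beta> h e n m < walk \<alpha> \<beta> e n (h * m)"
    and eq: "\<And>z. z \<notin> gamma n (h * m) ` {walk \<alpha> \<beta> e n (h * m)..} \<Longrightarrow> e z = e' z"
    and t: "0 \<le> t" "t \<le> h * m"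
  shows "walk \<alpha> \<beta> e n t = walk \<alpha> \<beta> e' n t"
proof (rule walk_cong_inspects[OF good_paths[OF n] t])
  fix r u assume u: "inspects n r u" "u \<le> h * m"
  show "e (gamma n u (walk \<alpha> \<beta> e n r)) = e' (gamma n u (walk \<alpha> \<beta> e n r))"
  proof (rule eq, rule notI)
    assume "gamma n u (walk \<alpha> \<beta> e n r) \<in> gamma n (h * m) ` {walk \<alpha> \<beta> e n (h * m)..}"
    then obtain x where "gamma n (h * m) x = gamma n u (walk \<alpha> \<beta> e n r)" "walk \<alpha> \<beta> e n (h * m) \<le> x" by auto
    then show False using inspected_le_front[OF n h u] fr by force
  qed
qed

section \<open>Stopping the clocks\<close>

lemma gamma_stop:
  assumes n: "good n" and t: "0 \<le> t" "t \<le> T"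
  shows "gamma (stop_clocks T n) t x = gamma n t x"
proof -
  let ?n = "stop_clocks T n"
  have T: "0 \<le> T" using t by simp
  note n' = good_stop[OF n T]
  note J = jump_times_stop_clocks[OF good_path[OF n] T]
  obtain a b where ab: "quiet n t a" "quiet n t b" and x: "\<And>z. z \<in> {x} \<Longrightarrow> a < z \<and> z \<le> b"
    using good_region[OF n, of "{x}" t] by (metis finite.emptyI finite_insert)
  have ab': "quiet ?n t a" "quiet ?n t b" using ab by (auto simp: quiet_def J)
  define P where "P = (\<lambda>u. u \<le> t \<longrightarrow> (\<forall>x. a < x \<and> x \<le> b \<longrightarrow> gamma ?n u x = gamma n u x))"
  have "P t" using t(1) order_refl[of 0]
  proof (rule event_induct[where J="region_times n a b"])
    fix r u assume ru: "0 \<le> r" "r < u" "region_times n a b \<inter> {r<..<u} = {}" and IH: "P r"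
    have no': "region_times ?n a b \<inter> {r<..<u} = {}" using ru(3) unfolding region_times_def J by blast
    show "P u" unfolding P_def
    proof (intro impI allI)
      fix x assume u: "u \<le> t" and x: "a < x \<and> x \<le> b"
      have "cross ?n u x = cross n u x" using u t by (simp add: cross_def J)
      moreover have "gamma ?n u x = gamma ?n r (cross ?n u x)"
        using x by (intro gamma_region_step[OF n' ab' ru(1,2) u _ _ no']) auto
      moreover have "gamma n u x = gamma n r (cross n u x)"
        using x by (intro gamma_region_step[OF n ab ru(1,2) u _ _ ru(3)]) auto
      ultimately show "gamma ?n u x = gamma n u x"
        using IH u ru cross_region[OF ab u, of x] x by (simp add: P_def)
    qed
  qed (auto simp: P_def finite_region_times[OF n])
  then show ?thesis using x by (simp add: P_def)
qed

lemma walk_stop: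
  assumes n: "good n" and t: "0 \<le> t" "t \<le> T"
  shows "walk \<alpha> \<beta> e (stop_clocks T n) t = walk \<alpha> \<beta> e n t"
proof -
  let ?n = "stop_clocks T n"
  have T: "0 \<le> T" using t by simp
  note n' = good_stop[OF n T]
  note J = jump_times_stop_clocks[OF good_path[OF n] T]
  define P where "P = (\<lambda>u. u \<le> t \<longrightarrow> walk \<alpha> \<beta> e ?n u = walk \<alpha> \<beta> e n u)"
  have "P t" using t(1) order_refl[of 0]
  proof (rule event_induct[where J="walk_clock_times n"])
    fix r u assume ru: "0 \<le> r" "r < u" "walk_clock_times n \<inter> {r<..<u} = {}" and IH: "P r"
    have no': "walk_clock_times ?n \<inter> {r<..<u} = {}" using ru(3) unfolding walk_clock_times_def J by blast
    show "P u" unfolding P_def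
    proof
      assume u: "u \<le> t"
      have "walk_jump \<alpha> \<beta> e ?n u x = walk_jump \<alpha> \<beta> e n u x" for x
        using u t ru gamma_stop[OF n, of u T x] by (simp add: walk_jump_def J exclusion_def)
      then show "walk \<alpha> \<beta> e ?n u = walk \<alpha> \<beta> e n u"
        using walk_step[OF good_paths[OF n'] ru(1,2) no', of \<alpha> \<beta> e] walk_step[OF good_paths[OF n] ru, of \<alpha> \<beta> e] IH u ru
        by (simp add: P_def)
    qed
  qed (use finite_walk_clock_times[OF good_paths[OF n]] in \<open>auto simp: P_def\<close>)
  then show ?thesis by (simp add: P_def)
qed

lemma right_path_stop:
  assumes n: "good n" and t: "0 \<le> t" "t \<le> T"
  shows "right_path (stop_clocks T n) s x t = right_path n s x t"
proof -
  have "0 \<le> T" using t by simp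
  then have "jump_times (stop_clocks T n (Arrow y)) \<inter> {r<..t} = jump_times (n (Arrow y)) \<inter> {r<..t}" for y r
    using t by (auto simp: jump_times_stop_clocks[OF good_path[OF n]])
  then show ?thesis unfolding right_path_def by simp
qed

lemma front_stop:
  assumes n: "good n" and h: "0 < h"
  shows "h * m \<le> T \<Longrightarrow> front \<alpha> \<beta> h e (stop_clocks T n) m = front \<alpha> \<beta> h e n m"
proof (induction m)
  case (Suc m)
  have le: "h * m \<le> h * Suc m" "0 \<le> h * m" using h by simp_all
  then have "0 \<le> h * Suc m" by linarith
  note le = le this Suc.prems order_trans[OF le(1) Suc.prems]
  have "stop_clocks T n c (h * m) = n c (h * m)" "stop_clocks T n c (h * Suc m) = n c (h * Suc m)" for c
    using le by (auto simp: stop_clocks_def min_def)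
  then show ?case
    using Suc.IH le walk_stop[OF n, of "h * m" T \<alpha> \<beta> e]
    by (simp add: Let_def block_def del: of_nat_Suc)
qed simp

section \<open>The walk ahead of an upward path\<close>

lemma finite_gap:
  assumes "finite (J \<inter> {t<..t+1::real})"
  obtains u where "t < u" "J \<inter> {t<..<u} = {}"
proof -
  define u where "u = Min (insert (t+1) (J \<inter> {t<..t+1}))"
  have "t < u" using assms by (auto simp: u_def)
  have "x \<notin> J" if "t < x" "x < u" for x
  proof
    assume "x \<in> J"
    have "x < t + 1" using assms that by (simp add: u_def)
    then have "u \<le> x" using \<open>x \<in> J\<close> that assms unfolding u_def by (intro Min_le) auto
    then show False using that by simp
  qed
  then have "J \<inter> {t<..<u} = {}" by auto
  with \<open>t < u\<close> show ?thesis by (rule that)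
qed

lemma walk_right_const:
  assumes n: "\<forall>c. counting_path (n c)" and t: "0 \<le> t"
  obtains u where "t < u" "\<And>s. t \<le> s \<Longrightarrow> s < u \<Longrightarrow> walk \<alpha> \<beta> e n s = walk \<alpha> \<beta> e n t"
proof -
  obtain u where u: "t < u" "walk_clock_times n \<inter> {t<..<u} = {}"
    using finite_gap[OF finite_walk_clock_times[OF n]] .
  then have "walk_clock_times n \<inter> {t<..s} = {}" if "s < u" for s using that by auto
  then show ?thesis using walk_const[OF n t] u that by metis
qed

text \<open>Only regular paths are assumed, not quiet edges, because \<open>caught\<close> has to be
  measurable on the whole space. So the loop may run for ever, and this case is treated
  separately.\<close>

lemma right_path_right_const:
  assumes n: "\<forall>c. counting_path (n c)" and t: "t \<le> s"
  shows "\<exists>u>s. \<forall>s'. s \<le> s' \<longrightarrow> s' < u \<longrightarrow> right_path n t x s' = right_path n t x s"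
proof -
  define b where "b = (\<lambda>s (r, y). jump_times (n (Arrow y)) \<inter> {r<..s} \<noteq> {})"
  define c where "c = (\<lambda>s (r, y). (Min (jump_times (n (Arrow y)) \<inter> {r<..s::real}), y + 1 :: int))"
  have rp: "right_path n t x s = snd (while (b s) (c s) (t, x))" for t x s
    by (simp add: right_path_def b_def c_def)
  have fin: "finite (jump_times (n c) \<inter> {r<..s})" for c r s using n by (intro finite_jump_times_subset) simp
  have b_mono: "b s' st" if "b s st" "s \<le> s'" for s s' st
    using that by (auto simp: b_def split: prod.splits)
  \<comment> \<open>Extending the time horizon from \<open>s\<close> to \<open>s'\<close> adds only
    later arrows, so a loop step that was possible remains the same.\<close>
  have c_eq: "c s' st = c s st" if "b s st" "s \<le> s'" for s s' st
  proof (cases st)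
    case (Pair r y)
    let ?J = "jump_times (n (Arrow y))"
    have ne: "?J \<inter> {r<..s} \<noteq> {}" using that by (simp add: b_def Pair)
    then have "Min (?J \<inter> {r<..s}) \<in> ?J \<inter> {r<..s}" by (intro Min_in fin)
    moreover have "Min (?J \<inter> {r<..s}) \<le> z" if "z \<in> ?J \<inter> {r<..s'}" for z
    proof (cases "z \<le> s")
      case True
      then show ?thesis using that by (intro Min_le fin) auto
    next
      case False
      then show ?thesis using \<open>Min (?J \<inter> {r<..s}) \<in> ?J \<inter> {r<..s}\<close> by simp
    qed
    ultimately have "Min (?J \<inter> {r<..s'}) = Min (?J \<inter> {r<..s})"
      using that(2) by (intro Min_eqI fin) simp_all
    then show ?thesis by (simp add: c_def Pair)
  qed
  have base: "\<exists>u>s. \<forall>s'. s \<le> s' \<longrightarrow> s' < u \<longrightarrow> right_path n t x s' = right_path n t x s"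
    if "\<not> b s (t, x)" "t \<le> s" for t x
  proof -
    obtain u where u: "s < u" "jump_times (n (Arrow x)) \<inter> {s<..<u} = {}"
      using finite_gap[OF fin] .
    have none: "jump_times (n (Arrow x)) \<inter> {t<..s} = {}" using that by (simp add: b_def)
    have "right_path n t x s' = x" if "s \<le> s'" "s' < u" for s'
    proof (rule right_path_no_arrow)
      have "z \<notin> jump_times (n (Arrow x))" if "t < z" "z \<le> s'" for z
        using none u(2) that \<open>s' < u\<close> by (cases "z \<le> s") auto
      then show "jump_times (n (Arrow x)) \<inter> {t<..s'} = {}" by auto
    qed
    then show ?thesis using u(1) by auto
  qed
  show ?thesis
  proof (cases "\<forall>k. b s ((c s ^^ k) (t, x))")
    \<comment> \<open>Without termination at \<open>s\<close> there is none at any later horizon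
      either, as all states agree; \<open>while\<close> then returns the same default value.\<close>
    case True
    have eq: "right_path n t x s' = right_path n t x s" if "s \<le> s'" for s'
    proof -
      have "(c s' ^^ k) (t, x) = (c s ^^ k) (t, x)" for k
        by (induction k) (use True that c_eq in auto)
      then have "\<forall>k. b s' ((c s' ^^ k) (t, x))" using True b_mono that by metis
      then show ?thesis using True by (simp add: rp while_def while_option_def)
    qed
    show ?thesis by (intro exI[of _ "s + 1"] conjI allI impI eq) simp
  next
    case False
    then obtain k where "\<not> b s ((c s ^^ k) (t, x))" by blast
    then show ?thesis using t
    proof (induction k arbitrary: t x)
      case (Suc k)
      show ?case
      proof (cases "b s (t, x)")
        case True
        define q where "q = Min (jump_times (n (Arrow x)) \<inter> {t<..s})"
        have cs: "c s (t, x) = (q, x + 1)" by (simp add: c_def q_def)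
        have "q \<le> s" using True Min_in[OF fin, of "Arrow x" t s] by (auto simp: b_def q_def)
        have eq: "right_path n t x s' = right_path n q (x + 1) s'" if "s \<le> s'" for s'
          using c_eq[OF True that] b_mono[OF True that] by (simp add: rp while_unfold[of "b s'" "c s'" "(t, x)"] cs)
        have "\<exists>u>s. \<forall>s'\<ge>s. s' < u \<longrightarrow> right_path n q (x + 1) s' = right_path n q (x + 1) s"
          using Suc.prems \<open>q \<le> s\<close> by (intro Suc.IH) (simp_all add: funpow_swap1 cs[symmetric] del: funpow.simps add: funpow_Suc_right)
        then obtain u where "s < u" and u: "\<forall>s'\<ge>s. s' < u \<longrightarrow> right_path n q (x + 1) s' = right_path n q (x + 1) s" by blast
        then show ?thesis
        proof (intro exI[of _ u] conjI allI impI)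
          fix s' assume "s \<le> s'" "s' < u"
          then have "right_path n t x s' = right_path n q (x + 1) s'" by (intro eq)
          also have "\<dots> = right_path n q (x + 1) s" using u \<open>s \<le> s'\<close> \<open>s' < u\<close> by blast
          also have "\<dots> = right_path n t x s" by (rule eq[symmetric]) simp
          finally show "right_path n t x s' = right_path n t x s" .
        qed
      next
        case False
        then show ?thesis using Suc.prems(2) by (intro base)
      qed
    qed (auto intro: base)
  qed
qed

text \<open>The event \<Gamma> as seen from time \<open>T\<close>; for \<open>T = 0\<close> it is
  \<Gamma> itself.\<close>

definition leads :: "(bool \<Rightarrow> real) \<Rightarrow> (bool \<Rightarrow> real) \<Rightarrow> (int \<Rightarrow> bool) \<Rightarrow> (clock \<Rightarrow> real \<Rightarrow> nat) \<Rightarrow> real \<Rightarrow> bool" where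
  "leads \<alpha> \<beta> e n T \<longleftrightarrow> (\<forall>s>T. right_path n T (walk \<alpha> \<beta> e n T - 1) s < walk \<alpha> \<beta> e n s)"

text \<open>By right-continuity, rational times suffice; this makes the event measurable.\<close>

definition caught :: "(bool \<Rightarrow> real) \<Rightarrow> (bool \<Rightarrow> real) \<Rightarrow> (int \<Rightarrow> bool) \<Rightarrow> (clock \<Rightarrow> real \<Rightarrow> nat) \<Rightarrow> real \<Rightarrow> real \<Rightarrow> bool" where
  "caught \<alpha> \<beta> e n T t \<longleftrightarrow> (\<exists>s\<in>\<rat>. T < s \<and> s \<le> t \<and> walk \<alpha> \<beta> e n s \<le> right_path n T (walk \<alpha> \<beta> e n T - 1) s)"

lemma caught_mono: "caught \<alpha> \<beta> e n T t \<Longrightarrow> t \<le> t' \<Longrightarrow> caught \<alpha> \<beta> e n T t'"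
  unfolding caught_def by force

text \<open>The strict inequality \<open>s < t\<close> leaves room for a rational time just after
  \<open>s\<close>, at which both paths still have the same values.\<close>

lemma caughtI:
  assumes n: "\<forall>c. counting_path (n c)" and s: "0 \<le> T" "T < s" "s < t"
    and le: "walk \<alpha> \<beta> e n s \<le> right_path n T (walk \<alpha> \<beta> e n T - 1) s"
  shows "caught \<alpha> \<beta> e n T t"
proof -
  obtain u where u: "s < u" "\<And>s'. s \<le> s' \<Longrightarrow> s' < u \<Longrightarrow> walk \<alpha> \<beta> e n s' = walk \<alpha> \<beta> e n s"
    using walk_right_const[OF n, of s] s by (metis less_eq_real_def order_less_trans)
  obtain u' where u': "s < u'" "\<forall>s'. s \<le> s' \<longrightarrow> s' < u' \<longrightarrow> right_path n T (walk \<alpha> \<beta> e n T - 1) s' = right_path n T (walk \<alpha> \<beta> e n T - 1) s"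
    using right_path_right_const[OF n, of T s] s by (metis less_imp_le)
  obtain q where q: "q \<in> \<rat>" "s < q" "q < min t (min u u')"
    using Rats_dense_in_real[of s "min t (min u u')"] s u(1) u'(1) by auto
  have "walk \<alpha> \<beta> e n q \<le> right_path n T (walk \<alpha> \<beta> e n T - 1) q"
    using le u(2)[of q] u'(2)[rule_format, of q] q by simp
  then show ?thesis
    using q s unfolding caught_def by (intro bexI[of _ q]) auto
qed

lemma leads_iff_not_caught:
  assumes n: "\<forall>c. counting_path (n c)" and T: "0 \<le> T"
  shows "leads \<alpha> \<beta> e n T \<longleftrightarrow> (\<forall>k::nat. \<not> caught \<alpha> \<beta> e n T (real k))"
proof
  assume "leads \<alpha> \<beta> e n T"
  then show "\<forall>k::nat. \<not> caught \<alpha> \<beta> e n T (real k)" by (force simp: leads_def caught_def)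
next
  assume *: "\<forall>k::nat. \<not> caught \<alpha> \<beta> e n T (real k)"
  show "leads \<alpha> \<beta> e n T" unfolding leads_def
  proof (intro allI impI)
    fix s assume "T < s"
    obtain k :: nat where "s < real k" using reals_Archimedean2 by blast
    then show "right_path n T (walk \<alpha> \<beta> e n T - 1) s < walk \<alpha> \<beta> e n s"
      using * caughtI[OF n T \<open>T < s\<close>] by (meson not_le)
  qed
qed

lemma leads_not_caught:
  assumes "leads \<alpha> \<beta> e n T"
  shows "\<not> caught \<alpha> \<beta> e n T t"
  using assms by (force simp: leads_def caught_def)

text \<open>At time \<open>t\<close> the old path \<open>Y\<close> is at least one site behind the
  walk, hence by monotonicity it stays below the path \<open>Y\<close> restarted one site behind the
  walk, which never catches up. Rationality of \<open>t\<close> is what makes \<open>caught\<close>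
  look at time \<open>t\<close> itself. This lemma turns failures of earlier slab ends into events
  of the past.\<close>

lemma leads_compose:
  assumes n: "good n" and st: "0 \<le> s" "s < t" "t \<in> \<rat>"
    and nc: "\<not> caught \<alpha> \<beta> e n s t" and l: "leads \<alpha> \<beta> e n t"
  shows "leads \<alpha> \<beta> e n s"
  unfolding leads_def
proof (intro allI impI)
  let ?X = "walk \<alpha> \<beta> e n"
  fix u assume u: "s < u"
  have t: "right_path n s (?X s - 1) t \<le> ?X t - 1"
    using nc st unfolding caught_def by force
  show "right_path n s (?X s - 1) u < ?X u"
  proof (cases u t rule: linorder_cases)
    case less
    then show ?thesis using caughtI[OF good_paths[OF n] st(1) u, of t \<alpha> \<beta> e] nc by force
  next
    case equal
    then show ?thesis using t by simp
  next
    case greater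
    have "right_path n s (?X s - 1) u = right_path n t (right_path n s (?X s - 1) t) u"
      using st greater by (intro right_path_append n) auto
    also have "\<dots> \<le> right_path n t (?X t - 1) u"
      using st greater by (intro right_path_mono n t) auto
    also have "\<dots> < ?X u" using l greater by (simp add: leads_def)
    finally show ?thesis .
  qed
qed

lemma caught_stop:
  assumes n: "good n" and "0 \<le> s" "s \<le> t" "t \<le> T"
  shows "caught \<alpha> \<beta> e (stop_clocks T n) s t \<longleftrightarrow> caught \<alpha> \<beta> e n s t"
  unfolding caught_def using assms by (intro bex_cong refl) (auto simp: walk_stop right_path_stop)

lemma caught_cong:
  assumes "\<And>u. 0 \<le> u \<Longrightarrow> u \<le> t \<Longrightarrow> walk \<alpha> \<beta> e n u = walk \<alpha> \<beta> e' n u" "0 \<le> s" "s \<le> t"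
  shows "caught \<alpha> \<beta> e n s t \<longleftrightarrow> caught \<alpha> \<beta> e' n s t"
  unfolding caught_def using assms(2,3) by (intro bex_cong refl) (auto simp: assms(1))

text \<open>A walk ahead of \<open>Y\<close> reads only sites to the right of \<open>Y\<close>, and
  by \<open>gamma_right_path\<close> these carry labels from 0 on.\<close>

lemma walk_cong_leads:
  assumes n: "good n" and l: "leads \<alpha> \<beta> e n 0" and eq: "\<And>y. 0 \<le> y \<Longrightarrow> e y = e' y" and t: "0 \<le> t"
  shows "walk \<alpha> \<beta> e n t = walk \<alpha> \<beta> e' n t"
proof (rule walk_cong_inspects[OF good_paths[OF n] t order_refl])
  fix r u assume i: "inspects n r u" "u \<le> t"
  let ?Y = "right_path n 0 (-1)" and ?X = "walk \<alpha> \<beta> e n"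
  have r: "0 \<le> r" "r < u" "u \<in> hat_times n" "walk_clock_times n \<inter> {r<..<u} = {}"
    using i by (auto simp: inspects_def)
  obtain b where b: "-1 \<le> b" "quiet n u b" using n unfolding good_def by blast
  let ?J = "region_times n (-1) b"
  have fin: "finite (?J \<inter> {r<..<u})"
    by (rule finite_subset[OF _ finite_region_times[OF n, of "-1" b r u]]) auto
  \<comment> \<open>After \<open>q\<close> no relevant arrow comes before \<open>u\<close>, so
    \<open>Y\<close> rests on the interval, and at \<open>u\<close> itself a hatted ring excludes an
    arrow. The comparison is made at the midpoint of \<open>q\<close> and \<open>u\<close>: there
    the walk is still at the inspected site, which it may leave at \<open>u\<close>, and the time is
    positive even if \<open>r = 0\<close>, where \<open>leads\<close> says nothing.\<close>
  define q where "q = Max (insert r (?J \<inter> {r<..<u}))"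
  have q: "r \<le> q" "q < u" using fin r by (auto simp: q_def)
  have "x \<notin> ?J" if "q < x" "x < u" for x
  proof
    assume "x \<in> ?J"
    then have "x \<le> q" unfolding q_def using that fin q by (intro Max_ge) auto
    then show False using that by simp
  qed
  moreover define r' where "r' = (q + u) / 2"
  ultimately have none: "?J \<inter> {r'<..<u} = {}" and r': "r < r'" "r' < u"
    using q by (auto simp: r'_def)
  have "walk_clock_times n \<inter> {r<..r'} = {}" using r(4) r' by auto
  then have X: "?X r' = ?X r" using r r' by (intro walk_const good_paths[OF n]) auto
  have "quiet n r' b" using b(2) r' by (auto simp: quiet_def)
  then have Y: "?Y r' \<in> {-1..b}" using right_path_bounds[OF n _ b(1)] by auto
  then have "jump_times (n (Arrow (?Y r'))) \<inter> {r'<..<u} = {}"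
    using none unfolding region_times_def by blast
  then have "?Y u = ?Y r' + of_bool (u \<in> jump_times (n (Arrow (?Y r'))))"
    using r r' by (intro right_path_step n) auto
  moreover have "u \<notin> jump_times (n (Arrow y))" for y
    using r(3) good_disjoint[OF n, of u "Arrow y"] by (auto simp: hat_times_def)
  ultimately have "?Y u = ?Y r'" by simp
  also have "\<dots> < ?X r'" using l r r' by (simp add: leads_def)
  finally have "-1 < gamma n u (?X r)" using r X by (intro gamma_right_path n) auto
  then show "e (gamma n u (?X r)) = e' (gamma n u (?X r))" by (intro eq) simp
qed

lemma leads_cong:
  assumes n: "good n" and eq: "\<And>y. 0 \<le> y \<Longrightarrow> e y = e' y"
  shows "leads \<alpha> \<beta> e n 0 \<longleftrightarrow> leads \<alpha> \<beta> e' n 0"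
proof -
  have *: "leads \<alpha> \<beta> e' n 0" if "leads \<alpha> \<beta> e n 0" "\<And>y. 0 \<le> y \<Longrightarrow> e y = e' y" for e e'
    using walk_cong_leads[OF n that] that(1) by (simp add: leads_def)
  show ?thesis using *[of e e'] *[of e' e] eq by auto
qed

lemma leads_shift:
  assumes n: "good n" and T: "0 \<le> T" and v: "v = walk \<alpha> \<beta> e n T" and e': "e' = (\<lambda>y. exclusion e n T (v + y))"
  shows "leads \<alpha> \<beta> e' (shift_clocks T v n) 0 \<longleftrightarrow> leads \<alpha> \<beta> e n T"
proof -
  let ?n = "shift_clocks T v n"
  have "right_path ?n 0 (-1) s < walk \<alpha> \<beta> e' ?n s \<longleftrightarrow> right_path n T (v - 1) (T + s) < walk \<alpha> \<beta> e n (T + s)"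
    if "0 < s" for s
    using walk_shift[OF n T _ v e', of s] right_path_shift[OF n T, of 0 v "-1" s] that by simp linarith
  then have "leads \<alpha> \<beta> e' ?n 0 \<longleftrightarrow> (\<forall>s>0. right_path n T (v - 1) (T + s) < walk \<alpha> \<beta> e n (T + s))"
    by (simp add: leads_def)
  also have "\<dots> \<longleftrightarrow> leads \<alpha> \<beta> e n T"
    unfolding leads_def v[symmetric]
    by (intro iffI allI impI) (metis add.commute diff_add_cancel diff_gt_0_iff_gt, simp)
  finally show ?thesis .
qed

section \<open>Measurability\<close>

text \<open>A loop with a random number of rounds becomes a sequence of iterates that freeze when
  the condition fails, so that measurability can be checked round by round. The default value of a
  non-terminating loop is the constant \<open>the None\<close>.\<close>

lemma while_freeze:
  defines "f \<equiv> \<lambda>b c s. if b s then c s else s"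
  shows "while b c s = (if \<exists>k. \<not> b ((f b c ^^ k) s) then (f b c ^^ (LEAST k. \<not> b ((f b c ^^ k) s))) s else the None)"
proof -
  have eq: "(f b c ^^ k) s = (c ^^ k) s" if "\<forall>i<k. b ((c ^^ i) s)" for k
    using that by (induction k) (auto simp: f_def)
  show ?thesis
  proof (cases "\<exists>k. \<not> b ((c ^^ k) s)")
    case True
    define K where "K = (LEAST k. \<not> b ((c ^^ k) s))"
    have K: "\<not> b ((c ^^ K) s)" unfolding K_def using True by (rule LeastI_ex)
    have less: "b ((c ^^ i) s)" if "i < K" for i using not_less_Least[of i] that unfolding K_def by blast
    have eqK: "(f b c ^^ i) s = (c ^^ i) s" if "i \<le> K" for i using less that by (intro eq) auto
    have "(LEAST k. \<not> b ((f b c ^^ k) s)) = K"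
      using K less eqK by (intro Least_equality) (auto simp: not_less[symmetric])
    moreover have "while b c s = (c ^^ K) s" using True by (simp add: while_def while_option_def K_def)
    moreover have "\<exists>k. \<not> b ((f b c ^^ k) s)" using K eqK[of K] by (intro exI[of _ K]) simp
    ultimately show ?thesis using eqK[of K] by simp
  next
    case False
    then have "\<forall>k. b ((f b c ^^ k) s)" using eq by auto
    then show ?thesis using False by (simp add: while_def while_option_def)
  qed
qed

text \<open>Loop states consist of a time and a site. Sites are countable, so each hypothesis may
  treat the site as fixed and only the time as random; times are kept nonnegative because paths are
  controlled only there.\<close>

lemma measurable_snd_while:
  fixes b :: "'w \<Rightarrow> real \<times> int \<Rightarrow> bool" and s0 :: "'w \<Rightarrow> real \<times> int"
  assumes init: "(\<lambda>w. fst (s0 w)) \<in> borel_measurable \<Omega>" "\<And>w. w \<in> space \<Omega> \<Longrightarrow> 0 \<le> fst (s0 w)"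
      "(\<lambda>w. snd (s0 w)) \<in> measurable \<Omega> (count_space UNIV)"
    and b: "\<And>R y. R \<in> borel_measurable \<Omega> \<Longrightarrow> (\<And>w. w \<in> space \<Omega> \<Longrightarrow> 0 \<le> R w) \<Longrightarrow> Measurable.pred \<Omega> (\<lambda>w. b w (R w, y))"
    and c1: "\<And>R y. R \<in> borel_measurable \<Omega> \<Longrightarrow> (\<And>w. w \<in> space \<Omega> \<Longrightarrow> 0 \<le> R w) \<Longrightarrow>
        (\<lambda>w. if b w (R w, y) then fst (c w (R w, y)) else R w) \<in> borel_measurable \<Omega>"
    and c2: "\<And>R y. R \<in> borel_measurable \<Omega> \<Longrightarrow> (\<And>w. w \<in> space \<Omega> \<Longrightarrow> 0 \<le> R w) \<Longrightarrow>
        (\<lambda>w. if b w (R w, y) then snd (c w (R w, y)) else y) \<in> measurable \<Omega> (count_space UNIV)"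
    and pos: "\<And>w r y. w \<in> space \<Omega> \<Longrightarrow> 0 \<le> r \<Longrightarrow> b w (r, y) \<Longrightarrow> 0 \<le> fst (c w (r, y))"
  shows "(\<lambda>w. snd (while (b w) (c w) (s0 w))) \<in> measurable \<Omega> (count_space UNIV)"
proof -
  define S where "S = (\<lambda>k w. ((\<lambda>s. if b w s then c w s else s) ^^ k) (s0 w))"
  have S: "(\<lambda>w. fst (S k w)) \<in> borel_measurable \<Omega> \<and> (\<lambda>w. snd (S k w)) \<in> measurable \<Omega> (count_space UNIV) \<and>
     (\<forall>w\<in>space \<Omega>. 0 \<le> fst (S k w))" for k
  proof (induction k)
    case 0
    then show ?case using init by (simp add: S_def)
  next
    case (Suc k)
    then have R: "(\<lambda>w. fst (S k w)) \<in> borel_measurable \<Omega>" "\<And>w. w \<in> space \<Omega> \<Longrightarrow> 0 \<le> fst (S k w)"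
      and Y: "(\<lambda>w. snd (S k w)) \<in> measurable \<Omega> (count_space UNIV)" by auto
    have step: "S (Suc k) w = (if b w (S k w) then c w (S k w) else S k w)" for w by (simp add: S_def)
    have "(\<lambda>w. if b w (fst (S k w), snd (S k w)) then fst (c w (fst (S k w), snd (S k w))) else fst (S k w)) \<in> borel_measurable \<Omega>"
      by (rule measurable_compose_countable[OF c1[OF R] Y])
    moreover have "(\<lambda>w. if b w (fst (S k w), snd (S k w)) then snd (c w (fst (S k w), snd (S k w))) else snd (S k w)) \<in> measurable \<Omega> (count_space UNIV)"
      by (rule measurable_compose_countable[OF c2[OF R] Y])
    moreover have "0 \<le> fst (S (Suc k) w)" if "w \<in> space \<Omega>" for w
      using pos[OF that R(2)[OF that], of "snd (S k w)"] R(2)[OF that] by (simp add: step)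
    ultimately show ?case by (simp add: step if_distrib cong: if_cong)
  qed
  have S2: "(\<lambda>w. snd (S k w)) \<in> measurable \<Omega> (count_space UNIV)" for k
    using S by blast
  have B[measurable]: "Measurable.pred \<Omega> (\<lambda>w. b w (S k w))" for k
  proof -
    have "Measurable.pred \<Omega> (\<lambda>w. b w (fst (S k w), snd (S k w)))"
      by (rule measurable_compose_countable[OF b S2]) (use S in blast)+
    then show ?thesis by simp
  qed
  have L: "(\<lambda>w. LEAST k. \<not> b w (S k w)) \<in> measurable \<Omega> (count_space UNIV)"
    by measurable
  have "(\<lambda>w. if \<exists>k. \<not> b w (S k w) then snd (S (LEAST k. \<not> b w (S k w)) w) else snd (the None :: real \<times> int)) \<in> measurable \<Omega> (count_space UNIV)"
  proof (rule measurable_If)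
    show "(\<lambda>w. snd (S (LEAST k. \<not> b w (S k w)) w)) \<in> measurable \<Omega> (count_space UNIV)"
      by (rule measurable_compose_countable[OF S2 L])
    show "{w \<in> space \<Omega>. \<exists>k. \<not> b w (S k w)} \<in> sets \<Omega>" by measurable
  qed simp
  also have "(\<lambda>w. if \<exists>k. \<not> b w (S k w) then snd (S (LEAST k. \<not> b w (S k w)) w) else snd (the None :: real \<times> int)) =
    (\<lambda>w. snd (while (b w) (c w) (s0 w)))"
    by (rule ext) (simp add: while_freeze S_def)
  finally show ?thesis .
qed

lemma measurable_nat_real:
  assumes "(\<lambda>w. real (f w)) \<in> borel_measurable \<Omega>"
  shows "f \<in> measurable \<Omega> (count_space UNIV)"
proof -
  have "(\<lambda>w. nat \<lfloor>real (f w)\<rfloor>) \<in> measurable \<Omega> (count_space UNIV)"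
    by (rule measurable_compose[OF measurable_compose[OF assms measurable_real_floor]]) simp
  then show ?thesis by simp
qed

lemma pred_nat_less [measurable (raw)]:
  fixes f g :: "'w \<Rightarrow> nat"
  assumes f: "f \<in> measurable \<Omega> (count_space UNIV)" and g: "g \<in> measurable \<Omega> (count_space UNIV)"
  shows "Measurable.pred \<Omega> (\<lambda>w. f w < g w)"
proof (rule measurable_compose_countable[where f="\<lambda>i w. i < g w" and g=f, OF _ f])
  show "Measurable.pred \<Omega> (\<lambda>w. i < g w)" for i
    by (rule measurable_compose[OF g]) simp
qed

text \<open>Random configurations and clocks on an arbitrary space, since the same measurability
  facts are needed on \<open>M\<close>, on the canonical spaces, and on their products.\<close>

locale clock_family =
  fixes \<Omega> :: "'w measure" and e :: "'w \<Rightarrow> int \<Rightarrow> bool" and n :: "'w \<Rightarrow> clock \<Rightarrow> real \<Rightarrow> nat"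
  assumes e_meas [measurable]: "\<And>y. (\<lambda>w. e w y) \<in> measurable \<Omega> (count_space UNIV)"
    and n_meas: "\<And>c t. 0 \<le> t \<Longrightarrow> (\<lambda>w. n w c t) \<in> measurable \<Omega> (count_space UNIV)"
    and n_path: "\<And>w. w \<in> space \<Omega> \<Longrightarrow> \<forall>c. counting_path (n w c)"
begin

text \<open>The random time is approached from the right through the lattices of mesh
  \<open>1 / Suc k\<close>, where it takes countably many values; right-continuity makes the values
  of the path eventually constant along the approximation.\<close>

lemma measurable_at_random_time:
  assumes R[measurable]: "R \<in> borel_measurable \<Omega>" and pos: "\<And>w. w \<in> space \<Omega> \<Longrightarrow> 0 \<le> R w"
  shows "(\<lambda>w. n w c (R w)) \<in> measurable \<Omega> (count_space UNIV)"
proof (rule measurable_nat_real)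
  define g where "g = (\<lambda>k w. (real_of_int \<lfloor>R w * real (Suc k)\<rfloor> + 1) / real (Suc k))"
  show "(\<lambda>w. real (n w c (R w))) \<in> borel_measurable \<Omega>"
  proof (rule borel_measurable_LIMSEQ_real)
    fix k
    have "(\<lambda>w. n w c (max 0 ((real_of_int \<lfloor>R w * real (Suc k)\<rfloor> + 1) / real (Suc k)))) \<in> measurable \<Omega> (count_space UNIV)"
      by (rule measurable_compose_countable[where f="\<lambda>i w. n w c (max 0 ((real_of_int i + 1) / real (Suc k)))"])
        (auto intro!: n_meas)
    then have [measurable]: "(\<lambda>w. n w c (max 0 (g k w))) \<in> measurable \<Omega> (count_space UNIV)" by (simp add: g_def)
    show "(\<lambda>w. real (n w c (max 0 (g k w)))) \<in> borel_measurable \<Omega>" by measurable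
  next
    fix w assume w: "w \<in> space \<Omega>"
    obtain u where u: "R w < u" "\<And>s. R w \<le> s \<Longrightarrow> s < u \<Longrightarrow> n w c s = n w c (R w)"
      using counting_path_right_const[of "n w c" "R w"] n_path[OF w] pos[OF w] by metis
    have lower: "R w \<le> g k w" and upper: "g k w \<le> R w + 1 / real (Suc k)" for k
    proof -
      have "R w * real (Suc k) \<le> real_of_int \<lfloor>R w * real (Suc k)\<rfloor> + 1" by linarith
      then show "R w \<le> g k w" unfolding g_def by (subst pos_le_divide_eq) auto
      have "real_of_int \<lfloor>R w * real (Suc k)\<rfloor> + 1 \<le> (R w + 1 / real (Suc k)) * real (Suc k)"
        by (simp add: distrib_right del: of_nat_Suc)
      then show "g k w \<le> R w + 1 / real (Suc k)" unfolding g_def by (subst pos_divide_le_eq) auto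
    qed
    obtain K where K: "1 / real (Suc K) < u - R w"
      using u(1) by (metis diff_gt_0_iff_gt inverse_eq_divide reals_Archimedean)
    have "n w c (max 0 (g k w)) = n w c (R w)" if "K \<le> k" for k
    proof -
      have "1 / real (Suc k) \<le> 1 / real (Suc K)" using that by (intro divide_left_mono) auto
      then show ?thesis using lower[of k] upper[of k] K pos[OF w] by (intro u(2)) auto
    qed
    then have "eventually (\<lambda>k. real (n w c (max 0 (g k w))) = real (n w c (R w))) sequentially"
      unfolding eventually_sequentially by auto
    then show "(\<lambda>k. real (n w c (max 0 (g k w)))) \<longlonglongrightarrow> real (n w c (R w))"
      by (rule tendsto_eventually)
  qed
qed

lemma pred_jump_Ioc:
  assumes [measurable]: "R \<in> borel_measurable \<Omega>" "S \<in> borel_measurable \<Omega>"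
    and pos: "\<And>w. w \<in> space \<Omega> \<Longrightarrow> 0 \<le> R w"
  shows "Measurable.pred \<Omega> (\<lambda>w. jump_times (n w c) \<inter> {R w<..S w} \<noteq> {})"
proof -
  have [measurable]: "(\<lambda>w. n w c (R w)) \<in> measurable \<Omega> (count_space UNIV)"
    by (intro measurable_at_random_time assms pos)
  have [measurable]: "(\<lambda>w. n w c (max (R w) (S w))) \<in> measurable \<Omega> (count_space UNIV)"
    by (intro measurable_at_random_time borel_measurable_max assms) (simp add: pos max.coboundedI1)
  have "Measurable.pred \<Omega> (\<lambda>w. n w c (R w) < n w c (max (R w) (S w)))" by (intro pred_nat_less) fact+
  also have "?this \<longleftrightarrow> ?thesis"
  proof (rule measurable_cong)
    fix w assume w: "w \<in> space \<Omega>"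
    show "(n w c (R w) < n w c (max (R w) (S w))) = (jump_times (n w c) \<inter> {R w<..S w} \<noteq> {})"
      using jump_times_Ioc_nonempty_iff[of "n w c" "R w" "S w"] n_path[OF w] pos[OF w]
      by (cases "R w \<le> S w") (auto simp: max_def)
  qed
  finally show ?thesis .
qed

lemma pred_jump_Ioo:
  assumes [measurable]: "R \<in> borel_measurable \<Omega>" "S \<in> borel_measurable \<Omega>"
    and pos: "\<And>w. w \<in> space \<Omega> \<Longrightarrow> 0 \<le> R w"
  shows "Measurable.pred \<Omega> (\<lambda>w. jump_times (n w c) \<inter> {R w<..<S w} \<noteq> {})"
proof -
  have [measurable]: "Measurable.pred \<Omega> (\<lambda>w. jump_times (n w c) \<inter> {R w<..S w - 1 / real (Suc k)} \<noteq> {})" for k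
    by (rule pred_jump_Ioc) (auto simp: pos)
  have *: "{r<..<s} = (\<Union>k. {r<..s - 1 / real (Suc k)})" for r s :: real
  proof (intro set_eqI iffI)
    fix x assume x: "x \<in> {r<..<s}"
    then obtain k where "1 / real (Suc k) < s - x"
      by (metis diff_gt_0_iff_gt greaterThanLessThan_iff inverse_eq_divide reals_Archimedean)
    then show "x \<in> (\<Union>k. {r<..s - 1 / real (Suc k)})" using x by (auto intro!: exI[of _ k])
  next
    fix x assume "x \<in> (\<Union>k. {r<..s - 1 / real (Suc k)})"
    then obtain k where "r < x" "x \<le> s - 1 / real (Suc k)" by auto
    moreover have "0 < 1 / real (Suc k)" by simp
    ultimately have "r < x" "x < s" by linarith+
    then show "x \<in> {r<..<s}" by simp
  qed
  have "Measurable.pred \<Omega> (\<lambda>w. \<exists>k. jump_times (n w c) \<inter> {R w<..S w - 1 / real (Suc k)} \<noteq> {})" by measurable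
  also have "(\<lambda>w. \<exists>k. jump_times (n w c) \<inter> {R w<..S w - 1 / real (Suc k)} \<noteq> {}) = (\<lambda>w. jump_times (n w c) \<inter> {R w<..<S w} \<noteq> {})"
    by (intro ext, subst *) blast
  finally show ?thesis .
qed

lemma pred_jump_at:
  assumes [measurable]: "R \<in> borel_measurable \<Omega>" and pos: "\<And>w. w \<in> space \<Omega> \<Longrightarrow> 0 \<le> R w"
  shows "Measurable.pred \<Omega> (\<lambda>w. R w \<in> jump_times (n w c))"
proof -
  have [measurable]: "(\<lambda>w. n w c (R w)) \<in> measurable \<Omega> (count_space UNIV)"
    by (intro measurable_at_random_time assms pos)
  have [measurable]: "(\<lambda>w. n w c (max 0 (R w - 1 / real (Suc k)))) \<in> measurable \<Omega> (count_space UNIV)" for k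
    by (intro measurable_at_random_time borel_measurable_max borel_measurable_diff borel_measurable_const assms) simp
  have [measurable]: "Measurable.pred \<Omega> (\<lambda>w. n w c (max 0 (R w - 1 / real (Suc k))) < n w c (R w))" for k
    by (intro pred_nat_less) fact+
  have "Measurable.pred \<Omega> (\<lambda>w. 0 < R w \<and> (\<forall>k. n w c (max 0 (R w - 1 / real (Suc k))) < n w c (R w)))" by measurable
  also have "?this \<longleftrightarrow> ?thesis"
  proof (rule measurable_cong)
    fix w assume w: "w \<in> space \<Omega>"
    show "(0 < R w \<and> (\<forall>k. n w c (max 0 (R w - 1 / real (Suc k))) < n w c (R w))) = (R w \<in> jump_times (n w c))"
    proof safe
      assume R: "0 < R w" and *: "\<forall>k. n w c (max 0 (R w - 1 / real (Suc k))) < n w c (R w)"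
      show "R w \<in> jump_times (n w c)"
        unfolding jump_times_def
      proof (safe intro!: R)
        fix s assume s: "s \<in> {0..<R w}"
        then obtain k where "1 / real (Suc k) < R w - s"
          by (metis atLeastLessThan_iff diff_gt_0_iff_gt inverse_eq_divide reals_Archimedean)
        then have "n w c s \<le> n w c (max 0 (R w - 1 / real (Suc k)))"
          using n_path[OF w] s by (intro counting_path_mono) auto
        then show "n w c s < n w c (R w)" using * by (metis le_less_trans)
      qed
    next
      fix k assume R: "R w \<in> jump_times (n w c)"
      then show "0 < R w" by (rule jump_times_pos)
      then show "n w c (max 0 (R w - 1 / real (Suc k))) < n w c (R w)"
        by (intro jump_times_less[OF R]) (auto simp del: of_nat_Suc)
    qed
  qed
  finally show ?thesis .
qed

lemma pred_rings_Ioc: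
  assumes "finite C" "R \<in> borel_measurable \<Omega>" "S \<in> borel_measurable \<Omega>" "\<And>w. w \<in> space \<Omega> \<Longrightarrow> 0 \<le> R w"
  shows "Measurable.pred \<Omega> (\<lambda>w. (\<Union>c\<in>C. jump_times (n w c)) \<inter> {R w<..S w} \<noteq> {})"
proof -
  have eq: "(\<lambda>w. (\<Union>c\<in>C. jump_times (n w c)) \<inter> {R w<..S w} \<noteq> {}) = (\<lambda>w. \<exists>c\<in>C. jump_times (n w c) \<inter> {R w<..S w} \<noteq> {})"
    by (intro ext) blast
  show ?thesis unfolding eq
    using assms by (intro pred_intros_finite pred_jump_Ioc)
qed

lemma pred_rings_Ioo:
  assumes "finite C" "R \<in> borel_measurable \<Omega>" "S \<in> borel_measurable \<Omega>" "\<And>w. w \<in> space \<Omega> \<Longrightarrow> 0 \<le> R w"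
  shows "Measurable.pred \<Omega> (\<lambda>w. (\<Union>c\<in>C. jump_times (n w c)) \<inter> {R w<..<S w} \<noteq> {})"
proof -
  have eq: "(\<lambda>w. (\<Union>c\<in>C. jump_times (n w c)) \<inter> {R w<..<S w} \<noteq> {}) = (\<lambda>w. \<exists>c\<in>C. jump_times (n w c) \<inter> {R w<..<S w} \<noteq> {})"
    by (intro ext) blast
  show ?thesis unfolding eq
    using assms by (intro pred_intros_finite pred_jump_Ioo)
qed

lemma finite_rings:
  assumes "finite C" "w \<in> space \<Omega>"
  shows "finite ((\<Union>c\<in>C. jump_times (n w c)) \<inter> {r<..s})"
proof -
  have "finite (\<Union>c\<in>C. jump_times (n w c) \<inter> {r<..s})"
    using assms n_path by (intro finite_UN_I finite_jump_times_subset) auto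
  moreover have "(\<Union>c\<in>C. jump_times (n w c)) \<inter> {r<..s} = (\<Union>c\<in>C. jump_times (n w c) \<inter> {r<..s})" by blast
  ultimately show ?thesis by metis
qed

text \<open>The last ring lies above a level exactly when some ring does, and the latter event is
  already known to be measurable.\<close>

lemma measurable_last_ring:
  assumes C: "finite C" and R[measurable]: "R \<in> borel_measurable \<Omega>" and pos: "\<And>w. w \<in> space \<Omega> \<Longrightarrow> 0 \<le> R w"
  shows "(\<lambda>w. if (\<Union>c\<in>C. jump_times (n w c)) \<inter> {0<..<R w} \<noteq> {}
      then Max ((\<Union>c\<in>C. jump_times (n w c)) \<inter> {0<..<R w}) else R w) \<in> borel_measurable \<Omega>"
    (is "?f \<in> _")
proof (rule borel_measurableI_greater)
  fix q
  let ?J = "\<lambda>w. \<Union>c\<in>C. jump_times (n w c)"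
  have [measurable]: "Measurable.pred \<Omega> (\<lambda>w. ?J w \<inter> {0<..<R w} \<noteq> {})"
    "Measurable.pred \<Omega> (\<lambda>w. ?J w \<inter> {max 0 q<..<R w} \<noteq> {})"
    using C by (intro pred_rings_Ioo; simp)+
  have "{w \<in> space \<Omega>. q < ?f w} = {w \<in> space \<Omega>. if ?J w \<inter> {0<..<R w} \<noteq> {} then ?J w \<inter> {max 0 q<..<R w} \<noteq> {} else q < R w}"
  proof (intro Collect_cong conj_cong refl)
    fix w assume w: "w \<in> space \<Omega>"
    have fin: "finite (?J w \<inter> {0<..<R w})"
      by (rule finite_subset[OF _ finite_rings[OF C w, of 0 "R w"]]) auto
    show "(q < ?f w) = (if ?J w \<inter> {0<..<R w} \<noteq> {} then ?J w \<inter> {max 0 q<..<R w} \<noteq> {} else q < R w)"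
      using fin by (auto simp: Max_gr_iff)
  qed
  also have "\<dots> \<in> sets \<Omega>" by measurable
  finally show "{w \<in> space \<Omega>. q < ?f w} \<in> sets \<Omega>" .
qed

lemma measurable_next_ring:
  assumes C: "finite C" and R[measurable]: "R \<in> borel_measurable \<Omega>" and pos: "\<And>w. w \<in> space \<Omega> \<Longrightarrow> 0 \<le> R w"
  shows "(\<lambda>w. if (\<Union>c\<in>C. jump_times (n w c)) \<inter> {R w<..t} \<noteq> {}
      then Min ((\<Union>c\<in>C. jump_times (n w c)) \<inter> {R w<..t}) else R w) \<in> borel_measurable \<Omega>"
    (is "?f \<in> _")
proof (rule borel_measurableI_le)
  fix q
  let ?J = "\<lambda>w. \<Union>c\<in>C. jump_times (n w c)"
  have [measurable]: "Measurable.pred \<Omega> (\<lambda>w. ?J w \<inter> {R w<..t} \<noteq> {})"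
    "Measurable.pred \<Omega> (\<lambda>w. ?J w \<inter> {R w<..min t q} \<noteq> {})"
    using C pos by (intro pred_rings_Ioc; simp)+
  have "{w \<in> space \<Omega>. ?f w \<le> q} = {w \<in> space \<Omega>. if ?J w \<inter> {R w<..t} \<noteq> {} then ?J w \<inter> {R w<..min t q} \<noteq> {} else R w \<le> q}"
  proof (intro Collect_cong conj_cong refl)
    fix w assume w: "w \<in> space \<Omega>"
    show "(?f w \<le> q) = (if ?J w \<inter> {R w<..t} \<noteq> {} then ?J w \<inter> {R w<..min t q} \<noteq> {} else R w \<le> q)"
      using finite_rings[OF C w, of "R w" t] by (auto simp: Min_le_iff)
  qed
  also have "\<dots> \<in> sets \<Omega>" by measurable
  finally show "{w \<in> space \<Omega>. ?f w \<le> q} \<in> sets \<Omega>" .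
qed

lemma ring_pos: "w \<in> space \<Omega> \<Longrightarrow> finite C \<Longrightarrow> (\<Union>c\<in>C. jump_times (n w c)) \<inter> {r<..s} \<noteq> {} \<Longrightarrow>
    0 \<le> Min ((\<Union>c\<in>C. jump_times (n w c)) \<inter> {r<..s})"
  using Min_in[OF finite_rings, of C w r s] by (auto dest: jump_times_pos)

lemma measurable_cross:
  assumes R[measurable]: "R \<in> borel_measurable \<Omega>" and pos: "\<And>w. w \<in> space \<Omega> \<Longrightarrow> 0 \<le> R w"
    and Y: "Y \<in> measurable \<Omega> (count_space UNIV)"
  shows "(\<lambda>w. cross (n w) (R w) (Y w)) \<in> measurable \<Omega> (count_space UNIV)"
proof (rule measurable_compose_countable[OF _ Y])
  fix y
  have [measurable]: "Measurable.pred \<Omega> (\<lambda>w. R w \<in> jump_times (n w c))" for c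
    by (intro pred_jump_at pos) simp_all
  show "(\<lambda>w. cross (n w) (R w) y) \<in> measurable \<Omega> (count_space UNIV)"
    unfolding cross_def by measurable
qed

lemma arrow_times_eq: "arrow_times f y = (\<Union>c\<in>{Arrow y, Arrow (y - 1)}. jump_times (f c))"
  by (auto simp: arrow_times_def)

lemma walk_clock_times_eq: "walk_clock_times f = (\<Union>c\<in>walk_clocks. jump_times (f c))"
  by (auto simp: walk_clock_times_def walk_clocks_def)

lemma measurable_gamma:
  assumes R[measurable]: "R \<in> borel_measurable \<Omega>" and pos: "\<And>w. w \<in> space \<Omega> \<Longrightarrow> 0 \<le> R w"
    and Y: "Y \<in> measurable \<Omega> (count_space UNIV)"
  shows "(\<lambda>w. gamma (n w) (R w) (Y w)) \<in> measurable \<Omega> (count_space UNIV)"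
  unfolding gamma_def
proof (rule measurable_snd_while)
  fix R :: "_ \<Rightarrow> real" and y :: int assume [measurable]: "R \<in> borel_measurable \<Omega>" and pos: "\<And>w. w \<in> space \<Omega> \<Longrightarrow> 0 \<le> R w"
  show b[measurable]: "Measurable.pred \<Omega> (\<lambda>w. case (R w, y) of (s, y) \<Rightarrow> arrow_times (n w) y \<inter> {0<..<s} \<noteq> {})"
    unfolding arrow_times_eq prod.case by (intro pred_rings_Ioo) simp_all
  show c1: "(\<lambda>w. if case (R w, y) of (s, y) \<Rightarrow> arrow_times (n w) y \<inter> {0<..<s} \<noteq> {}
        then fst (case (R w, y) of (s, y) \<Rightarrow> let r = Max (arrow_times (n w) y \<inter> {0<..<s}) in (r, cross (n w) r y))
        else R w) \<in> borel_measurable \<Omega>"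
    using measurable_last_ring[of "{Arrow y, Arrow (y - 1)}" R] pos
    by (simp add: arrow_times_eq Let_def cong: if_cong)
  have last: "0 \<le> (if case (R w, y) of (s, y) \<Rightarrow> arrow_times (n w) y \<inter> {0<..<s} \<noteq> {}
        then fst (case (R w, y) of (s, y) \<Rightarrow> let r = Max (arrow_times (n w) y \<inter> {0<..<s}) in (r, cross (n w) r y))
        else R w)" if w: "w \<in> space \<Omega>" for w
  proof (cases "arrow_times (n w) y \<inter> {0<..<R w} = {}")
    case False
    have "finite (arrow_times (n w) y \<inter> {0<..<R w})"
      by (rule finite_subset[OF _ finite_rings[OF _ w, of "{Arrow y, Arrow (y - 1)}" 0 "R w"]]) (auto simp: arrow_times_eq)
    from Max_in[OF this False] False show ?thesis by (auto simp: Let_def)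
  qed (use pos w in auto)
  \<comment> \<open>The time of the crossing is written as the variable of \<open>c1\<close>, which
    falls back to \<open>R\<close> when there is no arrow, so that \<open>measurable_cross\<close>
    is applied to a nonnegative measurable time.\<close>
  have "(\<lambda>w. if case (R w, y) of (s, y) \<Rightarrow> arrow_times (n w) y \<inter> {0<..<s} \<noteq> {}
        then cross (n w) (if case (R w, y) of (s, y) \<Rightarrow> arrow_times (n w) y \<inter> {0<..<s} \<noteq> {}
        then fst (case (R w, y) of (s, y) \<Rightarrow> let r = Max (arrow_times (n w) y \<inter> {0<..<s}) in (r, cross (n w) r y))
        else R w) y else y) \<in> measurable \<Omega> (count_space UNIV)"
    by (intro measurable_If measurable_cross c1 last b[unfolded pred_def] measurable_const) simp_all
  then show "(\<lambda>w. if case (R w, y) of (s, y) \<Rightarrow> arrow_times (n w) y \<inter> {0<..<s} \<noteq> {}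
        then snd (case (R w, y) of (s, y) \<Rightarrow> let r = Max (arrow_times (n w) y \<inter> {0<..<s}) in (r, cross (n w) r y))
        else y) \<in> measurable \<Omega> (count_space UNIV)"
    by (rule back_subst[where P="\<lambda>f. f \<in> _"]) (auto simp: fun_eq_iff Let_def)
next
  fix w and r :: real and y assume w: "w \<in> space \<Omega>" and "case (r, y) of (s, y) \<Rightarrow> arrow_times (n w) y \<inter> {0<..<s} \<noteq> {}"
  then have ne: "arrow_times (n w) y \<inter> {0<..<r} \<noteq> {}" by simp
  have "finite (arrow_times (n w) y \<inter> {0<..<r})"
    by (rule finite_subset[OF _ finite_rings[OF _ w, of "{Arrow y, Arrow (y - 1)}" 0 r]]) (auto simp: arrow_times_eq)
  from Max_in[OF this ne]
  show "0 \<le> fst (case (r, y) of (s, y) \<Rightarrow> let r = Max (arrow_times (n w) y \<inter> {0<..<s}) in (r, cross (n w) r y))"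
    by (simp add: Let_def)
qed (use assms measurable_cross[OF assms] in auto)

lemma measurable_exclusion:
  assumes "R \<in> borel_measurable \<Omega>" "\<And>w. w \<in> space \<Omega> \<Longrightarrow> 0 \<le> R w" "Y \<in> measurable \<Omega> (count_space UNIV)"
  shows "(\<lambda>w. exclusion (e w) (n w) (R w) (Y w)) \<in> measurable \<Omega> (count_space UNIV)"
  unfolding exclusion_def by (rule measurable_compose_countable[OF e_meas measurable_gamma[OF assms]])

lemma measurable_walk_jump:
  assumes R[measurable]: "R \<in> borel_measurable \<Omega>" and pos: "\<And>w. w \<in> space \<Omega> \<Longrightarrow> 0 \<le> R w"
  shows "(\<lambda>w. walk_jump \<alpha> \<beta> (e w) (n w) (R w) y) \<in> measurable \<Omega> (count_space UNIV)"
proof -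
  have [measurable]: "Measurable.pred \<Omega> (\<lambda>w. R w \<in> jump_times (n w c))" for c
    by (intro pred_jump_at pos) simp_all
  have E[measurable]: "Measurable.pred \<Omega> (\<lambda>w. exclusion (e w) (n w) (R w) y)"
    using measurable_exclusion[OF R pos, of "\<lambda>_. y"] by (simp add: pred_def)
  have [measurable]: "Measurable.pred \<Omega> (\<lambda>w. f (exclusion (e w) (n w) (R w) y) = (c::real))" for f c
    by (rule measurable_compose[OF E]) simp
  show ?thesis unfolding walk_jump_def Let_def by measurable
qed

text \<open>Rewrites the fold over the sorted list of rings as a loop over the next ring, to which
  \<open>measurable_snd_while\<close> applies.\<close>

lemma walk_eq_while:
  assumes n: "\<forall>c. counting_path (f c)" and "0 \<le> r" "r \<le> t"
  shows "walk \<alpha> \<beta> e' f t = snd (while (\<lambda>(r, x). walk_clock_times f \<inter> {r<..t} \<noteq> {})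
     (\<lambda>(r, x). (Min (walk_clock_times f \<inter> {r<..t}), x + walk_jump \<alpha> \<beta> e' f (Min (walk_clock_times f \<inter> {r<..t})) x))
     (r, walk \<alpha> \<beta> e' f r))"
  using assms(2,3)
proof (induction "card (walk_clock_times f \<inter> {r<..t})" arbitrary: r rule: less_induct)
  case less
  show ?case
  proof (cases "walk_clock_times f \<inter> {r<..t} = {}")
    case True
    then show ?thesis using walk_const[OF n less.prems True] by (subst while_unfold) simp
  next
    case False
    define q where "q = Min (walk_clock_times f \<inter> {r<..t})"
    have fin: "finite (walk_clock_times f \<inter> {s<..t})" for s by (rule finite_walk_clock_times[OF n])
    have q: "q \<in> walk_clock_times f \<inter> {r<..t}" unfolding q_def by (rule Min_in[OF fin False])
    have "q \<le> x" if "x \<in> walk_clock_times f \<inter> {r<..t}" for x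
      unfolding q_def using that by (intro Min_le fin)
    then have none: "walk_clock_times f \<inter> {r<..<q} = {}" using q by force
    have "walk_clock_times f \<inter> {q<..t} \<subset> walk_clock_times f \<inter> {r<..t}" using q by auto
    from less.hyps[OF psubset_card_mono[OF fin this]]
    have IH: "walk \<alpha> \<beta> e' f t = snd (while (\<lambda>(r, x). walk_clock_times f \<inter> {r<..t} \<noteq> {})
     (\<lambda>(r, x). (Min (walk_clock_times f \<inter> {r<..t}), x + walk_jump \<alpha> \<beta> e' f (Min (walk_clock_times f \<inter> {r<..t})) x))
     (q, walk \<alpha> \<beta> e' f q))" using q less.prems by auto
    have st: "walk \<alpha> \<beta> e' f q = walk \<alpha> \<beta> e' f r + walk_jump \<alpha> \<beta> e' f q (walk \<alpha> \<beta> e' f r)"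
      using q less.prems by (intro walk_step[OF n _ _ none]) auto
    show ?thesis using False by (subst while_unfold) (simp add: IH st q_def[symmetric])
  qed
qed

lemma measurable_walk:
  assumes t: "0 \<le> t"
  shows "(\<lambda>w. walk \<alpha> \<beta> (e w) (n w) t) \<in> measurable \<Omega> (count_space UNIV)"
proof -
  define b where "b = (\<lambda>w (r, x::int). walk_clock_times (n w) \<inter> {r<..t} \<noteq> {})"
  define c where "c = (\<lambda>w (r, x). (Min (walk_clock_times (n w) \<inter> {r<..t}), x + walk_jump \<alpha> \<beta> (e w) (n w) (Min (walk_clock_times (n w) \<inter> {r<..t})) x))"
  have fC: "finite walk_clocks" by (simp add: walk_clocks_def)
  have "(\<lambda>w. snd (while (b w) (c w) (0, 0))) \<in> measurable \<Omega> (count_space UNIV)"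
  proof (rule measurable_snd_while)
    fix R :: "_ \<Rightarrow> real" and y :: int assume R: "R \<in> borel_measurable \<Omega>" and pos: "\<And>w. w \<in> space \<Omega> \<Longrightarrow> 0 \<le> R w"
    show B: "Measurable.pred \<Omega> (\<lambda>w. b w (R w, y))"
      unfolding b_def walk_clock_times_eq prod.case using R pos by (intro pred_rings_Ioc fC) simp_all
    show c1: "(\<lambda>w. if b w (R w, y) then fst (c w (R w, y)) else R w) \<in> borel_measurable \<Omega>"
      using measurable_next_ring[OF fC R pos, of t] by (simp add: b_def c_def walk_clock_times_eq cong: if_cong)
    have nn: "0 \<le> (if b w (R w, y) then fst (c w (R w, y)) else R w)" if "w \<in> space \<Omega>" for w
      using ring_pos[OF that fC] pos[OF that] by (simp add: b_def c_def walk_clock_times_eq)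
    have "(\<lambda>w. y + walk_jump \<alpha> \<beta> (e w) (n w) (if b w (R w, y) then fst (c w (R w, y)) else R w) y) \<in> measurable \<Omega> (count_space UNIV)"
      by (rule measurable_compose[OF measurable_walk_jump[OF c1 nn]]) simp_all
    then have "(\<lambda>w. if b w (R w, y) then y + walk_jump \<alpha> \<beta> (e w) (n w) (if b w (R w, y) then fst (c w (R w, y)) else R w) y else y) \<in> measurable \<Omega> (count_space UNIV)"
      using B by (intro measurable_If) (simp_all add: pred_def)
    then show "(\<lambda>w. if b w (R w, y) then snd (c w (R w, y)) else y) \<in> measurable \<Omega> (count_space UNIV)"
      by (rule back_subst[where P="\<lambda>f. f \<in> _"]) (auto simp: fun_eq_iff c_def)
  qed (use ring_pos[OF _ fC] in \<open>auto simp: b_def c_def walk_clock_times_eq\<close>)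
  also have "?this \<longleftrightarrow> ?thesis"
    using walk_eq_while[OF n_path order_refl t, of _ \<alpha> \<beta>]
    by (intro measurable_cong) (simp add: b_def c_def)
  finally show ?thesis .
qed

lemma measurable_right_path:
  assumes t: "0 \<le> t" and Y: "Y \<in> measurable \<Omega> (count_space UNIV)"
  shows "(\<lambda>w. right_path (n w) t (Y w) s) \<in> measurable \<Omega> (count_space UNIV)"
  unfolding right_path_def
proof (rule measurable_snd_while)
  fix R :: "_ \<Rightarrow> real" and y :: int assume R: "R \<in> borel_measurable \<Omega>" and pos: "\<And>w. w \<in> space \<Omega> \<Longrightarrow> 0 \<le> R w"
  show B: "Measurable.pred \<Omega> (\<lambda>w. case (R w, y) of (r, y) \<Rightarrow> jump_times (n w (Arrow y)) \<inter> {r<..s} \<noteq> {})"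
    unfolding prod.case using R pos by (intro pred_jump_Ioc) simp_all
  show "(\<lambda>w. if case (R w, y) of (r, y) \<Rightarrow> jump_times (n w (Arrow y)) \<inter> {r<..s} \<noteq> {}
      then fst (case (R w, y) of (r, y) \<Rightarrow> (Min (jump_times (n w (Arrow y)) \<inter> {r<..s}), y + 1)) else R w) \<in> borel_measurable \<Omega>"
    using measurable_next_ring[of "{Arrow y}" R s] R pos by (simp cong: if_cong)
  show "(\<lambda>w. if case (R w, y) of (r, y) \<Rightarrow> jump_times (n w (Arrow y)) \<inter> {r<..s} \<noteq> {}
      then snd (case (R w, y) of (r, y) \<Rightarrow> (Min (jump_times (n w (Arrow y)) \<inter> {r<..s}), y + 1)) else y) \<in> measurable \<Omega> (count_space UNIV)"
    using B by (intro measurable_If) (simp_all add: pred_def)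
next
  fix w and r :: real and y assume w: "w \<in> space \<Omega>" and ne: "case (r, y) of (r, y) \<Rightarrow> jump_times (n w (Arrow y)) \<inter> {r<..s} \<noteq> {}"
  show "0 \<le> fst (case (r, y) of (r, y) \<Rightarrow> (Min (jump_times (n w (Arrow y)) \<inter> {r<..s}), y + 1))"
    using ring_pos[OF w, of "{Arrow y}" r s] ne by simp
qed (use t Y in auto)

lemma pred_caught:
  assumes T: "0 \<le> T"
  shows "Measurable.pred \<Omega> (\<lambda>w. caught \<alpha> \<beta> (e w) (n w) T t)"
proof -
  have [measurable]: "(\<lambda>w. walk \<alpha> \<beta> (e w) (n w) (max 0 s)) \<in> measurable \<Omega> (count_space UNIV)" for s
    by (rule measurable_walk) simp
  have [measurable]: "(\<lambda>w. right_path (n w) T (walk \<alpha> \<beta> (e w) (n w) (max 0 T) - 1) s) \<in> measurable \<Omega> (count_space UNIV)" for s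
    by (rule measurable_right_path[OF T]) measurable
  have [measurable]: "Measurable.pred \<Omega> (\<lambda>w. walk \<alpha> \<beta> (e w) (n w) (max 0 s) \<le> right_path (n w) T (walk \<alpha> \<beta> (e w) (n w) (max 0 T) - 1) s)" for s
    by (rule measurable_compose_countable[where f="\<lambda>i w. i \<le> right_path (n w) T (walk \<alpha> \<beta> (e w) (n w) (max 0 T) - 1) s" and g="\<lambda>w. walk \<alpha> \<beta> (e w) (n w) (max 0 s)"])
      (rule measurable_compose[where N="count_space UNIV"], simp_all)
  have "Measurable.pred \<Omega> (\<lambda>w. \<exists>q::rat. T < of_rat q \<and> of_rat q \<le> t \<and>
      walk \<alpha> \<beta> (e w) (n w) (max 0 (of_rat q)) \<le> right_path (n w) T (walk \<alpha> \<beta> (e w) (n w) (max 0 T) - 1) (of_rat q))"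
    by measurable
  also have "(\<lambda>w. \<exists>q::rat. T < of_rat q \<and> of_rat q \<le> t \<and>
      walk \<alpha> \<beta> (e w) (n w) (max 0 (of_rat q)) \<le> right_path (n w) T (walk \<alpha> \<beta> (e w) (n w) (max 0 T) - 1) (of_rat q)) =
      (\<lambda>w. caught \<alpha> \<beta> (e w) (n w) T t)"
  proof (rule ext)
    fix w
    have *: "max 0 s = s" if "T < s" for s using that T by simp
    have bex: "(\<exists>x\<in>range f. P x) = (\<exists>y. P (f y))" for P and f :: "rat \<Rightarrow> real" by blast
    have "max 0 T = T" using T by simp
    then show "(\<exists>q::rat. T < of_rat q \<and> of_rat q \<le> t \<and>
      walk \<alpha> \<beta> (e w) (n w) (max 0 (of_rat q)) \<le> right_path (n w) T (walk \<alpha> \<beta> (e w) (n w) (max 0 T) - 1) (of_rat q)) =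
      caught \<alpha> \<beta> (e w) (n w) T t"
      unfolding caught_def Rats_def bex by (simp only: * cong: conj_cong)
  qed
  finally show ?thesis .
qed

lemma pred_leads:
  assumes T: "0 \<le> T"
  shows "Measurable.pred \<Omega> (\<lambda>w. leads \<alpha> \<beta> (e w) (n w) T)"
proof -
  have [measurable]: "Measurable.pred \<Omega> (\<lambda>w. caught \<alpha> \<beta> (e w) (n w) T t)" for t by (rule pred_caught[OF T])
  have "Measurable.pred \<Omega> (\<lambda>w. \<forall>k::nat. \<not> caught \<alpha> \<beta> (e w) (n w) T (real k))" by measurable
  also have "?this \<longleftrightarrow> ?thesis" using leads_iff_not_caught[OF n_path T] by (intro measurable_cong) auto
  finally show ?thesis .
qed

lemma pred_no_event:
  assumes "0 \<le> s" "0 \<le> t"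
  shows "Measurable.pred \<Omega> (\<lambda>w. n w c t = n w c s)"
  by (rule measurable_compose_countable[where f="\<lambda>i w. n w c t = i" and g="\<lambda>w. n w c s"])
    (auto intro!: measurable_compose[OF n_meas] n_meas assms)

lemma measurable_block:
  assumes "0 \<le> s" "0 \<le> t" "Y \<in> measurable \<Omega> (count_space UNIV)"
  shows "(\<lambda>w. block (n w) s t (Y w)) \<in> measurable \<Omega> (count_space UNIV)"
  using assms(3)
  by (rule measurable_compose_countable[rotated])
    (unfold block_def, intro measurable_Least pred_no_event assms)

lemma measurable_front:
  assumes h: "0 < h"
  shows "(\<lambda>w. front \<alpha> \<beta> h (e w) (n w) m) \<in> measurable \<Omega> (count_space UNIV)"
proof (induction m)
  case (Suc m)
  note [measurable] = Suc
  have nn: "0 \<le> h * real k" for k using h by simp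
  have [measurable]: "(\<lambda>w. n w c (h * real k)) \<in> measurable \<Omega> (count_space UNIV)" for c k by (intro n_meas nn)
  have [measurable]: "(\<lambda>w. walk \<alpha> \<beta> (e w) (n w) (h * real m)) \<in> measurable \<Omega> (count_space UNIV)" by (intro measurable_walk nn)
  have [measurable]: "Measurable.pred \<Omega> (\<lambda>w. n w c (h * real (Suc m)) = n w c (h * real m))" for c
    by (intro pred_no_event nn)
  have int_max: "(\<lambda>w. max (f w) (g w)) \<in> measurable \<Omega> (count_space UNIV)"
    if "f \<in> measurable \<Omega> (count_space UNIV)" "g \<in> measurable \<Omega> (count_space UNIV)" for f g :: "_ \<Rightarrow> int"
    by (rule measurable_compose_countable[where f="\<lambda>i w. max i (g w)" and g=f])
      (auto intro!: measurable_compose[OF that(2)] that)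
  define B where "B = (\<lambda>w. if n w HatPlus (h * real (Suc m)) = n w HatPlus (h * real m) \<and> n w HatMinus (h * real (Suc m)) = n w HatMinus (h * real m)
     then front \<alpha> \<beta> h (e w) (n w) m
     else max (front \<alpha> \<beta> h (e w) (n w) m) (walk \<alpha> \<beta> (e w) (n w) (h * real m)
       + (int (n w Plus (h * real (Suc m))) - n w Plus (h * real m)) + (int (n w HatPlus (h * real (Suc m))) - n w HatPlus (h * real m))))"
  have [measurable]: "B \<in> measurable \<Omega> (count_space UNIV)"
    unfolding B_def
    by (intro measurable_If int_max) measurable
  have [measurable]: "(\<lambda>w. block (n w) (h * real m) (h * real (Suc m)) (B w)) \<in> measurable \<Omega> (count_space UNIV)"
    by (intro measurable_block nn) measurable
  have "(\<lambda>w. B w + int (block (n w) (h * real m) (h * real (Suc m)) (B w))) \<in> measurable \<Omega> (count_space UNIV)"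
    by measurable
  then show ?case unfolding B_def front.simps Let_def .
qed simp

end

section \<open>Laws of Poisson processes\<close>

text \<open>By the pi-lambda theorem it is enough to test independence on intersection-stable
  generators; the generators in use are the cylinder sets.\<close>

lemma (in prob_space) indep_varI_generator:
  assumes X: "X \<in> measurable M S" and Y: "Y \<in> measurable M T"
    and S: "sets S = sigma_sets (space S) G" "Int_stable G" "G \<subseteq> Pow (space S)"
    and T: "sets T = sigma_sets (space T) H" "Int_stable H" "H \<subseteq> Pow (space T)"
    and eq: "\<And>A B. A \<in> G \<Longrightarrow> B \<in> H \<Longrightarrow>
      prob ((X -` A \<inter> space M) \<inter> (Y -` B \<inter> space M)) = prob (X -` A \<inter> space M) * prob (Y -` B \<inter> space M)"
  shows "indep_var S X T Y"
proof -
  have gen: "sigma_sets (space M) {Z -` A \<inter> space M | A. A \<in> sets R} = sigma_sets (space M) {Z -` A \<inter> space M | A. A \<in> K}"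
    "Int_stable {Z -` A \<inter> space M | A. A \<in> K}"
    if "Z \<in> measurable M R" "sets R = sigma_sets (space R) K" "Int_stable K" for Z R K
  proof -
    have "{Z -` A \<inter> space M | A. A \<in> sets R} = sigma_sets (space M) {Z -` A \<inter> space M | A. A \<in> K}"
      unfolding that(2) using measurable_space[OF that(1)] by (intro sigma_sets_vimage_commute) auto
    then show "sigma_sets (space M) {Z -` A \<inter> space M | A. A \<in> sets R} = sigma_sets (space M) {Z -` A \<inter> space M | A. A \<in> K}"
      by (simp, subst sigma_sets_sigma_sets_eq) auto
    show "Int_stable {Z -` A \<inter> space M | A. A \<in> K}"
    proof (rule Int_stableI, clarify)
      fix A B assume "A \<in> K" "B \<in> K"
      then have "A \<inter> B \<in> K" using that(3) by (auto simp: Int_stable_def)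
      then show "\<exists>C. Z -` A \<inter> space M \<inter> (Z -` B \<inter> space M) = Z -` C \<inter> space M \<and> C \<in> K"
        by (intro exI[of _ "A \<inter> B"]) auto
    qed
  qed
  have G: "A \<in> sets S" if "A \<in> G" for A using that by (auto simp: S(1) intro: sigma_sets.Basic)
  have H: "A \<in> sets T" if "A \<in> H" for A using that by (auto simp: T(1) intro: sigma_sets.Basic)
  show ?thesis
    unfolding indep_var_eq gen(1)[OF X S(1,2)] gen(1)[OF Y T(1,2)]
  proof (intro conjI X Y indep_set_sigma_sets gen(2)[OF X S(1,2)] gen(2)[OF Y T(1,2)] indep_setI)
    show "{X -` A \<inter> space M |A. A \<in> G} \<subseteq> events" using measurable_sets[OF X] G by auto
    show "{Y -` A \<inter> space M |A. A \<in> H} \<subseteq> events" using measurable_sets[OF Y] H by auto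
  qed (use eq in auto)
qed

lemma PiM_generator:
  "sets (PiM I N) = sigma_sets (space (PiM I N)) (prod_algebra I N)"
  "Int_stable (prod_algebra I N)" "prod_algebra I N \<subseteq> Pow (space (PiM I N))"
  using prod_algebra_sets_into_space[of I N] by (auto simp: sets_PiM space_PiM Int_stable_prod_algebra)

lemma measurable_sum_component:
  assumes "finite I'" "I' \<subseteq> I"
  shows "(\<lambda>x. \<Sum>i\<in>I'. x i) \<in> measurable (PiM I (\<lambda>_. count_space (UNIV::nat set))) (count_space UNIV)"
  using assms
proof (induction I')
  case (insert i I')
  have "(\<lambda>x. (\<lambda>a x. a + (\<Sum>i\<in>I'. x i)) (x i) x) \<in> measurable (PiM I (\<lambda>_. count_space (UNIV::nat set))) (count_space UNIV)"
  proof (rule measurable_compose_countable[where f="\<lambda>a x. a + (\<Sum>i\<in>I'. x i)" and g="\<lambda>x. x i"])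
    have IH: "(\<lambda>x. \<Sum>i\<in>I'. x i) \<in> measurable (PiM I (\<lambda>_. count_space (UNIV::nat set))) (count_space UNIV)"
      using insert by simp
    show "(\<lambda>x. a + (\<Sum>i\<in>I'. x i)) \<in> measurable (PiM I (\<lambda>_. count_space (UNIV::nat set))) (count_space UNIV)" for a
      by (rule measurable_compose[OF IH]) simp
    show "(\<lambda>x. x i) \<in> measurable (PiM I (\<lambda>_. count_space (UNIV::nat set))) (count_space UNIV)"
      using insert by (intro measurable_component_singleton) simp
  qed
  then show ?case using insert by simp
qed simp

lemma sets_sum_components:
  assumes J: "finite J" and K: "\<And>j. j \<in> J \<Longrightarrow> finite (K j)" "\<And>j. j \<in> J \<Longrightarrow> K j \<subseteq> I"
  shows "{x \<in> space (PiM I (\<lambda>_. count_space (UNIV::nat set))). \<forall>j\<in>J. (\<Sum>i\<in>K j. x i) \<in> A j} \<in> sets (PiM I (\<lambda>_. count_space (UNIV::nat set)))"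
proof (rule sets.sets_Collect_finite_All[OF _ J])
  fix j assume j: "j \<in> J"
  have "(\<lambda>x. \<Sum>i\<in>K j. x i) -` A j \<inter> space (PiM I (\<lambda>_. count_space (UNIV::nat set))) \<in> sets (PiM I (\<lambda>_. count_space (UNIV::nat set)))"
    by (rule measurable_sets[OF measurable_sum_component[OF K[OF j]]]) simp
  also have "(\<lambda>x. \<Sum>i\<in>K j. x i) -` A j \<inter> space (PiM I (\<lambda>_. count_space (UNIV::nat set))) =
    {x \<in> space (PiM I (\<lambda>_. count_space (UNIV::nat set))). (\<Sum>i\<in>K j. x i) \<in> A j}" by blast
  finally show "{x \<in> space (PiM I (\<lambda>_. count_space (UNIV::nat set))). (\<Sum>i\<in>K j. x i) \<in> A j} \<in> sets (PiM I (\<lambda>_. count_space (UNIV::nat set)))" .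
qed

lemma restrict_in_prod_emb:
  assumes "J \<subseteq> I"
  shows "restrict f I \<in> prod_emb I (\<lambda>_. count_space UNIV) J (Pi\<^sub>E J A) \<longleftrightarrow> (\<forall>j\<in>J. f j \<in> A j)"
proof -
  have "restrict (restrict f I) J = restrict f J" using assms by (auto simp: restrict_def fun_eq_iff)
  then show ?thesis by (auto simp: prod_emb_def PiE_iff)
qed

text \<open>Independence of increments is given along monotone sequences of times, so a finite set
  of times has to be embedded in one. The sequence starts at 0 and is constant after the largest
  time.\<close>

lemma finite_time_enumeration:
  assumes "finite F" "\<And>x. x \<in> F \<Longrightarrow> (0::real) \<le> x"
  obtains t :: "nat \<Rightarrow> real" and k where "mono t" "t 0 = 0" "\<And>x. x \<in> F \<Longrightarrow> t (k x) = x"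
    "\<And>x y. x \<in> F \<Longrightarrow> y \<in> F \<Longrightarrow> x \<le> y \<Longrightarrow> k x \<le> k y" "\<And>i. 0 \<le> t i"
proof -
  define L where "L = sorted_list_of_set (insert 0 F)"
  have L: "set L = insert 0 F" "sorted L" "L \<noteq> []" using assms(1) by (auto simp: L_def simp del: sorted_list_of_set_insert_remove)
  define t where "t = (\<lambda>i. L ! min i (length L - 1))"
  have len: "min i (length L - 1) < length L" for i using L(3) by (cases L) auto
  have mono: "mono t" unfolding t_def by (intro monoI sorted_nth_mono L(2) len) auto
  have ex: "\<exists>i. t i = x" if "x \<in> F" for x
  proof -
    have "x \<in> set L" using that by (simp add: L(1))
    then obtain i where "i < length L" "L ! i = x" by (auto simp: in_set_conv_nth)
    moreover from this have "min i (length L - 1) = i" by (intro min_absorb1) linarith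
    ultimately show ?thesis by (intro exI[of _ i]) (simp add: t_def)
  qed
  define k where "k = (\<lambda>x. LEAST i. t i = x)"
  have k: "t (k x) = x" if "x \<in> F" for x unfolding k_def using ex[OF that] by (rule LeastI_ex)
  have km: "k x \<le> k y" if "x \<in> F" "y \<in> F" "x \<le> y" for x y
  proof (rule ccontr)
    assume "\<not> k x \<le> k y"
    then have "t (k y) \<le> t (k x)" using mono by (intro monoD[OF mono]) auto
    then have "x = y" using that k by simp
    then show False using \<open>\<not> k x \<le> k y\<close> by simp
  qed
  have "t i \<in> set L" for i unfolding t_def using len by (intro nth_mem)
  then have "t i = 0 \<or> t i \<in> F" for i unfolding L(1) by blast
  then have nn: "0 \<le> t i" for i using assms(2)[of "t i"] by (metis order_refl)
  have "0 \<le> L ! 0" using nn[of 0] by (simp add: t_def)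
  moreover have "0 \<in> set L" by (simp add: L(1))
  then obtain i where "i < length L" "L ! i = 0" by (auto simp: in_set_conv_nth)
  ultimately have "L ! 0 = 0" using sorted_nth_mono[OF L(2), of 0 i] by auto
  then have "t 0 = 0" by (simp add: t_def)
  then show ?thesis using that mono k km nn by blast
qed

definition stop_path :: "real \<Rightarrow> (real \<Rightarrow> nat) \<Rightarrow> real \<Rightarrow> nat" where
  "stop_path T f = (\<lambda>s\<in>{0..}. f (min s T))"

definition shift_path :: "real \<Rightarrow> (real \<Rightarrow> nat) \<Rightarrow> real \<Rightarrow> nat" where
  "shift_path T f = (\<lambda>s\<in>{0..}. f (T + s) - f T)"

context prob_space
begin

lemma poisson_processD:
  assumes "poisson_process M r N"
  shows "\<And>t. 0 \<le> t \<Longrightarrow> (\<lambda>\<omega>. N \<omega> t) \<in> measurable M (count_space UNIV)"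
    and "\<And>\<omega>. \<omega> \<in> space M \<Longrightarrow> counting_path (N \<omega>)"
    and "\<And>s t. 0 \<le> s \<Longrightarrow> s \<le> t \<Longrightarrow> distr M (count_space UNIV) (\<lambda>\<omega>. N \<omega> t - N \<omega> s) = measure_pmf (poisson_law (r * (t - s)))"
    and "\<And>t :: nat \<Rightarrow> real. 0 \<le> t 0 \<Longrightarrow> mono t \<Longrightarrow> indep_vars (\<lambda>_. count_space UNIV) (\<lambda>i \<omega>. N \<omega> (t (Suc i)) - N \<omega> (t i)) UNIV"
  using assms unfolding poisson_process_def counting_path_def by blast+

lemma measurable_increment:
  assumes "poisson_process M r N" "0 \<le> s" "0 \<le> t"
  shows "(\<lambda>\<omega>. N \<omega> t - N \<omega> s) \<in> measurable M (count_space UNIV)"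
  by (rule measurable_compose_countable[where f="\<lambda>i \<omega>. i - N \<omega> s" and g="\<lambda>\<omega>. N \<omega> t"])
    (auto intro!: measurable_compose[OF poisson_processD(1)[OF assms(1,2)]] poisson_processD(1)[OF assms(1,3)])

lemma increments_law:
  assumes N: "poisson_process M r N" and t: "0 \<le> t 0" "mono t"
  shows "distr M (PiM UNIV (\<lambda>_. count_space UNIV)) (\<lambda>\<omega> i. N \<omega> (t (Suc i)) - N \<omega> (t i))
    = PiM UNIV (\<lambda>i::nat. measure_pmf (poisson_law (r * (t (Suc i) - t i))))"
proof -
  have le: "0 \<le> t i" for i using t monoD[OF t(2), of 0 i] by simp
  have "distr M (PiM UNIV (\<lambda>_. count_space UNIV)) (\<lambda>\<omega>. \<lambda>i\<in>UNIV. N \<omega> (t (Suc i)) - N \<omega> (t i))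
    = PiM UNIV (\<lambda>i. distr M (count_space UNIV) (\<lambda>\<omega>. N \<omega> (t (Suc i)) - N \<omega> (t i)))"
    using poisson_processD(4)[OF N t]
    by (subst indep_vars_iff_distr_eq_PiM'[symmetric]) (auto intro!: measurable_increment[OF N] le)
  then show ?thesis
    using poisson_processD(3)[OF N] le monoD[OF t(2)] by (simp add: restrict_UNIV)
qed

lemma sum_increments:
  assumes f: "counting_path f" and t: "mono t" "\<And>i. 0 \<le> t i" and "k \<le> (l::nat)"
  shows "(\<Sum>i\<in>{k..<l}. f (t (Suc i)) - f (t i)) = f (t l) - f (t k)"
  using \<open>k \<le> l\<close>
proof (induction l rule: dec_induct)
  case (step l)
  have "f (t k) \<le> f (t l)" "f (t l) \<le> f (t (Suc l))"
    using t step by (auto intro!: counting_path_mono[OF f] monoD[OF t(1)])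
  then show ?case using step by simp
qed simp

lemma measurable_path:
  assumes "\<And>t. 0 \<le> t \<Longrightarrow> (\<lambda>\<omega>. N \<omega> t) \<in> measurable \<Omega> (count_space UNIV)"
  shows "(\<lambda>\<omega>. restrict (N \<omega>) {0..}) \<in> measurable \<Omega> path_space"
  using assms by (intro measurable_restrict) auto

text \<open>A value of the process is the sum of the increments before it, and increments along a
  sequence of times are independent Poisson variables with parameters fixed by the rate. So all
  cylinder probabilities are determined.\<close>

lemma poisson_process_law_unique:
  assumes N: "poisson_process M r N" and N': "poisson_process M r N'"
  shows "distr M path_space (\<lambda>\<omega>. restrict (N \<omega>) {0..}) = distr M path_space (\<lambda>\<omega>. restrict (N' \<omega>) {0..})"
proof (rule measure_eqI_PiM_infinite)
  have m: "(\<lambda>\<omega>. restrict (N \<omega>) {0..}) \<in> measurable M path_space"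
    if "poisson_process M r N" for N using poisson_processD(1)[OF that] by (intro measurable_path)
  show "finite_measure (distr M path_space (\<lambda>\<omega>. restrict (N \<omega>) {0..}))"
    by (intro prob_space.finite_measure prob_space_distr m N)
  fix A J assume J: "finite J" "J \<subseteq> {0::real..}" and A: "\<And>i. i \<in> J \<Longrightarrow> A i \<in> sets (count_space (UNIV :: nat set))"
  obtain t :: "nat \<Rightarrow> real" and k where t: "mono t" "t 0 = 0" "\<And>x. x \<in> J \<Longrightarrow> t (k x) = x" "\<And>i. 0 \<le> t i"
  proof -
    have "\<And>x. x \<in> J \<Longrightarrow> 0 \<le> x" using J by auto
    then show thesis
    proof (rule finite_time_enumeration[OF J(1)])
      fix t :: "nat \<Rightarrow> real" and k
      assume a: "mono t" "t 0 = 0" "\<And>x. x \<in> J \<Longrightarrow> t (k x) = x" "\<And>i. 0 \<le> t i"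
      show thesis by (rule that[of t k]; rule a)
    qed
  qed
  define S where "S = {x \<in> space (PiM UNIV (\<lambda>_::nat. count_space (UNIV::nat set))). \<forall>j\<in>J. (\<Sum>i\<in>{0..<k j}. x i) \<in> A j}"
  have S_eq: "S = {x. \<forall>j\<in>J. (\<Sum>i\<in>{0..<k j}. x i) \<in> A j}"
    unfolding S_def by (simp add: space_PiM)
  have S: "S \<in> sets (PiM UNIV (\<lambda>_::nat. count_space (UNIV::nat set)))"
    unfolding S_def using J(1) by (intro sets_sum_components) auto
  have eq: "emeasure (distr M path_space (\<lambda>\<omega>. restrict (N \<omega>) {0..})) (prod_emb {0..} (\<lambda>_. count_space UNIV) J (Pi\<^sub>E J A))
     = emeasure (PiM UNIV (\<lambda>i::nat. measure_pmf (poisson_law (r * (t (Suc i) - t i))))) S"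
    if N: "poisson_process M r N" for N
  proof -
    have "prod_emb {0..} (\<lambda>_. count_space UNIV) J (Pi\<^sub>E J A) \<in> sets path_space"
      using J A by (intro sets_PiM_I) auto
    then have "emeasure (distr M path_space (\<lambda>\<omega>. restrict (N \<omega>) {0..})) (prod_emb {0..} (\<lambda>_. count_space UNIV) J (Pi\<^sub>E J A))
       = emeasure M ((\<lambda>\<omega>. restrict (N \<omega>) {0..}) -` prod_emb {0..} (\<lambda>_. count_space UNIV) J (Pi\<^sub>E J A) \<inter> space M)"
      by (intro emeasure_distr m N)
    also have "(\<lambda>\<omega>. restrict (N \<omega>) {0..}) -` prod_emb {0..} (\<lambda>_. count_space UNIV) J (Pi\<^sub>E J A) \<inter> space M
      = (\<lambda>\<omega> i. N \<omega> (t (Suc i)) - N \<omega> (t i)) -` S \<inter> space M"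
    proof -
      have "(\<Sum>i\<in>{0..<k j}. N \<omega> (t (Suc i)) - N \<omega> (t i)) = N \<omega> j" if "\<omega> \<in> space M" "j \<in> J" for j \<omega>
        using sum_increments[OF poisson_processD(2)[OF N that(1)] t(1,4), of 0 "k j"] t(2) t(3)[OF that(2)]
          poisson_processD(2)[OF N that(1)] by (simp add: counting_path_def)
      note sum = this
      show ?thesis
      proof (intro set_eqI)
        fix \<omega>
        show "\<omega> \<in> (\<lambda>\<omega>. restrict (N \<omega>) {0..}) -` prod_emb {0..} (\<lambda>_. count_space UNIV) J (Pi\<^sub>E J A) \<inter> space M \<longleftrightarrow>
          \<omega> \<in> (\<lambda>\<omega> i. N \<omega> (t (Suc i)) - N \<omega> (t i)) -` S \<inter> space M"
        proof -
          have "\<omega> \<in> (\<lambda>\<omega>. restrict (N \<omega>) {0..}) -` prod_emb {0..} (\<lambda>_. count_space UNIV) J (Pi\<^sub>E J A) \<inter> space M \<longleftrightarrow>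
            \<omega> \<in> space M \<and> (\<forall>j\<in>J. N \<omega> j \<in> A j)"
            by (simp only: vimage_eq Int_iff restrict_in_prod_emb[OF J(2)] conj_commute)
          moreover have "\<omega> \<in> (\<lambda>\<omega> i. N \<omega> (t (Suc i)) - N \<omega> (t i)) -` S \<inter> space M \<longleftrightarrow>
            \<omega> \<in> space M \<and> (\<forall>j\<in>J. (\<Sum>i\<in>{0..<k j}. N \<omega> (t (Suc i)) - N \<omega> (t i)) \<in> A j)"
            unfolding S_eq by blast
          moreover have "(\<forall>j\<in>J. (\<Sum>i\<in>{0..<k j}. N \<omega> (t (Suc i)) - N \<omega> (t i)) \<in> A j) = (\<forall>j\<in>J. N \<omega> j \<in> A j)"
            if "\<omega> \<in> space M"
            by (rule ball_cong[OF refl]) (simp only: sum[OF that])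
          ultimately show ?thesis by blast
        qed
      qed
    qed
    also have "emeasure M \<dots> = emeasure (distr M (PiM UNIV (\<lambda>_. count_space UNIV)) (\<lambda>\<omega> i. N \<omega> (t (Suc i)) - N \<omega> (t i))) S"
      by (intro emeasure_distr[symmetric] S measurable_PiM_single')
        (auto intro!: measurable_increment[OF N] t)
    also have "\<dots> = emeasure (PiM UNIV (\<lambda>i::nat. measure_pmf (poisson_law (r * (t (Suc i) - t i))))) S"
      using t by (subst increments_law[OF N]) auto
    finally show ?thesis .
  qed
  show "emeasure (distr M path_space (\<lambda>\<omega>. restrict (N \<omega>) {0..})) (prod_emb {0..} (\<lambda>_. count_space UNIV) J (Pi\<^sub>E J A)) =
      emeasure (distr M path_space (\<lambda>\<omega>. restrict (N' \<omega>) {0..})) (prod_emb {0..} (\<lambda>_. count_space UNIV) J (Pi\<^sub>E J A))"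
    using eq[OF N] eq[OF N'] by simp
qed simp_all

text \<open>Cylinder events of the stopped and of the shifted path concern disjoint blocks of one
  sequence of independent increments.\<close>

lemma poisson_process_past_future:
  assumes N: "poisson_process M r N" and T: "0 \<le> T"
  shows "indep_var path_space (\<lambda>\<omega>. stop_path T (N \<omega>)) path_space (\<lambda>\<omega>. shift_path T (N \<omega>))"
proof (rule indep_varI_generator[OF _ _ PiM_generator PiM_generator])
  show "(\<lambda>\<omega>. stop_path T (N \<omega>)) \<in> measurable M path_space"
    unfolding stop_path_def using T poisson_processD(1)[OF N] by (intro measurable_restrict) auto
  show "(\<lambda>\<omega>. shift_path T (N \<omega>)) \<in> measurable M path_space"
    unfolding shift_path_def using T measurable_increment[OF N] by (intro measurable_restrict) auto
  fix A B assume "A \<in> prod_algebra {0::real..} (\<lambda>_. count_space (UNIV::nat set))"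
    "B \<in> prod_algebra {0::real..} (\<lambda>_. count_space (UNIV::nat set))"
  then obtain J E K D where A: "A = prod_emb {0..} (\<lambda>_. count_space UNIV) J (Pi\<^sub>E J E)" "finite J" "J \<subseteq> {0..}"
    and B: "B = prod_emb {0..} (\<lambda>_. count_space UNIV) K (Pi\<^sub>E K D)" "finite K" "K \<subseteq> {0..}"
    by (elim prod_algebraE) auto
  \<comment> \<open>\<open>T\<close> is made a point of the enumeration, so that its index separates
    the increments of the past from those of the future.\<close>
  define F where "F = insert T ((\<lambda>s. min s T) ` J \<union> (\<lambda>s. T + s) ` K)"
  have F: "finite F" "\<And>x. x \<in> F \<Longrightarrow> 0 \<le> x" using A B T by (auto simp: F_def)
  obtain t :: "nat \<Rightarrow> real" and k where t: "mono t" "t 0 = 0" "\<And>x. x \<in> F \<Longrightarrow> t (k x) = x"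
    and k: "\<And>x y. x \<in> F \<Longrightarrow> y \<in> F \<Longrightarrow> x \<le> y \<Longrightarrow> k x \<le> k y" and nn: "\<And>i. 0 \<le> t i"
  proof (rule finite_time_enumeration[OF F])
    fix t :: "nat \<Rightarrow> real" and k
    assume a: "mono t" "t 0 = 0" "\<And>x. x \<in> F \<Longrightarrow> t (k x) = x" "\<And>x y. x \<in> F \<Longrightarrow> y \<in> F \<Longrightarrow> x \<le> y \<Longrightarrow> k x \<le> k y" "\<And>i. 0 \<le> t i"
    show thesis by (rule that[of t k]; rule a)
  qed
  define inc where "inc = (\<lambda>i \<omega>. N \<omega> (t (Suc i)) - N \<omega> (t i))"
  have TF: "T \<in> F" by (simp add: F_def)
  have past: "k (min s T) \<le> k T" "t (k (min s T)) = min s T" if "s \<in> J" for s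
    using that TF by (auto intro!: k t(3) simp: F_def)
  have fut: "k T \<le> k (T + s)" "t (k (T + s)) = T + s" if "s \<in> K" for s
    using that TF B(3) by (auto intro!: k t(3) simp: F_def)
  have ind: "indep_var (PiM {..<k T} (\<lambda>_. count_space UNIV)) (\<lambda>\<omega>. restrict (\<lambda>i. inc i \<omega>) {..<k T})
     (PiM {k T..} (\<lambda>_. count_space UNIV)) (\<lambda>\<omega>. restrict (\<lambda>i. inc i \<omega>) {k T..})"
    unfolding inc_def using poisson_processD(4)[OF N _ t(1)] t(2) by (intro indep_var_restrict) auto
  define S1 where "S1 = {x \<in> space (PiM {..<k T} (\<lambda>_. count_space (UNIV::nat set))). \<forall>s\<in>J. (\<Sum>i\<in>{0..<k (min s T)}. x i) \<in> E s}"
  define S2 where "S2 = {x \<in> space (PiM {k T..} (\<lambda>_. count_space (UNIV::nat set))). \<forall>s\<in>K. (\<Sum>i\<in>{k T..<k (T + s)}. x i) \<in> D s}"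
  have S1: "S1 \<in> sets (PiM {..<k T} (\<lambda>_. count_space (UNIV::nat set)))"
    unfolding S1_def using past(1) by (intro sets_sum_components A(2)) force+
  have S2: "S2 \<in> sets (PiM {k T..} (\<lambda>_. count_space (UNIV::nat set)))"
    unfolding S2_def by (intro sets_sum_components B(2)) auto
  have 1: "(\<lambda>\<omega>. stop_path T (N \<omega>)) -` A \<inter> space M = (\<lambda>\<omega>. restrict (\<lambda>i. inc i \<omega>) {..<k T}) -` S1 \<inter> space M"
  proof -
    have "(\<Sum>i\<in>{0..<k (min s T)}. restrict (\<lambda>i. inc i \<omega>) {..<k T} i) = N \<omega> (min s T)" if "\<omega> \<in> space M" "s \<in> J" for s \<omega>
    proof -
      have "(\<Sum>i\<in>{0..<k (min s T)}. restrict (\<lambda>i. inc i \<omega>) {..<k T} i) = (\<Sum>i\<in>{0..<k (min s T)}. inc i \<omega>)"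
        using past[OF that(2)] by (intro sum.cong) auto
      also have "\<dots> = N \<omega> (min s T)"
        unfolding inc_def using sum_increments[OF poisson_processD(2)[OF N that(1)] t(1) nn, of 0 "k (min s T)"] t(2) past(2)[OF that(2)]
          poisson_processD(2)[OF N that(1)] by (simp add: counting_path_def)
      finally show ?thesis .
    qed
    note sum = this
    show ?thesis
    proof (intro set_eqI)
      fix \<omega>
      show "\<omega> \<in> (\<lambda>\<omega>. stop_path T (N \<omega>)) -` A \<inter> space M \<longleftrightarrow> \<omega> \<in> (\<lambda>\<omega>. restrict (\<lambda>i. inc i \<omega>) {..<k T}) -` S1 \<inter> space M"
      proof -
        have "\<omega> \<in> (\<lambda>\<omega>. stop_path T (N \<omega>)) -` A \<inter> space M \<longleftrightarrow> \<omega> \<in> space M \<and> (\<forall>s\<in>J. N \<omega> (min s T) \<in> E s)"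
          by (simp only: A(1) stop_path_def vimage_eq Int_iff restrict_in_prod_emb[OF A(3)] conj_commute)
        moreover have "\<omega> \<in> (\<lambda>\<omega>. restrict (\<lambda>i. inc i \<omega>) {..<k T}) -` S1 \<inter> space M \<longleftrightarrow>
          \<omega> \<in> space M \<and> (\<forall>s\<in>J. (\<Sum>i\<in>{0..<k (min s T)}. restrict (\<lambda>i. inc i \<omega>) {..<k T} i) \<in> E s)"
          unfolding S1_def by (auto simp: space_PiM simp del: restrict_apply)
        moreover have "(\<forall>s\<in>J. (\<Sum>i\<in>{0..<k (min s T)}. restrict (\<lambda>i. inc i \<omega>) {..<k T} i) \<in> E s) = (\<forall>s\<in>J. N \<omega> (min s T) \<in> E s)"
          if "\<omega> \<in> space M"
          by (rule ball_cong[OF refl]) (simp only: sum[OF that])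
        ultimately show ?thesis by blast
      qed
    qed
  qed
  have 2: "(\<lambda>\<omega>. shift_path T (N \<omega>)) -` B \<inter> space M = (\<lambda>\<omega>. restrict (\<lambda>i. inc i \<omega>) {k T..}) -` S2 \<inter> space M"
  proof -
    have "(\<Sum>i\<in>{k T..<k (T + s)}. restrict (\<lambda>i. inc i \<omega>) {k T..} i) = N \<omega> (T + s) - N \<omega> T" if "\<omega> \<in> space M" "s \<in> K" for s \<omega>
    proof -
      have "(\<Sum>i\<in>{k T..<k (T + s)}. restrict (\<lambda>i. inc i \<omega>) {k T..} i) = (\<Sum>i\<in>{k T..<k (T + s)}. inc i \<omega>)"
        by (intro sum.cong) auto
      also have "\<dots> = N \<omega> (T + s) - N \<omega> T"
        unfolding inc_def using sum_increments[OF poisson_processD(2)[OF N that(1)] t(1) nn fut(1)[OF that(2)]] fut(2)[OF that(2)] t(3)[OF TF]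
        by simp
      finally show ?thesis .
    qed
    note sum = this
    show ?thesis
    proof (intro set_eqI)
      fix \<omega>
      show "\<omega> \<in> (\<lambda>\<omega>. shift_path T (N \<omega>)) -` B \<inter> space M \<longleftrightarrow> \<omega> \<in> (\<lambda>\<omega>. restrict (\<lambda>i. inc i \<omega>) {k T..}) -` S2 \<inter> space M"
      proof -
        have "\<omega> \<in> (\<lambda>\<omega>. shift_path T (N \<omega>)) -` B \<inter> space M \<longleftrightarrow> \<omega> \<in> space M \<and> (\<forall>s\<in>K. N \<omega> (T + s) - N \<omega> T \<in> D s)"
          by (simp only: B(1) shift_path_def vimage_eq Int_iff restrict_in_prod_emb[OF B(3)] conj_commute)
        moreover have "\<omega> \<in> (\<lambda>\<omega>. restrict (\<lambda>i. inc i \<omega>) {k T..}) -` S2 \<inter> space M \<longleftrightarrow>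
          \<omega> \<in> space M \<and> (\<forall>s\<in>K. (\<Sum>i\<in>{k T..<k (T + s)}. restrict (\<lambda>i. inc i \<omega>) {k T..} i) \<in> D s)"
          unfolding S2_def by (auto simp: space_PiM simp del: restrict_apply)
        moreover have "(\<forall>s\<in>K. (\<Sum>i\<in>{k T..<k (T + s)}. restrict (\<lambda>i. inc i \<omega>) {k T..} i) \<in> D s) = (\<forall>s\<in>K. N \<omega> (T + s) - N \<omega> T \<in> D s)"
          if "\<omega> \<in> space M"
          by (rule ball_cong[OF refl]) (simp only: sum[OF that])
        ultimately show ?thesis by blast
      qed
    qed
  qed
  have "prob ((\<lambda>\<omega>. (restrict (\<lambda>i. inc i \<omega>) {..<k T}, restrict (\<lambda>i. inc i \<omega>) {k T..})) -` (S1 \<times> S2) \<inter> space M) =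
    prob ((\<lambda>\<omega>. restrict (\<lambda>i. inc i \<omega>) {..<k T}) -` S1 \<inter> space M) * prob ((\<lambda>\<omega>. restrict (\<lambda>i. inc i \<omega>) {k T..}) -` S2 \<inter> space M)"
    by (rule indep_varD[OF ind S1 S2])
  also have "(\<lambda>\<omega>. (restrict (\<lambda>i. inc i \<omega>) {..<k T}, restrict (\<lambda>i. inc i \<omega>) {k T..})) -` (S1 \<times> S2) \<inter> space M =
     ((\<lambda>\<omega>. stop_path T (N \<omega>)) -` A \<inter> space M) \<inter> ((\<lambda>\<omega>. shift_path T (N \<omega>)) -` B \<inter> space M)"
    unfolding 1 2 by auto
  finally show "prob (((\<lambda>\<omega>. stop_path T (N \<omega>)) -` A \<inter> space M) \<inter> ((\<lambda>\<omega>. shift_path T (N \<omega>)) -` B \<inter> space M)) =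
     prob ((\<lambda>\<omega>. stop_path T (N \<omega>)) -` A \<inter> space M) * prob ((\<lambda>\<omega>. shift_path T (N \<omega>)) -` B \<inter> space M)"
    unfolding 1 2 .
qed

end

section \<open>Canonical space of the clocks, and independence of past and future\<close>

instance clock :: countable
  by countable_datatype

abbreviation config_space :: "(int \<Rightarrow> bool) measure" where
  "config_space \<equiv> PiM UNIV (\<lambda>_. count_space UNIV)"

abbreviation clock_paths :: "(clock \<Rightarrow> real \<Rightarrow> nat) measure" where
  "clock_paths \<equiv> PiM UNIV (\<lambda>_. path_space)"

text \<open>The regular paths do not form a measurable subset of the uncountable product, so the canonical
  space of the clocks carries the trace \<open>\<sigma>\<close>-algebra.\<close>

definition clock_space :: "(clock \<Rightarrow> real \<Rightarrow> nat) measure" where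
  "clock_space = restrict_space clock_paths {n. \<forall>c. counting_path (n c)}"

lemma measurable_clock_spaceI:
  assumes "\<And>w c. w \<in> space \<Omega> \<Longrightarrow> counting_path (F w c)"
    and "\<And>w c. w \<in> space \<Omega> \<Longrightarrow> F w c \<in> extensional {0..}"
    and "\<And>c t. 0 \<le> t \<Longrightarrow> (\<lambda>w. F w c t) \<in> measurable \<Omega> (count_space UNIV)"
  shows "F \<in> measurable \<Omega> clock_space"
  unfolding clock_space_def
proof (rule measurable_restrict_space2)
  show "F \<in> space \<Omega> \<rightarrow> {n. \<forall>c. counting_path (n c)}" using assms(1) by auto
  have "(\<lambda>w. F w c) \<in> measurable \<Omega> path_space" for c
  proof -
    have "(\<lambda>w. restrict (F w c) {0..}) \<in> measurable \<Omega> path_space"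
      using assms(3) by (intro measurable_restrict) auto
    also have "?this \<longleftrightarrow> ?thesis"
      using assms(2) by (intro measurable_cong) (simp add: extensional_restrict)
    finally show ?thesis .
  qed
  note comp = this
  have "(\<lambda>w c. F w c) \<in> measurable \<Omega> clock_paths"
  proof (rule measurable_PiM_single')
    show "(\<lambda>w. F w c) \<in> measurable \<Omega> path_space" for c by (rule comp)
    show "(\<lambda>w c. F w c) \<in> space \<Omega> \<rightarrow> (\<Pi>\<^sub>E c\<in>UNIV. space path_space)"
      using assms(2) by (simp add: PiE_iff space_PiM Pi_iff)
  qed
  then show "F \<in> measurable \<Omega> clock_paths" by simp
qed

lemma space_clock_space:
  "n \<in> space clock_space \<longleftrightarrow> (\<forall>c. counting_path (n c) \<and> n c \<in> extensional {0..})"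
  by (auto simp: clock_space_def space_restrict_space space_PiM PiE_iff)

lemma measurable_clock_space_component:
  assumes "0 \<le> t"
  shows "(\<lambda>n. n c t) \<in> measurable clock_space (count_space UNIV)"
proof -
  have "(\<lambda>n. n c) \<in> measurable clock_paths path_space" by (rule measurable_component_singleton) simp
  moreover have "(\<lambda>f. f t) \<in> measurable path_space (count_space UNIV)"
    using assms by (intro measurable_component_singleton) simp
  ultimately have "(\<lambda>n. n c t) \<in> measurable clock_paths (count_space UNIV)" by (rule measurable_compose)
  then show ?thesis unfolding clock_space_def by (rule measurable_restrict_space1)
qed

lemma clock_familyI:
  assumes E: "E \<in> measurable \<Omega> config_space" and F: "F \<in> measurable \<Omega> clock_space"
  shows "clock_family \<Omega> E F"
proof
  show "(\<lambda>w. E w y) \<in> measurable \<Omega> (count_space UNIV)" for y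
    by (rule measurable_compose[OF E measurable_component_singleton]) simp
  show "(\<lambda>w. F w c t) \<in> measurable \<Omega> (count_space UNIV)" if "0 \<le> t" for c t
    by (rule measurable_compose[OF F measurable_clock_space_component[OF that]])
  show "\<forall>c. counting_path (F w c)" if "w \<in> space \<Omega>" for w
    using measurable_space[OF F that] by (simp add: space_clock_space)
qed

lemma stop_clocks_eq: "stop_clocks T n c = stop_path T (n c)"
  by (simp add: stop_clocks_def stop_path_def)

lemma shift_clocks_eq: "shift_clocks T v n c = shift_path T (n (translate v c))"
  by (simp add: shift_clocks_def shift_path_def)

lemma measurable_stop_clocks:
  assumes F: "F \<in> measurable \<Omega> clock_space" and T: "0 \<le> T"
  shows "(\<lambda>w. stop_clocks T (F w)) \<in> measurable \<Omega> clock_space"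
proof (rule measurable_clock_spaceI)
  show "counting_path (stop_clocks T (F w) c)" if "w \<in> space \<Omega>" for w c
    using measurable_space[OF F that] T by (intro counting_path_stop_clocks) (auto simp: space_clock_space)
  show "(\<lambda>w. stop_clocks T (F w) c t) \<in> measurable \<Omega> (count_space UNIV)" if "0 \<le> t" for c t
    using that T measurable_compose[OF F measurable_clock_space_component[of "min t T" c]]
    by (simp add: stop_clocks_def)
qed (simp add: stop_clocks_def)

lemma measurable_diff_nat:
  fixes f g :: "'w \<Rightarrow> nat"
  assumes f: "f \<in> measurable \<Omega> (count_space UNIV)" and g: "g \<in> measurable \<Omega> (count_space UNIV)"
  shows "(\<lambda>w. f w - g w) \<in> measurable \<Omega> (count_space UNIV)"
  by (rule measurable_compose_countable[where f="\<lambda>i w. i - g w" and g=f, OF measurable_compose[OF g] f]) simp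

lemma measurable_shift_clocks:
  assumes F: "F \<in> measurable \<Omega> clock_space" and T: "0 \<le> T" and V: "V \<in> measurable \<Omega> (count_space UNIV)"
  shows "(\<lambda>w. shift_clocks T (V w) (F w)) \<in> measurable \<Omega> clock_space"
proof (rule measurable_clock_spaceI)
  show "counting_path (shift_clocks T (V w) (F w) c)" if "w \<in> space \<Omega>" for w c
    using measurable_space[OF F that] T by (intro counting_path_shift_clocks) (auto simp: space_clock_space)
  show "(\<lambda>w. shift_clocks T (V w) (F w) c t) \<in> measurable \<Omega> (count_space UNIV)" if t: "0 \<le> t" for c t
  proof (rule measurable_compose_countable[OF _ V])
    fix v
    have "(\<lambda>w. F w (translate v c) (T + t) - F w (translate v c) T) \<in> measurable \<Omega> (count_space UNIV)"
      using T t by (intro measurable_diff_nat measurable_compose[OF F measurable_clock_space_component]) auto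
    then show "(\<lambda>w. shift_clocks T v (F w) c t) \<in> measurable \<Omega> (count_space UNIV)"
      using t by (simp add: shift_clocks_def)
  qed
qed (simp add: shift_clocks_def)

lemma measurable_stop_path: "0 \<le> T \<Longrightarrow> stop_path T \<in> measurable path_space path_space"
  unfolding stop_path_def by (intro measurable_restrict measurable_component_singleton) auto

lemma measurable_shift_path: "0 \<le> T \<Longrightarrow> shift_path T \<in> measurable path_space path_space"
  unfolding shift_path_def by (intro measurable_restrict measurable_diff_nat measurable_component_singleton) auto

lemma stop_path_restrict [simp]: "0 \<le> T \<Longrightarrow> stop_path T (restrict f {0..}) = stop_path T f"
  by (auto simp: stop_path_def fun_eq_iff)

lemma shift_path_restrict [simp]: "0 \<le> T \<Longrightarrow> shift_path T (restrict f {0..}) = shift_path T f"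
  by (auto simp: shift_path_def fun_eq_iff)

lemma in_prod_emb_iff:
  assumes "f \<in> space (PiM I N)" "J \<subseteq> I"
  shows "f \<in> prod_emb I N J (Pi\<^sub>E J A) \<longleftrightarrow> (\<forall>j\<in>J. f j \<in> A j)"
  using assms by (auto simp: prod_emb_def space_PiM)

context prob_space
begin

lemma indep_vars_cong_space:
  assumes "\<And>i \<omega>. i \<in> I \<Longrightarrow> \<omega> \<in> space M \<Longrightarrow> X i \<omega> = Y i \<omega>"
  shows "indep_vars S X I \<longleftrightarrow> indep_vars S Y I"
proof -
  have "X i -` A \<inter> space M = Y i -` A \<inter> space M" if "i \<in> I" for i A
    using assms[OF that] by (rule vimage_inter_cong)
  moreover have "X i \<in> measurable M (S i) \<longleftrightarrow> Y i \<in> measurable M (S i)" if "i \<in> I" for i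
    using assms[OF that] by (rule measurable_cong)
  ultimately show ?thesis unfolding indep_vars_def by (intro conj_cong ball_cong indep_sets_cong refl) auto
qed

lemma poisson_process_shift:
  assumes N: "poisson_process M r N" and T: "0 \<le> T"
  shows "poisson_process M r (\<lambda>\<omega>. shift_path T (N \<omega>))"
proof -
  note D = poisson_processD[OF N]
  have path: "counting_path (shift_path T (N \<omega>))" if "\<omega> \<in> space M" for \<omega>
    using counting_path_shift_clocks[of "\<lambda>_. N \<omega>" 0 Plus T] D(2)[OF that] T
    by (simp add: shift_clocks_eq)
  have diff: "shift_path T (N \<omega>) t - shift_path T (N \<omega>) s = N \<omega> (T + t) - N \<omega> (T + s)"
    if "\<omega> \<in> space M" "0 \<le> s" "0 \<le> t" for \<omega> s t
    using that counting_path_mono[OF D(2)[OF that(1)], of T "T + s"] counting_path_mono[OF D(2)[OF that(1)], of T "T + t"] T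
    by (simp add: shift_path_def)
  have "distr M (count_space UNIV) (\<lambda>\<omega>. shift_path T (N \<omega>) t - shift_path T (N \<omega>) s) = measure_pmf (poisson_law (r * (t - s)))"
    if "0 \<le> s" "s \<le> t" for s t
  proof -
    have "distr M (count_space UNIV) (\<lambda>\<omega>. shift_path T (N \<omega>) t - shift_path T (N \<omega>) s) =
      distr M (count_space UNIV) (\<lambda>\<omega>. N \<omega> (T + t) - N \<omega> (T + s))"
      using that by (intro distr_cong refl diff) auto
    then show ?thesis using D(3)[of "T + s" "T + t"] that T by simp
  qed
  moreover have "indep_vars (\<lambda>_. count_space UNIV) (\<lambda>i \<omega>. shift_path T (N \<omega>) (t (Suc i)) - shift_path T (N \<omega>) (t i)) UNIV"
    if t: "0 \<le> t 0" "mono t" for t :: "nat \<Rightarrow> real"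
  proof -
    have "0 \<le> t i" for i using t monoD[OF t(2), of 0 i] by simp
    then have "indep_vars (\<lambda>_. count_space UNIV) (\<lambda>i \<omega>. shift_path T (N \<omega>) (t (Suc i)) - shift_path T (N \<omega>) (t i)) UNIV \<longleftrightarrow>
      indep_vars (\<lambda>_. count_space UNIV) (\<lambda>i \<omega>. N \<omega> (T + t (Suc i)) - N \<omega> (T + t i)) UNIV"
      by (intro indep_vars_cong_space diff) auto
    also have "\<dots>" using D(4)[of "\<lambda>i. T + t i"] t T by (simp add: mono_def)
    finally show ?thesis .
  qed
  moreover have "(\<lambda>\<omega>. shift_path T (N \<omega>) t) \<in> measurable M (count_space UNIV)" if "0 \<le> t" for t
    using that T measurable_increment[OF N, of T "T + t"] by (simp add: shift_path_def)
  ultimately show ?thesis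
    unfolding poisson_process_def using path unfolding counting_path_def by blast
qed

text \<open>The variables take values in the given subsets, so a trace of a set has the same
  preimage as the set; this holds without measurability of the subsets.\<close>

lemma indep_var_restrict_space:
  assumes ind: "indep_var A X B Y" and X: "X \<in> space M \<rightarrow> S" and Y: "Y \<in> space M \<rightarrow> T"
  shows "indep_var (restrict_space A S) X (restrict_space B T) Y"
proof -
  have rv: "X \<in> measurable M A" "Y \<in> measurable M B" using indep_var_rv1[OF ind] indep_var_rv2[OF ind] by auto
  have eq: "{Z -` C \<inter> space M | C. C \<in> sets (restrict_space R U)} = {Z -` C \<inter> space M | C. C \<in> sets R}"
    if "Z \<in> space M \<rightarrow> U" for Z R U
  proof -
    have "Z -` (U \<inter> C) \<inter> space M = Z -` C \<inter> space M" for C using that by auto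
    then have "{Z -` (U \<inter> C) \<inter> space M | C. C \<in> sets R} = {Z -` C \<inter> space M | C. C \<in> sets R}" by simp
    moreover have "{Z -` C \<inter> space M | C. C \<in> (\<inter>) U ` sets R} = {Z -` (U \<inter> C) \<inter> space M | C. C \<in> sets R}" by blast
    ultimately show ?thesis by (simp add: sets_restrict_space)
  qed
  show ?thesis
    using ind rv X Y unfolding indep_var_eq eq[OF X] eq[OF Y] by (auto intro!: measurable_restrict_space2)
qed

lemma distr_restrict_space_eq:
  assumes eq: "distr M A X = distr M A Y" and X: "X \<in> measurable M A" "X \<in> space M \<rightarrow> S"
    and Y: "Y \<in> measurable M A" "Y \<in> space M \<rightarrow> S"
  shows "distr M (restrict_space A S) X = distr M (restrict_space A S) Y"
proof (rule measure_eqI)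
  fix C assume "C \<in> sets (distr M (restrict_space A S) X)"
  then have C': "C \<in> sets (restrict_space A S)" by simp
  then obtain C0 where C: "C = S \<inter> C0" "C0 \<in> sets A" by (auto simp: sets_restrict_space)
  have *: "emeasure (distr M (restrict_space A S) Z) C = emeasure (distr M A Z) C0"
    if Z: "Z \<in> measurable M A" "Z \<in> space M \<rightarrow> S" for Z
  proof -
    have "Z -` C \<inter> space M = Z -` C0 \<inter> space M" using Z(2) by (auto simp: C)
    then show ?thesis
      using Z C C' by (simp add: emeasure_distr measurable_restrict_space2)
  qed
  show "emeasure (distr M (restrict_space A S) X) C = emeasure (distr M (restrict_space A S) Y) C"
    using *[OF X] *[OF Y] eq by simp
qed simp

end

context graphical_construction
begin

text \<open>As \<open>jump_times\<close> ignores negative times, the walk and all paths are the same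
  for these clocks as for \<open>N\<close>.\<close>

definition clocks :: "'a \<Rightarrow> clock \<Rightarrow> real \<Rightarrow> nat" where
  "clocks \<omega> = (\<lambda>c. restrict (N c \<omega>) {0..})"

lemma counting_path_restrict: "counting_path f \<Longrightarrow> counting_path (restrict f {0..})"
proof -
  assume f: "counting_path f"
  have "((restrict f {0..}) \<longlongrightarrow> restrict f {0..} t) (at_right t)" if "0 \<le> t" for t
  proof -
    have "(f \<longlongrightarrow> f t) (at_right t)" using f that by (simp add: counting_path_def)
    moreover have "eventually (\<lambda>s. f s = restrict f {0..} s) (at_right t)"
      by (rule eventually_mono[OF eventually_at_right_less[of t]]) (use that in auto)
    ultimately have "(restrict f {0..} \<longlongrightarrow> f t) (at_right t)" by (rule Lim_transform_eventually)
    then show ?thesis using that by simp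
  qed
  then show ?thesis using f by (auto simp: counting_path_def mono_on_def)
qed

lemma measurable_clocks: "clocks \<in> measurable M clock_space"
  using poisson_processD(1,2)[OF clocks_poisson]
  by (intro measurable_clock_spaceI) (auto simp: clocks_def counting_path_restrict)

lemma clocks_path: "\<omega> \<in> space M \<Longrightarrow> counting_path (clocks \<omega> c)"
  using measurable_space[OF measurable_clocks] by (simp add: space_clock_space)

lemma measurable_into_clock_paths:
  "F \<in> measurable \<Omega> clock_space \<Longrightarrow> F \<in> measurable \<Omega> clock_paths"
  unfolding clock_space_def by (simp add: measurable_restrict_space2_iff)

lemma measurable_clocks_component: "(\<lambda>\<omega>. clocks \<omega> c) \<in> measurable M path_space"
  by (rule measurable_compose[OF measurable_into_clock_paths[OF measurable_clocks] measurable_component_singleton]) simp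

lemma indep_clocks: "indep_vars (\<lambda>_. path_space) (\<lambda>c \<omega>. clocks \<omega> c) UNIV"
  using clocks_indep by (simp add: clocks_def)

text \<open>On cylinder sets the probability factorises twice: over the clocks, which are
  independent, and within each clock into past and future.\<close>

lemma clocks_past_future_paths:
  assumes T: "0 \<le> T"
  shows "indep_var clock_paths (\<lambda>\<omega>. stop_clocks T (clocks \<omega>)) clock_paths (\<lambda>\<omega>. shift_clocks T 0 (clocks \<omega>))"
proof (rule indep_varI_generator[OF _ _ PiM_generator PiM_generator])
  let ?X = "\<lambda>\<omega>. stop_clocks T (clocks \<omega>)" and ?Y = "\<lambda>\<omega>. shift_clocks T 0 (clocks \<omega>)"
  show X: "?X \<in> measurable M clock_paths" and Y: "?Y \<in> measurable M clock_paths"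
    using T by (auto intro!: measurable_into_clock_paths measurable_stop_clocks measurable_shift_clocks measurable_clocks)
  fix A B assume "A \<in> prod_algebra UNIV (\<lambda>_::clock. path_space :: (real \<Rightarrow> nat) measure)"
    "B \<in> prod_algebra UNIV (\<lambda>_::clock. path_space :: (real \<Rightarrow> nat) measure)"
  then obtain J K and E D :: "clock \<Rightarrow> (real \<Rightarrow> nat) set" where A: "A = prod_emb UNIV (\<lambda>_. path_space) J (Pi\<^sub>E J E)" "finite J" "J \<noteq> {}" "\<And>c. c \<in> J \<Longrightarrow> E c \<in> sets path_space"
    and B: "B = prod_emb UNIV (\<lambda>_. path_space) K (Pi\<^sub>E K D)" "finite K" "\<And>c. c \<in> K \<Longrightarrow> D c \<in> sets path_space"
    by (elim prod_algebraE) auto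
  \<comment> \<open>Both cylinders are written over the same finite set of clocks, with the whole
    space as condition where one of them has none, so that the products can be compared factor by
    factor.\<close>
  define U where "U = J \<union> K"
  define E' where "E' = (\<lambda>c. if c \<in> J then E c else space path_space)"
  define D' where "D' = (\<lambda>c. if c \<in> K then D c else space path_space)"
  have U: "finite U" "U \<noteq> {}" using A B by (auto simp: U_def)
  have E': "E' c \<in> sets path_space" and D': "D' c \<in> sets path_space" for c
    using A B by (auto simp: E'_def D'_def)
  have tr: "translate 0 c = c" for c by (cases c) auto
  have sp: "stop_path T (clocks \<omega> c) \<in> space path_space" "shift_path T (clocks \<omega> c) \<in> space path_space"
    if "\<omega> \<in> space M" for \<omega> c
    using measurable_space[OF measurable_stop_path[OF T]] measurable_space[OF measurable_shift_path[OF T]]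
      measurable_space[OF measurable_clocks_component that] by blast+
  define Ap where "Ap = (\<lambda>c. stop_path T -` E' c \<inter> space path_space)"
  define Bp where "Bp = (\<lambda>c. shift_path T -` D' c \<inter> space path_space)"
  have Ap: "Ap c \<in> sets path_space" and Bp: "Bp c \<in> sets path_space" for c
    unfolding Ap_def Bp_def using measurable_sets[OF measurable_stop_path[OF T] E'] measurable_sets[OF measurable_shift_path[OF T] D'] by auto
  have cp: "clocks \<omega> c \<in> space path_space" if "\<omega> \<in> space M" for \<omega> c
    by (rule measurable_space[OF measurable_clocks_component that])
  have 1: "?X -` A \<inter> space M = (\<Inter>c\<in>U. (\<lambda>\<omega>. clocks \<omega> c) -` Ap c \<inter> space M)"
  proof (rule set_eqI)
    fix \<omega>
    have "?X \<omega> \<in> A \<longleftrightarrow> (\<forall>c\<in>U. clocks \<omega> c \<in> Ap c)" if w: "\<omega> \<in> space M"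
      unfolding A(1) in_prod_emb_iff[OF measurable_space[OF X w] subset_UNIV] stop_clocks_eq Ap_def
      using sp(1)[OF w] cp[OF w] by (auto simp: U_def E'_def)
    then show "\<omega> \<in> ?X -` A \<inter> space M \<longleftrightarrow> \<omega> \<in> (\<Inter>c\<in>U. (\<lambda>\<omega>. clocks \<omega> c) -` Ap c \<inter> space M)"
      using U(2) by auto
  qed
  have 2: "?Y -` B \<inter> space M = (\<Inter>c\<in>U. (\<lambda>\<omega>. clocks \<omega> c) -` Bp c \<inter> space M)"
  proof (rule set_eqI)
    fix \<omega>
    have "?Y \<omega> \<in> B \<longleftrightarrow> (\<forall>c\<in>U. clocks \<omega> c \<in> Bp c)" if w: "\<omega> \<in> space M"
      unfolding B(1) in_prod_emb_iff[OF measurable_space[OF Y w] subset_UNIV] shift_clocks_eq tr Bp_def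
      using sp(2)[OF w] cp[OF w] by (auto simp: U_def D'_def)
    then show "\<omega> \<in> ?Y -` B \<inter> space M \<longleftrightarrow> \<omega> \<in> (\<Inter>c\<in>U. (\<lambda>\<omega>. clocks \<omega> c) -` Bp c \<inter> space M)"
      using U(2) by auto
  qed
  have one: "prob ((\<lambda>\<omega>. clocks \<omega> c) -` (Ap c \<inter> Bp c) \<inter> space M) =
     prob ((\<lambda>\<omega>. clocks \<omega> c) -` Ap c \<inter> space M) * prob ((\<lambda>\<omega>. clocks \<omega> c) -` Bp c \<inter> space M)" for c
  proof -
    have eqA: "(\<lambda>\<omega>. clocks \<omega> c) -` Ap c \<inter> space M = (\<lambda>\<omega>. stop_path T (N c \<omega>)) -` E' c \<inter> space M"
      and eqB: "(\<lambda>\<omega>. clocks \<omega> c) -` Bp c \<inter> space M = (\<lambda>\<omega>. shift_path T (N c \<omega>)) -` D' c \<inter> space M"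
      using cp T by (auto simp: Ap_def Bp_def clocks_def)
    have "(\<lambda>\<omega>. clocks \<omega> c) -` (Ap c \<inter> Bp c) \<inter> space M =
      ((\<lambda>\<omega>. clocks \<omega> c) -` Ap c \<inter> space M) \<inter> ((\<lambda>\<omega>. clocks \<omega> c) -` Bp c \<inter> space M)" by auto
    also have "\<dots> = (\<lambda>x. (stop_path T (N c x), shift_path T (N c x))) -` (E' c \<times> D' c) \<inter> space M"
      unfolding eqA eqB by auto
    finally have "(\<lambda>\<omega>. clocks \<omega> c) -` (Ap c \<inter> Bp c) \<inter> space M =
      (\<lambda>x. (stop_path T (N c x), shift_path T (N c x))) -` (E' c \<times> D' c) \<inter> space M" .
    then show ?thesis
      unfolding eqA eqB using indep_varD[OF poisson_process_past_future[OF clocks_poisson T] E' D'] by simp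
  qed
  have "(?X -` A \<inter> space M) \<inter> (?Y -` B \<inter> space M) = (\<Inter>c\<in>U. (\<lambda>\<omega>. clocks \<omega> c) -` (Ap c \<inter> Bp c) \<inter> space M)"
    unfolding 1 2 by auto
  also have "prob \<dots> = (\<Prod>c\<in>U. prob ((\<lambda>\<omega>. clocks \<omega> c) -` (Ap c \<inter> Bp c) \<inter> space M))"
    using U Ap Bp by (intro indep_varsD[OF indep_clocks]) auto
  also have "\<dots> = (\<Prod>c\<in>U. prob ((\<lambda>\<omega>. clocks \<omega> c) -` Ap c \<inter> space M)) * (\<Prod>c\<in>U. prob ((\<lambda>\<omega>. clocks \<omega> c) -` Bp c \<inter> space M))"
    by (simp only: one prod.distrib)
  also have "(\<Prod>c\<in>U. prob ((\<lambda>\<omega>. clocks \<omega> c) -` Ap c \<inter> space M)) = prob (?X -` A \<inter> space M)"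
    unfolding 1 using U Ap by (intro indep_varsD[OF indep_clocks, symmetric]) auto
  also have "(\<Prod>c\<in>U. prob ((\<lambda>\<omega>. clocks \<omega> c) -` Bp c \<inter> space M)) = prob (?Y -` B \<inter> space M)"
    unfolding 2 using U Bp by (intro indep_varsD[OF indep_clocks, symmetric]) auto
  finally show "prob ((?X -` A \<inter> space M) \<inter> (?Y -` B \<inter> space M)) = prob (?X -` A \<inter> space M) * prob (?Y -` B \<inter> space M)" .
qed

lemma clocks_past_future:
  assumes T: "0 \<le> T"
  shows "indep_var clock_space (\<lambda>\<omega>. stop_clocks T (clocks \<omega>)) clock_space (\<lambda>\<omega>. shift_clocks T 0 (clocks \<omega>))"
  unfolding clock_space_def
  using T clocks_path
  by (intro indep_var_restrict_space clocks_past_future_paths)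
    (auto intro!: counting_path_stop_clocks counting_path_shift_clocks)

definition clock_law :: "(clock \<Rightarrow> real \<Rightarrow> nat) measure" where
  "clock_law = distr M clock_space clocks"

text \<open>In time, each shifted clock is again a Poisson process of the same rate, hence has the
  same law. In space, the translation permutes clocks injectively among clocks of equal rate, and
  reindexing a product measure along an injective map gives a product measure.\<close>

lemma shift_clocks_law:
  assumes T: "0 \<le> T"
  shows "distr M clock_space (\<lambda>\<omega>. shift_clocks T v (clocks \<omega>)) = clock_law"
  unfolding clock_law_def clock_space_def
proof (rule distr_restrict_space_eq)
  define law where "law = (\<lambda>c. distr M path_space (\<lambda>\<omega>. clocks \<omega> c))"
  have ps: "prob_space (law c)" for c unfolding law_def by (intro prob_space_distr measurable_clocks_component)
  have sets_law: "sets (law c) = sets path_space" for c by (simp add: law_def)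
  have lawN: "law c = distr M path_space (\<lambda>\<omega>. restrict (N c \<omega>) {0..})" for c by (simp add: law_def clocks_def)
  have rate: "clock_rate \<alpha> \<beta> (translate v c) = clock_rate \<alpha> \<beta> c" for c by (cases c) auto
  have law_tr: "law (translate v c) = law c" for c
    unfolding lawN using clocks_poisson[of "translate v c"] clocks_poisson[of c]
    unfolding rate by (rule poisson_process_law_unique)
  have law_shift: "distr M path_space (\<lambda>\<omega>. shift_path T (clocks \<omega> c)) = law c" for c
  proof -
    have "restrict (shift_path T f) {0..} = shift_path T f" for f by (simp add: shift_path_def)
    then have "distr M path_space (\<lambda>\<omega>. shift_path T (clocks \<omega> c)) = distr M path_space (\<lambda>\<omega>. restrict (shift_path T (N c \<omega>)) {0..})"
      using T by (simp add: clocks_def)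
    also have "\<dots> = law c"
      unfolding lawN by (intro poisson_process_law_unique[OF poisson_process_shift[OF clocks_poisson T] clocks_poisson])
    finally show ?thesis .
  qed
  have joint: "distr M clock_paths (\<lambda>\<omega> c. Z c \<omega>) = PiM UNIV law"
    if ind: "indep_vars (\<lambda>_. path_space) Z UNIV" and "\<And>c. distr M path_space (Z c) = law c" for Z
  proof -
    have "random_variable path_space (Z c)" for c using ind by (simp add: indep_vars_def)
    then have "distr M clock_paths (\<lambda>\<omega>. \<lambda>c\<in>UNIV. Z c \<omega>) = PiM UNIV (\<lambda>c. distr M path_space (Z c))"
      using ind by (subst indep_vars_iff_distr_eq_PiM'[symmetric]) auto
    then show ?thesis using that(2) by (simp add: restrict_UNIV)
  qed
  have 1: "distr M clock_paths clocks = PiM UNIV law"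
    using joint[OF indep_clocks] by (simp add: law_def)
  have 2: "distr M clock_paths (\<lambda>\<omega> c. shift_path T (clocks \<omega> c)) = PiM UNIV law"
    by (rule joint[OF indep_vars_compose2[OF indep_clocks] law_shift]) (rule measurable_shift_path[OF T])
  have mS: "(\<lambda>\<omega> c. shift_path T (clocks \<omega> c)) \<in> measurable M clock_paths"
  proof (rule measurable_PiM_single')
    show "(\<lambda>\<omega>. shift_path T (clocks \<omega> c)) \<in> measurable M path_space" for c
      by (rule measurable_compose[OF measurable_clocks_component measurable_shift_path[OF T]])
  qed (use measurable_space[OF measurable_shift_path[OF T]] measurable_space[OF measurable_clocks_component] in \<open>auto simp: PiE_iff\<close>)
  have mr: "(\<lambda>n c. n (translate v c)) \<in> measurable clock_paths clock_paths"
  proof (rule measurable_PiM_single')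
    show "(\<lambda>n. n (translate v c)) \<in> measurable clock_paths path_space" for c
      by (rule measurable_component_singleton) simp
  qed (auto simp: space_PiM PiE_iff)
  have sp: "sets (PiM UNIV law) = sets clock_paths" by (intro sets_PiM_cong refl sets_law)
  have "distr M clock_paths (\<lambda>\<omega>. shift_clocks T v (clocks \<omega>)) = distr (distr M clock_paths (\<lambda>\<omega> c. shift_path T (clocks \<omega> c))) clock_paths (\<lambda>n c. n (translate v c))"
    by (subst distr_distr[OF mr mS]) (simp add: comp_def shift_clocks_eq[abs_def])
  also have "\<dots> = distr (PiM UNIV law) (PiM UNIV (\<lambda>c. law (translate v c))) (\<lambda>n. \<lambda>c\<in>UNIV. n (translate v c))"
    unfolding 2 by (intro distr_cong) (auto simp: restrict_UNIV intro!: sets_PiM_cong sets_law[symmetric])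
  also have "\<dots> = PiM UNIV (\<lambda>c. law (translate v c))"
    using ps inj_translate by (intro distr_PiM_reindex) auto
  also have "\<dots> = PiM UNIV law" by (simp add: law_tr)
  finally show "distr M clock_paths (\<lambda>\<omega>. shift_clocks T v (clocks \<omega>)) = distr M clock_paths clocks"
    using 1 by simp
  show "(\<lambda>\<omega>. shift_clocks T v (clocks \<omega>)) \<in> measurable M clock_paths" "clocks \<in> measurable M clock_paths"
    using T by (auto intro!: measurable_into_clock_paths measurable_shift_clocks measurable_clocks)
qed (use T clocks_path in \<open>auto intro!: counting_path_shift_clocks\<close>)

lemma prob_config_clocks:
  assumes a: "a \<in> sets config_space" and b: "b \<in> sets clock_space"
  shows "prob ((\<eta> -` a \<inter> space M) \<inter> (clocks -` b \<inter> space M)) = prob (\<eta> -` a \<inter> space M) * prob (clocks -` b \<inter> space M)"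
proof -
  obtain b0 where b0: "b = {n. \<forall>c. counting_path (n c)} \<inter> b0" "b0 \<in> sets clock_paths"
    using b by (auto simp: clock_space_def sets_restrict_space)
  have eq: "clocks -` b \<inter> space M = clocks -` b0 \<inter> space M" using clocks_path by (auto simp: b0(1))
  have c: "clocks = (\<lambda>\<omega> c. restrict (N c \<omega>) {0..})" by (simp add: clocks_def fun_eq_iff)
  have m: "clocks \<in> space M \<rightarrow> space clock_paths"
    using measurable_space[OF measurable_into_clock_paths[OF measurable_clocks]] by auto
  have "\<eta> -` a \<inter> space M \<in> sets (vimage_algebra (space M) \<eta> config_space)"
    using a by (rule in_vimage_algebra)
  moreover have "clocks -` b0 \<inter> space M \<in> sets (vimage_algebra (space M) (\<lambda>\<omega> c. restrict (N c \<omega>) {0..}) clock_paths)"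
    unfolding c using b0(2) by (rule in_vimage_algebra)
  ultimately show ?thesis
    unfolding eq by (rule indep_setD[OF initial_indep_clocks])
qed

definition config_law :: "(int \<Rightarrow> bool) measure" where
  "config_law = distr M config_space \<eta>"

definition stopped_law :: "real \<Rightarrow> (clock \<Rightarrow> real \<Rightarrow> nat) measure" where
  "stopped_law T = distr M clock_space (\<lambda>\<omega>. stop_clocks T (clocks \<omega>))"

lemma config_law_eq: "config_law = PiM UNIV (\<lambda>_. measure_pmf (bernoulli_pmf \<rho>))"
  unfolding config_law_def by (rule initial_law)

lemma sets_laws [simp]: "sets config_law = sets config_space" "sets clock_law = sets clock_space"
    "sets (stopped_law T) = sets clock_space"
  by (simp_all add: config_law_def clock_law_def stopped_law_def)

lemma measurable_laws [measurable_cong]: "sets config_law = sets config_space" "sets clock_law = sets clock_space"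
    "sets (stopped_law T) = sets clock_space"
  by (simp_all add: config_law_def clock_law_def stopped_law_def)

lemma prob_space_laws: "prob_space config_law" "prob_space clock_law" "0 \<le> T \<Longrightarrow> prob_space (stopped_law T)"
  unfolding config_law_def clock_law_def stopped_law_def
  by (auto intro!: prob_space_distr initial_measurable measurable_clocks measurable_stop_clocks)

lemma past_future_law:
  assumes T: "0 \<le> T"
  shows "distr M (config_space \<Otimes>\<^sub>M (clock_space \<Otimes>\<^sub>M clock_space))
      (\<lambda>\<omega>. (\<eta> \<omega>, (stop_clocks T (clocks \<omega>), shift_clocks T 0 (clocks \<omega>))))
    = config_law \<Otimes>\<^sub>M (stopped_law T \<Otimes>\<^sub>M clock_law)"
proof -
  let ?g = "\<lambda>n. (stop_clocks T n, shift_clocks T 0 n)"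
  have g: "?g \<in> measurable clock_space (clock_space \<Otimes>\<^sub>M clock_space)"
    using T by (auto intro!: measurable_Pair measurable_stop_clocks measurable_shift_clocks)
  have mg: "(\<lambda>\<omega>. ?g (clocks \<omega>)) \<in> measurable M (clock_space \<Otimes>\<^sub>M clock_space)"
    by (rule measurable_compose[OF measurable_clocks g])
  have mt: "(\<lambda>\<omega>. (\<eta> \<omega>, ?g (clocks \<omega>))) \<in> measurable M (config_space \<Otimes>\<^sub>M (clock_space \<Otimes>\<^sub>M clock_space))"
    by (intro measurable_Pair initial_measurable mg[unfolded split_def])
  have 1: "stopped_law T \<Otimes>\<^sub>M clock_law = distr M (clock_space \<Otimes>\<^sub>M clock_space) (\<lambda>\<omega>. ?g (clocks \<omega>))"
    using clocks_past_future[OF T] shift_clocks_law[OF T, of 0]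
    unfolding indep_var_distribution_eq stopped_law_def by simp
  interpret c: prob_space config_law by (rule prob_space_laws(1))
  interpret p: prob_space "stopped_law T \<Otimes>\<^sub>M clock_law" unfolding 1 by (intro prob_space_distr mg)
  show ?thesis
  proof (rule pair_measure_eqI[symmetric])
    show "sigma_finite_measure config_law" "sigma_finite_measure (stopped_law T \<Otimes>\<^sub>M clock_law)" by unfold_locales
    show "sets (config_law \<Otimes>\<^sub>M (stopped_law T \<Otimes>\<^sub>M clock_law)) =
      sets (distr M (config_space \<Otimes>\<^sub>M (clock_space \<Otimes>\<^sub>M clock_space)) (\<lambda>\<omega>. (\<eta> \<omega>, ?g (clocks \<omega>))))"
      by (simp cong: sets_pair_measure_cong)
    fix A B assume "A \<in> sets config_law" "B \<in> sets (stopped_law T \<Otimes>\<^sub>M clock_law)"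
    then have A: "A \<in> sets config_space" and B: "B \<in> sets (clock_space \<Otimes>\<^sub>M clock_space)"
      by (simp_all cong: sets_pair_measure_cong)
    define b where "b = ?g -` B \<inter> space clock_space"
    have b: "b \<in> sets clock_space" unfolding b_def by (rule measurable_sets[OF g B])
    have eq: "(\<lambda>\<omega>. ?g (clocks \<omega>)) -` B \<inter> space M = clocks -` b \<inter> space M"
      using measurable_space[OF measurable_clocks] by (auto simp: b_def)
    have "(\<lambda>\<omega>. (\<eta> \<omega>, ?g (clocks \<omega>))) -` (A \<times> B) \<inter> space M = (\<eta> -` A \<inter> space M) \<inter> (clocks -` b \<inter> space M)"
      unfolding eq[symmetric] by auto
    then have "emeasure (distr M (config_space \<Otimes>\<^sub>M (clock_space \<Otimes>\<^sub>M clock_space)) (\<lambda>\<omega>. (\<eta> \<omega>, ?g (clocks \<omega>)))) (A \<times> B)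
      = emeasure M ((\<eta> -` A \<inter> space M) \<inter> (clocks -` b \<inter> space M))"
      using mt A B by (subst emeasure_distr) auto
    also have "\<dots> = emeasure M (\<eta> -` A \<inter> space M) * emeasure M (clocks -` b \<inter> space M)"
      using prob_config_clocks[OF A b] by (simp add: emeasure_eq_measure ennreal_mult)
    also have "\<dots> = emeasure config_law A * emeasure (stopped_law T \<Otimes>\<^sub>M clock_law) B"
      unfolding 1 config_law_def using A B mg initial_measurable by (simp add: emeasure_distr eq)
    finally show "emeasure config_law A * emeasure (stopped_law T \<Otimes>\<^sub>M clock_law) B =
      emeasure (distr M (config_space \<Otimes>\<^sub>M (clock_space \<Otimes>\<^sub>M clock_space)) (\<lambda>\<omega>. (\<eta> \<omega>, ?g (clocks \<omega>)))) (A \<times> B)" ..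
  qed
qed

text \<open>The substitute for conditional expectations: conditioning on the past is integrating
  over the future clocks first.\<close>

lemma nn_integral_past_future:
  assumes T: "0 \<le> T" and h: "h \<in> borel_measurable (config_space \<Otimes>\<^sub>M (clock_space \<Otimes>\<^sub>M clock_space))"
  shows "(\<integral>\<^sup>+\<omega>. h (\<eta> \<omega>, (stop_clocks T (clocks \<omega>), shift_clocks T 0 (clocks \<omega>))) \<partial>M)
    = (\<integral>\<^sup>+e. \<integral>\<^sup>+p. \<integral>\<^sup>+f. h (e, (p, f)) \<partial>clock_law \<partial>stopped_law T \<partial>config_law)"
proof -
  interpret c: prob_space config_law by (rule prob_space_laws(1))
  interpret s: prob_space "stopped_law T" by (rule prob_space_laws(3)[OF T])
  interpret k: prob_space clock_law by (rule prob_space_laws(2))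
  interpret sk: pair_prob_space "stopped_law T" clock_law ..
  interpret csk: pair_prob_space config_law "stopped_law T \<Otimes>\<^sub>M clock_law" ..
  have h': "h \<in> borel_measurable (config_law \<Otimes>\<^sub>M (stopped_law T \<Otimes>\<^sub>M clock_law))"
    using h by (simp cong: measurable_cong_sets sets_pair_measure_cong)
  have mt: "(\<lambda>\<omega>. (\<eta> \<omega>, (stop_clocks T (clocks \<omega>), shift_clocks T 0 (clocks \<omega>)))) \<in> measurable M (config_space \<Otimes>\<^sub>M (clock_space \<Otimes>\<^sub>M clock_space))"
    using T by (intro measurable_Pair initial_measurable measurable_stop_clocks measurable_shift_clocks measurable_clocks) auto
  have "(\<integral>\<^sup>+\<omega>. h (\<eta> \<omega>, (stop_clocks T (clocks \<omega>), shift_clocks T 0 (clocks \<omega>))) \<partial>M) =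
    (\<integral>\<^sup>+x. h x \<partial>(config_law \<Otimes>\<^sub>M (stopped_law T \<Otimes>\<^sub>M clock_law)))"
    unfolding past_future_law[OF T, symmetric] by (subst nn_integral_distr[OF mt]) (use h in auto)
  also have "\<dots> = (\<integral>\<^sup>+e. \<integral>\<^sup>+pf. h (e, pf) \<partial>(stopped_law T \<Otimes>\<^sub>M clock_law) \<partial>config_law)"
    by (rule sk.P.nn_integral_fst[OF h', symmetric])
  also have "\<dots> = (\<integral>\<^sup>+e. \<integral>\<^sup>+p. \<integral>\<^sup>+f. h (e, (p, f)) \<partial>clock_law \<partial>stopped_law T \<partial>config_law)"
    by (intro nn_integral_cong k.nn_integral_fst[symmetric] measurable_compose[OF measurable_Pair1' h']) simp
  finally show ?thesis .
qed

end

section \<open>Almost sure regularity of the clocks\<close>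

text \<open>A condition on countably many coordinates, hence measurable, that implies
  \<open>good\<close>: two clocks never ring in the same cell of a fine enough lattice, and quiet
  edges are required at integer times only.\<close>

definition regular_clocks :: "(clock \<Rightarrow> real \<Rightarrow> nat) \<Rightarrow> bool" where
  "regular_clocks n \<longleftrightarrow>
    (\<forall>c d. c \<noteq> d \<longrightarrow> (\<forall>k::nat. \<exists>m::nat. \<forall>i<k * Suc m.
      \<not> (n c (i / Suc m) < n c (Suc i / Suc m) \<and> n d (i / Suc m) < n d (Suc i / Suc m)))) \<and>
    (\<forall>(k::nat) j. (\<exists>b\<ge>j. n (Arrow b) k = 0) \<and> (\<exists>b\<le>j. n (Arrow b) k = 0))"

lemma good_if_regular:
  assumes n: "\<forall>c. counting_path (n c)" and reg: "regular_clocks n"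
  shows "good n"
  unfolding good_def
proof (intro conjI allI impI n[rule_format])
  fix c d :: clock assume cd: "c \<noteq> d"
  show "jump_times (n c) \<inter> jump_times (n d) = {}"
  proof (rule ccontr)
    assume "jump_times (n c) \<inter> jump_times (n d) \<noteq> {}"
    then obtain t where t: "t \<in> jump_times (n c)" "t \<in> jump_times (n d)" by auto
    have pos: "0 < t" using t by (simp add: jump_times_pos)
    obtain k :: nat where k: "t \<le> k" using real_arch_simple by blast
    obtain m :: nat where m: "\<And>i. i < k * Suc m \<Longrightarrow> \<not> (n c (i / Suc m) < n c (Suc i / Suc m) \<and> n d (i / Suc m) < n d (Suc i / Suc m))"
      using reg cd unfolding regular_clocks_def by metis
    \<comment> \<open>The cell of the lattice, open on the left and closed on the right, that
      contains \<open>t\<close>.\<close>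
    define i where "i = nat (\<lceil>t * Suc m\<rceil> - 1)"
    have c1: "1 \<le> \<lceil>t * Suc m\<rceil>" using pos by (simp add: one_le_ceiling del: of_nat_Suc)
    have i: "real i = of_int \<lceil>t * Suc m\<rceil> - 1" using c1 by (simp add: i_def)
    have lt: "real i < t * Suc m" and le: "t * Suc m \<le> real (Suc i)"
      unfolding of_nat_Suc i by linarith+
    have 1: "i / Suc m < t" using lt by (simp add: pos_divide_less_eq del: of_nat_Suc)
    have 2: "t \<le> Suc i / Suc m" using le by (simp add: pos_le_divide_eq del: of_nat_Suc)
    have "t * Suc m \<le> real (k * Suc m)" unfolding of_nat_mult using k by (intro mult_right_mono) auto
    then have "real i < real (k * Suc m)" using lt by linarith
    then have ik: "i < k * Suc m" by (simp only: of_nat_less_iff)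
    have "n c' (i / Suc m) < n c' (Suc i / Suc m)" if "t \<in> jump_times (n c')" for c'
    proof -
      have "n c' (i / Suc m) < n c' t" using that 1 by (intro jump_times_less) auto
      also have "\<dots> \<le> n c' (Suc i / Suc m)" using n 2 pos by (intro counting_path_mono) auto
      finally show ?thesis .
    qed
    then show False using m[OF ik] t by blast
  qed
next
  fix t :: real and k :: int
  obtain l :: nat where l: "t \<le> l" using real_arch_simple by blast
  have q: "quiet n t b" if "n (Arrow b) l = 0" for b
  proof -
    have "s \<notin> jump_times (n (Arrow b))" if "s \<le> t" for s
    proof
      assume s: "s \<in> jump_times (n (Arrow b))"
      have "n (Arrow b) s \<le> n (Arrow b) l"
        using n that l jump_times_pos[OF s] by (intro counting_path_mono) auto
      then show False using jump_times_less[OF s order_refl jump_times_pos[OF s]] \<open>n (Arrow b) l = 0\<close> by simp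
    qed
    then show ?thesis by (auto simp: quiet_def)
  qed
  show "\<exists>b\<ge>k. quiet n t b" "\<exists>b\<le>k. quiet n t b"
    using reg q unfolding regular_clocks_def by blast+
qed

text \<open>Stopping only removes events. The measurable predicate is carried over because the law
  of the stopped clocks needs regularity of its own.\<close>

lemma regular_clocks_stop:
  assumes n: "\<forall>c. counting_path (n c)" and reg: "regular_clocks n" and T: "0 \<le> T"
  shows "regular_clocks (stop_clocks T n)"
proof -
  have less: "n c (i / Suc m) < n c (Suc i / Suc m)"
    if "stop_clocks T n c (i / Suc m) < stop_clocks T n c (Suc i / Suc m)" for c i m
  proof -
    have "i / Suc m \<le> T"
    proof (rule ccontr)
      assume "\<not> i / Suc m \<le> T"
      moreover have "i / Suc m \<le> Suc i / Suc m" by (intro divide_right_mono) auto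
      ultimately have "min (i / Suc m) T = T" "min (Suc i / Suc m) T = T" by linarith+
      then show False using that by (simp add: stop_clocks_def)
    qed
    then have "n c (i / Suc m) < n c (min (Suc i / Suc m) T)"
      using that by (simp add: stop_clocks_def min_def)
    also have "\<dots> \<le> n c (Suc i / Suc m)" using n T by (intro counting_path_mono) auto
    finally show ?thesis .
  qed
  have zero: "stop_clocks T n c k = 0" if "n c k = 0" "0 \<le> k" for c k
  proof -
    have "n c (min k T) \<le> n c k" using n T that by (intro counting_path_mono) auto
    then show ?thesis using that by (simp add: stop_clocks_def)
  qed
  show ?thesis unfolding regular_clocks_def
  proof (intro conjI allI impI)
    fix c d :: clock and k :: nat assume "c \<noteq> d"
    then obtain m :: nat where m: "\<forall>i<k * Suc m. \<not> (n c (i / Suc m) < n c (Suc i / Suc m) \<and> n d (i / Suc m) < n d (Suc i / Suc m))"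
      using reg unfolding regular_clocks_def by metis
    then show "\<exists>m. \<forall>i<k * Suc m. \<not> (stop_clocks T n c (i / Suc m) < stop_clocks T n c (Suc i / Suc m) \<and> stop_clocks T n d (i / Suc m) < stop_clocks T n d (Suc i / Suc m))"
      using less by blast
  next
    fix k :: nat and j
    obtain b b' where "j \<le> b" "n (Arrow b) k = 0" "b' \<le> j" "n (Arrow b') k = 0"
      using reg unfolding regular_clocks_def by metis
    then show "\<exists>b\<ge>j. stop_clocks T n (Arrow b) k = 0" "\<exists>b\<le>j. stop_clocks T n (Arrow b) k = 0"
      using zero[of "Arrow b" k] zero[of "Arrow b'" k] by auto
  qed
qed

lemma pred_regular_clocks: "Measurable.pred clock_space regular_clocks"
proof -
  note [measurable] = measurable_clock_space_component
  have [measurable]: "Measurable.pred clock_space (\<lambda>n. n c (i / Suc m) < n c (Suc i / Suc m))" for c i m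
    by (intro pred_nat_less measurable_clock_space_component) auto
  have [measurable]: "Measurable.pred clock_space (\<lambda>n. n c (real k) = 0)" for c k
    by (rule measurable_compose[OF measurable_clock_space_component]) auto
  show ?thesis unfolding regular_clocks_def by measurable
qed

locale exclusion_walk = graphical_construction +
  assumes \<alpha>_pos: "\<And>j. 0 < \<alpha> j" and \<beta>_pos: "\<And>j. 0 < \<beta> j"
    and drift: "min (\<alpha> False) (\<alpha> True) - max (\<beta> False) (\<beta> True) > 1"
begin

lemma clock_rate_nonneg: "0 \<le> clock_rate \<alpha> \<beta> c"
  using \<alpha>_pos[of True] \<alpha>_pos[of False] \<beta>_pos[of True] \<beta>_pos[of False] by (cases c) (auto simp: min_def max_def)

lemma measurable_clocks_at: "0 \<le> t \<Longrightarrow> (\<lambda>\<omega>. clocks \<omega> c t) \<in> measurable M (count_space UNIV)"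
  by (rule measurable_compose[OF measurable_clocks measurable_clock_space_component])

lemma increment_law:
  assumes "0 \<le> s" "s \<le> t"
  shows "distr M (count_space UNIV) (\<lambda>\<omega>. clocks \<omega> c t - clocks \<omega> c s) = measure_pmf (poisson_law (clock_rate \<alpha> \<beta> c * (t - s)))"
  using poisson_processD(3)[OF clocks_poisson assms, of c] assms by (simp add: clocks_def)

lemma pmf_poisson_law:
  assumes "0 \<le> r"
  shows "pmf (poisson_law r) k = r ^ k / fact k * exp (- r)"
proof (cases "r = 0")
  case True
  then show ?thesis by (cases k) (auto simp: poisson_law_def)
qed (use assms in \<open>simp add: poisson_law_def\<close>)

lemma prob_no_event:
  assumes "0 \<le> s" "s \<le> t"
  shows "prob {\<omega> \<in> space M. clocks \<omega> c t = clocks \<omega> c s} = exp (- (clock_rate \<alpha> \<beta> c * (t - s)))"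
proof -
  have m: "(\<lambda>\<omega>. clocks \<omega> c t - clocks \<omega> c s) \<in> measurable M (count_space UNIV)"
    using assms by (intro measurable_diff_nat measurable_clocks_at) auto
  have "{\<omega> \<in> space M. clocks \<omega> c t = clocks \<omega> c s} = (\<lambda>\<omega>. clocks \<omega> c t - clocks \<omega> c s) -` {0} \<inter> space M"
    using counting_path_mono[OF clocks_path assms] by (auto intro: antisym)
  then have "prob {\<omega> \<in> space M. clocks \<omega> c t = clocks \<omega> c s} = measure (distr M (count_space UNIV) (\<lambda>\<omega>. clocks \<omega> c t - clocks \<omega> c s)) {0}"
    using m by (simp add: measure_distr)
  also have "\<dots> = pmf (poisson_law (clock_rate \<alpha> \<beta> c * (t - s))) 0"
    unfolding increment_law[OF assms] by (simp add: measure_pmf_single)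
  also have "\<dots> = exp (- (clock_rate \<alpha> \<beta> c * (t - s)))"
    using clock_rate_nonneg assms by (subst pmf_poisson_law) auto
  finally show ?thesis .
qed

lemma prob_event:
  assumes "0 \<le> s" "s \<le> t"
  shows "prob {\<omega> \<in> space M. clocks \<omega> c s < clocks \<omega> c t} = 1 - exp (- (clock_rate \<alpha> \<beta> c * (t - s)))"
proof -
  have [measurable]: "(\<lambda>\<omega>. clocks \<omega> c u) \<in> measurable M (count_space UNIV)" if "u \<in> {s, t}" for u
    using assms that by (intro measurable_clocks_at) auto
  have "(\<lambda>\<omega>. clocks \<omega> c t - clocks \<omega> c s) \<in> measurable M (count_space UNIV)"
    using assms by (intro measurable_diff_nat measurable_clocks_at) auto
  then have "(\<lambda>\<omega>. clocks \<omega> c t - clocks \<omega> c s) -` {0} \<inter> space M \<in> events" by (rule measurable_sets) simp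
  also have "(\<lambda>\<omega>. clocks \<omega> c t - clocks \<omega> c s) -` {0} \<inter> space M = {\<omega> \<in> space M. clocks \<omega> c t = clocks \<omega> c s}"
    using counting_path_mono[OF clocks_path assms] by (auto intro: antisym)
  finally have "prob (space M - {\<omega> \<in> space M. clocks \<omega> c t = clocks \<omega> c s}) = 1 - exp (- (clock_rate \<alpha> \<beta> c * (t - s)))"
    by (subst prob_compl) (simp_all add: prob_no_event[OF assms])
  also have "space M - {\<omega> \<in> space M. clocks \<omega> c t = clocks \<omega> c s} = {\<omega> \<in> space M. clocks \<omega> c s < clocks \<omega> c t}"
    using counting_path_mono[OF clocks_path assms] by (auto simp: order_less_le)
  finally show ?thesis .
qed

lemma prob_two_clocks:
  assumes "c \<noteq> d" and A: "A \<in> sets path_space" "B \<in> sets path_space"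
  shows "prob {\<omega> \<in> space M. clocks \<omega> c \<in> A \<and> clocks \<omega> d \<in> B} = prob {\<omega> \<in> space M. clocks \<omega> c \<in> A} * prob {\<omega> \<in> space M. clocks \<omega> d \<in> B}"
proof -
  have "prob (\<Inter>i\<in>{c, d}. (\<lambda>\<omega>. clocks \<omega> i) -` (if i = c then A else B) \<inter> space M) =
    (\<Prod>i\<in>{c, d}. prob ((\<lambda>\<omega>. clocks \<omega> i) -` (if i = c then A else B) \<inter> space M))"
    using A by (intro indep_varsD[OF indep_clocks]) auto
  then show ?thesis using \<open>c \<noteq> d\<close> by (simp add: vimage_def Int_def conj_ac cong: conj_cong)
qed

lemma event_set: "0 \<le> s \<Longrightarrow> 0 \<le> t \<Longrightarrow> {f \<in> space path_space. (f s :: nat) < f t} \<in> sets path_space"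
  using pred_nat_less[of "\<lambda>f. f s" path_space "\<lambda>f. f t"]
  by (auto simp: pred_def intro!: measurable_component_singleton)

text \<open>In one cell of length \<open>1 / Suc m\<close> both clocks ring with probability at most
  \<open>C / (Suc m)^2\<close>. There are \<open>k * Suc m\<close> cells, so the probability of a
  common cell tends to 0 as the lattice is refined.\<close>

lemma AE_no_simultaneous:
  assumes "c \<noteq> d"
  shows "AE \<omega> in M. \<exists>m::nat. \<forall>i<k * Suc m.
      \<not> (clocks \<omega> c (i / Suc m) < clocks \<omega> c (Suc i / Suc m) \<and> clocks \<omega> d (i / Suc m) < clocks \<omega> d (Suc i / Suc m))"
proof -
  define D where "D = (\<lambda>m i. {\<omega> \<in> space M. clocks \<omega> c (real i / real (Suc m)) < clocks \<omega> c (real (Suc i) / real (Suc m)) \<and> clocks \<omega> d (real i / real (Suc m)) < clocks \<omega> d (real (Suc i) / real (Suc m))})"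
  have Dm: "D m i \<in> events" for m i
  proof -
    have "Measurable.pred M (\<lambda>\<omega>. clocks \<omega> c (real i / real (Suc m)) < clocks \<omega> c (real (Suc i) / real (Suc m)))"
      "Measurable.pred M (\<lambda>\<omega>. clocks \<omega> d (real i / real (Suc m)) < clocks \<omega> d (real (Suc i) / real (Suc m)))"
      by (intro pred_nat_less measurable_clocks_at; simp)+
    then show ?thesis unfolding D_def by measurable
  qed
  define C where "C = clock_rate \<alpha> \<beta> c * clock_rate \<alpha> \<beta> d"
  have D: "prob (D m i) \<le> C / (real (Suc m))^2" for m i
  proof -
    have st: "0 \<le> real i / real (Suc m)" "real i / real (Suc m) \<le> real (Suc i) / real (Suc m)"
      by (simp, intro divide_right_mono) auto
    have diff: "real (Suc i) / real (Suc m) - real i / real (Suc m) = 1 / real (Suc m)"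
      by (simp add: diff_divide_distrib[symmetric])
    have one: "prob {\<omega> \<in> space M. clocks \<omega> c (real i / real (Suc m)) < clocks \<omega> c (real (Suc i) / real (Suc m))} \<le> clock_rate \<alpha> \<beta> c / Suc m" for c
      unfolding prob_event[OF st] diff using exp_ge_add_one_self[of "- (clock_rate \<alpha> \<beta> c * (1 / real (Suc m)))"] by simp
    have "D m i = {\<omega> \<in> space M. clocks \<omega> c \<in> {f \<in> space path_space. f (real i / real (Suc m)) < f (real (Suc i) / real (Suc m))} \<and>
       clocks \<omega> d \<in> {f \<in> space path_space. f (real i / real (Suc m)) < f (real (Suc i) / real (Suc m))}}"
      using measurable_space[OF measurable_clocks_component] by (auto simp: D_def)
    also have "prob \<dots> = prob {\<omega> \<in> space M. clocks \<omega> c \<in> {f \<in> space path_space. f (real i / real (Suc m)) < f (real (Suc i) / real (Suc m))}} *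
       prob {\<omega> \<in> space M. clocks \<omega> d \<in> {f \<in> space path_space. f (real i / real (Suc m)) < f (real (Suc i) / real (Suc m))}}"
      by (intro prob_two_clocks assms event_set) auto
    also have "\<dots> = prob {\<omega> \<in> space M. clocks \<omega> c (real i / real (Suc m)) < clocks \<omega> c (real (Suc i) / real (Suc m))} *
       prob {\<omega> \<in> space M. clocks \<omega> d (real i / real (Suc m)) < clocks \<omega> d (real (Suc i) / real (Suc m))}"
      using measurable_space[OF measurable_clocks_component] by (intro arg_cong2[where f="(*)"] arg_cong[where f=prob]) auto
    also have "\<dots> \<le> (clock_rate \<alpha> \<beta> c / Suc m) * (clock_rate \<alpha> \<beta> d / Suc m)"
      by (intro mult_mono one) (use clock_rate_nonneg in auto)
    finally show ?thesis by (simp add: C_def power2_eq_square del: of_nat_Suc)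
  qed
  define B where "B = (\<lambda>m. \<Union>i<k * Suc m. D m i)"
  have Bm: "B m \<in> events" for m using Dm by (auto simp: B_def)
  have B: "prob (B m) \<le> k * C / Suc m" for m
  proof -
    have "prob (B m) \<le> (\<Sum>i<k * Suc m. prob (D m i))"
      unfolding B_def using Dm by (intro finite_measure_subadditive_finite) auto
    also have "\<dots> \<le> (\<Sum>i<k * Suc m. C / (real (Suc m))^2)" by (intro sum_mono D)
    also have "\<dots> = k * C / Suc m" by (simp only: sum_constant card_lessThan of_nat_mult) (simp add: power2_eq_square del: of_nat_Suc)
    finally show ?thesis .
  qed
  have "prob (\<Inter>m. B m) \<le> k * C / Suc m" for m
    using Bm by (intro order_trans[OF finite_measure_mono B]) auto
  moreover have "(\<lambda>m. k * C / Suc m) \<longlonglongrightarrow> 0"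
    using LIMSEQ_Suc[OF lim_const_over_n[of "k * C"]] by simp
  ultimately have "prob (\<Inter>m. B m) \<le> 0"
    by (intro LIMSEQ_le_const[of _ 0]) auto
  then have "prob (\<Inter>m. B m) = 0" by (simp add: measure_le_0_iff)
  moreover have "(\<Inter>m. B m) \<in> events" using Bm by auto
  ultimately have "AE \<omega> in M. \<omega> \<notin> (\<Inter>m. B m)"
    by (intro AE_not_in null_setsI) (simp_all add: emeasure_eq_measure)
  then show ?thesis
    by (rule AE_mp) (auto simp: B_def D_def intro!: AE_I2)
qed

text \<open>The edges are independent and each has rung by time \<open>t\<close> with the same
  probability below 1, so almost surely not all of infinitely many have. The map \<open>b\<close>
  later enumerates the edges on either side of a site.\<close>

lemma AE_quiet:
  fixes b :: "nat \<Rightarrow> int"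
  assumes b: "inj b" and t: "0 \<le> t"
  shows "AE \<omega> in M. \<exists>i. clocks \<omega> (Arrow (b i)) t = 0"
proof -
  define D where "D = (\<lambda>L. {\<omega> \<in> space M. \<forall>i<L. 0 < clocks \<omega> (Arrow (b i)) t})"
  define q where "q = 1 - exp (- t)"
  have zero: "clocks \<omega> c 0 = 0" if "\<omega> \<in> space M" for \<omega> c using clocks_path[OF that, of c] by (simp add: counting_path_def)
  have Dm: "D L \<in> events" for L
  proof -
    have [measurable]: "Measurable.pred M (\<lambda>\<omega>. 0 < clocks \<omega> c t)" for c
      by (rule measurable_compose[OF measurable_clocks_at[OF t]]) simp
    show ?thesis unfolding D_def by measurable
  qed
  have D: "prob (D (Suc L)) = q ^ Suc L" for L
  proof -
    define A where "A = {f \<in> space path_space. f 0 < (f t :: nat)}"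
    have A: "A \<in> sets path_space" unfolding A_def using t by (intro event_set) auto
    have eq: "(\<lambda>\<omega>. clocks \<omega> c) -` A \<inter> space M = {\<omega> \<in> space M. clocks \<omega> c 0 < clocks \<omega> c t}" for c
      using measurable_space[OF measurable_clocks_component] by (auto simp: A_def)
    have "D (Suc L) = (\<Inter>c\<in>(\<lambda>i. Arrow (b i)) ` {..<Suc L}. (\<lambda>\<omega>. clocks \<omega> c) -` A \<inter> space M)"
      unfolding eq D_def using zero by auto
    also have "prob \<dots> = (\<Prod>c\<in>(\<lambda>i. Arrow (b i)) ` {..<Suc L}. prob ((\<lambda>\<omega>. clocks \<omega> c) -` A \<inter> space M))"
      using A by (intro indep_varsD[OF indep_clocks]) auto
    also have "\<dots> = (\<Prod>i<Suc L. q)"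
      unfolding eq using b t by (subst prod.reindex) (auto simp: inj_on_def prob_event q_def)
    finally show ?thesis by simp
  qed
  have "prob (\<Inter>L. D L) \<le> q ^ Suc L" for L
    unfolding D[symmetric] using Dm by (intro finite_measure_mono) auto
  moreover have "(\<lambda>L. q ^ Suc L) \<longlonglongrightarrow> 0"
    using t by (intro LIMSEQ_Suc LIMSEQ_realpow_zero) (auto simp: q_def)
  ultimately have "prob (\<Inter>L. D L) \<le> 0"
    by (intro LIMSEQ_le_const[of _ 0]) auto
  then have "prob (\<Inter>L. D L) = 0" by (simp add: measure_le_0_iff)
  moreover have "(\<Inter>L. D L) \<in> events" using Dm by auto
  ultimately have "AE \<omega> in M. \<omega> \<notin> (\<Inter>L. D L)"
    by (intro AE_not_in null_setsI) (simp_all add: emeasure_eq_measure)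
  then show ?thesis
    by (rule AE_mp) (auto simp: D_def intro!: AE_I2)
qed

lemma AE_regular_clocks: "AE \<omega> in M. regular_clocks (clocks \<omega>)"
proof -
  have 1: "AE \<omega> in M. \<forall>c d k. c \<noteq> d \<longrightarrow> (\<exists>m::nat. \<forall>i<k * Suc m.
      \<not> (clocks \<omega> c (i / Suc m) < clocks \<omega> c (Suc i / Suc m) \<and> clocks \<omega> d (i / Suc m) < clocks \<omega> d (Suc i / Suc m)))"
    unfolding AE_all_countable using AE_no_simultaneous by (intro allI AE_impI) blast
  have 2: "AE \<omega> in M. \<forall>(k::nat) (j::int). (\<exists>i. clocks \<omega> (Arrow (j + int i)) k = 0) \<and> (\<exists>i. clocks \<omega> (Arrow (j - int i)) k = 0)"
    unfolding AE_all_countable by (intro allI AE_conjI AE_quiet) (auto simp: inj_def)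
  from 1 2 show ?thesis
  proof eventually_elim
    case (elim \<omega>)
    have "\<exists>b\<ge>j. clocks \<omega> (Arrow b) k = 0" "\<exists>b\<le>j. clocks \<omega> (Arrow b) k = 0" for j and k :: nat
    proof -
      obtain i i' where "clocks \<omega> (Arrow (j + int i)) k = 0" "clocks \<omega> (Arrow (j - int i')) k = 0"
        using elim(2) by metis
      then show "\<exists>b\<ge>j. clocks \<omega> (Arrow b) k = 0" "\<exists>b\<le>j. clocks \<omega> (Arrow b) k = 0"
        using exI[of "\<lambda>b. b \<ge> j \<and> clocks \<omega> (Arrow b) k = 0" "j + int i"]
          exI[of "\<lambda>b. b \<le> j \<and> clocks \<omega> (Arrow b) k = 0" "j - int i'"] by simp_all
    qed
    then show ?case using elim(1) unfolding regular_clocks_def by blast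
  qed
qed

lemma AE_good: "AE \<omega> in M. good (clocks \<omega>)"
  using AE_regular_clocks by (rule AE_mp) (auto intro!: AE_I2 good_if_regular clocks_path)

lemma AE_good_clock_law: "AE n in clock_law. good n"
proof -
  have "AE n in clock_law. regular_clocks n"
    unfolding clock_law_def using pred_regular_clocks AE_regular_clocks
    by (subst AE_distr_iff[OF measurable_clocks]) (auto simp: pred_def)
  then show ?thesis
    by (rule AE_mp) (auto intro!: AE_I2 good_if_regular simp: clock_law_def space_clock_space)
qed

lemma AE_good_stopped_law:
  assumes T: "0 \<le> T"
  shows "AE n in stopped_law T. good n"
proof -
  have "AE \<omega> in M. regular_clocks (stop_clocks T (clocks \<omega>))"
    using AE_regular_clocks by (rule AE_mp) (auto intro!: AE_I2 regular_clocks_stop T clocks_path)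
  then have "AE n in stopped_law T. regular_clocks n"
    unfolding stopped_law_def using pred_regular_clocks
    by (subst AE_distr_iff[OF measurable_stop_clocks[OF measurable_clocks T]]) (auto simp: pred_def)
  then show ?thesis
    by (rule AE_mp) (auto intro!: AE_I2 good_if_regular simp: stopped_law_def space_clock_space)
qed

end

section \<open>The regeneration identity\<close>

text \<open>Functions of complementary sets of coordinates of a product measure are
  independent.\<close>

lemma nn_integral_PiM_indep:
  fixes D :: "'i \<Rightarrow> 'b measure"
  assumes D: "\<And>i. prob_space (D i)"
    and F: "F \<in> borel_measurable (PiM UNIV D)" "\<And>e e'. (\<And>i. i \<notin> J \<Longrightarrow> e i = e' i) \<Longrightarrow> F e = F e'"
    and G: "G \<in> borel_measurable (PiM UNIV D)" "\<And>e e'. (\<And>i. i \<in> J \<Longrightarrow> e i = e' i) \<Longrightarrow> G e = G e'"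
    and ne: "\<And>i. d i \<in> space (D i)"
  shows "(\<integral>\<^sup>+e. F e * G e \<partial>PiM UNIV D) = (\<integral>\<^sup>+e. F e \<partial>PiM UNIV D) * (\<integral>\<^sup>+e. G e \<partial>PiM UNIV D)"
proof -
  interpret product_prob_space D UNIV by (intro product_prob_spaceI D)
  interpret P: prob_space "PiM UNIV D" by (intro prob_space_PiM D)
  have ind: "P.indep_vars D (\<lambda>i e. e i) UNIV"
    by (subst P.indep_vars_iff_distr_eq_PiM') (auto simp: PiM_component restrict_UNIV distr_id2 intro!: PiM_cong)
  let ?J = "PiM J D" and ?K = "PiM (- J) D"
  have iv: "P.indep_var ?J (\<lambda>e. restrict e J) ?K (\<lambda>e. restrict e (- J))"
    using P.indep_var_restrict[OF ind, of J "- J"] by simp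
  \<comment> \<open>Missing coordinates are filled with a fixed point, which makes \<open>F\<close>
    and \<open>G\<close> functions on the partial products without changing their values.\<close>
  define ext where "ext = (\<lambda>(S :: 'i set) e i. if i \<in> S then e i else d i)"
  have ext: "ext S \<in> measurable (PiM S D) (PiM UNIV D)" for S
  proof (rule measurable_PiM_single')
    show "(\<lambda>e. ext S e i) \<in> measurable (PiM S D) (D i)" for i
      using ne by (cases "i \<in> S") (auto simp: ext_def intro!: measurable_component_singleton)
    show "(\<lambda>e i. ext S e i) \<in> space (PiM S D) \<rightarrow> (\<Pi>\<^sub>E i\<in>UNIV. space (D i))"
      using ne by (auto simp: ext_def space_PiM PiE_iff)
  qed
  have FF: "F (ext (- J) (restrict e (- J))) = F e" for e by (rule F(2)) (simp add: ext_def)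
  have GG: "G (ext J (restrict e J)) = G e" for e by (rule G(2)) (simp add: ext_def)
  have mF: "(\<lambda>x. F (ext (- J) x)) \<in> borel_measurable ?K" by (rule measurable_compose[OF ext F(1)])
  have mG: "(\<lambda>x. G (ext J x)) \<in> borel_measurable ?J" by (rule measurable_compose[OF ext G(1)])
  have rJ: "(\<lambda>e. restrict e J) \<in> measurable (PiM UNIV D) ?J" and rK: "(\<lambda>e. restrict e (- J)) \<in> measurable (PiM UNIV D) ?K"
    by (auto intro!: measurable_restrict_subset)
  define A where "A = distr (PiM UNIV D) ?J (\<lambda>e. restrict e J)"
  define B where "B = distr (PiM UNIV D) ?K (\<lambda>e. restrict e (- J))"
  interpret A: prob_space A unfolding A_def by (intro P.prob_space_distr rJ)
  interpret B: prob_space B unfolding B_def by (intro P.prob_space_distr rK)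
  have AB: "A \<Otimes>\<^sub>M B = distr (PiM UNIV D) (?J \<Otimes>\<^sub>M ?K) (\<lambda>e. (restrict e J, restrict e (- J)))"
    using iv unfolding P.indep_var_distribution_eq A_def B_def by simp
  have [measurable_cong]: "sets A = sets ?J" "sets B = sets ?K" by (simp_all add: A_def B_def)
  have mp: "(\<lambda>x. F (ext (- J) (snd x)) * G (ext J (fst x))) \<in> borel_measurable (?J \<Otimes>\<^sub>M ?K)"
    using mF mG by (intro borel_measurable_times_ennreal measurable_compose[OF measurable_snd mF] measurable_compose[OF measurable_fst mG])
  have "(\<integral>\<^sup>+e. F e * G e \<partial>PiM UNIV D) = (\<integral>\<^sup>+e. F (ext (- J) (snd (restrict e J, restrict e (- J)))) * G (ext J (fst (restrict e J, restrict e (- J)))) \<partial>PiM UNIV D)"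
    by (simp add: FF GG)
  also have "\<dots> = (\<integral>\<^sup>+x. F (ext (- J) (snd x)) * G (ext J (fst x)) \<partial>(A \<Otimes>\<^sub>M B))"
    unfolding AB by (subst nn_integral_distr[OF measurable_Pair[OF rJ rK]]) (use mp in auto)
  also have "\<dots> = (\<integral>\<^sup>+a. \<integral>\<^sup>+b. F (ext (- J) b) * G (ext J a) \<partial>B \<partial>A)"
    by (subst B.nn_integral_fst[symmetric]) (use mp in \<open>simp_all cong: measurable_cong_sets sets_pair_measure_cong add: A_def B_def\<close>)
  also have "\<dots> = (\<integral>\<^sup>+a. (\<integral>\<^sup>+b. F (ext (- J) b) \<partial>B) * G (ext J a) \<partial>A)"
    using mF by (intro nn_integral_cong nn_integral_multc) (simp add: B_def)
  also have "\<dots> = (\<integral>\<^sup>+b. F (ext (- J) b) \<partial>B) * (\<integral>\<^sup>+a. G (ext J a) \<partial>A)"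
    using mG by (intro nn_integral_cmult) (simp add: A_def)
  also have "(\<integral>\<^sup>+b. F (ext (- J) b) \<partial>B) = (\<integral>\<^sup>+e. F e \<partial>PiM UNIV D)"
    unfolding B_def using mF by (subst nn_integral_distr[OF rK]) (simp_all add: FF)
  also have "(\<integral>\<^sup>+a. G (ext J a) \<partial>A) = (\<integral>\<^sup>+e. G e \<partial>PiM UNIV D)"
    unfolding A_def using mG by (subst nn_integral_distr[OF rJ]) (simp_all add: GG)
  finally show ?thesis .
qed

lemma emeasure_Collect_of_bool:
  assumes "Measurable.pred \<Omega> P"
  shows "emeasure \<Omega> {w \<in> space \<Omega>. P w} = (\<integral>\<^sup>+w. of_bool (P w) \<partial>\<Omega>)"
proof -
  have "(\<integral>\<^sup>+w. of_bool (P w) \<partial>\<Omega>) = (\<integral>\<^sup>+w. indicator {w \<in> space \<Omega>. P w} w \<partial>\<Omega>)"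
    by (intro nn_integral_cong) (simp add: indicator_def)
  also have "\<dots> = emeasure \<Omega> {w \<in> space \<Omega>. P w}"
    using assms by (intro nn_integral_indicator) (simp add: pred_def)
  finally show ?thesis ..
qed

text \<open>For splitting according to the position of the walk, on which the set of fresh labels
  depends.\<close>

lemma nn_integral_split_int:
  fixes X :: "'w \<Rightarrow> int"
  assumes f: "f \<in> borel_measurable \<Omega>" and X: "X \<in> measurable \<Omega> (count_space UNIV)"
  shows "(\<integral>\<^sup>+w. f w \<partial>\<Omega>) = (\<Sum>k. \<integral>\<^sup>+w. f w * of_bool (X w = int_decode k) \<partial>\<Omega>)"
proof -
  have m: "(\<lambda>w. of_bool (X w = int_decode k) :: ennreal) \<in> borel_measurable \<Omega>" for k
    by (rule measurable_compose[OF X]) simp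
  have "(\<Sum>k. f w * of_bool (X w = int_decode k)) = f w" for w
  proof -
    have "(\<Sum>k. f w * of_bool (X w = int_decode k)) = (\<Sum>k\<in>{int_encode (X w)}. f w * of_bool (X w = int_decode k))"
      by (intro suminf_finite) auto
    then show ?thesis by simp
  qed
  then have "(\<integral>\<^sup>+w. f w \<partial>\<Omega>) = (\<integral>\<^sup>+w. (\<Sum>k. f w * of_bool (X w = int_decode k)) \<partial>\<Omega>)" by simp
  also have "\<dots> = (\<Sum>k. \<integral>\<^sup>+w. f w * of_bool (X w = int_decode k) \<partial>\<Omega>)"
    using f m by (intro nn_integral_suminf) auto
  finally show ?thesis .
qed

context exclusion_walk
begin

abbreviation "X \<equiv> walk \<alpha> \<beta>"

text \<open>The predicate is meant to be evaluated at the initial configuration and the clocks stopped at \<open>T\<close>.\<close>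

definition past :: "real \<Rightarrow> ((int \<Rightarrow> bool) \<times> (clock \<Rightarrow> real \<Rightarrow> nat) \<Rightarrow> bool) \<Rightarrow> bool" where
  "past T Q \<longleftrightarrow> Measurable.pred (config_space \<Otimes>\<^sub>M clock_space) Q \<and>
    (\<forall>e e' p. good p \<longrightarrow> (\<forall>t. 0 \<le> t \<longrightarrow> t \<le> T \<longrightarrow> X e p t = X e' p t) \<longrightarrow> Q (e, p) = Q (e', p))"

definition env :: "real \<Rightarrow> (int \<Rightarrow> bool) \<Rightarrow> (clock \<Rightarrow> real \<Rightarrow> nat) \<Rightarrow> int \<Rightarrow> bool" where
  "env T e p = (\<lambda>y. exclusion e p T (X e p T + y))"

text \<open>Dividing the probability of this event by that of \<Gamma> gives the law on the
  right-hand side of both identities.\<close>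

definition free_run :: "(real \<Rightarrow> int) set \<Rightarrow> (int \<Rightarrow> bool) \<Rightarrow> (clock \<Rightarrow> real \<Rightarrow> nat) \<Rightarrow> bool" where
  "free_run B e f \<longleftrightarrow> leads \<alpha> \<beta> e f 0 \<and> restrict (X e f) {0..} \<in> B"

lemma pred_free_run:
  assumes E: "E \<in> measurable \<Omega> config_space" and F: "F \<in> measurable \<Omega> clock_space" and B: "B \<in> sets path_space"
  shows "Measurable.pred \<Omega> (\<lambda>w. free_run B (E w) (F w))"
proof -
  interpret clock_family \<Omega> E F by (rule clock_familyI[OF E F])
  have [measurable]: "Measurable.pred \<Omega> (\<lambda>w. leads \<alpha> \<beta> (E w) (F w) 0)" by (rule pred_leads) simp
  have "(\<lambda>w. restrict (X (E w) (F w)) {0..}) \<in> measurable \<Omega> path_space"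
    by (intro measurable_restrict measurable_walk) simp
  then have [measurable]: "Measurable.pred \<Omega> (\<lambda>w. restrict (X (E w) (F w)) {0..} \<in> B)"
    by (rule pred_sets2[OF B])
  show ?thesis unfolding free_run_def by measurable
qed

lemma measurable_env:
  assumes E: "E \<in> measurable \<Omega> config_space" and F: "F \<in> measurable \<Omega> clock_space" and T: "0 \<le> T"
  shows "(\<lambda>w. env T (E w) (F w)) \<in> measurable \<Omega> config_space"
proof -
  interpret clock_family \<Omega> E F by (rule clock_familyI[OF E F])
  have "(\<lambda>w. env T (E w) (F w) y) \<in> measurable \<Omega> (count_space UNIV)" for y
    unfolding env_def using T
    by (intro measurable_exclusion measurable_compose[OF measurable_walk[OF T]]) simp_all
  then show ?thesis by (intro measurable_PiM_single') auto
qed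

lemma shift_clocks_invariant:
  assumes F: "F \<in> borel_measurable clock_space"
  shows "(\<integral>\<^sup>+f. F (shift_clocks 0 v f) \<partial>clock_law) = (\<integral>\<^sup>+f. F f \<partial>clock_law)"
proof -
  have m: "shift_clocks 0 v \<in> measurable clock_space clock_space"
    using measurable_shift_clocks[of "\<lambda>f. f" clock_space 0 "\<lambda>_. v"] by simp
  have m': "(\<lambda>\<omega>. shift_clocks 0 v (clocks \<omega>)) \<in> measurable M clock_space"
    by (rule measurable_compose[OF measurable_clocks m])
  have "(\<integral>\<^sup>+f. F (shift_clocks 0 v f) \<partial>clock_law) = (\<integral>\<^sup>+\<omega>. F (shift_clocks 0 v (clocks \<omega>)) \<partial>M)"
    unfolding clock_law_def by (subst nn_integral_distr[OF measurable_clocks]) (simp_all add: measurable_compose[OF m F])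
  also have "\<dots> = (\<integral>\<^sup>+f. F f \<partial>distr M clock_space (\<lambda>\<omega>. shift_clocks 0 v (clocks \<omega>)))"
    by (subst nn_integral_distr[OF m']) (simp_all add: F)
  also have "distr M clock_space (\<lambda>\<omega>. shift_clocks 0 v (clocks \<omega>)) = clock_law"
    by (rule shift_clocks_law) simp
  finally show ?thesis .
qed

lemma shift_clocks_shift: "0 \<le> T \<Longrightarrow> shift_clocks 0 v (shift_clocks T 0 n) = shift_clocks T v n"
  by (intro ext) (rename_tac c s, case_tac c, auto simp: shift_clocks_def)

lemma shift_clocks_0_clocks: "\<omega> \<in> space M \<Longrightarrow> shift_clocks 0 0 (clocks \<omega>) = clocks \<omega>"
  by (intro ext, rename_tac c s, case_tac c)
    (use clocks_path in \<open>auto simp: shift_clocks_def clocks_def counting_path_def\<close>)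

text \<open>The quenched probability: the configuration is held fixed and the clocks are
  averaged.\<close>

definition run_prob :: "(real \<Rightarrow> int) set \<Rightarrow> (int \<Rightarrow> bool) \<Rightarrow> ennreal" where
  "run_prob B e = (\<integral>\<^sup>+f. of_bool (free_run B e f) \<partial>clock_law)"

lemma measurable_run_prob:
  assumes B: "B \<in> sets path_space"
  shows "run_prob B \<in> borel_measurable config_space"
proof -
  interpret k: prob_space clock_law by (rule prob_space_laws)
  have "Measurable.pred (config_space \<Otimes>\<^sub>M clock_space) (\<lambda>w. free_run B (fst w) (snd w))"
    by (intro pred_free_run B measurable_fst measurable_snd)
  then have "(\<lambda>w. of_bool (free_run B (fst w) (snd w)) :: ennreal) \<in> borel_measurable (config_space \<Otimes>\<^sub>M clock_law)"
    by (simp cong: measurable_cong_sets sets_pair_measure_cong)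
  then have "(\<lambda>(e, f). of_bool (free_run B e f) :: ennreal) \<in> borel_measurable (config_space \<Otimes>\<^sub>M clock_law)"
    by (simp add: split_def)
  then show ?thesis unfolding run_prob_def by (rule k.borel_measurable_nn_integral)
qed

text \<open>On \<Gamma> the walk never reads a label to the left of its starting point, and whether
  \<Gamma> occurs does not depend on these labels either.\<close>

lemma run_prob_cong:
  assumes "\<And>y. 0 \<le> y \<Longrightarrow> e y = e' y"
  shows "run_prob B e = run_prob B e'"
  unfolding run_prob_def
proof (rule nn_integral_cong_AE, rule AE_mp[OF AE_good_clock_law], rule AE_I2, rule impI)
  fix f assume f: "good f"
  have "restrict (X e f) {0..} = restrict (X e' f) {0..}" if "leads \<alpha> \<beta> e f 0"
    using walk_cong_leads[OF f that assms] by (auto simp: restrict_def fun_eq_iff)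
  then show "of_bool (free_run B e f) = (of_bool (free_run B e' f) :: ennreal)"
    using leads_cong[OF f assms] by (auto simp: free_run_def)
qed

lemma nn_integral_run_prob:
  assumes B: "B \<in> sets path_space"
  shows "(\<integral>\<^sup>+e. run_prob B e \<partial>config_law) = emeasure M {\<omega> \<in> space M. free_run B (\<eta> \<omega>) (clocks \<omega>)}"
proof -
  have m: "Measurable.pred M (\<lambda>\<omega>. free_run B (\<eta> \<omega>) (clocks \<omega>))"
    by (intro pred_free_run B initial_measurable measurable_clocks)
  have h: "(\<lambda>w. of_bool (free_run B (fst w) (snd (snd w))) :: ennreal) \<in> borel_measurable (config_space \<Otimes>\<^sub>M (clock_space \<Otimes>\<^sub>M clock_space))"
    by (rule measurable_compose[OF pred_free_run[OF measurable_fst _ B]])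
      (auto intro!: measurable_compose[OF measurable_snd measurable_snd])
  have "emeasure M {\<omega> \<in> space M. free_run B (\<eta> \<omega>) (clocks \<omega>)} = (\<integral>\<^sup>+\<omega>. of_bool (free_run B (\<eta> \<omega>) (clocks \<omega>)) \<partial>M)"
    by (rule emeasure_Collect_of_bool[OF m])
  \<comment> \<open>A shift by time 0 is the identity on clocks; it brings the integrand into the
    form of \<open>nn_integral_past_future\<close> with \<open>T = 0\<close>.\<close>
  also have "\<dots> = (\<integral>\<^sup>+\<omega>. of_bool (free_run B (\<eta> \<omega>) (shift_clocks 0 0 (clocks \<omega>))) \<partial>M)"
    by (intro nn_integral_cong) (simp add: shift_clocks_0_clocks)
  also have "\<dots> = (\<integral>\<^sup>+e. \<integral>\<^sup>+p. \<integral>\<^sup>+f. of_bool (free_run B e f) \<partial>clock_law \<partial>stopped_law 0 \<partial>config_law)"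
    using nn_integral_past_future[OF order_refl h] by simp
  also have "\<dots> = (\<integral>\<^sup>+e. run_prob B e \<partial>config_law)"
    using prob_space.emeasure_space_1[OF prob_space_laws(3)[OF order_refl]] by (simp add: run_prob_def)
  finally show ?thesis ..
qed

text \<open>Given the clocks up to \<open>T = h * m\<close>, let \<open>J\<close> be the image under \<open>gamma\<close> of the sites from the walk onwards. When
  the front is behind the walk, the past depends on the initial configuration only outside \<open>J\<close>, and the
  event that the walk stays ahead only on \<open>J\<close>; the product measure factorises.\<close>

lemma fresh_environment:
  assumes h: "0 < h" and p: "good p" and ps: "p \<in> space clock_space" and Q: "past (h * m) Q" and B: "B \<in> sets path_space"
  shows "(\<integral>\<^sup>+e. of_bool (Q (e, p) \<and> front \<alpha> \<beta> h e p m < X e p (h * m)) * run_prob B (env (h * m) e p) \<partial>config_law)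
    = (\<integral>\<^sup>+e. of_bool (Q (e, p) \<and> front \<alpha> \<beta> h e p m < X e p (h * m)) \<partial>config_law) * (\<integral>\<^sup>+e. run_prob B e \<partial>config_law)"
proof -
  define T where "T = h * m"
  have T: "0 \<le> T" using h by (simp add: T_def)
  define A where "A = (\<lambda>e. Q (e, p) \<and> front \<alpha> \<beta> h e p m < X e p T)"
  have mp: "(\<lambda>e. p) \<in> measurable config_space clock_space" using ps by simp
  have mi: "(\<lambda>e. e) \<in> measurable config_space config_space" by simp
  interpret clock_family config_space "\<lambda>e. e" "\<lambda>e. p" by (rule clock_familyI[OF mi mp])
  have mX: "(\<lambda>e. X e p T) \<in> measurable config_space (count_space UNIV)" by (rule measurable_walk[OF T])
  have mfr: "(\<lambda>e. front \<alpha> \<beta> h e p m) \<in> measurable config_space (count_space UNIV)" by (rule measurable_front[OF h])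
  have mQ: "Measurable.pred config_space (\<lambda>e. Q (e, p))"
    using Q unfolding past_def by (intro measurable_compose[OF measurable_Pair[OF mi mp]]) auto
  have mless: "Measurable.pred config_space (\<lambda>e. front \<alpha> \<beta> h e p m < X e p T)"
    by (rule measurable_compose_countable[where f="\<lambda>i e. i < X e p T" and g="\<lambda>e. front \<alpha> \<beta> h e p m", OF _ mfr])
      (rule measurable_compose[OF mX], simp)
  have mA: "Measurable.pred config_space A" unfolding A_def using mQ mless by measurable
  have menv: "(\<lambda>e. run_prob B (env T e p)) \<in> borel_measurable config_space"
    by (rule measurable_compose[OF measurable_env[OF mi mp T] measurable_run_prob[OF B]])
  have A_of: "(\<lambda>e. of_bool (A e) :: ennreal) \<in> borel_measurable config_space" by (rule measurable_compose[OF mA]) simp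
  note cl = measurable_cong_sets[OF sets_laws(1) refl]
  have inj: "inj (gamma p T)" by (rule gamma_inj[OF p T])
  define D where "D = (\<lambda>_::int. measure_pmf (bernoulli_pmf \<rho>))"
  have law: "config_law = PiM UNIV D" by (simp add: config_law_eq D_def)
  have D: "prob_space (D i)" for i by (simp add: D_def prob_space_measure_pmf)
  \<comment> \<open>Once the position \<open>x\<close> is prescribed, the set \<open>J\<close>
    depends on the clocks alone and is no longer random under \<open>config_law\<close>.\<close>
  have split_term: "(\<integral>\<^sup>+e. of_bool (A e) * run_prob B (env T e p) * of_bool (X e p T = x) \<partial>config_law) =
    (\<integral>\<^sup>+e. of_bool (A e) * of_bool (X e p T = x) \<partial>config_law) * (\<integral>\<^sup>+e. run_prob B e \<partial>config_law)" for x
  proof -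
    define J where "J = gamma p T ` {x..}"
    define F where "F = (\<lambda>e. of_bool (A e \<and> X e p T = x) :: ennreal)"
    define G where "G = (\<lambda>e. run_prob B (\<lambda>y. e (gamma p T (x + y))))"
    have mF: "F \<in> borel_measurable config_law"
    proof -
      have "Measurable.pred config_space (\<lambda>e. X e p T = x)" by (rule measurable_compose[OF mX]) simp
      then have "Measurable.pred config_space (\<lambda>e. A e \<and> X e p T = x)" using mA by measurable
      then show ?thesis unfolding F_def cl by (rule measurable_compose) simp
    qed
    have mre: "(\<lambda>e y. e (gamma p T (x + y))) \<in> measurable config_space config_space"
      by (intro measurable_PiM_single' measurable_component_singleton) auto
    have mG: "G \<in> borel_measurable config_law" unfolding G_def cl by (rule measurable_compose[OF mre measurable_run_prob[OF B]])
    have Fdep: "F e = F e'" if off: "\<And>i. i \<notin> J \<Longrightarrow> e i = e' i" for e e'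
    proof -
      \<comment> \<open>Stated for arbitrary configurations, because \<open>walk_local\<close> needs
        the front condition for its first configuration and the implication is used in both
        directions.\<close>
      have *: "A e' \<and> X e' p T = x" if A: "A e \<and> X e p T = x" and off: "\<And>i. i \<notin> J \<Longrightarrow> e i = e' i" for e e'
      proof -
        have same: "X e p t = X e' p t" if "0 \<le> t" "t \<le> T" for t
        proof (rule walk_local[OF p h])
          show "front \<alpha> \<beta> h e p m < X e p (h * real m)" using A by (simp add: A_def T_def)
          show "e z = e' z" if "z \<notin> gamma p (h * real m) ` {X e p (h * real m)..}" for z
            using that A by (intro off) (simp add: J_def T_def)
        qed (use that in \<open>simp_all add: T_def\<close>)
        then have "front \<alpha> \<beta> h e p m = front \<alpha> \<beta> h e' p m" unfolding T_def by (intro front_cong h)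
        moreover have "Q (e, p) = Q (e', p)" using Q same p unfolding past_def T_def by blast
        ultimately show ?thesis using A same[OF T order_refl] by (simp add: A_def)
      qed
      have "(A e \<and> X e p T = x) = (A e' \<and> X e' p T = x)"
        by (intro iffI; erule *; simp add: off)
      then show ?thesis by (simp only: F_def)
    qed
    have Gdep: "G e = G e'" if "\<And>i. i \<in> J \<Longrightarrow> e i = e' i" for e e'
      unfolding G_def by (rule run_prob_cong) (auto intro!: that simp: J_def)
    have "(\<integral>\<^sup>+e. of_bool (A e) * run_prob B (env T e p) * of_bool (X e p T = x) \<partial>config_law) = (\<integral>\<^sup>+e. F e * G e \<partial>config_law)"
      by (intro nn_integral_cong) (auto simp: F_def G_def env_def exclusion_def)
    also have "\<dots> = (\<integral>\<^sup>+e. F e \<partial>config_law) * (\<integral>\<^sup>+e. G e \<partial>config_law)"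
      unfolding law by (rule nn_integral_PiM_indep[OF D mF[unfolded law] Fdep mG[unfolded law] Gdep, where d="\<lambda>_. True"]) (auto simp: D_def)
    also have "(\<integral>\<^sup>+e. G e \<partial>config_law) = (\<integral>\<^sup>+e. run_prob B e \<partial>distr config_law config_space (\<lambda>e y. e (gamma p T (x + y))))"
      unfolding G_def using mre measurable_run_prob[OF B] by (subst nn_integral_distr) (auto simp: cl)
    \<comment> \<open>Reading an i.i.d. configuration along the injective map
      \<open>\<lambda>y. gamma p T (x + y)\<close> does not change its law.\<close>
    also have "distr config_law config_space (\<lambda>e y. e (gamma p T (x + y))) = config_law"
    proof -
      have "distr (PiM UNIV D) (PiM UNIV (\<lambda>y. D (gamma p T (x + y)))) (\<lambda>e. \<lambda>y\<in>UNIV. e (gamma p T (x + y))) = PiM UNIV (\<lambda>y. D (gamma p T (x + y)))"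
        using inj by (intro distr_PiM_reindex D) (auto simp: inj_on_def dest!: injD[OF inj])
      moreover have "distr (PiM UNIV D) config_space (\<lambda>e y. e (gamma p T (x + y))) = distr (PiM UNIV D) (PiM UNIV D) (\<lambda>e y. e (gamma p T (x + y)))"
        using sets_laws(1) unfolding law by (intro distr_cong) auto
      ultimately show ?thesis unfolding law by (simp add: D_def restrict_UNIV)
    qed
    finally show ?thesis by (simp add: F_def of_bool_conj)
  qed
  have "(\<integral>\<^sup>+e. of_bool (A e) * run_prob B (env T e p) \<partial>config_law) =
     (\<Sum>k. \<integral>\<^sup>+e. of_bool (A e) * run_prob B (env T e p) * of_bool (X e p T = int_decode k) \<partial>config_law)"
    by (rule nn_integral_split_int) (use A_of menv mX in \<open>auto simp: cl\<close>)
  also have "\<dots> = (\<Sum>k. \<integral>\<^sup>+e. of_bool (A e) * of_bool (X e p T = int_decode k) \<partial>config_law) * (\<integral>\<^sup>+e. run_prob B e \<partial>config_law)"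
    unfolding split_term by simp
  also have "(\<Sum>k. \<integral>\<^sup>+e. of_bool (A e) * of_bool (X e p T = int_decode k) \<partial>config_law) = (\<integral>\<^sup>+e. of_bool (A e) \<partial>config_law)"
    by (rule nn_integral_split_int[symmetric]) (use A_of mX in \<open>auto simp: cl\<close>)
  finally show ?thesis by (simp add: A_def T_def)
qed

lemma pred_int_less:
  fixes f g :: "'w \<Rightarrow> int"
  assumes f: "f \<in> measurable \<Omega> (count_space UNIV)" and g: "g \<in> measurable \<Omega> (count_space UNIV)"
  shows "Measurable.pred \<Omega> (\<lambda>w. f w < g w)"
  by (rule measurable_compose_countable[where f="\<lambda>i w. i < g w" and g=f, OF measurable_compose[OF g] f]) simp

lemma measurable_int_diff:
  fixes f g :: "'w \<Rightarrow> int"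
  assumes f: "f \<in> measurable \<Omega> (count_space UNIV)" and g: "g \<in> measurable \<Omega> (count_space UNIV)"
  shows "(\<lambda>w. f w - g w) \<in> measurable \<Omega> (count_space UNIV)"
  by (rule measurable_compose_countable[where f="\<lambda>i w. i - g w" and g=f, OF measurable_compose[OF g] f]) simp

definition ahead :: "real \<Rightarrow> nat \<Rightarrow> (int \<Rightarrow> bool) \<Rightarrow> (clock \<Rightarrow> real \<Rightarrow> nat) \<Rightarrow> bool" where
  "ahead h m e n \<longleftrightarrow> front \<alpha> \<beta> h e n m < X e n (h * m)"

lemma pred_ahead:
  assumes E: "E \<in> measurable \<Omega> config_space" and F: "F \<in> measurable \<Omega> clock_space" and h: "0 < h"
  shows "Measurable.pred \<Omega> (\<lambda>w. ahead h m (E w) (F w))"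
proof -
  interpret clock_family \<Omega> E F by (rule clock_familyI[OF E F])
  show ?thesis unfolding ahead_def using h by (intro pred_int_less measurable_front measurable_walk) auto
qed

lemma ahead_stop:
  assumes "good n" "0 < h" "h * m \<le> T"
  shows "ahead h m e (stop_clocks T n) \<longleftrightarrow> ahead h m e n"
  using assms by (simp add: ahead_def front_stop walk_stop)

lemma ahead_cong:
  assumes "0 < h" "\<And>t. 0 \<le> t \<Longrightarrow> t \<le> h * m \<Longrightarrow> X e n t = X e' n t"
  shows "ahead h m e n \<longleftrightarrow> ahead h m e' n"
  using assms front_cong[OF assms] by (simp add: ahead_def)

abbreviation "fut T \<omega> \<equiv> (\<lambda>s\<in>{0..}. X (\<eta> \<omega>) (clocks \<omega>) (T + s) - X (\<eta> \<omega>) (clocks \<omega>) T)"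

lemma measurable_fut:
  assumes T: "0 \<le> T"
  shows "fut T \<in> measurable M path_space"
proof -
  interpret clock_family M \<eta> clocks by (rule clock_familyI[OF initial_measurable measurable_clocks])
  show ?thesis using T by (intro measurable_restrict measurable_int_diff measurable_walk) auto
qed

lemma pred_past:
  assumes Q: "past T Q" and T: "0 \<le> T"
  shows "Measurable.pred M (\<lambda>\<omega>. Q (\<eta> \<omega>, stop_clocks T (clocks \<omega>)))"
  by (rule measurable_compose[OF measurable_Pair[OF initial_measurable measurable_stop_clocks[OF measurable_clocks T]]])
    (use Q in \<open>auto simp: past_def\<close>)

text \<open>\<open>Q\<close> and \<open>ahead\<close> are read off the initial configuration and the
  stopped clocks. Staying ahead, together with the future path, is a free run in the environment
  seen from the walk and driven by the shifted clocks. Integrating the future clocks leaves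
  \<open>run_prob\<close>; averaging the configuration then factorises by
  \<open>fresh_environment\<close>.\<close>

lemma regeneration:
  assumes h: "0 < h" and Q: "past (h * m) Q" and B: "B \<in> sets path_space"
  shows "emeasure M {\<omega> \<in> space M. Q (\<eta> \<omega>, stop_clocks (h * m) (clocks \<omega>)) \<and> ahead h m (\<eta> \<omega>) (clocks \<omega>) \<and>
      leads \<alpha> \<beta> (\<eta> \<omega>) (clocks \<omega>) (h * m) \<and> fut (h * m) \<omega> \<in> B}
    = emeasure M {\<omega> \<in> space M. Q (\<eta> \<omega>, stop_clocks (h * m) (clocks \<omega>)) \<and> ahead h m (\<eta> \<omega>) (clocks \<omega>)} *
      emeasure M {\<omega> \<in> space M. free_run B (\<eta> \<omega>) (clocks \<omega>)}"
proof -
  define T where "T = h * m"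
  have T: "0 \<le> T" using h by (simp add: T_def)
  let ?p = "\<lambda>\<omega>. stop_clocks T (clocks \<omega>)" and ?f = "\<lambda>\<omega>. shift_clocks T 0 (clocks \<omega>)"
  let ?S = "config_space \<Otimes>\<^sub>M (clock_space \<Otimes>\<^sub>M clock_space)"
  define A where "A = (\<lambda>e p. Q (e, p) \<and> ahead h m e p)"
  define R where "R = (\<lambda>e p f. free_run B (env T e p) (shift_clocks 0 (X e p T) f))"
  interpret clock_family M \<eta> clocks by (rule clock_familyI[OF initial_measurable measurable_clocks])
  interpret c: prob_space config_law by (rule prob_space_laws(1))
  interpret s: prob_space "stopped_law T" by (rule prob_space_laws(3)[OF T])
  interpret k: prob_space clock_law by (rule prob_space_laws(2))
  interpret cs: pair_sigma_finite config_law "stopped_law T" by unfold_locales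
  have Qm: "Measurable.pred (config_space \<Otimes>\<^sub>M clock_space) Q" using Q by (simp add: past_def)
  have A2: "Measurable.pred (config_space \<Otimes>\<^sub>M clock_space) (\<lambda>x. A (fst x) (snd x))"
    unfolding A_def using Qm pred_ahead[OF measurable_fst measurable_snd h] by simp
  have e3: "(\<lambda>x. fst x) \<in> measurable ?S config_space" and p3: "(\<lambda>x. fst (snd x)) \<in> measurable ?S clock_space"
    and f3: "(\<lambda>x. snd (snd x)) \<in> measurable ?S clock_space"
    by (auto intro!: measurable_compose[OF measurable_snd measurable_fst] measurable_compose[OF measurable_snd measurable_snd])
  have A3: "Measurable.pred ?S (\<lambda>x. A (fst x) (fst (snd x)))"
    using measurable_compose[OF measurable_Pair[OF e3 p3] A2] by simp
  interpret S: clock_family ?S "\<lambda>x. fst x" "\<lambda>x. fst (snd x)" by (rule clock_familyI[OF e3 p3])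
  have R3: "Measurable.pred ?S (\<lambda>x. R (fst x) (fst (snd x)) (snd (snd x)))"
    unfolding R_def by (intro pred_free_run measurable_env measurable_shift_clocks e3 p3 f3 B T S.measurable_walk order_refl)
  have h3: "(\<lambda>x. of_bool (A (fst x) (fst (snd x)) \<and> R (fst x) (fst (snd x)) (snd (snd x))) :: ennreal) \<in> borel_measurable ?S"
    by (rule measurable_compose[OF pred_intros_logic(3)[OF A3 R3]]) simp
  have h3': "(\<lambda>x. of_bool (A (fst x) (fst (snd x))) :: ennreal) \<in> borel_measurable ?S"
    by (rule measurable_compose[OF A3]) simp
  have pA: "Measurable.pred M (\<lambda>\<omega>. A (\<eta> \<omega>) (?p \<omega>))"
    using measurable_compose[OF measurable_Pair[OF initial_measurable measurable_stop_clocks[OF measurable_clocks T]] A2] by simp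
  have pAR: "Measurable.pred M (\<lambda>\<omega>. A (\<eta> \<omega>) (?p \<omega>) \<and> R (\<eta> \<omega>) (?p \<omega>) (?f \<omega>))"
  proof -
    have "(\<lambda>\<omega>. (\<eta> \<omega>, (?p \<omega>, ?f \<omega>))) \<in> measurable M ?S"
      using T by (intro measurable_Pair initial_measurable measurable_stop_clocks measurable_shift_clocks measurable_clocks) auto
    from measurable_compose[OF this pred_intros_logic(3)[OF A3 R3]] show ?thesis by simp
  qed
  have Aeq: "AE \<omega> in M. A (\<eta> \<omega>) (?p \<omega>) \<longleftrightarrow> Q (\<eta> \<omega>, ?p \<omega>) \<and> ahead h m (\<eta> \<omega>) (clocks \<omega>)"
    by (rule AE_mp[OF AE_good]) (auto intro!: AE_I2 simp: A_def T_def ahead_stop[OF _ h])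
  have Req: "AE \<omega> in M. R (\<eta> \<omega>) (?p \<omega>) (?f \<omega>) \<longleftrightarrow> leads \<alpha> \<beta> (\<eta> \<omega>) (clocks \<omega>) T \<and> fut T \<omega> \<in> B"
  proof (rule AE_mp[OF AE_good], rule AE_I2, rule impI)
    fix \<omega> assume n: "good (clocks \<omega>)"
    let ?n = "clocks \<omega>" and ?e = "\<eta> \<omega>"
    have X: "X ?e (?p \<omega>) T = X ?e ?n T" by (rule walk_stop[OF n T order_refl])
    have env: "env T ?e (?p \<omega>) = (\<lambda>y. exclusion ?e ?n T (X ?e ?n T + y))"
      unfolding env_def X exclusion_def gamma_stop[OF n T order_refl] ..
    have "restrict (X (env T ?e (?p \<omega>)) (shift_clocks T (X ?e ?n T) ?n)) {0..} = fut T \<omega>"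
      using walk_shift[OF n T _ refl env] by (auto simp: restrict_def fun_eq_iff)
    then show "R ?e (?p \<omega>) (?f \<omega>) \<longleftrightarrow> leads \<alpha> \<beta> ?e ?n T \<and> fut T \<omega> \<in> B"
      unfolding R_def shift_clocks_shift[OF T] X free_run_def leads_shift[OF n T refl env] by simp
  qed
  \<comment> \<open>The future clocks are recentred at the walk, whose position is random but known
    from the past; translation invariance of their law removes the shift.\<close>
  have inner: "(\<integral>\<^sup>+f. of_bool (A e p \<and> R e p f) \<partial>clock_law) = of_bool (A e p) * run_prob B (env T e p)"
    if p: "p \<in> space clock_space" for e p
  proof -
    have m: "(\<lambda>f. of_bool (free_run B (env T e p) f) :: ennreal) \<in> borel_measurable clock_space"
      by (rule measurable_compose[OF pred_free_run[OF _ _ B, of "\<lambda>_. env T e p" clock_space "\<lambda>f. f"]])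
        (auto simp: space_PiM)
    have "(\<integral>\<^sup>+f. of_bool (R e p f) \<partial>clock_law) = run_prob B (env T e p)"
      unfolding R_def run_prob_def by (rule shift_clocks_invariant[OF m])
    then show ?thesis by (cases "A e p") simp_all
  qed
  have "emeasure M {\<omega> \<in> space M. Q (\<eta> \<omega>, ?p \<omega>) \<and> ahead h m (\<eta> \<omega>) (clocks \<omega>) \<and>
      leads \<alpha> \<beta> (\<eta> \<omega>) (clocks \<omega>) T \<and> fut T \<omega> \<in> B} = emeasure M {\<omega> \<in> space M. A (\<eta> \<omega>) (?p \<omega>) \<and> R (\<eta> \<omega>) (?p \<omega>) (?f \<omega>)}"
  proof (rule emeasure_eq_AE)
    show "AE \<omega> in M. \<omega> \<in> {\<omega> \<in> space M. Q (\<eta> \<omega>, ?p \<omega>) \<and> ahead h m (\<eta> \<omega>) (clocks \<omega>) \<and>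
      leads \<alpha> \<beta> (\<eta> \<omega>) (clocks \<omega>) T \<and> fut T \<omega> \<in> B} \<longleftrightarrow> \<omega> \<in> {\<omega> \<in> space M. A (\<eta> \<omega>) (?p \<omega>) \<and> R (\<eta> \<omega>) (?p \<omega>) (?f \<omega>)}"
      using Aeq Req by eventually_elim auto
    have "Measurable.pred M (\<lambda>\<omega>. Q (\<eta> \<omega>, ?p \<omega>))" using pred_past[OF Q] T by (simp add: T_def)
    moreover have "Measurable.pred M (\<lambda>\<omega>. ahead h m (\<eta> \<omega>) (clocks \<omega>))" by (rule pred_ahead[OF initial_measurable measurable_clocks h])
    moreover have "Measurable.pred M (\<lambda>\<omega>. leads \<alpha> \<beta> (\<eta> \<omega>) (clocks \<omega>) T)" by (rule pred_leads[OF T])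
    moreover have "Measurable.pred M (\<lambda>\<omega>. fut T \<omega> \<in> B)" by (rule pred_sets2[OF B measurable_fut[OF T]])
    ultimately show "{\<omega> \<in> space M. Q (\<eta> \<omega>, ?p \<omega>) \<and> ahead h m (\<eta> \<omega>) (clocks \<omega>) \<and>
      leads \<alpha> \<beta> (\<eta> \<omega>) (clocks \<omega>) T \<and> fut T \<omega> \<in> B} \<in> events" by (intro sets.sets_Collect_conj) (simp_all add: pred_def)
    show "{\<omega> \<in> space M. A (\<eta> \<omega>) (?p \<omega>) \<and> R (\<eta> \<omega>) (?p \<omega>) (?f \<omega>)} \<in> events" using pAR by (simp add: pred_def)
  qed
  also have "\<dots> = (\<integral>\<^sup>+\<omega>. of_bool (A (\<eta> \<omega>) (?p \<omega>) \<and> R (\<eta> \<omega>) (?p \<omega>) (?f \<omega>)) \<partial>M)"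
    by (rule emeasure_Collect_of_bool[OF pAR])
  also have "\<dots> = (\<integral>\<^sup>+e. \<integral>\<^sup>+p. \<integral>\<^sup>+f. of_bool (A e p \<and> R e p f) \<partial>clock_law \<partial>stopped_law T \<partial>config_law)"
    using nn_integral_past_future[OF T h3] by simp
  also have "\<dots> = (\<integral>\<^sup>+e. \<integral>\<^sup>+p. of_bool (A e p) * run_prob B (env T e p) \<partial>stopped_law T \<partial>config_law)"
    by (intro nn_integral_cong inner) (simp add: stopped_law_def)
  \<comment> \<open>The configuration has to be averaged with the past clocks held fixed, because
    they determine, with the position of the walk, which labels are fresh.\<close>
  also have "\<dots> = (\<integral>\<^sup>+p. \<integral>\<^sup>+e. of_bool (A e p) * run_prob B (env T e p) \<partial>config_law \<partial>stopped_law T)"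
  proof (rule cs.Fubini'[symmetric])
    have "(\<lambda>x. of_bool (A (fst x) (snd x)) * run_prob B (env T (fst x) (snd x))) \<in> borel_measurable (config_space \<Otimes>\<^sub>M clock_space)"
      by (intro borel_measurable_times_ennreal measurable_compose[OF A2] measurable_compose[OF measurable_env[OF measurable_fst measurable_snd T] measurable_run_prob[OF B]]) simp
    then show "(\<lambda>(e, p). of_bool (A e p) * run_prob B (env T e p)) \<in> borel_measurable (config_law \<Otimes>\<^sub>M stopped_law T)"
      by (simp add: split_def cong: measurable_cong_sets sets_pair_measure_cong)
  qed
  also have "\<dots> = (\<integral>\<^sup>+p. (\<integral>\<^sup>+e. of_bool (A e p) \<partial>config_law) * (\<integral>\<^sup>+e. run_prob B e \<partial>config_law) \<partial>stopped_law T)"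
  proof (rule nn_integral_cong_AE, rule AE_mp[OF AE_good_stopped_law[OF T]], rule AE_I2, rule impI)
    fix p assume "p \<in> space (stopped_law T)" "good p"
    then show "(\<integral>\<^sup>+e. of_bool (A e p) * run_prob B (env T e p) \<partial>config_law) =
      (\<integral>\<^sup>+e. of_bool (A e p) \<partial>config_law) * (\<integral>\<^sup>+e. run_prob B e \<partial>config_law)"
      using fresh_environment[OF h _ _ Q B, of p] by (simp add: A_def ahead_def T_def stopped_law_def)
  qed
  also have "\<dots> = (\<integral>\<^sup>+p. \<integral>\<^sup>+e. of_bool (A e p) \<partial>config_law \<partial>stopped_law T) * (\<integral>\<^sup>+e. run_prob B e \<partial>config_law)"
  proof (rule nn_integral_multc)
    have "Measurable.pred (clock_space \<Otimes>\<^sub>M config_space) (\<lambda>x. A (snd x) (fst x))"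
      using measurable_compose[OF measurable_Pair[OF measurable_snd measurable_fst] A2] by simp
    then have "(\<lambda>x. of_bool (A (snd x) (fst x)) :: ennreal) \<in> borel_measurable (clock_space \<Otimes>\<^sub>M config_space)"
      by (rule measurable_compose) simp
    then have "(\<lambda>(p, e). of_bool (A e p) :: ennreal) \<in> borel_measurable (stopped_law T \<Otimes>\<^sub>M config_law)"
      by (simp add: split_def cong: measurable_cong_sets sets_pair_measure_cong)
    then show "(\<lambda>p. \<integral>\<^sup>+e. of_bool (A e p) \<partial>config_law) \<in> borel_measurable (stopped_law T)"
      by (rule c.borel_measurable_nn_integral)
  qed
  also have "(\<integral>\<^sup>+p. \<integral>\<^sup>+e. of_bool (A e p) \<partial>config_law \<partial>stopped_law T) = (\<integral>\<^sup>+e. \<integral>\<^sup>+p. of_bool (A e p) \<partial>stopped_law T \<partial>config_law)"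
  proof (rule cs.Fubini')
    have "(\<lambda>x. of_bool (A (fst x) (snd x)) :: ennreal) \<in> borel_measurable (config_space \<Otimes>\<^sub>M clock_space)"
      by (rule measurable_compose[OF A2]) simp
    then show "(\<lambda>(e, p). of_bool (A e p) :: ennreal) \<in> borel_measurable (config_law \<Otimes>\<^sub>M stopped_law T)"
      by (simp add: split_def cong: measurable_cong_sets sets_pair_measure_cong)
  qed
  also have "\<dots> = (\<integral>\<^sup>+\<omega>. of_bool (A (\<eta> \<omega>) (?p \<omega>)) \<partial>M)"
    using nn_integral_past_future[OF T h3'] by (simp add: k.emeasure_space_1)
  also have "\<dots> = emeasure M {\<omega> \<in> space M. A (\<eta> \<omega>) (?p \<omega>)}"
    by (rule emeasure_Collect_of_bool[OF pA, symmetric])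
  also have "\<dots> = emeasure M {\<omega> \<in> space M. Q (\<eta> \<omega>, ?p \<omega>) \<and> ahead h m (\<eta> \<omega>) (clocks \<omega>)}"
  proof (rule emeasure_eq_AE)
    show "AE \<omega> in M. \<omega> \<in> {\<omega> \<in> space M. A (\<eta> \<omega>) (?p \<omega>)} \<longleftrightarrow> \<omega> \<in> {\<omega> \<in> space M. Q (\<eta> \<omega>, ?p \<omega>) \<and> ahead h m (\<eta> \<omega>) (clocks \<omega>)}"
      using Aeq by eventually_elim auto
    show "{\<omega> \<in> space M. A (\<eta> \<omega>) (?p \<omega>)} \<in> events" using pA by (simp add: pred_def)
    have "Measurable.pred M (\<lambda>\<omega>. Q (\<eta> \<omega>, ?p \<omega>))" using pred_past[OF Q] T by (simp add: T_def)
    moreover have "Measurable.pred M (\<lambda>\<omega>. ahead h m (\<eta> \<omega>) (clocks \<omega>))" by (rule pred_ahead[OF initial_measurable measurable_clocks h])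
    ultimately show "{\<omega> \<in> space M. Q (\<eta> \<omega>, ?p \<omega>) \<and> ahead h m (\<eta> \<omega>) (clocks \<omega>)} \<in> events"
      by (intro sets.sets_Collect_conj) (simp_all add: pred_def)
  qed
  finally show ?thesis unfolding nn_integral_run_prob[OF B] T_def .
qed

end

section \<open>One time slab\<close>

text \<open>The contraction factor equals 1 at \<theta> = 0, so its derivative there decides. The
  derivative is \<open>\<phi> h\<close>, and \<phi> vanishes at 0 with slope
  \<open>- a + b + 1\<close>, which is negative. Hence \<open>h\<close> is chosen small, and then
  \<theta> small depending on \<open>h\<close>.\<close>

lemma exists_slab_parameters:
  fixes a b :: real
  assumes a: "0 < a" and b: "0 < b" and ab: "1 < a - b"
  obtains N :: nat and \<theta> :: real where "0 < N" "0 < \<theta>" "(1 - exp (- (1 / N))) * exp \<theta> < 1"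
    "(exp (- (a * (1 / N))) + (1 - exp (- (a * (1 / N)))) * exp (- \<theta>)) * exp (b * (1 / N) * (exp \<theta> - 1))
      * (exp (- (1 / N)) / (1 - (1 - exp (- (1 / N))) * exp \<theta>)) < 1"
proof -
  \<comment> \<open>Mean change per slab of the deficit of the walk: it gains a step with
    probability \<open>1 - exp (- a * h)\<close>, loses \<open>b * h\<close>, and the block of
    arrows adds \<open>exp h - 1\<close>.\<close>
  define \<phi> where "\<phi> = (\<lambda>h. - (1 - exp (- (a * h))) + b * h + (exp h - 1))"
  have "(\<phi> has_real_derivative (- a + b + 1)) (at 0)"
    unfolding \<phi>_def by (auto intro!: derivative_eq_intros)
  then obtain d where d: "0 < d" "\<And>h. 0 < h \<Longrightarrow> h < d \<Longrightarrow> \<phi> (0 + h) < \<phi> 0"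
    using DERIV_neg_dec_right[of \<phi> "- a + b + 1" 0] ab by auto
  \<comment> \<open>A reciprocal integer as slab length makes all slab ends rational.\<close>
  obtain N :: nat where N: "0 < N" "1 / N < d"
    using d(1) by (metis nat_approx_posE zero_less_Suc)
  define h where "h = 1 / real N"
  have h: "0 < h" using N by (simp add: h_def)
  have \<phi>: "\<phi> h < 0" using d(2)[of h] N h by (simp add: \<phi>_def h_def)
  define q where "q = 1 - exp (- h)"
  have q: "0 < q" "q < 1" using h by (auto simp: q_def)
  define \<kappa> where "\<kappa> = (\<lambda>\<theta>. (exp (- (a * h)) + (1 - exp (- (a * h))) * exp (- \<theta>)) * exp (b * h * (exp \<theta> - 1)) * (exp (- h) / (1 - q * exp \<theta>)))"
  have "(\<kappa> has_real_derivative (- (1 - exp (- (a * h))) + b * h + q / exp (- h))) (at 0)"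
    unfolding \<kappa>_def using q
    by (auto intro!: derivative_eq_intros simp: q_def field_simps power2_eq_square)
  moreover have "q / exp (- h) = exp h - 1" by (simp add: q_def field_simps exp_minus)
  ultimately have "(\<kappa> has_real_derivative \<phi> h) (at 0)" by (simp add: \<phi>_def)
  then obtain d' where d': "0 < d'" "\<And>x. 0 < x \<Longrightarrow> x < d' \<Longrightarrow> \<kappa> (0 + x) < \<kappa> 0"
    using DERIV_neg_dec_right[of \<kappa> "\<phi> h" 0] \<phi> by auto
  have k0: "\<kappa> 0 = 1" by (simp add: \<kappa>_def q_def)
  \<comment> \<open>The second bound keeps \<open>q * exp \<theta>\<close> below 1, so that the
    geometric block has a finite exponential moment.\<close>
  define \<theta> where "\<theta> = min (d' / 2) (- ln q / 2)"
  have \<theta>: "0 < \<theta>" "\<theta> < d'" using d'(1) q by (auto simp: \<theta>_def)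
  have "ln q < 0" using q by simp
  then have "\<theta> < - ln q" by (simp add: \<theta>_def min_def)
  then have "exp \<theta> < exp (- ln q)" by simp
  then have "q * exp \<theta> < 1" using q by (simp add: exp_minus field_simps)
  moreover have "\<kappa> \<theta> < 1" using d'(2)[of \<theta>] \<theta> k0 by simp
  ultimately show ?thesis
    using that[of N \<theta>] N(1) \<theta>(1) by (simp add: \<kappa>_def q_def h_def)
qed

lemma Least_nat_eq_iff:
  fixes P :: "nat \<Rightarrow> bool"
  assumes ex: "\<exists>k. P k"
  shows "(LEAST k. P k) = k \<longleftrightarrow> P k \<and> (\<forall>i<k. \<not> P i)"
proof
  assume "(LEAST k. P k) = k"
  then show "P k \<and> (\<forall>i<k. \<not> P i)" using LeastI_ex[OF ex] not_less_Least[of _ P] by blast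
next
  assume "P k \<and> (\<forall>i<k. \<not> P i)"
  then show "(LEAST k. P k) = k" by (intro Least_equality) (auto simp: not_less[symmetric])
qed

context exclusion_walk
begin

lemma measurable_clocks_const: "0 \<le> t \<Longrightarrow> (\<lambda>\<omega>. g (clocks \<omega> c t)) \<in> measurable M (count_space UNIV)"
  by (rule measurable_compose[OF measurable_clocks_at]) simp_all

lemma clocks_0: "\<omega> \<in> space M \<Longrightarrow> clocks \<omega> c 0 = 0"
  using clocks_path[of \<omega> c] by (simp add: counting_path_def)

lemma nn_integral_clock:
  fixes g :: "nat \<Rightarrow> ennreal"
  assumes t: "0 \<le> t"
  shows "(\<integral>\<^sup>+\<omega>. g (clocks \<omega> c t) \<partial>M) = (\<Sum>k. g k * ennreal (pmf (poisson_law (clock_rate \<alpha> \<beta> c * t)) k))"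
proof -
  have m: "(\<lambda>\<omega>. clocks \<omega> c t - clocks \<omega> c 0) \<in> measurable M (count_space UNIV)"
    using t by (intro measurable_diff_nat measurable_clocks_at) auto
  have "(\<integral>\<^sup>+\<omega>. g (clocks \<omega> c t) \<partial>M) = (\<integral>\<^sup>+\<omega>. g (clocks \<omega> c t - clocks \<omega> c 0) \<partial>M)"
    by (intro nn_integral_cong) (simp add: clocks_0)
  also have "\<dots> = (\<integral>\<^sup>+k. g k \<partial>distr M (count_space UNIV) (\<lambda>\<omega>. clocks \<omega> c t - clocks \<omega> c 0))"
    by (subst nn_integral_distr[OF m]) auto
  also have "\<dots> = (\<integral>\<^sup>+k. g k \<partial>measure_pmf (poisson_law (clock_rate \<alpha> \<beta> c * t)))"
    using increment_law[OF order_refl t, of c] by simp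
  also have "\<dots> = (\<integral>\<^sup>+k. ennreal (pmf (poisson_law (clock_rate \<alpha> \<beta> c * t)) k) * g k \<partial>count_space UNIV)"
    by (rule nn_integral_measure_pmf)
  also have "\<dots> = (\<Sum>k. g k * ennreal (pmf (poisson_law (clock_rate \<alpha> \<beta> c * t)) k))"
    by (subst nn_integral_count_space_nat) (simp add: mult.commute)
  finally show ?thesis .
qed

lemma clock_mgf:
  assumes t: "0 \<le> t"
  shows "(\<integral>\<^sup>+\<omega>. ennreal (exp (\<theta> * real (clocks \<omega> c t))) \<partial>M) = ennreal (exp (clock_rate \<alpha> \<beta> c * t * (exp \<theta> - 1)))"
proof -
  define r where "r = clock_rate \<alpha> \<beta> c * t"
  have r: "0 \<le> r" using t clock_rate_nonneg by (simp add: r_def)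
  have s: "(\<lambda>k. (r * exp \<theta>) ^ k / fact k * exp (- r)) sums (exp (r * exp \<theta>) * exp (- r))"
    using exp_converges[of "r * exp \<theta>"] by (intro sums_mult2) (simp add: divide_inverse mult.commute)
  have "(\<integral>\<^sup>+\<omega>. ennreal (exp (\<theta> * real (clocks \<omega> c t))) \<partial>M) = (\<Sum>k. ennreal (exp (\<theta> * real k)) * ennreal (pmf (poisson_law r) k))"
    unfolding r_def by (rule nn_integral_clock[OF t])
  also have "\<dots> = (\<Sum>k. ennreal ((r * exp \<theta>) ^ k / fact k * exp (- r)))"
    using r by (intro suminf_cong) (simp add: pmf_poisson_law ennreal_mult'[symmetric] power_mult_distrib exp_of_nat_mult[symmetric] mult_ac)
  also have "\<dots> = ennreal (exp (r * exp \<theta>) * exp (- r))"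
    using r s by (intro suminf_ennreal_eq) auto
  also have "exp (r * exp \<theta>) * exp (- r) = exp (r * (exp \<theta> - 1))"
    by (simp add: exp_add[symmetric] algebra_simps)
  finally show ?thesis by (simp add: r_def)
qed

lemma clock_indicator_mgf:
  assumes t: "0 \<le> t"
  shows "(\<integral>\<^sup>+\<omega>. ennreal (exp (- \<theta> * of_bool (0 < clocks \<omega> c t))) \<partial>M) =
    ennreal (exp (- (clock_rate \<alpha> \<beta> c * t)) + (1 - exp (- (clock_rate \<alpha> \<beta> c * t))) * exp (- \<theta>))"
proof -
  define E where "E = {\<omega> \<in> space M. 0 < clocks \<omega> c t}"
  have "Measurable.pred M (\<lambda>\<omega>. 0 < clocks \<omega> c t)" by (rule measurable_clocks_const[OF t])
  then have E: "E \<in> events" by (simp add: E_def pred_def)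
  have "E = {\<omega> \<in> space M. clocks \<omega> c 0 < clocks \<omega> c t}" using clocks_0 by (auto simp: E_def)
  then have pE: "prob E = 1 - exp (- (clock_rate \<alpha> \<beta> c * t))" using prob_event[OF order_refl t, of c] by simp
  have "(\<integral>\<^sup>+\<omega>. ennreal (exp (- \<theta> * of_bool (0 < clocks \<omega> c t))) \<partial>M) =
    (\<integral>\<^sup>+\<omega>. indicator (space M - E) \<omega> + ennreal (exp (- \<theta>)) * indicator E \<omega> \<partial>M)"
    by (intro nn_integral_cong) (auto simp: E_def indicator_def)
  also have "\<dots> = emeasure M (space M - E) + ennreal (exp (- \<theta>)) * emeasure M E"
    using E by (subst nn_integral_add) (auto simp: nn_integral_cmult)
  also have "\<dots> = ennreal (1 - prob E) + ennreal (exp (- \<theta>)) * ennreal (prob E)"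
    using E by (simp add: emeasure_eq_measure prob_compl)
  also have "\<dots> = ennreal ((1 - prob E) + exp (- \<theta>) * prob E)"
    using E by (simp add: ennreal_mult[symmetric] ennreal_plus[symmetric] del: ennreal_plus)
  finally show ?thesis by (simp add: pE mult.commute)
qed

text \<open>The first \<open>k\<close> edges each have an arrow and the next has none; the edges are
  independent, which gives a geometric law.\<close>

lemma prob_block:
  assumes h: "0 < h"
  shows "emeasure M {\<omega> \<in> space M. block (clocks \<omega>) 0 h r = k} = ennreal ((1 - exp (- h)) ^ k * exp (- h))"
proof -
  define A where "A = (\<lambda>i. {f \<in> space path_space. if i < k then f 0 < (f h :: nat) else f h = f 0})"
  have A: "A i \<in> sets path_space" for i
  proof -
    have e: "{f \<in> space path_space. f 0 < (f h :: nat)} \<in> sets path_space" "{f \<in> space path_space. f h < (f 0 :: nat)} \<in> sets path_space"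
      using h by (auto intro!: event_set)
    have "{f \<in> space path_space. f h = (f 0 :: nat)} = space path_space - {f \<in> space path_space. f 0 < (f h :: nat)} - {f \<in> space path_space. f h < (f 0 :: nat)}"
      by auto
    then have "{f \<in> space path_space. f h = (f 0 :: nat)} \<in> sets path_space" using e by auto
    then show ?thesis using e(1) by (auto simp: A_def)
  qed
  have v: "prob ((\<lambda>\<omega>. clocks \<omega> (Arrow (r + int i))) -` A i \<inter> space M) = (if i < k then 1 - exp (- h) else exp (- h))" for i
  proof -
    have "(\<lambda>\<omega>. clocks \<omega> (Arrow (r + int i))) -` A i \<inter> space M =
       {\<omega> \<in> space M. if i < k then clocks \<omega> (Arrow (r + int i)) 0 < clocks \<omega> (Arrow (r + int i)) h else clocks \<omega> (Arrow (r + int i)) h = clocks \<omega> (Arrow (r + int i)) 0}"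
      using measurable_space[OF measurable_clocks_component] by (auto simp: A_def)
    then show ?thesis using h prob_event[of 0 h "Arrow (r + int i)"] prob_no_event[of 0 h "Arrow (r + int i)"] by simp
  qed
  define I where "I = (\<lambda>i. Arrow (r + int i)) ` {..k}"
  define J where "J = (\<lambda>c. A (nat ((case c of Arrow y \<Rightarrow> y - r | _ \<Rightarrow> 0))))"
  have JA: "J (Arrow (r + int i)) = A i" for i by (simp add: J_def)
  have "prob (\<Inter>c\<in>I. (\<lambda>\<omega>. clocks \<omega> c) -` J c \<inter> space M) = (\<Prod>c\<in>I. prob ((\<lambda>\<omega>. clocks \<omega> c) -` J c \<inter> space M))"
    using A by (intro indep_varsD[OF indep_clocks]) (auto simp: I_def J_def)
  also have "\<dots> = (\<Prod>i\<le>k. if i < k then 1 - exp (- h) else exp (- h))"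
    unfolding I_def by (subst prod.reindex) (auto simp: inj_on_def JA v)
  also have "\<dots> = (\<Prod>i<k. 1 - exp (- h)) * exp (- h)"
    by (simp add: lessThan_Suc_atMost[symmetric])
  finally have P: "prob (\<Inter>c\<in>I. (\<lambda>\<omega>. clocks \<omega> c) -` J c \<inter> space M) = (1 - exp (- h)) ^ k * exp (- h)" by simp
  have "emeasure M {\<omega> \<in> space M. block (clocks \<omega>) 0 h r = k} = emeasure M (\<Inter>c\<in>I. (\<lambda>\<omega>. clocks \<omega> c) -` J c \<inter> space M)"
  proof (rule emeasure_eq_AE)
    interpret clock_family M \<eta> clocks by (rule clock_familyI[OF initial_measurable measurable_clocks])
    have "(\<lambda>\<omega>. block (clocks \<omega>) 0 h r) \<in> measurable M (count_space UNIV)" using h by (intro measurable_block) auto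
    then have "Measurable.pred M (\<lambda>\<omega>. block (clocks \<omega>) 0 h r = k)" by (rule measurable_compose) simp
    then show "{\<omega> \<in> space M. block (clocks \<omega>) 0 h r = k} \<in> events" by (simp add: pred_def)
    show "(\<Inter>c\<in>I. (\<lambda>\<omega>. clocks \<omega> c) -` J c \<inter> space M) \<in> events"
      using A by (intro sets.finite_INT measurable_sets[OF measurable_clocks_component]) (auto simp: I_def J_def)
    show "AE \<omega> in M. \<omega> \<in> {\<omega> \<in> space M. block (clocks \<omega>) 0 h r = k} \<longleftrightarrow> \<omega> \<in> (\<Inter>c\<in>I. (\<lambda>\<omega>. clocks \<omega> c) -` J c \<inter> space M)"
    proof (rule AE_mp[OF AE_good], rule AE_I2, rule impI)
      fix \<omega> assume w: "\<omega> \<in> space M" and n: "good (clocks \<omega>)"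
      let ?P = "\<lambda>k. clocks \<omega> (Arrow (r + int k)) h = clocks \<omega> (Arrow (r + int k)) 0"
      have ex: "?P (block (clocks \<omega>) 0 h r)" using h by (intro block_quiet[OF n]) auto
      have "block (clocks \<omega>) 0 h r = k \<longleftrightarrow> ?P k \<and> (\<forall>i<k. \<not> ?P i)"
        unfolding block_def by (rule Least_nat_eq_iff[OF exI[of ?P, OF ex]])
      also have "\<dots> \<longleftrightarrow> (\<forall>i\<le>k. clocks \<omega> (Arrow (r + int i)) \<in> A i)"
      proof -
        have a: "clocks \<omega> (Arrow (r + int i)) \<in> A i \<longleftrightarrow> (if i < k then \<not> ?P i else ?P i)" for i
          using measurable_space[OF measurable_clocks_component w, of "Arrow (r + int i)"] clocks_0[OF w, of "Arrow (r + int i)"]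
          by (simp add: A_def)
        have "(\<forall>i\<le>k. clocks \<omega> (Arrow (r + int i)) \<in> A i) \<longleftrightarrow> (\<forall>i<k. \<not> ?P i) \<and> ?P k"
          unfolding a by (auto simp only: order_le_less if_True if_False split: if_splits)
        then show ?thesis by blast
      qed
      also have "\<dots> \<longleftrightarrow> \<omega> \<in> (\<Inter>c\<in>I. (\<lambda>\<omega>. clocks \<omega> c) -` J c \<inter> space M)"
        using w by (auto simp: I_def JA)
      finally show "\<omega> \<in> {\<omega> \<in> space M. block (clocks \<omega>) 0 h r = k} \<longleftrightarrow> \<omega> \<in> (\<Inter>c\<in>I. (\<lambda>\<omega>. clocks \<omega> c) -` J c \<inter> space M)"
        using w by simp
    qed
  qed
  then show ?thesis using P by (simp add: emeasure_eq_measure)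
qed

lemma measurable_block_clocks: "0 < h \<Longrightarrow> (\<lambda>\<omega>. block (clocks \<omega>) 0 h r) \<in> measurable M (count_space UNIV)"
  using clock_family.measurable_block[OF clock_familyI[OF initial_measurable measurable_clocks], of 0 h "\<lambda>_. r"] by simp

lemma block_mgf:
  assumes h: "0 < h" and \<theta>: "(1 - exp (- h)) * exp \<theta> < 1"
  shows "(\<integral>\<^sup>+\<omega>. ennreal (exp (\<theta> * real (block (clocks \<omega>) 0 h r))) \<partial>M) = ennreal (exp (- h) / (1 - (1 - exp (- h)) * exp \<theta>))"
proof -
  define q where "q = 1 - exp (- h)"
  have q: "0 \<le> q * exp \<theta>" "q * exp \<theta> < 1" "0 \<le> q" using h \<theta> by (auto simp: q_def)
  note m = measurable_block_clocks[OF h, of r]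
  have mk: "{\<omega> \<in> space M. block (clocks \<omega>) 0 h r = k} \<in> events" for k
    using measurable_sets[OF m, of "{k}"] by (simp add: vimage_def Int_def conj_commute)
  have expand: "g (block (clocks \<omega>) 0 h r) = (\<Sum>k. g k * indicator {\<omega> \<in> space M. block (clocks \<omega>) 0 h r = k} \<omega>)"
    if "\<omega> \<in> space M" for \<omega> and g :: "nat \<Rightarrow> ennreal"
  proof -
    have "(\<Sum>k. g k * indicator {\<omega> \<in> space M. block (clocks \<omega>) 0 h r = k} \<omega>) =
      (\<Sum>k\<in>{block (clocks \<omega>) 0 h r}. g k * indicator {\<omega> \<in> space M. block (clocks \<omega>) 0 h r = k} \<omega>)"
      by (intro suminf_finite) auto
    then show ?thesis using that by simp
  qed
  have "(\<integral>\<^sup>+\<omega>. ennreal (exp (\<theta> * real (block (clocks \<omega>) 0 h r))) \<partial>M) =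
    (\<integral>\<^sup>+\<omega>. (\<Sum>k. ennreal (exp (\<theta> * real k)) * indicator {\<omega> \<in> space M. block (clocks \<omega>) 0 h r = k} \<omega>) \<partial>M)"
    by (intro nn_integral_cong expand)
  also have "\<dots> = (\<Sum>k. \<integral>\<^sup>+\<omega>. ennreal (exp (\<theta> * real k)) * indicator {\<omega> \<in> space M. block (clocks \<omega>) 0 h r = k} \<omega> \<partial>M)"
    using mk by (intro nn_integral_suminf) auto
  also have "\<dots> = (\<Sum>k. ennreal (exp (\<theta> * real k)) * ennreal (q ^ k * exp (- h)))"
    using mk by (simp add: nn_integral_cmult_indicator prob_block[OF h] q_def)
  also have "\<dots> = (\<Sum>k. ennreal ((q * exp \<theta>) ^ k * exp (- h)))"
    using q by (intro suminf_cong) (simp add: ennreal_mult'[symmetric] power_mult_distrib exp_of_nat_mult[symmetric] mult_ac)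
  also have "\<dots> = ennreal (1 / (1 - q * exp \<theta>) * exp (- h))"
    using q by (intro suminf_ennreal_eq sums_mult2 geometric_sums) auto
  finally show ?thesis by (simp add: q_def)
qed

end

text \<open>Increments over disjoint pieces yield distinct jump times. The total increment would not
  suffice, as a path may jump by more than one; this is why \<open>bold\<close> subdivides the
  slab.\<close>

lemma card_jump_times_ge:
  assumes g: "counting_path g" and s: "0 \<le> s" and h: "0 < h"
    and inc: "\<And>i. i \<le> K \<Longrightarrow> g (s + h * real i / real (Suc K)) < g (s + h * real (Suc i) / real (Suc K))"
  shows "Suc K \<le> card (jump_times g \<inter> {s<..s + h})"
proof -
  define t where "t = (\<lambda>i. s + h * real i / real (Suc K))"
  have mono: "t i \<le> t j" if "i \<le> j" for i j
    unfolding t_def using that h by (intro add_left_mono divide_right_mono mult_left_mono) auto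
  have t0: "t 0 = s" and tK: "t (Suc K) = s + h" by (simp_all add: t_def del: of_nat_Suc)
  have "\<exists>u. u \<in> jump_times g \<inter> {t i<..t (Suc i)}" if "i \<le> K" for i
  proof -
    have "0 \<le> t i" using mono[of 0 i] t0 s by simp
    moreover have "g (t i) < g (t (Suc i))" unfolding t_def by (rule inc[OF that])
    ultimately show ?thesis using jump_times_Ioc_nonempty_iff[OF g, of "t i" "t (Suc i)"] mono[of i "Suc i"] by auto
  qed
  then obtain u where u: "\<And>i. i \<le> K \<Longrightarrow> u i \<in> jump_times g \<inter> {t i<..t (Suc i)}" by metis
  have less: "u i < u j" if "i < j" "j \<le> K" for i j
    using u[of i] u[of j] mono[of "Suc i" j] that by auto
  have "inj_on u {..K}"
  proof (rule inj_onI)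
    fix i j assume "i \<in> {..K}" "j \<in> {..K}" "u i = u j"
    then show "i = j" using less[of i j] less[of j i] by (cases i j rule: linorder_cases) auto
  qed
  moreover have "u ` {..K} \<subseteq> jump_times g \<inter> {s<..s + h}"
  proof
    fix x assume "x \<in> u ` {..K}"
    then obtain i where i: "i \<le> K" "x = u i" by auto
    then have "s \<le> t i" "t (Suc i) \<le> s + h" using mono[of 0 i] mono[of "Suc i" "Suc K"] t0 tK by auto
    then show "x \<in> jump_times g \<inter> {s<..s + h}" using u[OF i(1)] i(2) by auto
  qed
  ultimately have "card {..K} \<le> card (jump_times g \<inter> {s<..s + h})"
    using finite_jump_times_subset[OF g] by (intro card_inj_on_le) auto
  then show ?thesis by simp
qed

text \<open>In such a slab the walk gains more than \<open>K\<close> steps while a front at \<open>r\<close> does not move.\<close>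

definition bold :: "real \<Rightarrow> nat \<Rightarrow> int \<Rightarrow> (clock \<Rightarrow> real \<Rightarrow> nat) \<Rightarrow> bool" where
  "bold h K r f \<longleftrightarrow> (\<forall>i\<le>K. f Plus (h * real i / real (Suc K)) < f Plus (h * real (Suc i) / real (Suc K))) \<and>
     f Minus h = 0 \<and> f HatPlus h = 0 \<and> f HatMinus h = 0 \<and> f (Arrow r) h = 0"

text \<open>The exponent collects all that the walk can lose in a slab against a front starting at
  \<open>r\<close>: the block of arrows and its own steps to the left, with every hatted ring
  counted as such a step.\<close>

definition slab_weight :: "real \<Rightarrow> real \<Rightarrow> int \<Rightarrow> (clock \<Rightarrow> real \<Rightarrow> nat) \<Rightarrow> real" where
  "slab_weight \<theta> h r f = exp (\<theta> * (real (block f 0 h r) + real (f Minus h) + real (f HatMinus h)))"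

text \<open>At most one step to the right is credited per slab, which to first order in
  \<open>h\<close> loses nothing.\<close>

definition front_weight :: "real \<Rightarrow> real \<Rightarrow> int \<Rightarrow> (clock \<Rightarrow> real \<Rightarrow> nat) \<Rightarrow> real" where
  "front_weight \<theta> h r f = slab_weight \<theta> h r f * exp (- \<theta> * of_bool (0 < f Plus h))"

text \<open>For a slab in which the front is reset to the farthest site that the walk may have
  reached. Distances are then counted from the position \<open>x\<close> of the walk at the
  beginning of the slab, and the old front drops out.\<close>

definition push_weight :: "real \<Rightarrow> real \<Rightarrow> int \<Rightarrow> (clock \<Rightarrow> real \<Rightarrow> nat) \<Rightarrow> real" where
  "push_weight \<theta> h x f = slab_weight \<theta> h (x + int (f Plus h) + int (f HatPlus h)) f * exp (\<theta> * (real (f Plus h) + real (f HatPlus h)))"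

lemma block_shift:
  assumes "0 \<le> s" "0 < h" "\<forall>c. counting_path (n c)"
  shows "block (shift_clocks s 0 n) 0 h r = block n s (s + h) r"
proof -
  have "shift_clocks s 0 n (Arrow y) h = shift_clocks s 0 n (Arrow y) 0 \<longleftrightarrow> n (Arrow y) (s + h) = n (Arrow y) s" for y
    using assms counting_path_mono[of "n (Arrow y)" s "s + h"] by (auto simp: shift_clocks_def)
  then show ?thesis by (simp add: block_def)
qed

context exclusion_walk
begin

lemma walk_clocks_integral:
  fixes g :: "clock \<Rightarrow> nat \<Rightarrow> ennreal"
  assumes h: "0 \<le> h"
  shows "(\<integral>\<^sup>+\<omega>. (\<Prod>c\<in>walk_clocks. g c (clocks \<omega> c h)) \<partial>M) = (\<Prod>c\<in>walk_clocks. \<integral>\<^sup>+\<omega>. g c (clocks \<omega> c h) \<partial>M)"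
proof (rule indep_vars_nn_integral)
  have "indep_vars (\<lambda>_. borel) (\<lambda>c \<omega>. g c (clocks \<omega> c h)) UNIV"
  proof (rule indep_vars_compose2[OF indep_clocks, where Y="\<lambda>c f. g c (f h)"])
    show "(\<lambda>f. g c (f h)) \<in> borel_measurable path_space" for c
      by (rule measurable_compose[OF measurable_component_singleton]) (use h in auto)
  qed
  then show "indep_vars (\<lambda>_. borel) (\<lambda>c \<omega>. g c (clocks \<omega> c h)) walk_clocks"
    by (rule indep_vars_subset) simp
qed (simp_all add: walk_clocks_def)

text \<open>The site where the block begins may depend on the clocks of the walk. Since these are
  independent of the arrows, and the law of the block is the same at every site, the moment of the
  block still factors out.\<close>

lemma slab_integral:
  fixes g :: "clock \<Rightarrow> nat \<Rightarrow> ennreal" and site :: "nat \<Rightarrow> nat \<Rightarrow> int"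
  assumes h: "0 < h" and \<theta>: "(1 - exp (- h)) * exp \<theta> < 1"
  shows "(\<integral>\<^sup>+\<omega>. (\<Prod>c\<in>walk_clocks. g c (clocks \<omega> c h)) *
      ennreal (exp (\<theta> * real (block (clocks \<omega>) 0 h (site (clocks \<omega> Plus h) (clocks \<omega> HatPlus h))))) \<partial>M)
    = (\<Prod>c\<in>walk_clocks. \<integral>\<^sup>+\<omega>. g c (clocks \<omega> c h) \<partial>M) * ennreal (exp (- h) / (1 - (1 - exp (- h)) * exp \<theta>))"
proof -
  let ?J = "PiM walk_clocks (\<lambda>_. path_space :: (real \<Rightarrow> nat) measure)"
  let ?K = "PiM (range Arrow) (\<lambda>_. path_space :: (real \<Rightarrow> nat) measure)"
  have iv: "indep_var ?J (\<lambda>\<omega>. restrict (\<lambda>c. clocks \<omega> c) walk_clocks) ?K (\<lambda>\<omega>. restrict (\<lambda>c. clocks \<omega> c) (range Arrow))"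
    by (rule indep_var_restrict[OF indep_clocks]) (auto simp: walk_clocks_def)
  define ra where "ra = (\<lambda>\<omega>. restrict (\<lambda>c. clocks \<omega> c) walk_clocks)"
  define rb where "rb = (\<lambda>\<omega>. restrict (\<lambda>c. clocks \<omega> c) (range Arrow))"
  have ra: "ra \<in> measurable M ?J" and rb: "rb \<in> measurable M ?K"
    using indep_var_rv1[OF iv] indep_var_rv2[OF iv] by (simp_all add: ra_def rb_def)
  define A where "A = distr M ?J ra"
  define B where "B = distr M ?K rb"
  interpret A: prob_space A unfolding A_def by (intro prob_space_distr ra)
  interpret B: prob_space B unfolding B_def by (intro prob_space_distr rb)
  have AB: "A \<Otimes>\<^sub>M B = distr M (?J \<Otimes>\<^sub>M ?K) (\<lambda>\<omega>. (ra \<omega>, rb \<omega>))"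
    using iv unfolding indep_var_distribution_eq A_def B_def ra_def rb_def by simp
  have [measurable_cong]: "sets A = sets ?J" "sets B = sets ?K" by (simp_all add: A_def B_def)
  define F1 where "F1 = (\<lambda>a. \<Prod>c\<in>walk_clocks. g c (a c h))"
  define E where "E = (\<lambda>r b. ennreal (exp (\<theta> * real (block b 0 h r))))"
  define R where "R = (\<lambda>a. site (a Plus h) (a HatPlus h))"
  have comp: "(\<lambda>a. a c t) \<in> measurable (PiM I (\<lambda>_. path_space :: (real \<Rightarrow> nat) measure)) (count_space UNIV)"
    if "c \<in> I" "0 \<le> t" for c I and t :: real
  proof -
    have "(\<lambda>f. f t) \<in> measurable (path_space :: (real \<Rightarrow> nat) measure) (count_space UNIV)"
      using that by (intro measurable_component_singleton) simp
    then show ?thesis by (rule measurable_compose[OF measurable_component_singleton[OF that(1)]])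
  qed
  have mF1: "F1 \<in> borel_measurable ?J"
    unfolding F1_def using h by (intro borel_measurable_prod_ennreal measurable_compose[OF comp]) auto
  have mR: "R \<in> measurable ?J (count_space UNIV)"
    unfolding R_def using h
    by (intro measurable_compose_countable[where f="\<lambda>i a. site i (a HatPlus h)" and g="\<lambda>a. a Plus h", OF measurable_compose[OF comp] comp])
      (auto simp: walk_clocks_def)
  have mE: "E r \<in> borel_measurable ?K" for r
  proof -
    have "Measurable.pred ?K (\<lambda>b. b (Arrow (r + int k)) h = b (Arrow (r + int k)) 0)" for k
      using h by (intro measurable_compose_countable[where f="\<lambda>i b. b (Arrow (r + int k)) h = i" and g="\<lambda>b. b (Arrow (r + int k)) 0", OF measurable_compose[OF comp] comp])
        auto
    then have "(\<lambda>b. block b 0 h r) \<in> measurable ?K (count_space UNIV)" unfolding block_def by (rule measurable_Least)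
    then show ?thesis unfolding E_def by (rule measurable_compose) simp
  qed
  have mh: "(\<lambda>x. F1 (fst x) * E (R (fst x)) (snd x)) \<in> borel_measurable (?J \<Otimes>\<^sub>M ?K)"
  proof (rule borel_measurable_times_ennreal)
    show "(\<lambda>x. F1 (fst x)) \<in> borel_measurable (?J \<Otimes>\<^sub>M ?K)" by (rule measurable_compose[OF measurable_fst mF1])
    show "(\<lambda>x. E (R (fst x)) (snd x)) \<in> borel_measurable (?J \<Otimes>\<^sub>M ?K)"
      by (rule measurable_compose_countable[where f="\<lambda>r x. E r (snd x)" and g="\<lambda>x. R (fst x)", OF measurable_compose[OF measurable_snd mE] measurable_compose[OF measurable_fst mR]])
  qed
  have blk: "block (rb \<omega>) 0 h r = block (clocks \<omega>) 0 h r" for \<omega> r by (simp add: block_def rb_def)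
  have Ra: "R (ra \<omega>) = site (clocks \<omega> Plus h) (clocks \<omega> HatPlus h)" for \<omega> by (simp add: R_def ra_def walk_clocks_def)
  have F1a: "F1 (ra \<omega>) = (\<Prod>c\<in>walk_clocks. g c (clocks \<omega> c h))" for \<omega> by (simp add: F1_def ra_def)
  have inner: "(\<integral>\<^sup>+b. E r b \<partial>B) = ennreal (exp (- h) / (1 - (1 - exp (- h)) * exp \<theta>))" for r
  proof -
    have "(\<integral>\<^sup>+b. E r b \<partial>B) = (\<integral>\<^sup>+\<omega>. E r (rb \<omega>) \<partial>M)"
      unfolding B_def by (subst nn_integral_distr[OF rb]) (simp_all add: mE)
    also have "\<dots> = (\<integral>\<^sup>+\<omega>. ennreal (exp (\<theta> * real (block (clocks \<omega>) 0 h r))) \<partial>M)" by (simp add: E_def blk)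
    finally show ?thesis unfolding block_mgf[OF h \<theta>] .
  qed
  have "(\<integral>\<^sup>+\<omega>. (\<Prod>c\<in>walk_clocks. g c (clocks \<omega> c h)) *
      ennreal (exp (\<theta> * real (block (clocks \<omega>) 0 h (site (clocks \<omega> Plus h) (clocks \<omega> HatPlus h))))) \<partial>M)
    = (\<integral>\<^sup>+\<omega>. F1 (fst (ra \<omega>, rb \<omega>)) * E (R (fst (ra \<omega>, rb \<omega>))) (snd (ra \<omega>, rb \<omega>)) \<partial>M)"
    by (simp add: F1a Ra blk E_def)
  also have "\<dots> = (\<integral>\<^sup>+x. F1 (fst x) * E (R (fst x)) (snd x) \<partial>(A \<Otimes>\<^sub>M B))"
    unfolding AB by (subst nn_integral_distr[OF measurable_Pair[OF ra rb]]) (use mh in auto)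
  also have "\<dots> = (\<integral>\<^sup>+a. \<integral>\<^sup>+b. F1 a * E (R a) b \<partial>B \<partial>A)"
    by (subst B.nn_integral_fst[symmetric]) (use mh in \<open>simp_all cong: measurable_cong_sets sets_pair_measure_cong add: A_def B_def\<close>)
  also have "\<dots> = (\<integral>\<^sup>+a. F1 a * ennreal (exp (- h) / (1 - (1 - exp (- h)) * exp \<theta>)) \<partial>A)"
    using mE by (intro nn_integral_cong) (simp add: nn_integral_cmult B_def inner[unfolded B_def])
  also have "\<dots> = (\<integral>\<^sup>+a. F1 a \<partial>A) * ennreal (exp (- h) / (1 - (1 - exp (- h)) * exp \<theta>))"
    using mF1 by (intro nn_integral_multc) (simp add: A_def)
  also have "(\<integral>\<^sup>+a. F1 a \<partial>A) = (\<integral>\<^sup>+\<omega>. (\<Prod>c\<in>walk_clocks. g c (clocks \<omega> c h)) \<partial>M)"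
    unfolding A_def using mF1 by (subst nn_integral_distr[OF ra]) (simp_all add: F1a)
  finally show ?thesis using h by (simp add: walk_clocks_integral)
qed

text \<open>The rates of \<open>Minus\<close> and \<open>HatMinus\<close> add up to the larger
  \<beta>, which gives the first factor; the second is the exponential moment of the geometric
  block.\<close>

definition slab_const :: "real \<Rightarrow> real \<Rightarrow> real" where
  "slab_const \<theta> h = exp (max (\<beta> False) (\<beta> True) * h * (exp \<theta> - 1)) * (exp (- h) / (1 - (1 - exp (- h)) * exp \<theta>))"

text \<open>Only \<open>Plus\<close> is credited to the walk, and its rate is the smaller \<alpha>.
  This is the contraction factor of \<open>exists_slab_parameters\<close>.\<close>

definition front_const :: "real \<Rightarrow> real \<Rightarrow> real" where
  "front_const \<theta> h = (let a = min (\<alpha> False) (\<alpha> True) in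
     (exp (- (a * h)) + (1 - exp (- (a * h))) * exp (- \<theta>)) * slab_const \<theta> h)"

text \<open>The rates of \<open>Plus\<close> and \<open>HatPlus\<close> add up to the larger
  \<alpha>. Only finiteness of this constant matters, since it is the additive term of an affine
  recursion.\<close>

definition push_const :: "real \<Rightarrow> real \<Rightarrow> real" where
  "push_const \<theta> h = exp (max (\<alpha> False) (\<alpha> True) * h * (exp \<theta> - 1)) * slab_const \<theta> h"

lemma prod_walk_clocks: "(\<Prod>c\<in>walk_clocks. f c) = f Plus * f Minus * f HatPlus * (f HatMinus :: 'z :: comm_monoid_mult)"
  by (simp add: walk_clocks_def mult.assoc)

lemma consts_pos:
  assumes "0 < h" "(1 - exp (- h)) * exp \<theta> < 1"
  shows "0 < slab_const \<theta> h" "0 < front_const \<theta> h" "0 < push_const \<theta> h"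
proof -
  show s: "0 < slab_const \<theta> h" using assms by (simp add: slab_const_def)
  have "0 < min (\<alpha> False) (\<alpha> True) * h" using \<alpha>_pos assms by simp
  then show "0 < front_const \<theta> h" using s unfolding front_const_def Let_def
    by (intro mult_pos_pos add_pos_nonneg mult_nonneg_nonneg) auto
  show "0 < push_const \<theta> h" using s by (simp add: push_const_def)
qed

lemma minus_mgf:
  assumes h: "0 < h"
  shows "(\<integral>\<^sup>+\<omega>. ennreal (exp (\<theta> * real (clocks \<omega> Minus h))) \<partial>M) * (\<integral>\<^sup>+\<omega>. ennreal (exp (\<theta> * real (clocks \<omega> HatMinus h))) \<partial>M)
    = ennreal (exp (max (\<beta> False) (\<beta> True) * h * (exp \<theta> - 1)))"
  using h by (simp add: clock_mgf ennreal_mult[symmetric] exp_add[symmetric] algebra_simps)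

lemma plus_mgf:
  assumes h: "0 < h"
  shows "(\<integral>\<^sup>+\<omega>. ennreal (exp (\<theta> * real (clocks \<omega> Plus h))) \<partial>M) * (\<integral>\<^sup>+\<omega>. ennreal (exp (\<theta> * real (clocks \<omega> HatPlus h))) \<partial>M)
    = ennreal (exp (max (\<alpha> False) (\<alpha> True) * h * (exp \<theta> - 1)))"
  using h by (simp add: clock_mgf ennreal_mult[symmetric] exp_add[symmetric] algebra_simps)

lemma slab_weight_integral:
  assumes h: "0 < h" and \<theta>: "(1 - exp (- h)) * exp \<theta> < 1"
  shows "(\<integral>\<^sup>+\<omega>. ennreal (slab_weight \<theta> h r (clocks \<omega>)) \<partial>M) = ennreal (slab_const \<theta> h)"
proof -
  let ?g = "\<lambda>c k. if c = Minus \<or> c = HatMinus then ennreal (exp (\<theta> * real k)) else 1"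
  have "(\<integral>\<^sup>+\<omega>. ennreal (slab_weight \<theta> h r (clocks \<omega>)) \<partial>M) = (\<integral>\<^sup>+\<omega>. (\<Prod>c\<in>walk_clocks. ?g c (clocks \<omega> c h)) *
      ennreal (exp (\<theta> * real (block (clocks \<omega>) 0 h ((\<lambda>_ _. r) (clocks \<omega> Plus h) (clocks \<omega> HatPlus h))))) \<partial>M)"
    by (intro nn_integral_cong) (simp add: slab_weight_def prod_walk_clocks ennreal_mult[symmetric] exp_add[symmetric] distrib_left ac_simps)
  also have "\<dots> = (\<Prod>c\<in>walk_clocks. \<integral>\<^sup>+\<omega>. ?g c (clocks \<omega> c h) \<partial>M) * ennreal (exp (- h) / (1 - (1 - exp (- h)) * exp \<theta>))"
    by (rule slab_integral[OF h \<theta>, where g="?g" and site="\<lambda>_ _. r"])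
  also have "\<dots> = ((\<integral>\<^sup>+\<omega>. ennreal (exp (\<theta> * real (clocks \<omega> Minus h))) \<partial>M) * (\<integral>\<^sup>+\<omega>. ennreal (exp (\<theta> * real (clocks \<omega> HatMinus h))) \<partial>M)) * ennreal (exp (- h) / (1 - (1 - exp (- h)) * exp \<theta>))"
    by (simp add: prod_walk_clocks emeasure_space_1)
  also have "\<dots> = ennreal (slab_const \<theta> h)"
    unfolding minus_mgf[OF h] slab_const_def using \<theta> by (subst ennreal_mult[symmetric]) auto
  finally show ?thesis .
qed

lemma front_weight_integral:
  assumes h: "0 < h" and \<theta>: "(1 - exp (- h)) * exp \<theta> < 1"
  shows "(\<integral>\<^sup>+\<omega>. ennreal (front_weight \<theta> h r (clocks \<omega>)) \<partial>M) = ennreal (front_const \<theta> h)"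
proof -
  let ?g = "\<lambda>c k. if c = Minus \<or> c = HatMinus then ennreal (exp (\<theta> * real k)) else if c = Plus then ennreal (exp (- \<theta> * of_bool (0 < k))) else 1"
  have a: "0 < min (\<alpha> False) (\<alpha> True) * h" using \<alpha>_pos h by simp
  have "(\<integral>\<^sup>+\<omega>. ennreal (front_weight \<theta> h r (clocks \<omega>)) \<partial>M) = (\<integral>\<^sup>+\<omega>. (\<Prod>c\<in>walk_clocks. ?g c (clocks \<omega> c h)) *
      ennreal (exp (\<theta> * real (block (clocks \<omega>) 0 h ((\<lambda>_ _. r) (clocks \<omega> Plus h) (clocks \<omega> HatPlus h))))) \<partial>M)"
    by (intro nn_integral_cong) (simp add: front_weight_def slab_weight_def prod_walk_clocks ennreal_mult[symmetric] exp_add[symmetric] distrib_left ac_simps del: mult_minus_left mult_minus_right)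
  also have "\<dots> = (\<integral>\<^sup>+\<omega>. ennreal (exp (- \<theta> * of_bool (0 < clocks \<omega> Plus h))) \<partial>M) *
     ((\<integral>\<^sup>+\<omega>. ennreal (exp (\<theta> * real (clocks \<omega> Minus h))) \<partial>M) * (\<integral>\<^sup>+\<omega>. ennreal (exp (\<theta> * real (clocks \<omega> HatMinus h))) \<partial>M)) *
     ennreal (exp (- h) / (1 - (1 - exp (- h)) * exp \<theta>))"
  proof -
    have "(\<integral>\<^sup>+\<omega>. (\<Prod>c\<in>walk_clocks. ?g c (clocks \<omega> c h)) *
      ennreal (exp (\<theta> * real (block (clocks \<omega>) 0 h ((\<lambda>_ _. r) (clocks \<omega> Plus h) (clocks \<omega> HatPlus h))))) \<partial>M) =
      (\<Prod>c\<in>walk_clocks. \<integral>\<^sup>+\<omega>. ?g c (clocks \<omega> c h) \<partial>M) * ennreal (exp (- h) / (1 - (1 - exp (- h)) * exp \<theta>))"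
      by (rule slab_integral[OF h \<theta>, where g="?g" and site="\<lambda>_ _. r"])
    then show ?thesis by (simp add: prod_walk_clocks emeasure_space_1 mult.assoc)
  qed
  also have "\<dots> = ennreal (front_const \<theta> h)"
  proof -
    have gen: "ennreal A * ennreal B * ennreal L = ennreal (A * (B * L))" if "0 \<le> A" "0 \<le> B" "0 \<le> L" for A B L :: real
      using that by (simp add: ennreal_mult mult.assoc)
    show ?thesis
      unfolding minus_mgf[OF h] front_const_def slab_const_def Let_def clock_indicator_mgf[OF less_imp_le[OF h]] clock_rate.simps
      using a \<theta> by (intro gen) auto
  qed
  finally show ?thesis .
qed

lemma push_weight_integral:
  assumes h: "0 < h" and \<theta>: "(1 - exp (- h)) * exp \<theta> < 1"
  shows "(\<integral>\<^sup>+\<omega>. ennreal (push_weight \<theta> h x (clocks \<omega>)) \<partial>M) = ennreal (push_const \<theta> h)"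
proof -
  let ?g = "\<lambda>(c::clock) k. ennreal (exp (\<theta> * real k))"
  have "(\<integral>\<^sup>+\<omega>. ennreal (push_weight \<theta> h x (clocks \<omega>)) \<partial>M) = (\<integral>\<^sup>+\<omega>. (\<Prod>c\<in>walk_clocks. ?g c (clocks \<omega> c h)) *
      ennreal (exp (\<theta> * real (block (clocks \<omega>) 0 h ((\<lambda>u v. x + int u + int v) (clocks \<omega> Plus h) (clocks \<omega> HatPlus h))))) \<partial>M)"
    by (intro nn_integral_cong) (simp add: push_weight_def slab_weight_def prod_walk_clocks ennreal_mult[symmetric] exp_add[symmetric] distrib_left ac_simps)
  also have "\<dots> = ((\<integral>\<^sup>+\<omega>. ennreal (exp (\<theta> * real (clocks \<omega> Plus h))) \<partial>M) * (\<integral>\<^sup>+\<omega>. ennreal (exp (\<theta> * real (clocks \<omega> HatPlus h))) \<partial>M)) *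
     ((\<integral>\<^sup>+\<omega>. ennreal (exp (\<theta> * real (clocks \<omega> Minus h))) \<partial>M) * (\<integral>\<^sup>+\<omega>. ennreal (exp (\<theta> * real (clocks \<omega> HatMinus h))) \<partial>M)) *
     ennreal (exp (- h) / (1 - (1 - exp (- h)) * exp \<theta>))"
  proof -
    have "(\<integral>\<^sup>+\<omega>. (\<Prod>c\<in>walk_clocks. ?g c (clocks \<omega> c h)) *
      ennreal (exp (\<theta> * real (block (clocks \<omega>) 0 h ((\<lambda>u v. x + int u + int v) (clocks \<omega> Plus h) (clocks \<omega> HatPlus h))))) \<partial>M) =
      (\<Prod>c\<in>walk_clocks. \<integral>\<^sup>+\<omega>. ?g c (clocks \<omega> c h) \<partial>M) * ennreal (exp (- h) / (1 - (1 - exp (- h)) * exp \<theta>))"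
      by (rule slab_integral[OF h \<theta>, where g="?g" and site="\<lambda>u v. x + int u + int v"])
    then show ?thesis unfolding prod_walk_clocks by (simp only: mult_ac)
  qed
  also have "\<dots> = ennreal (push_const \<theta> h)"
    unfolding minus_mgf[OF h] plus_mgf[OF h] push_const_def slab_const_def using \<theta>
    by (simp add: ennreal_mult[symmetric] mult.assoc)
  finally show ?thesis .
qed

definition bold_prob :: "real \<Rightarrow> nat \<Rightarrow> real" where
  "bold_prob h K = prob {\<omega> \<in> space M. \<forall>i\<le>K. clocks \<omega> Plus (h * real i / real (Suc K)) < clocks \<omega> Plus (h * real (Suc i) / real (Suc K))}
     * exp (- (clock_rate \<alpha> \<beta> Minus * h)) * exp (- (clock_rate \<alpha> \<beta> HatPlus * h)) * exp (- (clock_rate \<alpha> \<beta> HatMinus * h)) * exp (- h)"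

lemma prob_bold:
  assumes h: "0 < h"
  shows "emeasure M {\<omega> \<in> space M. bold h K r (clocks \<omega>)} = ennreal (bold_prob h K)"
proof -
  define A where "A = (\<lambda>c. if c = Plus then {f \<in> space path_space. \<forall>i\<le>K. f (h * real i / real (Suc K)) < (f (h * real (Suc i) / real (Suc K)) :: nat)} else {f \<in> space path_space. f h = 0})"
  define I where "I = {Plus, Minus, HatPlus, HatMinus, Arrow r}"
  have nn: "0 \<le> h * real i / real (Suc K)" for i using h by simp
  have A1: "{f \<in> space path_space. \<forall>i\<le>K. f (h * real i / real (Suc K)) < (f (h * real (Suc i) / real (Suc K)) :: nat)} \<in> sets path_space"
  proof -
    have [measurable]: "Measurable.pred path_space (\<lambda>f. f (h * real i / real (Suc K)) < (f (h * real (Suc i) / real (Suc K)) :: nat))" for i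
      using event_set[OF nn nn, of i "Suc i"] by (simp only: pred_def)
    show ?thesis by measurable
  qed
  have A2: "{f \<in> space path_space. f h = (0::nat)} \<in> sets path_space"
  proof -
    have "(\<lambda>f. f h) -` {0} \<inter> space (path_space :: (real \<Rightarrow> nat) measure) \<in> sets path_space"
      by (rule measurable_sets[OF measurable_component_singleton]) (use h in auto)
    then show ?thesis by (simp add: vimage_def Int_def conj_commute)
  qed
  have A: "A c \<in> sets path_space" for c by (cases "c = Plus") (simp_all only: A_def if_True if_False refl A1 A2)
  have v: "(\<lambda>\<omega>. clocks \<omega> c) -` A c \<inter> space M = (if c = Plus then {\<omega> \<in> space M. \<forall>i\<le>K. clocks \<omega> Plus (h * real i / real (Suc K)) < clocks \<omega> Plus (h * real (Suc i) / real (Suc K))}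
     else {\<omega> \<in> space M. clocks \<omega> c h = clocks \<omega> c 0})" for c
  proof (cases "c = Plus")
    case True
    show ?thesis unfolding A_def True if_P[OF refl] using measurable_space[OF measurable_clocks_component, of _ Plus] by blast
  next
    case False
    have "clocks \<omega> c \<in> {f \<in> space path_space. f h = 0} \<longleftrightarrow> clocks \<omega> c h = clocks \<omega> c 0" if "\<omega> \<in> space M" for \<omega>
      using measurable_space[OF measurable_clocks_component that, of c] clocks_0[OF that, of c] by simp
    then show ?thesis unfolding A_def if_not_P[OF False] by blast
  qed
  have "{\<omega> \<in> space M. bold h K r (clocks \<omega>)} = (\<Inter>c\<in>I. (\<lambda>\<omega>. clocks \<omega> c) -` A c \<inter> space M)"
  proof -
    have b: "bold h K r (clocks \<omega>) \<longleftrightarrow> (\<forall>i\<le>K. clocks \<omega> Plus (h * real i / real (Suc K)) < clocks \<omega> Plus (h * real (Suc i) / real (Suc K))) \<and>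
      (\<forall>c\<in>{Minus, HatPlus, HatMinus, Arrow r}. clocks \<omega> c h = clocks \<omega> c 0)" if "\<omega> \<in> space M" for \<omega>
      by (simp add: bold_def clocks_0[OF that] del: of_nat_Suc)
    have "(\<Inter>c\<in>I. (\<lambda>\<omega>. clocks \<omega> c) -` A c \<inter> space M) = ((\<lambda>\<omega>. clocks \<omega> Plus) -` A Plus \<inter> space M) \<inter>
      (\<Inter>c\<in>{Minus, HatPlus, HatMinus, Arrow r}. (\<lambda>\<omega>. clocks \<omega> c) -` A c \<inter> space M)"
      unfolding I_def by simp
    also have "\<dots> = {\<omega> \<in> space M. bold h K r (clocks \<omega>)}"
      unfolding v[of Plus] if_P[OF refl] using b v[of Minus] v[of HatPlus] v[of HatMinus] v[of "Arrow r"]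
      by (simp del: of_nat_Suc) blast
    finally show ?thesis ..
  qed
  then have "prob {\<omega> \<in> space M. bold h K r (clocks \<omega>)} = (\<Prod>c\<in>I. prob ((\<lambda>\<omega>. clocks \<omega> c) -` A c \<inter> space M))"
    using A indep_varsD[OF indep_clocks, of I A] by (simp add: I_def)
  also have "\<dots> = bold_prob h K"
    unfolding v using prob_no_event[of 0 h] h by (simp add: I_def bold_prob_def del: of_nat_Suc clock_rate.simps(1-4)) 
  finally show ?thesis by (simp add: emeasure_eq_measure)
qed

lemma bold_prob_pos:
  assumes h: "0 < h"
  shows "0 < bold_prob h K"
proof -
  define t where "t = (\<lambda>i. h * real i / real (Suc K))"
  have t: "0 \<le> t i" "mono t" for i
    unfolding t_def using h by (auto simp del: of_nat_Suc intro!: monoI divide_right_mono mult_left_mono)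
  have d: "t (Suc i) - t i = h / real (Suc K)" for i
    by (simp add: t_def diff_divide_distrib[symmetric] algebra_simps)
  define inc where "inc = (\<lambda>i \<omega>. N Plus \<omega> (t (Suc i)) - N Plus \<omega> (t i))"
  have cl: "clocks \<omega> Plus (t i) = N Plus \<omega> (t i)" for i \<omega> using t by (simp add: clocks_def)
  have eq: "inc i -` {0<..} \<inter> space M = {\<omega> \<in> space M. clocks \<omega> Plus (t i) < clocks \<omega> Plus (t (Suc i))}" for i
    unfolding cl by (auto simp: inc_def)
  have pos: "0 < prob (inc i -` {0<..} \<inter> space M)" for i
    unfolding eq using h \<alpha>_pos t monoD[OF t(2), of i "Suc i"] by (subst prob_event) (auto simp: d simp del: of_nat_Suc)
  have "indep_vars (\<lambda>_. count_space UNIV) inc UNIV"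
    unfolding inc_def using poisson_processD(4)[OF clocks_poisson t(1) t(2)] .
  then have "prob (\<Inter>i\<in>{..K}. inc i -` {0<..} \<inter> space M) = (\<Prod>i\<in>{..K}. prob (inc i -` {0<..} \<inter> space M))"
    by (rule indep_varsD) auto
  also have "\<dots> > 0" by (intro prod_pos) (simp add: pos)
  also have "(\<Inter>i\<in>{..K}. inc i -` {0<..} \<inter> space M) = {\<omega> \<in> space M. \<forall>i\<le>K. clocks \<omega> Plus (t i) < clocks \<omega> Plus (t (Suc i))}"
    unfolding eq by auto
  finally show ?thesis by (simp add: bold_prob_def t_def del: clock_rate.simps)
qed

lemma nn_integral_clock_law:
  assumes "F \<in> borel_measurable clock_space"
  shows "(\<integral>\<^sup>+f. F f \<partial>clock_law) = (\<integral>\<^sup>+\<omega>. F (clocks \<omega>) \<partial>M)"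
  unfolding clock_law_def using assms by (subst nn_integral_distr[OF measurable_clocks]) auto

text \<open>A functional of the coming slab whose mean does not depend on a parameter from the past factors out.\<close>

lemma slab_step:
  fixes r :: "(int \<Rightarrow> bool) \<Rightarrow> (clock \<Rightarrow> real \<Rightarrow> nat) \<Rightarrow> int" and w :: "int \<Rightarrow> (clock \<Rightarrow> real \<Rightarrow> nat) \<Rightarrow> ennreal"
  assumes T: "0 \<le> T" and G: "(\<lambda>x. G (fst x) (snd x)) \<in> borel_measurable (config_space \<Otimes>\<^sub>M clock_space)"
    and r: "(\<lambda>x. r (fst x) (snd x)) \<in> measurable (config_space \<Otimes>\<^sub>M clock_space) (count_space UNIV)"
    and w: "\<And>i. w i \<in> borel_measurable clock_space" and c: "\<And>i. (\<integral>\<^sup>+\<omega>. w i (clocks \<omega>) \<partial>M) = c"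
  shows "(\<integral>\<^sup>+\<omega>. G (\<eta> \<omega>) (stop_clocks T (clocks \<omega>)) * w (r (\<eta> \<omega>) (stop_clocks T (clocks \<omega>))) (shift_clocks T 0 (clocks \<omega>)) \<partial>M)
    = (\<integral>\<^sup>+\<omega>. G (\<eta> \<omega>) (stop_clocks T (clocks \<omega>)) \<partial>M) * c"
proof -
  interpret s: prob_space "stopped_law T" by (rule prob_space_laws(3)[OF T])
  interpret k: prob_space clock_law by (rule prob_space_laws(2))
  let ?S = "config_space \<Otimes>\<^sub>M (clock_space \<Otimes>\<^sub>M clock_space)"
  have ep: "(\<lambda>x. (fst x, fst (snd x))) \<in> measurable ?S (config_space \<Otimes>\<^sub>M clock_space)"
    by (auto intro!: measurable_Pair measurable_compose[OF measurable_snd measurable_fst])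
  have f3: "(\<lambda>x. snd (snd x)) \<in> measurable ?S clock_space" by (intro measurable_compose[OF measurable_snd measurable_snd])
  have G3: "(\<lambda>x. G (fst x) (fst (snd x))) \<in> borel_measurable ?S" using measurable_compose[OF ep G] by simp
  have r3: "(\<lambda>x. r (fst x) (fst (snd x))) \<in> measurable ?S (count_space UNIV)" using measurable_compose[OF ep r] by simp
  have w3: "(\<lambda>x. w (r (fst x) (fst (snd x))) (snd (snd x))) \<in> borel_measurable ?S"
    by (rule measurable_compose_countable[where f="\<lambda>i x. w i (snd (snd x))", OF measurable_compose[OF f3 w] r3])
  have c': "(\<integral>\<^sup>+f. w i f \<partial>clock_law) = c" for i using nn_integral_clock_law[OF w] c by simp
  have wm: "w i \<in> borel_measurable clock_law" for i using w by (simp add: clock_law_def)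
  have Gp: "(\<lambda>p. G e p) \<in> borel_measurable (stopped_law T)" for e
    using measurable_compose[OF measurable_Pair1'[of e config_space clock_space] G] by (simp add: space_PiM stopped_law_def)
  have "(\<integral>\<^sup>+\<omega>. G (\<eta> \<omega>) (stop_clocks T (clocks \<omega>)) * w (r (\<eta> \<omega>) (stop_clocks T (clocks \<omega>))) (shift_clocks T 0 (clocks \<omega>)) \<partial>M)
    = (\<integral>\<^sup>+e. \<integral>\<^sup>+p. \<integral>\<^sup>+f. G e p * w (r e p) f \<partial>clock_law \<partial>stopped_law T \<partial>config_law)"
    using nn_integral_past_future[OF T borel_measurable_times_ennreal[OF G3 w3]] by simp
  also have "\<dots> = (\<integral>\<^sup>+e. \<integral>\<^sup>+p. G e p * c \<partial>stopped_law T \<partial>config_law)"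
    by (intro nn_integral_cong) (simp add: nn_integral_cmult wm c')
  also have "\<dots> = (\<integral>\<^sup>+e. (\<integral>\<^sup>+p. G e p \<partial>stopped_law T) * c \<partial>config_law)"
    by (intro nn_integral_cong nn_integral_multc Gp)
  also have "\<dots> = (\<integral>\<^sup>+e. \<integral>\<^sup>+p. G e p \<partial>stopped_law T \<partial>config_law) * c"
  proof (rule nn_integral_multc)
    have "(\<lambda>(e, p). G e p) \<in> borel_measurable (config_law \<Otimes>\<^sub>M stopped_law T)"
      using G by (simp add: split_def cong: measurable_cong_sets sets_pair_measure_cong)
    then show "(\<lambda>e. \<integral>\<^sup>+p. G e p \<partial>stopped_law T) \<in> borel_measurable config_law"
      by (rule s.borel_measurable_nn_integral)
  qed
  also have "(\<integral>\<^sup>+e. \<integral>\<^sup>+p. G e p \<partial>stopped_law T \<partial>config_law) = (\<integral>\<^sup>+\<omega>. G (\<eta> \<omega>) (stop_clocks T (clocks \<omega>)) \<partial>M)"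
    using nn_integral_past_future[OF T G3] by (simp add: k.emeasure_space_1)
  finally show ?thesis .
qed

end

section \<open>Drift estimates\<close>

lemma slab_increments:
  assumes n: "good n" and s: "0 \<le> s" and h: "0 < h"
  defines "f \<equiv> shift_clocks s 0 n"
  shows "int (n c (s + h)) - int (n c s) = int (f c h)"
    and "walk \<alpha> \<beta> e n (s + h) \<ge> walk \<alpha> \<beta> e n s + of_bool (0 < f Plus h) - int (f Minus h) - int (f HatMinus h)"
    and "\<And>u. s \<le> u \<Longrightarrow> u \<le> s + h \<Longrightarrow> walk \<alpha> \<beta> e n u \<ge> walk \<alpha> \<beta> e n s - int (f Minus h) - int (f HatMinus h)"
    and "block n s (s + h) r = block f 0 h r"
proof -
  have tr: "translate 0 c = c" for c by (cases c) auto
  have le: "n c s \<le> n c u" if "s \<le> u" for c u using s that by (intro counting_path_mono good_path n) auto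
  have inc: "int (n c (s + h)) - int (n c s) = int (f c h)" for c
    using le[of "s + h" c] h by (simp add: f_def shift_clocks_def tr)
  show "int (n c (s + h)) - int (n c s) = int (f c h)" by (rule inc)
  have "of_bool (0 < f Plus h) \<le> int (card (jump_times (n Plus) \<inter> {s<..s + h}))"
  proof (cases "0 < f Plus h")
    case True
    then have "n Plus s < n Plus (s + h)" using inc[of Plus] by simp
    then have "jump_times (n Plus) \<inter> {s<..s + h} \<noteq> {}"
      using jump_times_Ioc_nonempty_iff[OF good_path[OF n] s, of "s + h" Plus] h by simp
    then have "0 < card (jump_times (n Plus) \<inter> {s<..s + h})"
      using finite_jump_times_subset[OF good_path[OF n]] by (simp add: card_gt_0_iff)
    then show ?thesis by simp
  qed simp
  then show "walk \<alpha> \<beta> e n (s + h) \<ge> walk \<alpha> \<beta> e n s + of_bool (0 < f Plus h) - int (f Minus h) - int (f HatMinus h)"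
    using walk_increment_bounds(2)[OF good_paths[OF n] s, of "s + h" \<alpha> \<beta> e] inc[of Minus] inc[of HatMinus] h by linarith
  show "walk \<alpha> \<beta> e n u \<ge> walk \<alpha> \<beta> e n s - int (f Minus h) - int (f HatMinus h)" if "s \<le> u" "u \<le> s + h" for u
  proof -
    have "n c u \<le> n c (s + h)" for c using s that by (intro counting_path_mono good_path n) auto
    from this[of Minus] this[of HatMinus] show ?thesis
      using walk_increment_bounds(2)[OF good_paths[OF n] s that(1), of \<alpha> \<beta> e] inc[of Minus] inc[of HatMinus] by linarith
  qed
  show "block n s (s + h) r = block f 0 h r" unfolding f_def by (rule block_shift[OF s h good_paths[OF n], symmetric])
qed

text \<open>The block begins either at the old front or at the farthest site that the walk may have
  reached. Each case is bounded by one of the two summands, and the other summand is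
  nonnegative.\<close>

lemma front_step:
  assumes n: "good n" and h: "0 < h" and \<theta>: "0 < \<theta>"
    and f_def: "f = shift_clocks (h * real m) 0 n"
  shows "exp (\<theta> * real_of_int (front \<alpha> \<beta> h e n (Suc m) - walk \<alpha> \<beta> e n (h * real (Suc m)))) \<le>
    exp (\<theta> * real_of_int (front \<alpha> \<beta> h e n m - walk \<alpha> \<beta> e n (h * real m))) * front_weight \<theta> h (front \<alpha> \<beta> h e n m) f
    + push_weight \<theta> h (walk \<alpha> \<beta> e n (h * real m)) f"
proof -
  define s where "s = h * real m"
  have s: "0 \<le> s" using h by (simp add: s_def)
  have t: "h * real (Suc m) = s + h" by (simp add: s_def algebra_simps)
  note inc = slab_increments[OF n s h, folded f_def[folded s_def]]
  let ?R = "front \<alpha> \<beta> h e n m" and ?X = "walk \<alpha> \<beta> e n s" and ?X' = "walk \<alpha> \<beta> e n (s + h)"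
  define b where "b = (if n HatPlus (s + h) = n HatPlus s \<and> n HatMinus (s + h) = n HatMinus s then ?R
          else max ?R (?X + int (f Plus h) + int (f HatPlus h)))"
  have fr: "front \<alpha> \<beta> h e n (Suc m) = b + int (block f 0 h b)"
    unfolding front.simps Let_def t s_def[symmetric] inc(1) inc(4) b_def by (simp add: f_def s_def)
  have X': "?X' \<ge> ?X + of_bool (0 < f Plus h) - int (f Minus h) - int (f HatMinus h)"
    using inc(2)[of \<alpha> \<beta> e] by (simp add: f_def s_def)
  have X'': "?X' \<ge> ?X - int (f Minus h) - int (f HatMinus h)" using X' by (cases "0 < f Plus h") auto
  have "b = ?R \<or> b = ?X + int (f Plus h) + int (f HatPlus h)" by (auto simp: b_def max_def)
  then have "exp (\<theta> * real_of_int (b + int (block f 0 h b) - ?X')) \<le>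
    exp (\<theta> * real_of_int (?R - ?X)) * front_weight \<theta> h ?R f + push_weight \<theta> h ?X f"
  proof
    assume b: "b = ?R"
    have "exp (\<theta> * real_of_int (b + int (block f 0 h b) - ?X')) \<le>
      exp (\<theta> * real_of_int (?R - ?X + int (block f 0 h ?R) + int (f Minus h) + int (f HatMinus h) - of_bool (0 < f Plus h)))"
      unfolding b using \<theta> X' by (intro exp_mono mult_left_mono of_int_le_iff[THEN iffD2]) auto
    also have "\<dots> = exp (\<theta> * real_of_int (?R - ?X)) * front_weight \<theta> h ?R f"
      unfolding front_weight_def slab_weight_def exp_add[symmetric] by (simp add: algebra_simps)
    also have "\<dots> \<le> \<dots> + push_weight \<theta> h ?X f" by (simp add: push_weight_def slab_weight_def)
    finally show ?thesis .
  next
    assume b: "b = ?X + int (f Plus h) + int (f HatPlus h)"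
    have "exp (\<theta> * real_of_int (b + int (block f 0 h b) - ?X')) \<le>
      exp (\<theta> * real_of_int (int (block f 0 h b) + int (f Minus h) + int (f HatMinus h) + int (f Plus h) + int (f HatPlus h)))"
      using \<theta> X'' b by (intro exp_mono mult_left_mono of_int_le_iff[THEN iffD2]) auto
    also have "\<dots> = push_weight \<theta> h ?X f"
      unfolding push_weight_def slab_weight_def exp_add[symmetric] b[symmetric] by (simp add: algebra_simps)
    also have "\<dots> \<le> exp (\<theta> * real_of_int (?R - ?X)) * front_weight \<theta> h ?R f + \<dots>" by (simp add: front_weight_def slab_weight_def)
    finally show ?thesis .
  qed
  then show ?thesis unfolding fr t by (simp add: s_def)
qed

lemma ahead_step:
  assumes n: "good n" and h: "0 < h"
    and K: "front \<alpha> \<beta> h e n m - walk \<alpha> \<beta> e n (h * real m) \<le> int K"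
    and bold: "bold h K (front \<alpha> \<beta> h e n m) (shift_clocks (h * real m) 0 n)"
  shows "front \<alpha> \<beta> h e n (Suc m) < walk \<alpha> \<beta> e n (h * real (Suc m))"
proof -
  define s where "s = h * real m"
  define f where "f = shift_clocks s 0 n"
  have s: "0 \<le> s" using h by (simp add: s_def)
  have t: "h * real (Suc m) = s + h" by (simp add: s_def algebra_simps)
  note inc = slab_increments[OF n s h, folded f_def]
  let ?R = "front \<alpha> \<beta> h e n m"
  have b: "bold h K ?R f" using bold by (simp add: f_def s_def)
  have le: "n c s \<le> n c (s + x)" if "0 \<le> x" for c x using s that by (intro counting_path_mono good_path n) auto
  have f0: "f c 0 = 0" for c by (simp add: f_def shift_clocks_def)
  have "block f 0 h ?R = 0"
    unfolding block_def using b by (intro Least_equality) (auto simp: bold_def f0)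
  then have fr: "front \<alpha> \<beta> h e n (Suc m) = ?R"
    using inc(1)[of HatPlus] inc(1)[of HatMinus] b
    unfolding front.simps Let_def t s_def[symmetric] inc(4) by (simp add: bold_def)
  have "Suc K \<le> card (jump_times (n Plus) \<inter> {s<..s + h})"
  proof (rule card_jump_times_ge[OF good_path[OF n] s h])
    fix i assume "i \<le> K"
    then have *: "f Plus (h * real i / real (Suc K)) < f Plus (h * real (Suc i) / real (Suc K))"
      using b unfolding bold_def by blast
    have nn: "0 \<le> h * real i / real (Suc K)" "0 \<le> h * real (Suc i) / real (Suc K)" using h by simp_all
    show "n Plus (s + h * real i / real (Suc K)) < n Plus (s + h * real (Suc i) / real (Suc K))"
      using * le[OF nn(1), of Plus] le[OF nn(2), of Plus] nn
      by (simp add: f_def shift_clocks_def del: of_nat_Suc)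
  qed
  then have "walk \<alpha> \<beta> e n (s + h) \<ge> walk \<alpha> \<beta> e n s + int (Suc K)"
    using walk_increment_bounds(2)[OF good_paths[OF n] s, of "s + h" \<alpha> \<beta> e] inc(1)[of Minus] inc(1)[of HatMinus] h b
    by (simp add: bold_def)
  then show ?thesis using K unfolding fr t by (simp add: s_def)
qed

text \<open>\<open>Y\<close> uses arrows only, so the first edge without an arrow stops it, exactly
  as it stops the front in a slab without hatted rings.\<close>

lemma right_path_slab:
  assumes n: "good n" and s: "0 \<le> s" and h: "0 < h" and u: "s \<le> u" "u \<le> s + h"
  shows "right_path n 0 y u \<le> right_path n 0 y s + int (block (shift_clocks s 0 n) 0 h (right_path n 0 y s))"
proof -
  let ?n = "shift_clocks s 0 n"
  define r where "r = right_path n 0 y s"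
  define B where "B = r + int (block n s (s + h) r)"
  have "n (Arrow B) (s + h) = n (Arrow B) s" unfolding B_def using s h by (intro block_quiet n) auto
  then have "quiet ?n (s + h - s) B" using s h by (intro quiet_shift[OF n s]) auto
  then have q: "quiet ?n (u - s) B" using u by (auto simp: quiet_def)
  have "right_path n 0 y u = right_path n s r u" unfolding r_def using s u by (intro right_path_append n) auto
  also have "\<dots> = right_path ?n 0 r (u - s)" using right_path_shift[OF n s order_refl, of 0 r "u - s"] by simp
  also have "\<dots> \<le> B" by (rule right_path_bounds[OF good_shift[OF n s] q]) (simp add: B_def)
  finally show ?thesis unfolding B_def r_def slab_increments(4)[OF n s h] .
qed

text \<open>The second part prepares a Markov inequality: if the walk is caught during the slab, the
  gap at its beginning plus all losses of the slab is nonnegative. A step to the right may come only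
  later in the slab, hence \<open>slab_weight\<close> without this credit.\<close>

lemma gap_step:
  assumes n: "good n" and h: "0 < h" and \<theta>: "0 < \<theta>" and s: "0 \<le> s"
  defines "f \<equiv> shift_clocks s 0 n" and "Y \<equiv> right_path n 0 (-1)"
  shows "exp (\<theta> * real_of_int (Y (s + h) - walk \<alpha> \<beta> e n (s + h))) \<le>
      exp (\<theta> * real_of_int (Y s - walk \<alpha> \<beta> e n s)) * front_weight \<theta> h (Y s) f"
    and "\<And>u. s \<le> u \<Longrightarrow> u \<le> s + h \<Longrightarrow> walk \<alpha> \<beta> e n u \<le> Y u \<Longrightarrow>
      1 \<le> exp (\<theta> * real_of_int (Y s - walk \<alpha> \<beta> e n s)) * slab_weight \<theta> h (Y s) f"
proof -
  let ?X = "walk \<alpha> \<beta> e n"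
  note inc = slab_increments[OF n s h, folded f_def]
  have Y: "Y u \<le> Y s + int (block f 0 h (Y s))" if "s \<le> u" "u \<le> s + h" for u
    unfolding Y_def f_def by (rule right_path_slab[OF n s h that])
  have "exp (\<theta> * real_of_int (Y (s + h) - ?X (s + h))) \<le>
    exp (\<theta> * real_of_int (Y s - ?X s + int (block f 0 h (Y s)) + int (f Minus h) + int (f HatMinus h) - of_bool (0 < f Plus h)))"
    using \<theta> inc(2)[of \<alpha> \<beta> e] Y[of "s + h"] h by (intro exp_mono mult_left_mono of_int_le_iff[THEN iffD2]) auto
  also have "\<dots> = exp (\<theta> * real_of_int (Y s - ?X s)) * front_weight \<theta> h (Y s) f"
    unfolding front_weight_def slab_weight_def exp_add[symmetric] by (simp add: algebra_simps)
  finally show "exp (\<theta> * real_of_int (Y (s + h) - ?X (s + h))) \<le> exp (\<theta> * real_of_int (Y s - ?X s)) * front_weight \<theta> h (Y s) f" .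
  fix u assume u: "s \<le> u" "u \<le> s + h" "?X u \<le> Y u"
  have "0 \<le> Y s - ?X s + int (block f 0 h (Y s)) + int (f Minus h) + int (f HatMinus h)"
    using inc(3)[OF u(1,2), of \<alpha> \<beta> e] Y[OF u(1,2)] u(3) by linarith
  then have "0 \<le> \<theta> * real_of_int (Y s - ?X s + int (block f 0 h (Y s)) + int (f Minus h) + int (f HatMinus h))"
    using \<theta> by (intro mult_nonneg_nonneg) (simp_all only: of_int_0_le_iff less_imp_le)
  then have "1 \<le> exp (\<theta> * real_of_int (Y s - ?X s + int (block f 0 h (Y s)) + int (f Minus h) + int (f HatMinus h)))"
    by simp
  also have "\<dots> = exp (\<theta> * real_of_int (Y s - ?X s)) * slab_weight \<theta> h (Y s) f"
    unfolding slab_weight_def exp_add[symmetric] by (simp add: algebra_simps)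
  finally show "1 \<le> exp (\<theta> * real_of_int (Y s - ?X s)) * slab_weight \<theta> h (Y s) f" .
qed

lemma measurable_slab_weights:
  assumes h: "0 < h"
  shows "(\<lambda>f. ennreal (slab_weight \<theta> h r f)) \<in> borel_measurable clock_space"
    and "(\<lambda>f. ennreal (front_weight \<theta> h r f)) \<in> borel_measurable clock_space"
    and "(\<lambda>f. ennreal (push_weight \<theta> h r f)) \<in> borel_measurable clock_space"
    and "(\<lambda>f. of_bool (bold h K r f) :: ennreal) \<in> borel_measurable clock_space"
proof -
  interpret clock_family clock_space "\<lambda>_ _. False" "\<lambda>f. f" by (rule clock_familyI) (auto simp: space_PiM)
  have c: "(\<lambda>f. f c t) \<in> measurable clock_space (count_space UNIV)" if "0 \<le> t" for c t by (rule measurable_clock_space_component[OF that])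
  have [measurable]: "(\<lambda>f. real (f c h)) \<in> borel_measurable clock_space" for c
    using h by (intro measurable_compose[OF c]) auto
  have b: "(\<lambda>f. block f 0 h (R f)) \<in> measurable clock_space (count_space UNIV)" if "R \<in> measurable clock_space (count_space UNIV)" for R
    using h by (intro measurable_block that) auto
  have [measurable]: "(\<lambda>f. real (block f 0 h (R f))) \<in> borel_measurable clock_space" if "R \<in> measurable clock_space (count_space UNIV)" for R
    by (rule measurable_compose[OF b[OF that]]) simp
  have [measurable]: "(\<lambda>f. real (block f 0 h r)) \<in> borel_measurable clock_space" for r
    by (rule measurable_compose[OF b]) simp_all
  have [measurable]: "(\<lambda>f. of_bool (0 < f c h) :: real) \<in> borel_measurable clock_space" for c
    using h by (intro measurable_compose[OF c]) auto
  have R: "(\<lambda>f. r + int (f Plus h) + int (f HatPlus h)) \<in> measurable clock_space (count_space UNIV)"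
    using h by (intro measurable_compose_countable[where f="\<lambda>i f. r + int i + int (f HatPlus h)" and g="\<lambda>f. f Plus h", OF measurable_compose[OF c] c]) auto
  have [measurable]: "(\<lambda>f. real (block f 0 h (r + int (f Plus h) + int (f HatPlus h)))) \<in> borel_measurable clock_space"
    by (rule measurable_compose[OF b[OF R]]) simp
  show "(\<lambda>f. ennreal (slab_weight \<theta> h r f)) \<in> borel_measurable clock_space"
    "(\<lambda>f. ennreal (front_weight \<theta> h r f)) \<in> borel_measurable clock_space"
    "(\<lambda>f. ennreal (push_weight \<theta> h r f)) \<in> borel_measurable clock_space"
    unfolding front_weight_def push_weight_def slab_weight_def by measurable
  have [measurable]: "Measurable.pred clock_space (\<lambda>f. f Plus (h * real i / real (Suc K)) < f Plus (h * real (Suc i) / real (Suc K)))" for i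
    using h by (intro pred_nat_less c) auto
  have [measurable]: "Measurable.pred clock_space (\<lambda>f. f c h = 0)" for c
    using h by (intro measurable_compose[OF c]) auto
  have "Measurable.pred clock_space (bold h K r)" unfolding bold_def by measurable
  then show "(\<lambda>f. of_bool (bold h K r f) :: ennreal) \<in> borel_measurable clock_space"
    by (rule measurable_compose) simp
qed

lemma ennreal_affine_recursion:
  fixes a :: "nat \<Rightarrow> ennreal" and \<kappa> C A :: real
  assumes k: "0 < \<kappa>" "\<kappa> < 1" and C: "0 \<le> C" and A: "0 \<le> A" "a 0 \<le> ennreal A"
    and step: "\<And>j. a (Suc j) \<le> a j * ennreal \<kappa> + ennreal C"
  shows "a j \<le> ennreal (\<kappa> ^ j * A + C / (1 - \<kappa>))"
proof (induction j)
  case 0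
  show ?case using k C A(1) by (intro order_trans[OF A(2)] ennreal_leI) simp
next
  case (Suc j)
  have nn: "0 \<le> \<kappa> ^ j * A + C / (1 - \<kappa>)" using k C A(1) by simp
  have "a (Suc j) \<le> ennreal (\<kappa> ^ j * A + C / (1 - \<kappa>)) * ennreal \<kappa> + ennreal C"
    by (intro order_trans[OF step] add_right_mono mult_right_mono Suc) simp
  also have "\<dots> = ennreal ((\<kappa> ^ j * A + C / (1 - \<kappa>)) * \<kappa> + C)"
    using nn k C by (simp add: ennreal_mult[symmetric] ennreal_plus[symmetric] del: ennreal_plus)
  also have "(\<kappa> ^ j * A + C / (1 - \<kappa>)) * \<kappa> + C = \<kappa> ^ Suc j * A + C / (1 - \<kappa>)"
    using k by (simp add: field_simps)
  finally show ?case .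
qed

lemma stop_stop_clocks: "0 \<le> T \<Longrightarrow> T \<le> T' \<Longrightarrow> stop_clocks T (stop_clocks T' n) = stop_clocks T n"
  by (intro ext) (auto simp: stop_clocks_def min_def)

section \<open>Contraction of exponential moments from slab to slab\<close>

text \<open>\<open>h \<in> \<rat>\<close> puts the slab ends among the rational times at which
  \<open>caught\<close> looks, as \<open>leads_compose\<close> demands; \<open>block_small\<close>
  makes the moments of the blocks finite.\<close>

locale slab_walk = exclusion_walk +
  fixes h \<theta> :: real
  assumes h_pos: "0 < h" and h_rat: "h \<in> \<rat>" and \<theta>_pos: "0 < \<theta>"
    and block_small: "(1 - exp (- h)) * exp \<theta> < 1" and contraction: "front_const \<theta> h < 1"
begin

abbreviation "\<kappa> \<equiv> front_const \<theta> h"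

lemma \<kappa>: "0 < \<kappa>" "\<kappa> < 1" and slab_consts: "0 < slab_const \<theta> h" "0 < push_const \<theta> h"
  using consts_pos[OF h_pos block_small] contraction by auto

definition grid :: "nat \<Rightarrow> real" where "grid m = h * real m"

lemma grid: "0 \<le> grid m" "grid (Suc m) = grid m + h" "grid 0 = 0" "grid m \<in> \<rat>" "m \<le> m' \<Longrightarrow> grid m \<le> grid m'" "m < m' \<Longrightarrow> grid m < grid m'"
  using h_pos h_rat by (auto simp: grid_def algebra_simps)

abbreviation "R m e p \<equiv> front \<alpha> \<beta> h e p m"
abbreviation "Y m p \<equiv> right_path p 0 (-1) (grid m)"
text \<open>Lyapunov function for the deficit of the walk against the front; \<open>gap\<close> is
  its analogue for \<open>Y\<close> in place of the front.\<close>

abbreviation "pot m e p \<equiv> ennreal (exp (\<theta> * real_of_int (R m e p - X e p (grid m))))"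
abbreviation "gap m e p \<equiv> ennreal (exp (\<theta> * real_of_int (Y m p - X e p (grid m))))"
abbreviation "pst m \<omega> \<equiv> stop_clocks (grid m) (clocks \<omega>)"
abbreviation "slab m \<omega> \<equiv> shift_clocks (grid m) 0 (clocks \<omega>)"
abbreviation "cond Q m \<omega> \<equiv> (of_bool (Q (\<eta> \<omega>, pst m \<omega>)) :: ennreal)"

lemma measurable_front_walk:
  "(\<lambda>x. R m (fst x) (snd x)) \<in> measurable (config_space \<Otimes>\<^sub>M clock_space) (count_space UNIV)"
  "(\<lambda>x. X (fst x) (snd x) (grid m)) \<in> measurable (config_space \<Otimes>\<^sub>M clock_space) (count_space UNIV)"
  "(\<lambda>x. Y m (snd x)) \<in> measurable (config_space \<Otimes>\<^sub>M clock_space) (count_space UNIV)"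
proof -
  interpret clock_family "config_space \<Otimes>\<^sub>M clock_space" fst snd by (rule clock_familyI) auto
  show "(\<lambda>x. R m (fst x) (snd x)) \<in> measurable (config_space \<Otimes>\<^sub>M clock_space) (count_space UNIV)" by (rule measurable_front[OF h_pos])
  show "(\<lambda>x. X (fst x) (snd x) (grid m)) \<in> measurable (config_space \<Otimes>\<^sub>M clock_space) (count_space UNIV)" by (rule measurable_walk[OF grid(1)])
  show "(\<lambda>x. Y m (snd x)) \<in> measurable (config_space \<Otimes>\<^sub>M clock_space) (count_space UNIV)"
    by (intro measurable_right_path) simp_all
qed

lemma measurable_exp_int:
  assumes "f \<in> measurable \<Omega> (count_space UNIV)" "g \<in> measurable \<Omega> (count_space UNIV)"
  shows "(\<lambda>x. ennreal (exp (\<theta> * real_of_int (f x - g x)))) \<in> borel_measurable \<Omega>"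
  by (rule measurable_compose[OF measurable_int_diff[OF assms]]) simp

lemma past_pred: "past T Q \<Longrightarrow> Measurable.pred (config_space \<Otimes>\<^sub>M clock_space) Q"
  by (simp add: past_def)

lemma measurable_of_bool_past:
  "past T Q \<Longrightarrow> (\<lambda>x. of_bool (Q (fst x, snd x)) :: ennreal) \<in> borel_measurable (config_space \<Otimes>\<^sub>M clock_space)"
  using measurable_compose[OF past_pred, of T Q of_bool borel] by simp

lemma measurable_pair: "(\<lambda>\<omega>. (\<eta> \<omega>, clocks \<omega>)) \<in> measurable M (config_space \<Otimes>\<^sub>M clock_space)"
  "(\<lambda>\<omega>. (\<eta> \<omega>, pst m \<omega>)) \<in> measurable M (config_space \<Otimes>\<^sub>M clock_space)"
  by (auto intro!: measurable_Pair initial_measurable measurable_clocks measurable_stop_clocks grid)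

lemma measurable_cond: "past (grid m) Q \<Longrightarrow> cond Q m \<in> borel_measurable M"
  using measurable_compose[OF measurable_pair(2) measurable_of_bool_past] by simp

lemma measurable_exp_gaps: "(\<lambda>\<omega>. pot m (\<eta> \<omega>) (clocks \<omega>)) \<in> borel_measurable M"
  "(\<lambda>\<omega>. gap m (\<eta> \<omega>) (clocks \<omega>)) \<in> borel_measurable M"
  using measurable_compose[OF measurable_pair(1) measurable_exp_int[OF measurable_front_walk(1,2)]]
    measurable_compose[OF measurable_pair(1) measurable_exp_int[OF measurable_front_walk(3,2)]] by simp_all

text \<open>An event known at \<open>T\<close> is known later. The predicate then receives a longer
  past, from which the second stopping recovers the shorter one.\<close>

lemma past_mono:
  assumes Q: "past T Q" and T: "0 \<le> T" "T \<le> T'"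
  shows "past T' (\<lambda>(e, p). Q (e, stop_clocks T p))"
  unfolding past_def
proof (intro conjI allI impI)
  have "(\<lambda>x. (fst x, stop_clocks T (snd x))) \<in> measurable (config_space \<Otimes>\<^sub>M clock_space) (config_space \<Otimes>\<^sub>M clock_space)"
    using T by (intro measurable_Pair measurable_stop_clocks) auto
  from measurable_compose[OF this past_pred[OF Q]]
  show "Measurable.pred (config_space \<Otimes>\<^sub>M clock_space) (\<lambda>(e, p). Q (e, stop_clocks T p))" by (simp add: split_def)
  fix e e' p assume p: "good p" and eq: "\<forall>t. 0 \<le> t \<longrightarrow> t \<le> T' \<longrightarrow> X e p t = X e' p t"
  have "good (stop_clocks T p)" by (rule good_stop[OF p T(1)])
  moreover have "X e (stop_clocks T p) t = X e' (stop_clocks T p) t" if "0 \<le> t" "t \<le> T" for t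
    using eq that T by (simp add: walk_stop[OF p])
  ultimately show "(case (e, p) of (e, p) \<Rightarrow> Q (e, stop_clocks T p)) = (case (e', p) of (e, p) \<Rightarrow> Q (e, stop_clocks T p))"
    using Q unfolding past_def by auto
qed

lemma cond_mono:
  assumes "m \<le> m'"
  shows "cond (\<lambda>(e, p). Q (e, stop_clocks (grid m) p)) m' \<omega> = cond Q m \<omega>"
  using stop_stop_clocks[OF grid(1) grid(5)[OF assms]] by simp

lemma stop_front_walk:
  assumes "good (clocks \<omega>)"
  shows "R m (\<eta> \<omega>) (pst m \<omega>) = R m (\<eta> \<omega>) (clocks \<omega>)" "X (\<eta> \<omega>) (pst m \<omega>) (grid m) = X (\<eta> \<omega>) (clocks \<omega>) (grid m)"
    "Y m (pst m \<omega>) = Y m (clocks \<omega>)"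
  using front_stop[OF assms h_pos, of m "grid m"] walk_stop[OF assms grid(1) order_refl] right_path_stop[OF assms grid(1) order_refl]
  by (simp_all add: grid_def)

text \<open>Version of \<open>slab_step\<close> for the original clocks: on regular realisations
  front, walk and \<open>Y\<close> at the slab end are the same for stopped and unstopped clocks, so
  the integrals agree.\<close>

lemma slab_step_grid:
  fixes r :: "(int \<Rightarrow> bool) \<Rightarrow> (clock \<Rightarrow> real \<Rightarrow> nat) \<Rightarrow> int" and w :: "int \<Rightarrow> (clock \<Rightarrow> real \<Rightarrow> nat) \<Rightarrow> ennreal"
  assumes Q: "past (grid m) Q" and w: "\<And>i. w i \<in> borel_measurable clock_space" and c: "\<And>i. (\<integral>\<^sup>+\<omega>. w i (clocks \<omega>) \<partial>M) = c"
    and G: "(\<lambda>x. G (fst x) (snd x)) \<in> borel_measurable (config_space \<Otimes>\<^sub>M clock_space)"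
    and r: "(\<lambda>x. r (fst x) (snd x)) \<in> measurable (config_space \<Otimes>\<^sub>M clock_space) (count_space UNIV)"
    and stop: "\<And>\<omega>. good (clocks \<omega>) \<Longrightarrow> G (\<eta> \<omega>) (pst m \<omega>) = G (\<eta> \<omega>) (clocks \<omega>) \<and> r (\<eta> \<omega>) (pst m \<omega>) = r (\<eta> \<omega>) (clocks \<omega>)"
  shows "(\<integral>\<^sup>+\<omega>. cond Q m \<omega> * G (\<eta> \<omega>) (clocks \<omega>) * w (r (\<eta> \<omega>) (clocks \<omega>)) (slab m \<omega>) \<partial>M) =
    (\<integral>\<^sup>+\<omega>. cond Q m \<omega> * G (\<eta> \<omega>) (clocks \<omega>) \<partial>M) * c"
proof -
  have "(\<integral>\<^sup>+\<omega>. cond Q m \<omega> * G (\<eta> \<omega>) (clocks \<omega>) * w (r (\<eta> \<omega>) (clocks \<omega>)) (slab m \<omega>) \<partial>M) =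
    (\<integral>\<^sup>+\<omega>. (cond Q m \<omega> * G (\<eta> \<omega>) (pst m \<omega>)) * w (r (\<eta> \<omega>) (pst m \<omega>)) (slab m \<omega>) \<partial>M)"
    by (rule nn_integral_cong_AE, rule AE_mp[OF AE_good]) (auto intro!: AE_I2 simp: stop)
  also have "\<dots> = (\<integral>\<^sup>+\<omega>. cond Q m \<omega> * G (\<eta> \<omega>) (pst m \<omega>) \<partial>M) * c"
    by (rule slab_step[where r=r and w=w and G="\<lambda>e p. of_bool (Q (e, p)) * G e p" and T="grid m", OF grid(1) borel_measurable_times_ennreal[OF measurable_of_bool_past[OF Q] G] r]) (rule w c)+
  also have "(\<integral>\<^sup>+\<omega>. cond Q m \<omega> * G (\<eta> \<omega>) (pst m \<omega>) \<partial>M) = (\<integral>\<^sup>+\<omega>. cond Q m \<omega> * G (\<eta> \<omega>) (clocks \<omega>) \<partial>M)"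
    by (rule nn_integral_cong_AE, rule AE_mp[OF AE_good]) (auto intro!: AE_I2 simp: stop)
  finally show ?thesis .
qed

lemma measurable_weight:
  fixes w :: "'i::countable \<Rightarrow> _"
  assumes w: "\<And>i. w i \<in> borel_measurable clock_space"
    and r: "(\<lambda>x. r (fst x) (snd x)) \<in> measurable (config_space \<Otimes>\<^sub>M clock_space) (count_space UNIV)"
  shows "(\<lambda>\<omega>. w (r (\<eta> \<omega>) (clocks \<omega>)) (slab m \<omega>) :: ennreal) \<in> borel_measurable M"
proof (rule measurable_compose_countable[where f="\<lambda>i \<omega>. w i (slab m \<omega>)" and g="\<lambda>\<omega>. r (\<eta> \<omega>) (clocks \<omega>)"])
  show "(\<lambda>\<omega>. w i (slab m \<omega>)) \<in> borel_measurable M" for i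
    by (rule measurable_compose[OF measurable_shift_clocks[OF measurable_clocks grid(1)] w]) simp
  show "(\<lambda>\<omega>. r (\<eta> \<omega>) (clocks \<omega>)) \<in> measurable M (count_space UNIV)"
    using measurable_compose[OF measurable_pair(1) r] by simp
qed

text \<open>Holding on every event \<open>Q\<close> of the past, this is a conditional drift
  inequality without conditional expectations. The two terms of \<open>front_step\<close> are
  integrated separately: the first contracts, the second contributes a constant times the
  probability of \<open>Q\<close>.\<close>

lemma front_drift:
  assumes Q: "past (grid m) Q"
  shows "(\<integral>\<^sup>+\<omega>. cond Q m \<omega> * pot (Suc m) (\<eta> \<omega>) (clocks \<omega>) \<partial>M) \<le>
    (\<integral>\<^sup>+\<omega>. cond Q m \<omega> * pot m (\<eta> \<omega>) (clocks \<omega>) \<partial>M) * ennreal \<kappa> + (\<integral>\<^sup>+\<omega>. cond Q m \<omega> \<partial>M) * ennreal (push_const \<theta> h)"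
proof -
  let ?w1 = "\<lambda>i f. ennreal (front_weight \<theta> h i f)" and ?w2 = "\<lambda>i f. ennreal (push_weight \<theta> h i f)"
  have "(\<integral>\<^sup>+\<omega>. cond Q m \<omega> * pot (Suc m) (\<eta> \<omega>) (clocks \<omega>) \<partial>M) \<le>
    (\<integral>\<^sup>+\<omega>. cond Q m \<omega> * pot m (\<eta> \<omega>) (clocks \<omega>) * ?w1 (R m (\<eta> \<omega>) (clocks \<omega>)) (slab m \<omega>)
      + cond Q m \<omega> * 1 * ?w2 (X (\<eta> \<omega>) (clocks \<omega>) (grid m)) (slab m \<omega>) \<partial>M)"
  proof (rule nn_integral_mono_AE, rule AE_mp[OF AE_good], rule AE_I2, rule impI)
    fix \<omega> assume n: "good (clocks \<omega>)"
    have "exp (\<theta> * real_of_int (R (Suc m) (\<eta> \<omega>) (clocks \<omega>) - X (\<eta> \<omega>) (clocks \<omega>) (grid (Suc m)))) \<le>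
      exp (\<theta> * real_of_int (R m (\<eta> \<omega>) (clocks \<omega>) - X (\<eta> \<omega>) (clocks \<omega>) (grid m))) * front_weight \<theta> h (R m (\<eta> \<omega>) (clocks \<omega>)) (slab m \<omega>)
      + push_weight \<theta> h (X (\<eta> \<omega>) (clocks \<omega>) (grid m)) (slab m \<omega>)"
      unfolding grid_def by (rule front_step[OF n h_pos \<theta>_pos refl])
    moreover have "0 \<le> front_weight \<theta> h i f" "0 \<le> push_weight \<theta> h i f" for i f
      by (simp_all add: front_weight_def push_weight_def slab_weight_def)
    ultimately have "pot (Suc m) (\<eta> \<omega>) (clocks \<omega>) \<le> pot m (\<eta> \<omega>) (clocks \<omega>) * ?w1 (R m (\<eta> \<omega>) (clocks \<omega>)) (slab m \<omega>) + ?w2 (X (\<eta> \<omega>) (clocks \<omega>) (grid m)) (slab m \<omega>)"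
      by (simp add: ennreal_mult'[symmetric] ennreal_plus[symmetric] ennreal_leI del: ennreal_plus)
    then show "cond Q m \<omega> * pot (Suc m) (\<eta> \<omega>) (clocks \<omega>) \<le> cond Q m \<omega> * pot m (\<eta> \<omega>) (clocks \<omega>) * ?w1 (R m (\<eta> \<omega>) (clocks \<omega>)) (slab m \<omega>)
      + cond Q m \<omega> * 1 * ?w2 (X (\<eta> \<omega>) (clocks \<omega>) (grid m)) (slab m \<omega>)"
      by (cases "Q (\<eta> \<omega>, pst m \<omega>)") simp_all
  qed
  also have "\<dots> = (\<integral>\<^sup>+\<omega>. cond Q m \<omega> * pot m (\<eta> \<omega>) (clocks \<omega>) * ?w1 (R m (\<eta> \<omega>) (clocks \<omega>)) (slab m \<omega>) \<partial>M)
      + (\<integral>\<^sup>+\<omega>. cond Q m \<omega> * 1 * ?w2 (X (\<eta> \<omega>) (clocks \<omega>) (grid m)) (slab m \<omega>) \<partial>M)"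
    by (intro nn_integral_add borel_measurable_times_ennreal measurable_cond[OF Q] measurable_exp_gaps borel_measurable_const
        measurable_weight[where w="?w1"] measurable_weight[where w="?w2" and r="\<lambda>e p. X e p (grid m)"] measurable_front_walk measurable_slab_weights[OF h_pos])
  also have "(\<integral>\<^sup>+\<omega>. cond Q m \<omega> * pot m (\<eta> \<omega>) (clocks \<omega>) * ?w1 (R m (\<eta> \<omega>) (clocks \<omega>)) (slab m \<omega>) \<partial>M) = (\<integral>\<^sup>+\<omega>. cond Q m \<omega> * pot m (\<eta> \<omega>) (clocks \<omega>) \<partial>M) * ennreal \<kappa>"
    by (rule slab_step_grid[where G="pot m" and r="R m" and w="?w1", OF Q measurable_slab_weights(2)[OF h_pos] front_weight_integral[OF h_pos block_small]
        measurable_exp_int[OF measurable_front_walk(1,2)] measurable_front_walk(1)]) (simp add: stop_front_walk)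
  also have "(\<integral>\<^sup>+\<omega>. cond Q m \<omega> * 1 * ?w2 (X (\<eta> \<omega>) (clocks \<omega>) (grid m)) (slab m \<omega>) \<partial>M) = (\<integral>\<^sup>+\<omega>. cond Q m \<omega> * 1 \<partial>M) * ennreal (push_const \<theta> h)"
    by (rule slab_step_grid[where G="\<lambda>_ _. 1" and r="\<lambda>e p. X e p (grid m)" and w="?w2", OF Q measurable_slab_weights(3)[OF h_pos] push_weight_integral[OF h_pos block_small]
        borel_measurable_const measurable_front_walk(2)]) (simp add: stop_front_walk)
  finally show ?thesis by simp
qed

lemma gap_drift:
  assumes Q: "past (grid m) Q"
  shows "(\<integral>\<^sup>+\<omega>. cond Q m \<omega> * gap (Suc m) (\<eta> \<omega>) (clocks \<omega>) \<partial>M) \<le> (\<integral>\<^sup>+\<omega>. cond Q m \<omega> * gap m (\<eta> \<omega>) (clocks \<omega>) \<partial>M) * ennreal \<kappa>"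
proof -
  let ?w1 = "\<lambda>i f. ennreal (front_weight \<theta> h i f)"
  have "(\<integral>\<^sup>+\<omega>. cond Q m \<omega> * gap (Suc m) (\<eta> \<omega>) (clocks \<omega>) \<partial>M) \<le>
    (\<integral>\<^sup>+\<omega>. cond Q m \<omega> * gap m (\<eta> \<omega>) (clocks \<omega>) * ?w1 (Y m (clocks \<omega>)) (slab m \<omega>) \<partial>M)"
  proof (rule nn_integral_mono_AE, rule AE_mp[OF AE_good], rule AE_I2, rule impI)
    fix \<omega> assume n: "good (clocks \<omega>)"
    have "exp (\<theta> * real_of_int (Y (Suc m) (clocks \<omega>) - X (\<eta> \<omega>) (clocks \<omega>) (grid (Suc m)))) \<le>
      exp (\<theta> * real_of_int (Y m (clocks \<omega>) - X (\<eta> \<omega>) (clocks \<omega>) (grid m))) * front_weight \<theta> h (Y m (clocks \<omega>)) (slab m \<omega>)"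
      unfolding grid(2) by (rule gap_step(1)[OF n h_pos \<theta>_pos grid(1)])
    then have "gap (Suc m) (\<eta> \<omega>) (clocks \<omega>) \<le> gap m (\<eta> \<omega>) (clocks \<omega>) * ?w1 (Y m (clocks \<omega>)) (slab m \<omega>)"
      by (simp add: ennreal_mult'[symmetric] ennreal_leI)
    then show "cond Q m \<omega> * gap (Suc m) (\<eta> \<omega>) (clocks \<omega>) \<le> cond Q m \<omega> * gap m (\<eta> \<omega>) (clocks \<omega>) * ?w1 (Y m (clocks \<omega>)) (slab m \<omega>)"
      by (cases "Q (\<eta> \<omega>, pst m \<omega>)") simp_all
  qed
  also have "\<dots> = (\<integral>\<^sup>+\<omega>. cond Q m \<omega> * gap m (\<eta> \<omega>) (clocks \<omega>) \<partial>M) * ennreal \<kappa>"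
    by (rule slab_step_grid[where G="gap m" and r="\<lambda>_ p. Y m p" and w="?w1", OF Q measurable_slab_weights(2)[OF h_pos] front_weight_integral[OF h_pos block_small]
        measurable_exp_int[OF measurable_front_walk(3,2)] measurable_front_walk(3)]) (simp add: stop_front_walk)
  finally show ?thesis .
qed

lemma past_True: "past T (\<lambda>_. True)" by (simp add: past_def)

text \<open>Gives the recursion a finite start. The value may be large compared with the probability
  of \<open>Q\<close>, which is why \<open>ahead_recurrent\<close> has to wait some slabs.\<close>

lemma pot_finite: "(\<integral>\<^sup>+\<omega>. pot m (\<eta> \<omega>) (clocks \<omega>) \<partial>M) < \<infinity>"
proof (induction m)
  case 0
  have "(\<integral>\<^sup>+\<omega>. pot 0 (\<eta> \<omega>) (clocks \<omega>) \<partial>M) = (\<integral>\<^sup>+\<omega>. ennreal (exp (- \<theta>)) \<partial>M)"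
    by (intro nn_integral_cong) (simp add: grid(3))
  then show ?case by (simp add: emeasure_space_1)
next
  case (Suc m)
  have "(\<integral>\<^sup>+\<omega>. pot (Suc m) (\<eta> \<omega>) (clocks \<omega>) \<partial>M) \<le> (\<integral>\<^sup>+\<omega>. pot m (\<eta> \<omega>) (clocks \<omega>) \<partial>M) * ennreal \<kappa> + ennreal (push_const \<theta> h)"
    using front_drift[OF past_True, of m] by (simp add: emeasure_space_1)
  also have "\<dots> < \<infinity>" using Suc by (simp add: ennreal_mult_less_top ennreal_add_less_top)
  finally show ?case .
qed

lemma nn_integral_cond:
  assumes Q: "past (grid m) Q"
  shows "(\<integral>\<^sup>+\<omega>. cond Q m \<omega> \<partial>M) = ennreal (prob {\<omega> \<in> space M. Q (\<eta> \<omega>, pst m \<omega>)})"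
  by (subst emeasure_Collect_of_bool[symmetric]) (use pred_past[OF Q grid(1)] in \<open>auto simp: emeasure_eq_measure\<close>)

text \<open>The front stays tight behind the walk, uniformly over the past, and a bold slab then leaves it behind.\<close>

lemma ahead_recurrent:
  "\<exists>q>0. \<forall>m Q. past (grid m) Q \<longrightarrow> (\<exists>m'>m. q * prob {\<omega> \<in> space M. Q (\<eta> \<omega>, pst m \<omega>)} \<le>
     prob {\<omega> \<in> space M. Q (\<eta> \<omega>, pst m \<omega>) \<and> ahead h m' (\<eta> \<omega>) (clocks \<omega>)})"
proof -
  define C where "C = push_const \<theta> h"
  define C' where "C' = 1 + C / (1 - \<kappa>)"
  have C: "0 < C" "0 < C'" using slab_consts \<kappa> by (auto simp: C_def C'_def add_pos_pos)
  \<comment> \<open>With \<open>2 * C' \<le> exp (\<theta> * K)\<close>, Markov's inequality leaves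
    at least half of \<open>Q\<close> with a deficit of at most \<open>K\<close>. Neither
    \<open>C'\<close> nor \<open>K\<close> depends on \<open>Q\<close>.\<close>
  obtain K :: nat where K: "ln (2 * C') / \<theta> \<le> real K" using real_arch_simple by blast
  then have "ln (2 * C') \<le> \<theta> * real K" using \<theta>_pos by (simp add: pos_divide_le_eq mult.commute)
  then have "2 * C' \<le> exp (\<theta> * real K)" using C by (metis exp_le_cancel_iff exp_ln mult_pos_pos zero_less_numeral)
  note K = this
  define q where "q = bold_prob h K / 2"
  have q: "0 < q" using bold_prob_pos[OF h_pos] by (simp add: q_def)
  have "\<exists>m'>m. q * prob {\<omega> \<in> space M. Q (\<eta> \<omega>, pst m \<omega>)} \<le> prob {\<omega> \<in> space M. Q (\<eta> \<omega>, pst m \<omega>) \<and> ahead h m' (\<eta> \<omega>) (clocks \<omega>)}"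
    if Q: "past (grid m) Q" for m Q
  proof (cases "prob {\<omega> \<in> space M. Q (\<eta> \<omega>, pst m \<omega>)} = 0")
    case True
    then show ?thesis by (intro exI[of _ "Suc m"]) (simp only: mult_zero_right measure_nonneg lessI simp_thms)
  next
    case False
    define P where "P = prob {\<omega> \<in> space M. Q (\<eta> \<omega>, pst m \<omega>)}"
    have P: "0 < P" using False by (simp add: P_def zero_less_measure_iff)
    \<comment> \<open>The event \<open>Q\<close> read off the longer past up to
      \<open>grid (m + j)\<close>, so that \<open>front_drift\<close> can be iterated on it.\<close>
    define Q' where "Q' = (\<lambda>(j::nat) (e, p). Q (e, stop_clocks (grid m) p))"
    have Q': "past (grid (m + j)) (Q' j)" for j
      unfolding Q'_def by (rule past_mono[OF Q grid(1)]) (simp add: grid(5))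
    have cond': "cond (Q' j) (m + j) \<omega> = cond Q m \<omega>" for j \<omega>
      unfolding Q'_def by (rule cond_mono) simp
    define a where "a = (\<lambda>j. \<integral>\<^sup>+\<omega>. cond Q m \<omega> * pot (m + j) (\<eta> \<omega>) (clocks \<omega>) \<partial>M)"
    have Pc: "(\<integral>\<^sup>+\<omega>. cond Q m \<omega> \<partial>M) = ennreal P" unfolding P_def by (rule nn_integral_cond[OF Q])
    have step: "a (Suc j) \<le> a j * ennreal \<kappa> + ennreal (C * P)" for j
      using front_drift[OF Q'[of j]] C P unfolding a_def cond' Pc by (simp add: C_def ennreal_mult[symmetric] mult.commute)
    have "a 0 \<le> (\<integral>\<^sup>+\<omega>. pot m (\<eta> \<omega>) (clocks \<omega>) \<partial>M)"
      unfolding a_def by (intro nn_integral_mono) (simp add: of_bool_def)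
    then have "a 0 < \<infinity>" using pot_finite[of m] by (rule order_le_less_trans)
    then obtain A where A: "0 \<le> A" "a 0 = ennreal A" by (cases "a 0") auto
    have bound: "a j \<le> ennreal (\<kappa> ^ j * A + C * P / (1 - \<kappa>))" for j
      using C P A by (intro ennreal_affine_recursion \<kappa> step) auto
    have "(\<lambda>j. \<kappa> ^ j * A) \<longlonglongrightarrow> 0" using \<kappa> by (intro tendsto_mult_left_zero LIMSEQ_realpow_zero) auto
    then have "eventually (\<lambda>j. \<kappa> ^ j * A < P) sequentially" using P by (simp add: order_tendstoD(2))
    then obtain j where j: "\<kappa> ^ j * A < P" unfolding eventually_sequentially by blast
    define k where "k = m + j"
    have aj: "a j \<le> ennreal (C' * P)"
      using j by (intro order_trans[OF bound] ennreal_leI) (simp add: C'_def algebra_simps)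
    let ?Q = "\<lambda>\<omega>. Q (\<eta> \<omega>, pst m \<omega>)" and ?D = "\<lambda>\<omega>. R k (\<eta> \<omega>) (clocks \<omega>) - X (\<eta> \<omega>) (clocks \<omega>) (grid k)"
    have mQ: "Measurable.pred M ?Q" by (rule pred_past[OF Q grid(1)])
    have "(\<lambda>\<omega>. ?D \<omega>) \<in> measurable M (count_space UNIV)"
      using measurable_compose[OF measurable_pair(1) measurable_int_diff[OF measurable_front_walk(1,2)]] by simp
    then have mD: "Measurable.pred M (\<lambda>\<omega>. ?D \<omega> \<le> int K)" by (rule measurable_compose) simp
    have mDK: "{\<omega> \<in> space M. ?Q \<omega> \<and> \<not> ?D \<omega> \<le> int K} \<in> events" "{\<omega> \<in> space M. ?Q \<omega> \<and> ?D \<omega> \<le> int K} \<in> events"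
      using mQ mD by measurable
    have "ennreal (prob {\<omega> \<in> space M. ?Q \<omega> \<and> \<not> ?D \<omega> \<le> int K}) * ennreal (exp (\<theta> * real K)) =
      (\<integral>\<^sup>+\<omega>. ennreal (exp (\<theta> * real K)) * indicator {\<omega> \<in> space M. ?Q \<omega> \<and> \<not> ?D \<omega> \<le> int K} \<omega> \<partial>M)"
      using mDK by (simp add: nn_integral_cmult_indicator emeasure_eq_measure mult.commute)
    also have "\<dots> \<le> a j" unfolding a_def k_def[symmetric]
    proof (rule nn_integral_mono)
      fix \<omega> assume "\<omega> \<in> space M"
      have "exp (\<theta> * real K) \<le> exp (\<theta> * real_of_int (?D \<omega>))" if "\<not> ?D \<omega> \<le> int K"
        using that \<theta>_pos by (intro exp_mono mult_left_mono) auto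
      then show "ennreal (exp (\<theta> * real K)) * indicator {\<omega> \<in> space M. ?Q \<omega> \<and> \<not> ?D \<omega> \<le> int K} \<omega> \<le> cond Q m \<omega> * pot k (\<eta> \<omega>) (clocks \<omega>)"
        by (auto simp: indicator_def ennreal_leI)
    qed
    also note aj
    finally have "prob {\<omega> \<in> space M. ?Q \<omega> \<and> \<not> ?D \<omega> \<le> int K} * exp (\<theta> * real K) \<le> C' * P"
      using C P by (simp add: ennreal_mult[symmetric])
    moreover have "prob {\<omega> \<in> space M. ?Q \<omega> \<and> \<not> ?D \<omega> \<le> int K} * (2 * C') \<le> prob {\<omega> \<in> space M. ?Q \<omega> \<and> \<not> ?D \<omega> \<le> int K} * exp (\<theta> * real K)"
      using K by (intro mult_left_mono) auto
    ultimately have "C' * (2 * prob {\<omega> \<in> space M. ?Q \<omega> \<and> \<not> ?D \<omega> \<le> int K}) \<le> C' * P" by (simp add: mult_ac)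
    then have half: "2 * prob {\<omega> \<in> space M. ?Q \<omega> \<and> \<not> ?D \<omega> \<le> int K} \<le> P" using C by (simp only: mult_le_cancel_left_pos)
    have "P = prob ({\<omega> \<in> space M. ?Q \<omega> \<and> ?D \<omega> \<le> int K} \<union> {\<omega> \<in> space M. ?Q \<omega> \<and> \<not> ?D \<omega> \<le> int K})"
      unfolding P_def by (rule arg_cong[where f=prob]) auto
    also have "\<dots> = prob {\<omega> \<in> space M. ?Q \<omega> \<and> ?D \<omega> \<le> int K} + prob {\<omega> \<in> space M. ?Q \<omega> \<and> \<not> ?D \<omega> \<le> int K}"
      using mDK by (intro finite_measure_Union) auto
    finally have half': "P / 2 \<le> prob {\<omega> \<in> space M. ?Q \<omega> \<and> ?D \<omega> \<le> int K}" using half by simp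
    let ?w = "\<lambda>i f. of_bool (bold h K i f) :: ennreal"
    let ?G = "\<lambda>e p. of_bool (R k e p - X e p (grid k) \<le> int K) :: ennreal"
    have mG: "(\<lambda>x. ?G (fst x) (snd x)) \<in> borel_measurable (config_space \<Otimes>\<^sub>M clock_space)"
      by (rule measurable_compose[OF measurable_int_diff[OF measurable_front_walk(1,2)]]) simp
    have wc: "(\<integral>\<^sup>+\<omega>. ?w i (clocks \<omega>) \<partial>M) = ennreal (bold_prob h K)" for i
    proof -
      have "Measurable.pred clock_space (bold h K i)"
      proof -
        have "(\<lambda>f. ?w i f = 1) = bold h K i" by (auto simp: fun_eq_iff of_bool_def)
        moreover have "Measurable.pred clock_space (\<lambda>f. ?w i f = 1)"
          using measurable_slab_weights(4)[OF h_pos, of K i] by measurable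
        ultimately show ?thesis by simp
      qed
      then have "Measurable.pred M (\<lambda>\<omega>. bold h K i (clocks \<omega>))" by (rule measurable_compose[OF measurable_clocks])
      from emeasure_Collect_of_bool[OF this] show ?thesis by (simp add: prob_bold[OF h_pos])
    qed
    have "ennreal (prob {\<omega> \<in> space M. ?Q \<omega> \<and> ?D \<omega> \<le> int K}) = (\<integral>\<^sup>+\<omega>. of_bool (?Q \<omega> \<and> ?D \<omega> \<le> int K) \<partial>M)"
      using mDK(2) by (subst emeasure_Collect_of_bool[symmetric]) (auto simp: pred_def emeasure_eq_measure)
    also have "\<dots> = (\<integral>\<^sup>+\<omega>. cond (Q' j) k \<omega> * ?G (\<eta> \<omega>) (clocks \<omega>) \<partial>M)"
      by (intro nn_integral_cong) (auto simp: k_def cond' )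
    finally have "ennreal (prob {\<omega> \<in> space M. ?Q \<omega> \<and> ?D \<omega> \<le> int K}) * ennreal (bold_prob h K) =
      (\<integral>\<^sup>+\<omega>. cond (Q' j) k \<omega> * ?G (\<eta> \<omega>) (clocks \<omega>) \<partial>M) * ennreal (bold_prob h K)" by simp
    also have "\<dots> = (\<integral>\<^sup>+\<omega>. cond (Q' j) k \<omega> * ?G (\<eta> \<omega>) (clocks \<omega>) * ?w (R k (\<eta> \<omega>) (clocks \<omega>)) (slab k \<omega>) \<partial>M)"
      by (rule slab_step_grid[where G="?G" and r="R k" and w="?w", OF Q'[of j, folded k_def] measurable_slab_weights(4)[OF h_pos] wc mG measurable_front_walk(1), symmetric])
        (simp add: stop_front_walk)
    also have "\<dots> \<le> (\<integral>\<^sup>+\<omega>. of_bool (?Q \<omega> \<and> ahead h (Suc k) (\<eta> \<omega>) (clocks \<omega>)) \<partial>M)"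
    proof (rule nn_integral_mono_AE, rule AE_mp[OF AE_good], rule AE_I2, rule impI)
      fix \<omega> assume n: "good (clocks \<omega>)"
      have "ahead h (Suc k) (\<eta> \<omega>) (clocks \<omega>)" if "?D \<omega> \<le> int K" "bold h K (R k (\<eta> \<omega>) (clocks \<omega>)) (slab k \<omega>)"
        using ahead_step[OF n h_pos that[unfolded grid_def]] by (simp add: ahead_def)
      then show "cond (Q' j) k \<omega> * ?G (\<eta> \<omega>) (clocks \<omega>) * ?w (R k (\<eta> \<omega>) (clocks \<omega>)) (slab k \<omega>) \<le> of_bool (?Q \<omega> \<and> ahead h (Suc k) (\<eta> \<omega>) (clocks \<omega>))"
        using cond'[of j \<omega>] by (auto simp: k_def of_bool_def split: if_splits)
    qed
    also have "\<dots> = ennreal (prob {\<omega> \<in> space M. ?Q \<omega> \<and> ahead h (Suc k) (\<eta> \<omega>) (clocks \<omega>)})"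
    proof -
      have "Measurable.pred M (\<lambda>\<omega>. ?Q \<omega> \<and> ahead h (Suc k) (\<eta> \<omega>) (clocks \<omega>))"
        using mQ pred_ahead[OF initial_measurable measurable_clocks h_pos, of "Suc k"] by (rule pred_intros_logic(3))
      then show ?thesis by (subst emeasure_Collect_of_bool[symmetric]) (simp_all add: emeasure_eq_measure)
    qed
    finally have "prob {\<omega> \<in> space M. ?Q \<omega> \<and> ?D \<omega> \<le> int K} * bold_prob h K \<le> prob {\<omega> \<in> space M. ?Q \<omega> \<and> ahead h (Suc k) (\<eta> \<omega>) (clocks \<omega>)}"
      using bold_prob_pos[OF h_pos, of K] by (simp add: ennreal_mult[symmetric])
    moreover have "P / 2 * bold_prob h K \<le> prob {\<omega> \<in> space M. ?Q \<omega> \<and> ?D \<omega> \<le> int K} * bold_prob h K"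
      using half' bold_prob_pos[OF h_pos, of K] by (intro mult_right_mono) auto
    ultimately show ?thesis by (intro exI[of _ "Suc k"]) (simp add: k_def q_def P_def mult_ac)
  qed
  then show ?thesis using q by blast
qed

end

section \<open>The walk stays ahead with positive probability\<close>

text \<open>Gives the walk a head start of arbitrary size: the arrow out of \<open>-1\<close> is
  silent, so \<open>Y\<close> rests, while the walk steps right more than \<open>K\<close> times and
  never left.\<close>

lemma bold_start:
  assumes n: "good n" and h: "0 < h" and bold: "bold h K (-1) n"
  shows "right_path n 0 (-1) h = - 1" and "int K + 1 \<le> walk \<alpha> \<beta> e n h"
    and "\<And>s. 0 \<le> s \<Longrightarrow> s \<le> h \<Longrightarrow> right_path n 0 (-1) s < walk \<alpha> \<beta> e n s"
proof -
  have mono: "n c s \<le> n c t" if "0 \<le> s" "s \<le> t" for c s t using that by (intro counting_path_mono good_path n)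
  have n0: "n c 0 = 0" for c using good_path[OF n, of c] by (simp add: counting_path_def)
  have Y: "right_path n 0 (-1) s = - 1" if "0 \<le> s" "s \<le> h" for s
  proof (rule right_path_no_arrow)
    have "n (Arrow (-1)) s = n (Arrow (-1)) 0" using mono[OF that, of "Arrow (-1)"] bold n0 by (simp add: bold_def)
    then show "jump_times (n (Arrow (-1))) \<inter> {0<..s} = {}"
      using jump_times_Ioc_nonempty_iff[OF good_path[OF n] order_refl that(1), of "Arrow (-1)"] by auto
  qed
  show "right_path n 0 (-1) h = - 1" using Y h by simp
  have X: "int (card (jump_times (n Plus) \<inter> {0<..s})) \<le> walk \<alpha> \<beta> e n s" if "0 \<le> s" "s \<le> h" for s
    using walk_increment_bounds(2)[OF good_paths[OF n] order_refl that(1), of \<alpha> \<beta> e] mono[OF that, of Minus] mono[OF that, of HatMinus] bold n0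
    by (simp add: bold_def)
  show "right_path n 0 (-1) s < walk \<alpha> \<beta> e n s" if "0 \<le> s" "s \<le> h" for s using X[OF that] Y[OF that] by linarith
  have "Suc K \<le> card (jump_times (n Plus) \<inter> {0<..0 + h})"
    using bold by (intro card_jump_times_ge[OF good_path[OF n] order_refl h]) (auto simp: bold_def)
  then show "int K + 1 \<le> walk \<alpha> \<beta> e n h" using X[of h] h by simp
qed

lemma bold_stop_clocks:
  assumes h: "0 < h"
  shows "bold h K r (stop_clocks h n) = bold h K r n"
proof -
  have "h * real i / real (Suc K) \<le> h" if "i \<le> Suc K" for i
    using that h by (simp add: pos_divide_le_eq mult_left_mono del: of_nat_Suc)
  then have "stop_clocks h n c (h * real i / real (Suc K)) = n c (h * real i / real (Suc K))" if "i \<le> Suc K" for c i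
    using that h by (simp add: stop_clocks_def min_absorb1 del: of_nat_Suc)
  moreover have "stop_clocks h n c h = n c h" for c using h by (simp add: stop_clocks_def)
  ultimately show ?thesis unfolding bold_def by (metis Suc_le_mono le_Suc_eq)
qed

context slab_walk
begin

lemma pred_walk_events:
  shows "0 \<le> T \<Longrightarrow> Measurable.pred M (\<lambda>\<omega>. leads \<alpha> \<beta> (\<eta> \<omega>) (clocks \<omega>) T)"
    and "0 \<le> T \<Longrightarrow> Measurable.pred M (\<lambda>\<omega>. caught \<alpha> \<beta> (\<eta> \<omega>) (clocks \<omega>) T t)"
    and "Measurable.pred M (\<lambda>\<omega>. ahead h m (\<eta> \<omega>) (clocks \<omega>))"
proof -
  interpret clock_family M \<eta> clocks by (rule clock_familyI[OF initial_measurable measurable_clocks])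
  show "0 \<le> T \<Longrightarrow> Measurable.pred M (\<lambda>\<omega>. leads \<alpha> \<beta> (\<eta> \<omega>) (clocks \<omega>) T)" by (rule pred_leads)
  show "0 \<le> T \<Longrightarrow> Measurable.pred M (\<lambda>\<omega>. caught \<alpha> \<beta> (\<eta> \<omega>) (clocks \<omega>) T t)" by (rule pred_caught)
  show "Measurable.pred M (\<lambda>\<omega>. ahead h m (\<eta> \<omega>) (clocks \<omega>))"
    by (rule pred_ahead[OF initial_measurable measurable_clocks h_pos])
qed

lemma pred_bold: "Measurable.pred clock_space (bold h K r)"
proof -
  have "(\<lambda>f. (of_bool (bold h K r f) :: ennreal) = 1) = bold h K r" by (auto simp: fun_eq_iff)
  moreover have "Measurable.pred clock_space (\<lambda>f. (of_bool (bold h K r f) :: ennreal) = 1)"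
    using measurable_slab_weights(4)[OF h_pos, of K r] by measurable
  ultimately show ?thesis by simp
qed

text \<open>The bold first slab rules out being caught up to time \<open>h\<close>, so the walk is
  caught in a slab of positive index, to which \<open>gap_step\<close> applies.\<close>

lemma not_leads_slab:
  assumes n: "good n" and bold: "bold h K (-1) n" and nl: "\<not> leads \<alpha> \<beta> e n 0"
  shows "\<exists>m. 1 \<le> gap (Suc m) e n * ennreal (slab_weight \<theta> h (Y (Suc m) n) (shift_clocks (grid (Suc m)) 0 n))"
proof -
  obtain s where s: "0 < s" "X e n s \<le> right_path n 0 (-1) s"
    using nl unfolding leads_def by (auto simp: not_less)
  then have hs: "h < s" using bold_start(3)[OF n h_pos bold, of s \<alpha> \<beta> e] by force
  define m where "m = nat \<lfloor>s / h\<rfloor> - 1"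
  have "1 \<le> \<lfloor>s / h\<rfloor>" using hs h_pos by (simp add: le_floor_iff pos_le_divide_eq)
  then have m: "real (Suc m) = real_of_int \<lfloor>s / h\<rfloor>" by (simp add: m_def)
  have "real (Suc m) \<le> s / h" "s / h \<le> real (Suc m) + 1" unfolding m by linarith+
  then have "grid (Suc m) \<le> s" "s \<le> grid (Suc m) + h" using h_pos
    by (simp_all add: grid_def pos_le_divide_eq pos_divide_le_eq algebra_simps)
  from gap_step(2)[OF n h_pos \<theta>_pos grid(1) this s(2)]
  have "1 \<le> exp (\<theta> * real_of_int (Y (Suc m) n - X e n (grid (Suc m)))) * slab_weight \<theta> h (Y (Suc m) n) (shift_clocks (grid (Suc m)) 0 n)" .
  then have "1 \<le> gap (Suc m) e n * ennreal (slab_weight \<theta> h (Y (Suc m) n) (shift_clocks (grid (Suc m)) 0 n))"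
    by (simp add: ennreal_mult'[symmetric])
  then show ?thesis by blast
qed

text \<open>After a bold first slab the exponential of \<theta> times the gap is at most
  \<open>exp (- \<theta> * K)\<close>, and its mean then contracts by \<kappa> per slab. A slab in
  which the walk is caught contributes at least 1 to the sum of the weighted gaps, so the mean of
  that sum bounds the probability of a bold start followed by being caught. For large
  \<open>K\<close> this is at most half the probability of the bold start.\<close>

lemma prob_leads_pos: "0 < prob {\<omega> \<in> space M. leads \<alpha> \<beta> (\<eta> \<omega>) (clocks \<omega>) 0}"
proof -
  define S where "S = slab_const \<theta> h"
  have S: "0 < S" using slab_consts by (simp add: S_def)
  \<comment> \<open>\<open>K\<close> is so large that the series over the slabs,
    \<open>S * exp (- \<theta> * K) / (1 - \<kappa>)\<close>, is at most 1/2.\<close>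
  obtain K :: nat where K: "ln (2 * S / (1 - \<kappa>)) / \<theta> \<le> real K" using real_arch_simple by blast
  then have "ln (2 * S / (1 - \<kappa>)) \<le> \<theta> * real K" using \<theta>_pos by (simp add: pos_divide_le_eq mult.commute)
  then have "2 * S / (1 - \<kappa>) \<le> exp (\<theta> * real K)" using S \<kappa> by (metis exp_le_cancel_iff exp_ln divide_pos_pos mult_pos_pos zero_less_numeral diff_gt_0_iff_gt)
  then have "2 * S / (1 - \<kappa>) * exp (- \<theta> * real K) \<le> exp (\<theta> * real K) * exp (- \<theta> * real K)" by (intro mult_right_mono) auto
  then have K: "S * exp (- \<theta> * real K) / (1 - \<kappa>) \<le> 1 / 2" by (simp add: exp_minus field_simps)
  define P where "P = bold_prob h K"
  have P: "0 < P" using bold_prob_pos[OF h_pos] by (simp add: P_def)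
  let ?b = "\<lambda>\<omega>. bold h K (-1) (clocks \<omega>)" and ?l = "\<lambda>\<omega>. leads \<alpha> \<beta> (\<eta> \<omega>) (clocks \<omega>) 0"
  define Q where "Q = (\<lambda>(e :: int \<Rightarrow> bool, p). bold h K (-1) (stop_clocks h p))"
  have past_bold: "past h (\<lambda>(e, p). bold h K (-1) p)"
    unfolding past_def split_def by (auto intro: measurable_compose[OF measurable_snd pred_bold])
  have Q: "past (grid (Suc m)) Q" for m
    unfolding Q_def using past_mono[OF past_bold, of "grid (Suc m)"] h_pos by (simp add: grid_def split_def mult_le_cancel_left1)
  have Q': "Q (\<eta> \<omega>, pst (Suc m) \<omega>) = ?b \<omega>" for m \<omega>
  proof -
    have "h \<le> grid (Suc m)" using h_pos by (simp add: grid_def mult_le_cancel_left1)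
    then show ?thesis using stop_stop_clocks[of h "grid (Suc m)" "clocks \<omega>"] h_pos bold_stop_clocks[OF h_pos, of K "-1" "clocks \<omega>"] by (simp add: Q_def)
  qed
  have mb [measurable]: "Measurable.pred M ?b" by (rule measurable_compose[OF measurable_clocks pred_bold])
  have ml [measurable]: "Measurable.pred M ?l" by (rule pred_walk_events(1)) simp
  have Eb: "(\<integral>\<^sup>+\<omega>. of_bool (?b \<omega>) \<partial>M) = ennreal P"
    using emeasure_Collect_of_bool[OF mb] by (simp add: prob_bold[OF h_pos] P_def)
  define a where "a = (\<lambda>m. \<integral>\<^sup>+\<omega>. of_bool (?b \<omega>) * gap (Suc m) (\<eta> \<omega>) (clocks \<omega>) \<partial>M)"
  have step: "a (Suc m) \<le> a m * ennreal \<kappa>" for m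
    using gap_drift[OF Q, of m] unfolding a_def Q' by simp
  have "a 0 \<le> (\<integral>\<^sup>+\<omega>. of_bool (?b \<omega>) * ennreal (exp (- \<theta> * real K)) \<partial>M)" unfolding a_def
  proof (rule nn_integral_mono_AE, rule AE_mp[OF AE_good], rule AE_I2, rule impI)
    fix \<omega> assume n: "good (clocks \<omega>)"
    have "gap (Suc 0) (\<eta> \<omega>) (clocks \<omega>) \<le> ennreal (exp (- \<theta> * real K))" if b: "?b \<omega>"
    proof -
      have "Y (Suc 0) (clocks \<omega>) - X (\<eta> \<omega>) (clocks \<omega>) (grid (Suc 0)) \<le> - int K"
        using bold_start(1)[OF n h_pos b] bold_start(2)[OF n h_pos b, of \<alpha> \<beta> "\<eta> \<omega>"] by (simp add: grid_def)
      then have "\<theta> * real_of_int (Y (Suc 0) (clocks \<omega>) - X (\<eta> \<omega>) (clocks \<omega>) (grid (Suc 0))) \<le> \<theta> * real_of_int (- int K)"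
        using \<theta>_pos by (intro mult_left_mono of_int_le_iff[THEN iffD2]) auto
      then show ?thesis by (intro ennreal_leI exp_mono) simp
    qed
    then show "of_bool (?b \<omega>) * gap (Suc 0) (\<eta> \<omega>) (clocks \<omega>) \<le> of_bool (?b \<omega>) * ennreal (exp (- \<theta> * real K))" by (cases "?b \<omega>") auto
  qed
  also have "\<dots> = ennreal (P * exp (- \<theta> * real K))"
    using mb P by (subst nn_integral_multc) (auto simp: Eb ennreal_mult)
  finally have a0: "a 0 \<le> ennreal (P * exp (- \<theta> * real K))" .
  have am: "a m \<le> ennreal (P * exp (- \<theta> * real K) * \<kappa> ^ m)" for m
  proof (induction m)
    case (Suc m)
    have "a (Suc m) \<le> ennreal (P * exp (- \<theta> * real K) * \<kappa> ^ m) * ennreal \<kappa>"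
      using Suc by (intro order_trans[OF step] mult_right_mono) auto
    then show ?case using P \<kappa> by (simp add: ennreal_mult[symmetric] mult_ac)
  qed (use a0 in simp)
  let ?w = "\<lambda>i f. ennreal (slab_weight \<theta> h i f)"
  let ?u = "\<lambda>m \<omega>. of_bool (?b \<omega>) * gap (Suc m) (\<eta> \<omega>) (clocks \<omega>) * ?w (Y (Suc m) (clocks \<omega>)) (slab (Suc m) \<omega>)"
  have u: "(\<integral>\<^sup>+\<omega>. ?u m \<omega> \<partial>M) = a m * ennreal S" for m
    using slab_step_grid[where G="gap (Suc m)" and r="\<lambda>_. Y (Suc m)" and w="?w", OF Q measurable_slab_weights(1)[OF h_pos]
        slab_weight_integral[OF h_pos block_small] measurable_exp_int[OF measurable_front_walk(3,2)] measurable_front_walk(3)]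
    unfolding Q' a_def S_def by (simp add: stop_front_walk)
  have mu: "?u m \<in> borel_measurable M" for m
    by (intro borel_measurable_times_ennreal measurable_exp_gaps measurable_compose[OF mb] measurable_weight[where w="?w" and r="\<lambda>_. Y (Suc m)"]
        measurable_slab_weights[OF h_pos] measurable_front_walk) simp
  have "emeasure M {\<omega> \<in> space M. ?b \<omega> \<and> \<not> ?l \<omega>} = (\<integral>\<^sup>+\<omega>. of_bool (?b \<omega> \<and> \<not> ?l \<omega>) \<partial>M)"
    using mb ml by (intro emeasure_Collect_of_bool) measurable
  also have "\<dots> \<le> (\<integral>\<^sup>+\<omega>. (\<Sum>m. ?u m \<omega>) \<partial>M)"
  proof (rule nn_integral_mono_AE, rule AE_mp[OF AE_good], rule AE_I2, rule impI)
    fix \<omega> assume n: "good (clocks \<omega>)"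
    show "of_bool (?b \<omega> \<and> \<not> ?l \<omega>) \<le> (\<Sum>m. ?u m \<omega>)"
    proof (cases "?b \<omega> \<and> \<not> ?l \<omega>")
      case True
      then obtain m where "1 \<le> ?u m \<omega>" using not_leads_slab[OF n, of K "\<eta> \<omega>"] by auto
      also have "?u m \<omega> = (\<Sum>i\<in>{m}. ?u i \<omega>)" by simp
      also have "\<dots> \<le> (\<Sum>m. ?u m \<omega>)" by (intro sum_le_suminf) auto
      finally show ?thesis using True by simp
    next
      case False
      then have "of_bool (?b \<omega> \<and> \<not> ?l \<omega>) = (0 :: ennreal)" by (simp only: of_bool_eq)
      then show ?thesis by (simp only: zero_le)
    qed
  qed
  also have "\<dots> = (\<Sum>m. a m * ennreal S)" by (simp only: nn_integral_suminf[OF mu] u)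
  also have "\<dots> \<le> (\<Sum>m. ennreal (P * exp (- \<theta> * real K) * S * \<kappa> ^ m))"
  proof (intro suminf_le)
    fix m show "a m * ennreal S \<le> ennreal (P * exp (- \<theta> * real K) * S * \<kappa> ^ m)"
      using mult_right_mono[OF am, of "ennreal S" m] P \<kappa> S by (simp add: ennreal_mult[symmetric] mult_ac)
  qed auto
  also have "\<dots> = ennreal (P * exp (- \<theta> * real K) * S * (1 / (1 - \<kappa>)))"
    using P \<kappa> S suminf_geometric[of \<kappa>] by (subst suminf_ennreal2) (auto simp: suminf_mult summable_geometric intro!: summable_mult)
  also have "\<dots> \<le> ennreal (P / 2)"
    using mult_left_mono[OF K, of P] P by (intro ennreal_leI) (simp add: mult_ac)
  finally have half: "prob {\<omega> \<in> space M. ?b \<omega> \<and> \<not> ?l \<omega>} \<le> P / 2" using P by (simp add: emeasure_eq_measure)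
  have "P = prob {\<omega> \<in> space M. ?b \<omega>}" using P by (simp add: measure_def prob_bold[OF h_pos] P_def)
  also have "\<dots> \<le> prob ({\<omega> \<in> space M. ?b \<omega> \<and> \<not> ?l \<omega>} \<union> {\<omega> \<in> space M. ?l \<omega>})"
    using mb ml by (intro finite_measure_mono) auto
  also have "\<dots> \<le> prob {\<omega> \<in> space M. ?b \<omega> \<and> \<not> ?l \<omega>} + prob {\<omega> \<in> space M. ?l \<omega>}"
    by (intro measure_Un_le) measurable
  finally show ?thesis using half P by linarith
qed

end

section \<open>The regeneration time\<close>

context slab_walk
begin

abbreviation "\<gamma> \<equiv> prob {\<omega> \<in> space M. leads \<alpha> \<beta> (\<eta> \<omega>) (clocks \<omega>) 0}"

definition regen :: "nat \<Rightarrow> 'a \<Rightarrow> bool" where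
  "regen m \<omega> \<longleftrightarrow> ahead h m (\<eta> \<omega>) (clocks \<omega>) \<and> leads \<alpha> \<beta> (\<eta> \<omega>) (clocks \<omega>) (grid m)"

text \<open>By time \<open>grid j\<close> it is known that no slab boundary \<open>1, \<dots>, n\<close> is a regeneration.\<close>

definition missed :: "nat \<Rightarrow> nat \<Rightarrow> (int \<Rightarrow> bool) \<times> (clock \<Rightarrow> real \<Rightarrow> nat) \<Rightarrow> bool" where
  "missed n j = (\<lambda>(e, p). \<forall>k\<in>{1..n}. ahead h k e p \<longrightarrow> caught \<alpha> \<beta> e p (grid k) (grid j))"

lemma pred_regen [measurable]: "Measurable.pred M (regen m)"
proof -
  note [measurable] = pred_walk_events(1)[OF grid(1)[of m]] pred_walk_events(3)[of m]
  show ?thesis unfolding regen_def by measurable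
qed

lemma past_conj: "past T P \<Longrightarrow> past T Q \<Longrightarrow> past T (\<lambda>x. P x \<and> Q x)"
  unfolding past_def by (intro conjI pred_intros_logic(3)) (blast+)

lemma past_missed:
  assumes "n \<le> j"
  shows "past (grid j) (missed n j)"
  unfolding past_def
proof (intro conjI allI impI)
  interpret clock_family "config_space \<Otimes>\<^sub>M clock_space" fst snd by (rule clock_familyI) auto
  have [measurable]: "Measurable.pred (config_space \<Otimes>\<^sub>M clock_space) (\<lambda>x. ahead h k (fst x) (snd x))" for k
    by (rule pred_ahead[OF _ _ h_pos]) auto
  have [measurable]: "Measurable.pred (config_space \<Otimes>\<^sub>M clock_space) (\<lambda>x. caught \<alpha> \<beta> (fst x) (snd x) (grid k) t)" for k t
    by (rule pred_caught[OF grid(1)])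
  show "Measurable.pred (config_space \<Otimes>\<^sub>M clock_space) (missed n j)"
    unfolding missed_def split_def by measurable
  fix e e' p assume eq: "\<forall>t. 0 \<le> t \<longrightarrow> t \<le> grid j \<longrightarrow> X e p t = X e' p t"
  have "ahead h k e p = ahead h k e' p" "caught \<alpha> \<beta> e p (grid k) (grid j) = caught \<alpha> \<beta> e' p (grid k) (grid j)" if "k \<in> {1..n}" for k
  proof -
    have k: "k \<le> j" "grid k \<le> grid j" using that assms by (auto intro!: grid(5))
    show "ahead h k e p = ahead h k e' p" using eq k by (intro ahead_cong h_pos) (auto simp: grid_def)
    show "caught \<alpha> \<beta> e p (grid k) (grid j) = caught \<alpha> \<beta> e' p (grid k) (grid j)" using eq k by (intro caught_cong grid(1,5)) auto
  qed
  then show "missed n j (e, p) = missed n j (e', p)" by (simp add: missed_def)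
qed

lemma missed_stop:
  assumes "good p" "n \<le> j"
  shows "missed n j (e, stop_clocks (grid j) p) = missed n j (e, p)"
proof -
  have "ahead h k e (stop_clocks (grid j) p) = ahead h k e p"
    "caught \<alpha> \<beta> e (stop_clocks (grid j) p) (grid k) (grid j) = caught \<alpha> \<beta> e p (grid k) (grid j)" if "k \<in> {1..n}" for k
  proof -
    have k: "k \<le> j" "grid k \<le> grid j" using that assms by (auto intro!: grid(5))
    show "ahead h k e (stop_clocks (grid j) p) = ahead h k e p" using k by (intro ahead_stop assms h_pos) (simp add: grid_def)
    show "caught \<alpha> \<beta> e (stop_clocks (grid j) p) (grid k) (grid j) = caught \<alpha> \<beta> e p (grid k) (grid j)" using k by (intro caught_stop assms grid(1,5)) auto
  qed
  then show ?thesis by (simp add: missed_def)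
qed

text \<open>Knowing that \<open>grid m\<close> is good for ever, whether an earlier slab end is good
  for ever has been decided by time \<open>grid m\<close>.\<close>

lemma caught_iff_not_leads:
  assumes n: "good n" and l: "leads \<alpha> \<beta> e n (grid m)" and k: "k < m"
  shows "caught \<alpha> \<beta> e n (grid k) (grid m) \<longleftrightarrow> \<not> leads \<alpha> \<beta> e n (grid k)"
  using leads_compose[OF n grid(1) grid(6)[OF k] grid(4) _ l] leads_not_caught[of \<alpha> \<beta> e n "grid k"] by blast

lemma first_regen:
  assumes n: "good (clocks \<omega>)" and m: "regen m \<omega>" "1 \<le> m"
  shows "missed (m - 1) m (\<eta> \<omega>, pst m \<omega>) \<longleftrightarrow> (\<forall>k\<in>{1..m-1}. \<not> regen k \<omega>)"
proof -
  have "(ahead h k (\<eta> \<omega>) (clocks \<omega>) \<longrightarrow> caught \<alpha> \<beta> (\<eta> \<omega>) (clocks \<omega>) (grid k) (grid m)) \<longleftrightarrow> \<not> regen k \<omega>" if "k \<in> {1..m-1}" for k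
    using caught_iff_not_leads[OF n, of "\<eta> \<omega>" m k] that m by (force simp: regen_def)
  then show ?thesis unfolding missed_stop[OF n diff_le_self] unfolding missed_def by simp
qed

lemma regen_law:
  assumes Q: "past (grid m) Q" and B: "B \<in> sets path_space"
  shows "prob {\<omega> \<in> space M. Q (\<eta> \<omega>, pst m \<omega>) \<and> regen m \<omega> \<and> fut (grid m) \<omega> \<in> B} =
    prob {\<omega> \<in> space M. Q (\<eta> \<omega>, pst m \<omega>) \<and> ahead h m (\<eta> \<omega>) (clocks \<omega>)} * prob {\<omega> \<in> space M. free_run B (\<eta> \<omega>) (clocks \<omega>)}"
  using regeneration[OF h_pos Q[unfolded grid_def] B]
  unfolding regen_def grid_def emeasure_eq_measure by (simp add: ennreal_mult[symmetric] conj_assoc)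

lemma free_run_UNIV: "free_run (space path_space) e f \<longleftrightarrow> leads \<alpha> \<beta> e f 0"
  by (simp add: free_run_def space_PiM)

lemma fut_space: "fut T \<omega> \<in> space path_space"
  by (simp add: space_PiM)

lemma regen_prob:
  assumes Q: "past (grid m) Q"
  shows "prob {\<omega> \<in> space M. Q (\<eta> \<omega>, pst m \<omega>) \<and> regen m \<omega>} =
    prob {\<omega> \<in> space M. Q (\<eta> \<omega>, pst m \<omega>) \<and> ahead h m (\<eta> \<omega>) (clocks \<omega>)} * \<gamma>"
  using regen_law[OF Q sets.top] unfolding free_run_UNIV by (simp only: fut_space simp_thms)

text \<open>Suppose that with positive probability no regeneration ever happens. For each
  \<open>n\<close>, the failures at \<open>1\<close> to \<open>n\<close> are known by some later
  slab end up to half of that probability, and from there a regeneration still follows with a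
  probability bounded below. This mass lies in \<open>H n\<close> and outside \<open>Hinf\<close>,
  uniformly in \<open>n\<close>, which contradicts the convergence of \<open>prob (H n)\<close> to
  \<open>prob Hinf\<close>.\<close>

lemma AE_regen: "AE \<omega> in M. \<exists>m\<ge>1. regen m \<omega>"
proof -
  obtain q where q: "0 < q" and rec: "\<And>m Q. past (grid m) Q \<Longrightarrow> \<exists>m'>m. q * prob {\<omega> \<in> space M. Q (\<eta> \<omega>, pst m \<omega>)} \<le>
     prob {\<omega> \<in> space M. Q (\<eta> \<omega>, pst m \<omega>) \<and> ahead h m' (\<eta> \<omega>) (clocks \<omega>)}"
    using ahead_recurrent by blast
  define H where "H = (\<lambda>n. {\<omega> \<in> space M. \<forall>k\<in>{1..n}. \<not> regen k \<omega>})"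
  define Hinf where "Hinf = {\<omega> \<in> space M. \<forall>k\<ge>1. \<not> regen k \<omega>}"
  have [measurable]: "H n \<in> events" "Hinf \<in> events" for n unfolding H_def Hinf_def by measurable
  have "(\<lambda>n. prob (H n)) \<longlonglongrightarrow> prob (\<Inter>n. H n)"
    by (rule finite_Lim_measure_decseq) (auto simp: H_def decseq_def)
  also have "(\<Inter>n. H n) = Hinf" by (fastforce simp: H_def Hinf_def)
  finally have lim: "(\<lambda>n. prob (H n)) \<longlonglongrightarrow> prob Hinf" .
  have "prob Hinf = 0"
  proof (rule ccontr)
    assume "prob Hinf \<noteq> 0"
    then have pos: "0 < prob Hinf" by (simp add: zero_less_measure_iff)
    \<comment> \<open>The mass by which every \<open>H n\<close> would exceed \<open>Hinf\<close>.
      The factor 1/2 pays for observing the failures by a finite time; \<gamma> and \<open>q\<close>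
      do not depend on the past.\<close>
    define \<delta> where "\<delta> = \<gamma> * (q * (prob Hinf / 2))"
    have "0 < \<delta>" using pos q prob_leads_pos by (simp add: \<delta>_def)
    then have "\<forall>\<^sub>F n in sequentially. prob (H n) < prob Hinf + \<delta>" by (intro order_tendstoD(2)[OF lim]) simp
    then obtain n where n: "prob (H n) < prob Hinf + \<delta>" unfolding eventually_sequentially by blast
    define J where "J = (\<lambda>j. {\<omega> \<in> space M. missed n (n + j) (\<eta> \<omega>, pst (n + j) \<omega>)})"
    have J [measurable]: "J j \<in> events" for j
      using pred_past[OF past_missed[of n "n + j"] grid(1)] by (simp add: J_def pred_def)
    define J' where "J' = (\<lambda>j. {\<omega> \<in> space M. missed n (n + j) (\<eta> \<omega>, clocks \<omega>)})"
    have J' [measurable]: "J' j \<in> events" for j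
      using measurable_compose[OF measurable_pair(1) past_pred[OF past_missed[of n "n + j"]]] by (simp add: J'_def pred_def)
    have JJ: "prob (J j) = prob (J' j)" for j
    proof (rule finite_measure_eq_AE)
      show "AE \<omega> in M. \<omega> \<in> J j \<longleftrightarrow> \<omega> \<in> J' j"
        by (rule AE_mp[OF AE_good], rule AE_I2) (simp add: J_def J'_def missed_stop)
    qed (rule J J')+
    have "incseq J'" unfolding incseq_def
    proof (intro allI impI subsetI)
      fix i j \<omega> assume ij: "i \<le> j" and w: "\<omega> \<in> J' i"
      have "grid (n + i) \<le> grid (n + j)" using ij by (intro grid(5)) simp
      then show "\<omega> \<in> J' j" using w caught_mono unfolding J'_def missed_def prod.case by blast
    qed
    then have limJ: "(\<lambda>j. prob (J' j)) \<longlonglongrightarrow> prob (\<Union>j. J' j)" by (intro finite_Lim_measure_incseq) auto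
    have "prob Hinf \<le> prob (\<Union>j. J' j)"
    proof (rule finite_measure_mono_AE, rule AE_mp[OF AE_good], rule AE_I2, intro impI)
      fix \<omega> assume w: "\<omega> \<in> space M" "good (clocks \<omega>)" "\<omega> \<in> Hinf"
      \<comment> \<open>Being caught shows at a finite time, so for the finitely many
        \<open>k\<close> up to \<open>n\<close> there is a common slab end by which all failures
        have shown.\<close>
      have "\<exists>i. ahead h k (\<eta> \<omega>) (clocks \<omega>) \<longrightarrow> caught \<alpha> \<beta> (\<eta> \<omega>) (clocks \<omega>) (grid k) (grid i)" if "k \<in> {1..n}" for k
      proof (cases "ahead h k (\<eta> \<omega>) (clocks \<omega>)")
        case True
        then have "\<not> leads \<alpha> \<beta> (\<eta> \<omega>) (clocks \<omega>) (grid k)" using w(3) that by (auto simp: Hinf_def regen_def)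
        then obtain t :: nat where t: "caught \<alpha> \<beta> (\<eta> \<omega>) (clocks \<omega>) (grid k) (real t)"
          using leads_iff_not_caught[OF good_paths[OF w(2)] grid(1)] by blast
        obtain i :: nat where "real t / h \<le> real i" using real_arch_simple by blast
        then have "real t \<le> grid i" using h_pos by (simp add: grid_def pos_divide_le_eq mult.commute)
        then show ?thesis using caught_mono[OF t] by blast
      qed simp
      then obtain i where i: "\<And>k. k \<in> {1..n} \<Longrightarrow> ahead h k (\<eta> \<omega>) (clocks \<omega>) \<longrightarrow> caught \<alpha> \<beta> (\<eta> \<omega>) (clocks \<omega>) (grid k) (grid (i k))" by metis
      define j where "j = Max (insert 0 (i ` {1..n}))"
      have "grid (i k) \<le> grid (n + j)" if "k \<in> {1..n}" for k
      proof -
        have "i k \<le> j" unfolding j_def using that by (intro Max_ge) auto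
        then show ?thesis by (intro grid(5)) simp
      qed
      then have "missed n (n + j) (\<eta> \<omega>, clocks \<omega>)" using i caught_mono unfolding missed_def prod.case by blast
      then show "\<omega> \<in> (\<Union>j. J' j)" using w(1) by (auto simp: J'_def)
    qed auto
    then have "prob Hinf / 2 < prob (\<Union>j. J' j)" using pos by linarith
    then have "\<forall>\<^sub>F j in sequentially. prob Hinf / 2 < prob (J' j)" by (rule order_tendstoD(1)[OF limJ])
    then obtain j where j: "prob Hinf / 2 < prob (J j)" unfolding eventually_sequentially JJ by blast
    obtain m where m: "n + j < m" "q * prob (J j) \<le> prob {\<omega> \<in> space M. missed n (n + j) (\<eta> \<omega>, pst (n + j) \<omega>) \<and> ahead h m (\<eta> \<omega>) (clocks \<omega>)}"
      using rec[OF past_missed[of n "n + j"]] unfolding J_def by auto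
    define Q where "Q = (\<lambda>(e, p). missed n (n + j) (e, stop_clocks (grid (n + j)) p))"
    have Q: "past (grid m) Q" unfolding Q_def using m(1) by (intro past_mono past_missed grid) auto
    have Qc: "Q (\<eta> \<omega>, pst m \<omega>) = missed n (n + j) (\<eta> \<omega>, pst (n + j) \<omega>)" for \<omega>
      using m(1) by (simp add: Q_def stop_stop_clocks[OF grid(1) grid(5)])
    let ?E = "{\<omega> \<in> space M. Q (\<eta> \<omega>, pst m \<omega>) \<and> regen m \<omega>}"
    have "\<delta> \<le> \<gamma> * (q * prob (J j))" unfolding \<delta>_def using j q by (intro mult_left_mono) auto
    also have "\<dots> \<le> prob ?E" unfolding regen_prob[OF Q] unfolding Qc using mult_left_mono[OF m(2), of \<gamma>] by (simp add: mult.commute)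
    finally have d: "\<delta> \<le> prob ?E" .
    note [measurable] = pred_past[OF Q grid(1)]
    \<comment> \<open>On \<open>?E\<close> there is a regeneration at \<open>m\<close>, so it is
      disjoint from \<open>Hinf\<close>; as \<open>m\<close> exceeds \<open>n\<close> and the
      failures up to \<open>n\<close> are known on \<open>?E\<close>, both are almost surely
      contained in \<open>H n\<close>.\<close>
    have "prob ?E + prob Hinf = prob (?E \<union> Hinf)"
      using m(1) by (intro finite_measure_Union[symmetric]) (auto simp: Hinf_def)
    also have "\<dots> \<le> prob (H n)"
    proof (rule finite_measure_mono_AE, rule AE_mp[OF AE_good], rule AE_I2, intro impI)
      fix \<omega> assume w: "\<omega> \<in> space M" "good (clocks \<omega>)" "\<omega> \<in> ?E \<union> Hinf"
      from w(3) show "\<omega> \<in> H n"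
      proof
        assume "\<omega> \<in> ?E"
        then have "missed n (n + j) (\<eta> \<omega>, clocks \<omega>)" unfolding Qc by (simp add: missed_stop[OF w(2)])
        then show ?thesis using w(1) leads_not_caught unfolding H_def missed_def regen_def prod.case by blast
      qed (auto simp: H_def Hinf_def)
    qed auto
    finally show False using n d by linarith
  qed
  then have "Hinf \<in> null_sets M" by (simp add: null_sets_def emeasure_eq_measure)
  from AE_not_in[OF this] show ?thesis by (rule AE_mp, intro AE_I2) (auto simp: Hinf_def)
qed

end

section \<open>Conditioning at the regeneration time\<close>

text \<open>A deterministic candidate is measurable for every sub-\<sigma>-algebra, so the defining
  integrals over the sets of \<open>F\<close> reduce to a product rule.\<close>

lemma cond_law_is_const:
  assumes P: "prob_space P" and F: "subalgebra P F" and Z: "Z \<in> measurable P S"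
    and eq: "\<And>A D. A \<in> sets S \<Longrightarrow> D \<in> sets F \<Longrightarrow> measure P (D \<inter> {\<omega> \<in> space P. Z \<omega> \<in> A}) = measure P D * \<mu> A"
  shows "cond_law_is P F S Z \<mu>"
  unfolding cond_law_is_def
proof
  fix A assume A: "A \<in> sets S"
  interpret prob_space P by (rule P)
  interpret finite_measure_subalgebra P F by unfold_locales (rule F)
  have E: "{\<omega> \<in> space P. Z \<omega> \<in> A} \<in> sets P" using measurable_sets[OF Z A] by (simp add: vimage_def Int_def conj_commute)
  show "AE \<omega> in P. real_cond_exp P F (indicator {\<omega> \<in> space P. Z \<omega> \<in> A}) \<omega> = \<mu> A"
  proof (rule real_cond_exp_charact)
    fix D assume D: "D \<in> sets F"
    then have "D \<in> sets P" using F by (auto simp: subalgebra_def)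
    then show "(\<integral>\<omega>\<in>D. indicator {\<omega> \<in> space P. Z \<omega> \<in> A} \<omega> \<partial>P) = (\<integral>\<omega>\<in>D. \<mu> A \<partial>P)"
      using E eq[OF A D] by (simp add: set_lebesgue_integral_def indicator_inter_arith[symmetric] mult.commute)
  qed (use E in \<open>auto simp: emeasure_eq_measure\<close>)
qed

lemma enn2real_min: "0 \<le> s \<Longrightarrow> 0 \<le> t \<Longrightarrow> enn2real (min (ennreal s) (ennreal t)) = min s t"
  by (simp add: min_def)

lemma walk_clocks_cong:
  assumes "\<And>c. jump_times (n c) = jump_times (n' c)"
  shows "walk \<alpha> \<beta> e n = walk \<alpha> \<beta> e n'" "right_path n = right_path n'"
proof -
  have cross: "cross n = cross n'" and at: "arrow_times n = arrow_times n'"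
    by (simp_all add: fun_eq_iff cross_def arrow_times_def assms)
  have "gamma n t x = gamma n' t x" for t x unfolding gamma_def cross at by simp
  then have "walk_jump \<alpha> \<beta> e n = walk_jump \<alpha> \<beta> e n'"
    by (simp add: fun_eq_iff walk_jump_def exclusion_def assms)
  moreover have "walk_clock_times n = walk_clock_times n'" by (simp add: walk_clock_times_def assms)
  ultimately show "walk \<alpha> \<beta> e n = walk \<alpha> \<beta> e n'" by (simp add: fun_eq_iff walk_def)
  show "right_path n = right_path n'" by (simp add: fun_eq_iff right_path_def assms)
qed

context slab_walk
begin

abbreviation "W \<equiv> walk_process \<alpha> \<beta> \<eta> N"
abbreviation "\<Gamma> \<equiv> Gamma_event M \<alpha> \<beta> \<eta> N"

lemma walk_process_clocks: "W \<omega> = X (\<eta> \<omega>) (clocks \<omega>)"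
  unfolding walk_process_def by (rule walk_clocks_cong) (simp add: clocks_def)

lemma Gamma_clocks: "\<Gamma> = {\<omega> \<in> space M. leads \<alpha> \<beta> (\<eta> \<omega>) (clocks \<omega>) 0}"
proof -
  have "right_path (\<lambda>c. N c \<omega>) = right_path (clocks \<omega>)" for \<omega> by (rule walk_clocks_cong) (simp add: clocks_def)
  then show ?thesis by (simp add: Gamma_event_def walk_process_clocks leads_def)
qed

text \<open>The value 0 of the index encodes that there is no regeneration.\<close>

definition regen_index :: "'a \<Rightarrow> nat" where
  "regen_index \<omega> = (if \<exists>m\<ge>1. regen m \<omega> then LEAST m. 1 \<le> m \<and> regen m \<omega> else 0)"

text \<open>The search begins at index 1, which makes the time positive; the infinite value occurs
  on a null set only.\<close>

definition regen_time :: "'a \<Rightarrow> ennreal" where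
  "regen_time \<omega> = (if regen_index \<omega> = 0 then \<infinity> else ennreal (grid (regen_index \<omega>)))"

lemma regen_index_iff:
  assumes "1 \<le> m"
  shows "regen_index \<omega> = m \<longleftrightarrow> regen m \<omega> \<and> (\<forall>k\<in>{1..m-1}. \<not> regen k \<omega>)"
proof
  assume m: "regen_index \<omega> = m"
  then have ex: "\<exists>m\<ge>1. regen m \<omega>" using assms by (auto simp: regen_index_def split: if_splits)
  then have m: "m = (LEAST m. 1 \<le> m \<and> regen m \<omega>)" using m by (simp add: regen_index_def)
  have "regen m \<omega>" using LeastI_ex[of "\<lambda>m. 1 \<le> m \<and> regen m \<omega>"] ex m by auto
  moreover have "\<not> regen k \<omega>" if "k \<in> {1..m-1}" for k
  proof -
    have "k < (LEAST m. 1 \<le> m \<and> regen m \<omega>)" using that assms unfolding m[symmetric] by auto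
    from not_less_Least[OF this] show ?thesis using that by auto
  qed
  ultimately show "regen m \<omega> \<and> (\<forall>k\<in>{1..m-1}. \<not> regen k \<omega>)" by blast
next
  assume m: "regen m \<omega> \<and> (\<forall>k\<in>{1..m-1}. \<not> regen k \<omega>)"
  have "(LEAST m. 1 \<le> m \<and> regen m \<omega>) = m"
  proof (rule Least_equality)
    show "m \<le> k" if "1 \<le> k \<and> regen k \<omega>" for k
      using m that by (cases "k \<le> m - 1") auto
  qed (use m assms in simp)
  then show "regen_index \<omega> = m" using m assms by (auto simp: regen_index_def)
qed

lemma regen_index_0: "regen_index \<omega> = 0 \<longleftrightarrow> (\<forall>m\<ge>1. \<not> regen m \<omega>)"
proof (cases "\<exists>m\<ge>1. regen m \<omega>")
  case True
  then have "1 \<le> (LEAST m. 1 \<le> m \<and> regen m \<omega>)" using LeastI_ex[of "\<lambda>m. 1 \<le> m \<and> regen m \<omega>"] by auto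
  then show ?thesis using True by (simp add: regen_index_def)
qed (auto simp: regen_index_def)

lemma measurable_regen_index [measurable]: "regen_index \<in> measurable M (count_space UNIV)"
proof -
  have "Measurable.pred M (\<lambda>\<omega>. regen_index \<omega> = m)" for m
    by (cases "m = 0") (simp_all add: regen_index_0 regen_index_iff, measurable)
  then show ?thesis
    by (subst measurable_count_space_eq2_countable) (auto simp: pred_def vimage_def Int_def conj_commute)
qed

lemma measurable_by_index:
  "(\<And>m. f m \<in> measurable M S) \<Longrightarrow> (\<lambda>\<omega>. f (regen_index \<omega>) \<omega>) \<in> measurable M S"
  by (rule measurable_compose_countable[OF _ measurable_regen_index])

lemma measurable_regen_time [measurable]: "regen_time \<in> borel_measurable M"
  using measurable_by_index[of "\<lambda>m _. if m = 0 then \<infinity> else ennreal (grid m)" borel] by (simp add: regen_time_def[abs_def])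

lemma measurable_X: "0 \<le> t \<Longrightarrow> (\<lambda>\<omega>. X (\<eta> \<omega>) (clocks \<omega>) t) \<in> measurable M (count_space UNIV)"
proof -
  interpret clock_family M \<eta> clocks by (rule clock_familyI[OF initial_measurable measurable_clocks])
  show "0 \<le> t \<Longrightarrow> (\<lambda>\<omega>. X (\<eta> \<omega>) (clocks \<omega>) t) \<in> measurable M (count_space UNIV)" by (rule measurable_walk)
qed

definition stopped :: "'a \<Rightarrow> ennreal \<times> (real \<Rightarrow> int)" where
  "stopped \<omega> = (regen_time \<omega>, \<lambda>s\<in>{0..}. W \<omega> (enn2real (min (ennreal s) (regen_time \<omega>))))"

lemma measurable_stopped: "stopped \<in> measurable M (borel \<Otimes>\<^sub>M path_space)"
proof -
  have "(\<lambda>\<omega>. W \<omega> (enn2real (min (ennreal s) (regen_time \<omega>)))) \<in> measurable M (count_space UNIV)" for s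
    using measurable_by_index[of "\<lambda>m \<omega>. X (\<eta> \<omega>) (clocks \<omega>) (enn2real (min (ennreal s) (if m = 0 then \<infinity> else ennreal (grid m))))" "count_space UNIV"]
    by (simp add: regen_time_def walk_process_clocks measurable_X)
  then show ?thesis unfolding stopped_def[abs_def] by (intro measurable_Pair measurable_restrict measurable_regen_time)
qed

lemma measurable_future: "future W regen_time \<in> measurable M path_space"
proof -
  have "(\<lambda>\<omega>. W \<omega> (enn2real (regen_time \<omega>) + s) - W \<omega> (enn2real (regen_time \<omega>))) \<in> measurable M (count_space UNIV)" if "0 \<le> s" for s
    using measurable_by_index[of "\<lambda>m \<omega>. X (\<eta> \<omega>) (clocks \<omega>) (enn2real (if m = 0 then \<infinity> else ennreal (grid m)) + s) -
      X (\<eta> \<omega>) (clocks \<omega>) (enn2real (if m = 0 then \<infinity> else ennreal (grid m)))" "count_space UNIV"] that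
    by (simp add: regen_time_def walk_process_clocks measurable_X measurable_int_diff)
  then show ?thesis unfolding future_def[abs_def] by (intro measurable_restrict) simp
qed

lemma sets_history: "D \<in> sets (history M W regen_time) \<longleftrightarrow> (\<exists>B\<in>sets (borel \<Otimes>\<^sub>M path_space). D = stopped -` B \<inter> space M)"
  unfolding history_def stopped_def[symmetric]
  by (subst sets_vimage_algebra2) (auto simp: space_PiM space_pair_measure stopped_def)

lemma subalgebra_history: "subalgebra M (history M W regen_time)"
proof -
  have "space (history M W regen_time) = space M" by (simp add: history_def)
  then show ?thesis using measurable_sets[OF measurable_stopped] by (auto simp: subalgebra_def sets_history)
qed

lemma future_at: "1 \<le> m \<Longrightarrow> regen_index \<omega> = m \<Longrightarrow> future W regen_time \<omega> = fut (grid m) \<omega>"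
  by (simp add: future_def regen_time_def walk_process_clocks grid(1))

text \<open>At each slab end the probability is a weight, which does not involve \<open>B\<close>,
  times the probability of a free run. Summing over the slab ends and comparing with the whole path
  space in place of \<open>B\<close> eliminates the weights.\<close>

lemma regeneration_at_index:
  assumes D: "D \<in> events" and Q: "\<And>m. 1 \<le> m \<Longrightarrow> past (grid m) (Q m)"
    and DQ: "\<And>m \<omega>. \<omega> \<in> space M \<Longrightarrow> good (clocks \<omega>) \<Longrightarrow> 1 \<le> m \<Longrightarrow> regen m \<omega> \<Longrightarrow> regen_index \<omega> = m \<Longrightarrow> \<omega> \<in> D \<longleftrightarrow> Q m (\<eta> \<omega>, pst m \<omega>)"
    and B: "B \<in> sets path_space"
  shows "prob (D \<inter> {\<omega> \<in> space M. future W regen_time \<omega> \<in> B}) * \<gamma> = prob D * prob {\<omega> \<in> space M. free_run B (\<eta> \<omega>) (clocks \<omega>)}"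
proof -
  \<comment> \<open>The weight contains \<open>ahead\<close> and not \<open>regen\<close>: staying
    ahead from the slab end on is part of the free run.\<close>
  define a where "a = (\<lambda>m. prob {\<omega> \<in> space M. (Q m (\<eta> \<omega>, pst m \<omega>) \<and> missed (m - 1) m (\<eta> \<omega>, pst m \<omega>)) \<and> ahead h m (\<eta> \<omega>) (clocks \<omega>)})"
  have sums: "(\<lambda>m. a (Suc m) * prob {\<omega> \<in> space M. free_run B (\<eta> \<omega>) (clocks \<omega>)}) sums prob (D \<inter> {\<omega> \<in> space M. future W regen_time \<omega> \<in> B})"
    if B: "B \<in> sets path_space" for B
  proof -
    have fB [measurable]: "Measurable.pred M (\<lambda>\<omega>. future W regen_time \<omega> \<in> B)" by (rule pred_sets2[OF B measurable_future])
    define E where "E = (\<lambda>m. D \<inter> {\<omega> \<in> space M. regen_index \<omega> = Suc m \<and> future W regen_time \<omega> \<in> B})"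
    have E [measurable]: "E m \<in> events" for m unfolding E_def using D by measurable
    have "(\<lambda>m. prob (E m)) sums prob (\<Union>m. E m)"
    proof (rule finite_measure_UNION)
      show "disjoint_family E" by (auto simp: E_def disjoint_family_on_def)
    qed auto
    also have "prob (\<Union>m. E m) = prob (D \<inter> {\<omega> \<in> space M. future W regen_time \<omega> \<in> B})"
    proof (rule finite_measure_eq_AE, rule AE_mp[OF AE_regen], rule AE_I2, intro impI)
      fix \<omega> assume "\<omega> \<in> space M" "\<exists>m\<ge>1. regen m \<omega>"
      then have "regen_index \<omega> \<noteq> 0" by (auto simp: regen_index_0)
      then obtain m where "regen_index \<omega> = Suc m" by (cases "regen_index \<omega>") auto
      then show "\<omega> \<in> (\<Union>m. E m) \<longleftrightarrow> \<omega> \<in> D \<inter> {\<omega> \<in> space M. future W regen_time \<omega> \<in> B}" by (auto simp: E_def)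
    qed (use D in measurable)
    also have "(\<lambda>m. prob (E m)) = (\<lambda>m. a (Suc m) * prob {\<omega> \<in> space M. free_run B (\<eta> \<omega>) (clocks \<omega>)})"
    proof
      fix m
      have pm: "past (grid (Suc m)) (\<lambda>x. Q (Suc m) x \<and> missed (Suc m - 1) (Suc m) x)"
        by (intro past_conj Q past_missed) auto
      have "prob (E m) = prob {\<omega> \<in> space M. (Q (Suc m) (\<eta> \<omega>, pst (Suc m) \<omega>) \<and> missed (Suc m - 1) (Suc m) (\<eta> \<omega>, pst (Suc m) \<omega>)) \<and> regen (Suc m) \<omega> \<and> fut (grid (Suc m)) \<omega> \<in> B}"
      proof (rule finite_measure_eq_AE, rule AE_mp[OF AE_good], rule AE_I2, intro impI)
        fix \<omega> assume w: "\<omega> \<in> space M" "good (clocks \<omega>)"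
        show "\<omega> \<in> E m \<longleftrightarrow> \<omega> \<in> {\<omega> \<in> space M. (Q (Suc m) (\<eta> \<omega>, pst (Suc m) \<omega>) \<and> missed (Suc m - 1) (Suc m) (\<eta> \<omega>, pst (Suc m) \<omega>)) \<and> regen (Suc m) \<omega> \<and> fut (grid (Suc m)) \<omega> \<in> B}"
        proof (cases "regen (Suc m) \<omega>")
          case True
          have i: "regen_index \<omega> = Suc m \<longleftrightarrow> missed (Suc m - 1) (Suc m) (\<eta> \<omega>, pst (Suc m) \<omega>)"
            using first_regen[OF w(2) True] regen_index_iff[of "Suc m" \<omega>] True by simp
          show ?thesis
          proof (cases "regen_index \<omega> = Suc m")
            case ri: True
            show ?thesis using DQ[OF w _ True ri] future_at[OF _ ri] i ri w(1) True unfolding E_def by simp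
          qed (use i in \<open>simp add: E_def\<close>)
        qed (use regen_index_iff[of "Suc m" \<omega>] in \<open>auto simp: E_def\<close>)
      next
        have "Measurable.pred M (\<lambda>\<omega>. fut (grid (Suc m)) \<omega> \<in> B)" by (rule pred_sets2[OF B measurable_fut[OF grid(1)]])
        note [measurable] = this pred_past[OF pm grid(1)]
        show "{\<omega> \<in> space M. (Q (Suc m) (\<eta> \<omega>, pst (Suc m) \<omega>) \<and> missed (Suc m - 1) (Suc m) (\<eta> \<omega>, pst (Suc m) \<omega>)) \<and> regen (Suc m) \<omega> \<and> fut (grid (Suc m)) \<omega> \<in> B} \<in> events"
          by measurable
      qed simp
      then show "prob (E m) = a (Suc m) * prob {\<omega> \<in> space M. free_run B (\<eta> \<omega>) (clocks \<omega>)}"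
        using regen_law[OF pm B] by (simp add: a_def)
    qed
    finally show ?thesis .
  qed
  \<comment> \<open>The case of the whole path space, in which the free run has probability
    \<gamma>.\<close>
  have "(\<lambda>m. a (Suc m) * \<gamma>) sums prob D"
    using sums[OF sets.top] D measurable_space[OF measurable_future] sets.sets_into_space[OF D]
    unfolding free_run_UNIV by (simp add: Int_absorb2 Collect_conj_eq subset_eq cong: conj_cong)
  then have "(\<lambda>m. a (Suc m) * \<gamma> * prob {\<omega> \<in> space M. free_run B (\<eta> \<omega>) (clocks \<omega>)}) sums (prob D * prob {\<omega> \<in> space M. free_run B (\<eta> \<omega>) (clocks \<omega>)})"
    by (rule sums_mult2)
  moreover have "(\<lambda>m. a (Suc m) * prob {\<omega> \<in> space M. free_run B (\<eta> \<omega>) (clocks \<omega>)} * \<gamma>) sums (prob (D \<inter> {\<omega> \<in> space M. future W regen_time \<omega> \<in> B}) * \<gamma>)"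
    by (rule sums_mult2[OF sums[OF B]])
  ultimately show ?thesis by (simp add: sums_unique2 mult_ac)
qed

lemma past_stopped:
  assumes B: "B \<in> sets (borel \<Otimes>\<^sub>M path_space)"
  shows "past (grid m) (\<lambda>(e, p). (ennreal (grid m), \<lambda>s\<in>{0..}. X e p (min s (grid m))) \<in> B)"
  unfolding past_def
proof (intro conjI allI impI)
  interpret clock_family "config_space \<Otimes>\<^sub>M clock_space" fst snd by (rule clock_familyI) auto
  have "(\<lambda>x. (ennreal (grid m), \<lambda>s\<in>{0..}. X (fst x) (snd x) (min s (grid m)))) \<in> measurable (config_space \<Otimes>\<^sub>M clock_space) (borel \<Otimes>\<^sub>M path_space)"
    using grid(1) by (intro measurable_Pair measurable_restrict measurable_walk) auto
  from pred_sets2[OF B this]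
  show "Measurable.pred (config_space \<Otimes>\<^sub>M clock_space) (\<lambda>(e, p). (ennreal (grid m), \<lambda>s\<in>{0..}. X e p (min s (grid m))) \<in> B)"
    by (simp add: split_def)
  fix e e' p assume eq: "\<forall>t. 0 \<le> t \<longrightarrow> t \<le> grid m \<longrightarrow> X e p t = X e' p t"
  have "(\<lambda>s\<in>{0..}. X e p (min s (grid m))) = (\<lambda>s\<in>{0..}. X e' p (min s (grid m)))"
    using grid(1)[of m] by (intro restrict_ext eq[rule_format]) auto
  then show "(case (e, p) of (e, p) \<Rightarrow> (ennreal (grid m), \<lambda>s\<in>{0..}. X e p (min s (grid m))) \<in> B) =
    (case (e', p) of (e, p) \<Rightarrow> (ennreal (grid m), \<lambda>s\<in>{0..}. X e p (min s (grid m))) \<in> B)" by simp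
qed

lemma stopped_at:
  assumes "good (clocks \<omega>)" "regen_index \<omega> = m" "1 \<le> m"
  shows "stopped \<omega> = (ennreal (grid m), \<lambda>s\<in>{0..}. X (\<eta> \<omega>) (pst m \<omega>) (min s (grid m)))"
  using assms grid(1)[of m]
  by (auto simp: stopped_def regen_time_def walk_process_clocks walk_stop enn2real_min intro!: restrict_ext)

text \<open>If \<open>grid m\<close> is a regeneration, \<Gamma> is equivalent to this event, so
  that conditioning on \<Gamma> only modifies the event of the past.\<close>

lemma past_not_caught: "past (grid m) (\<lambda>(e, p). \<not> caught \<alpha> \<beta> e p 0 (grid m))"
  unfolding past_def
proof (intro conjI allI impI)
  interpret clock_family "config_space \<Otimes>\<^sub>M clock_space" fst snd by (rule clock_familyI) auto
  have [measurable]: "Measurable.pred (config_space \<Otimes>\<^sub>M clock_space) (\<lambda>x. caught \<alpha> \<beta> (fst x) (snd x) 0 t)" for t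
    by (rule pred_caught) simp
  show "Measurable.pred (config_space \<Otimes>\<^sub>M clock_space) (\<lambda>(e, p). \<not> caught \<alpha> \<beta> e p 0 (grid m))"
    unfolding split_def by measurable
  fix e e' p assume "\<forall>t. 0 \<le> t \<longrightarrow> t \<le> grid m \<longrightarrow> X e p t = X e' p t"
  then show "(case (e, p) of (e, p) \<Rightarrow> \<not> caught \<alpha> \<beta> e p 0 (grid m)) = (case (e', p) of (e, p) \<Rightarrow> \<not> caught \<alpha> \<beta> e p 0 (grid m))"
    using caught_cong[of "grid m" \<alpha> \<beta> e p e' 0] grid(1) by simp
qed

lemma regeneration_structure:
  "regen_time \<in> borel_measurable M"
  "AE \<omega> in M. 0 < regen_time \<omega> \<and> regen_time \<omega> < \<infinity>"
  "cond_law_is M (history M W regen_time) path_space (future W regen_time)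
     (\<lambda>A. \<P>(\<omega> in M. restrict (W \<omega>) {0..} \<in> A \<bar> \<omega> \<in> \<Gamma>))"
  "cond_law_is (uniform_measure M \<Gamma>) (history M W regen_time) path_space (future W regen_time)
     (\<lambda>A. \<P>(\<omega> in M. restrict (W \<omega>) {0..} \<in> A \<bar> \<omega> \<in> \<Gamma>))"
proof -
  show "regen_time \<in> borel_measurable M" by (rule measurable_regen_time)
  show "AE \<omega> in M. 0 < regen_time \<omega> \<and> regen_time \<omega> < \<infinity>"
  proof (rule AE_mp[OF AE_regen], rule AE_I2, intro impI)
    fix \<omega> assume "\<exists>m\<ge>1. regen m \<omega>"
    then have "regen_index \<omega> \<noteq> 0" by (auto simp: regen_index_0)
    then show "0 < regen_time \<omega> \<and> regen_time \<omega> < \<infinity>" using h_pos by (simp add: regen_time_def grid_def)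
  qed
  have \<Gamma> [measurable]: "\<Gamma> \<in> events" using pred_walk_events(1)[of 0] by (simp add: Gamma_clocks pred_def)
  have \<gamma>: "prob \<Gamma> = \<gamma>" "0 < \<gamma>" using prob_leads_pos by (simp_all add: Gamma_clocks)
  define \<mu> where "\<mu> = (\<lambda>A. \<P>(\<omega> in M. restrict (W \<omega>) {0..} \<in> A \<bar> \<omega> \<in> \<Gamma>))"
  have \<mu>: "\<mu> A = prob {\<omega> \<in> space M. free_run A (\<eta> \<omega>) (clocks \<omega>)} / \<gamma>" for A
    unfolding \<mu>_def cond_prob_def by (simp add: Gamma_clocks walk_process_clocks free_run_def conj_commute cong: conj_cong)
  have eq: "prob (D \<inter> {\<omega> \<in> space M. future W regen_time \<omega> \<in> A}) = prob D * \<mu> A"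
    "prob (\<Gamma> \<inter> D \<inter> {\<omega> \<in> space M. future W regen_time \<omega> \<in> A}) = prob (\<Gamma> \<inter> D) * \<mu> A"
    if A: "A \<in> sets path_space" and D: "D \<in> sets (history M W regen_time)" for A D
  proof -
    obtain B where B: "B \<in> sets (borel \<Otimes>\<^sub>M path_space)" and DB: "D = stopped -` B \<inter> space M" using D by (auto simp: sets_history)
    have De: "D \<in> events" using D subalgebra_history by (auto simp: subalgebra_def)
    have "prob (D \<inter> {\<omega> \<in> space M. future W regen_time \<omega> \<in> A}) * \<gamma> = prob D * prob {\<omega> \<in> space M. free_run A (\<eta> \<omega>) (clocks \<omega>)}"
      by (rule regeneration_at_index[OF De past_stopped[OF B] _ A]) (auto simp: DB stopped_at)
    then show "prob (D \<inter> {\<omega> \<in> space M. future W regen_time \<omega> \<in> A}) = prob D * \<mu> A"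
      using \<gamma> by (simp add: \<mu> field_simps)
    have "prob (\<Gamma> \<inter> D \<inter> {\<omega> \<in> space M. future W regen_time \<omega> \<in> A}) * \<gamma> = prob (\<Gamma> \<inter> D) * prob {\<omega> \<in> space M. free_run A (\<eta> \<omega>) (clocks \<omega>)}"
    proof (rule regeneration_at_index[OF _ past_conj[OF past_not_caught past_stopped[OF B]] _ A])
      fix m \<omega> assume w: "\<omega> \<in> space M" "good (clocks \<omega>)" "1 \<le> m" "regen m \<omega>" "regen_index \<omega> = m"
      have "leads \<alpha> \<beta> (\<eta> \<omega>) (clocks \<omega>) 0 \<longleftrightarrow> \<not> caught \<alpha> \<beta> (\<eta> \<omega>) (clocks \<omega>) 0 (grid m)"
        using caught_iff_not_leads[OF w(2), of "\<eta> \<omega>" m 0] w(3,4) by (simp add: regen_def grid(3))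
      also have "\<dots> \<longleftrightarrow> \<not> caught \<alpha> \<beta> (\<eta> \<omega>) (pst m \<omega>) 0 (grid m)"
        using caught_stop[OF w(2) order_refl grid(1) order_refl] by simp
      finally show "\<omega> \<in> \<Gamma> \<inter> D \<longleftrightarrow> (case (\<eta> \<omega>, pst m \<omega>) of (e, p) \<Rightarrow> \<not> caught \<alpha> \<beta> e p 0 (grid m)) \<and>
        (case (\<eta> \<omega>, pst m \<omega>) of (e, p) \<Rightarrow> (ennreal (grid m), \<lambda>s\<in>{0..}. X e p (min s (grid m))) \<in> B)"
        using w(1) by (simp add: Gamma_clocks DB stopped_at[OF w(2,5,3)])
    qed (use De in measurable)
    then show "prob (\<Gamma> \<inter> D \<inter> {\<omega> \<in> space M. future W regen_time \<omega> \<in> A}) = prob (\<Gamma> \<inter> D) * \<mu> A"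
      using \<gamma> by (simp add: \<mu> field_simps)
  qed
  show "cond_law_is M (history M W regen_time) path_space (future W regen_time) (\<lambda>A. \<P>(\<omega> in M. restrict (W \<omega>) {0..} \<in> A \<bar> \<omega> \<in> \<Gamma>))"
    unfolding \<mu>_def[symmetric] by (rule cond_law_is_const[OF prob_space_axioms subalgebra_history measurable_future eq(1)])
  show "cond_law_is (uniform_measure M \<Gamma>) (history M W regen_time) path_space (future W regen_time) (\<lambda>A. \<P>(\<omega> in M. restrict (W \<omega>) {0..} \<in> A \<bar> \<omega> \<in> \<Gamma>))"
    unfolding \<mu>_def[symmetric]
  proof (rule cond_law_is_const)
    show "prob_space (uniform_measure M \<Gamma>)"
      using \<gamma> by (intro prob_space_uniform_measure) (auto simp: emeasure_eq_measure)
    show "subalgebra (uniform_measure M \<Gamma>) (history M W regen_time)" using subalgebra_history by (simp add: subalgebra_def)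
    show "future W regen_time \<in> measurable (uniform_measure M \<Gamma>) path_space" using measurable_future by simp
    fix A D assume A: "A \<in> sets (path_space :: (real \<Rightarrow> int) measure)" and D: "D \<in> sets (history M W regen_time)"
    have [measurable]: "D \<in> events" using D subalgebra_history by (auto simp: subalgebra_def)
    have [measurable]: "Measurable.pred M (\<lambda>\<omega>. future W regen_time \<omega> \<in> A)" by (rule pred_sets2[OF A measurable_future])
    show "measure (uniform_measure M \<Gamma>) (D \<inter> {\<omega> \<in> space (uniform_measure M \<Gamma>). future W regen_time \<omega> \<in> A}) = measure (uniform_measure M \<Gamma>) D * \<mu> A"
      using eq(2)[OF A D] \<gamma> by (simp add: measure_uniform_measure emeasure_eq_measure Int_assoc)
  qed
qed

end

theorem theorem5:
  fixes M :: "'a measure"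
    and \<rho> :: real
    and \<alpha> \<beta> :: "bool \<Rightarrow> real"
    and \<eta> :: "'a \<Rightarrow> int \<Rightarrow> bool"
    and N :: "clock \<Rightarrow> 'a \<Rightarrow> real \<Rightarrow> nat"
  assumes "0 \<le> \<rho>" and "\<rho> \<le> 1"
    and "\<And>j. 0 < \<alpha> j" and "\<And>j. 0 < \<beta> j"
    and "min (\<alpha> False) (\<alpha> True) - max (\<beta> False) (\<beta> True) > 1"
    and "graphical_construction M \<rho> \<alpha> \<beta> \<eta> N"
  shows "let X = walk_process \<alpha> \<beta> \<eta> N; \<Gamma> = Gamma_event M \<alpha> \<beta> \<eta> N in
    \<exists>\<tau> :: 'a \<Rightarrow> ennreal.
      \<tau> \<in> borel_measurable M \<and>
      (AE \<omega> in M. 0 < \<tau> \<omega> \<and> \<tau> \<omega> < \<infinity>) \<and>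
      cond_law_is M (history M X \<tau>) path_space (future X \<tau>)
        (\<lambda>A. \<P>(\<omega> in M. restrict (X \<omega>) {0..} \<in> A \<bar> \<omega> \<in> \<Gamma>)) \<and>
      cond_law_is (uniform_measure M \<Gamma>) (history M X \<tau>) path_space (future X \<tau>)
        (\<lambda>A. \<P>(\<omega> in M. restrict (X \<omega>) {0..} \<in> A \<bar> \<omega> \<in> \<Gamma>))"
proof -
  interpret exclusion_walk M \<rho> \<alpha> \<beta> \<eta> N
    using assms by (intro exclusion_walk.intro exclusion_walk_axioms.intro)
  have a: "0 < min (\<alpha> False) (\<alpha> True)" and b: "0 < max (\<beta> False) (\<beta> True)"
    using assms(3,4)[of True] assms(3,4)[of False] by auto
  obtain n :: nat and \<theta> :: real where n: "0 < n" "0 < \<theta>" "(1 - exp (- (1 / n))) * exp \<theta> < 1"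
    "(exp (- (min (\<alpha> False) (\<alpha> True) * (1 / n))) + (1 - exp (- (min (\<alpha> False) (\<alpha> True) * (1 / n)))) * exp (- \<theta>)) *
      exp (max (\<beta> False) (\<beta> True) * (1 / n) * (exp \<theta> - 1)) * (exp (- (1 / n)) / (1 - (1 - exp (- (1 / n))) * exp \<theta>)) < 1"
    by (rule exists_slab_parameters[OF a b assms(5)])
  interpret slab_walk M \<rho> \<alpha> \<beta> \<eta> N "1 / n" \<theta>
  proof
    show "front_const \<theta> (1 / n) < 1" using n(4) by (simp only: front_const_def slab_const_def Let_def mult.assoc)
  qed (use n in auto)
  show ?thesis unfolding Let_def using regeneration_structure by blast
qed

end
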